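(* Let $E$ be a quaternionic vector space and let $U\subseteq E$ be a real vector subspace. Then the pair $(U,E)$ admits a decomposition, unique up to the order of the factors (factors being considered up to isomorphism of pairs), as a finite product of pairs in which each factor is one of the following: (a) $(U_k,\mathbb{H}^{k+1})$ for some integer $k\geq 0$; (b) $(V_k,\mathbb{H}^{2k+1})$ for some integer $k\geq 0$; (c) $(W_{k,q},\mathbb{H}^{k})$ for some integer $k\geq 1$ and some $q\in S^2$; (d) the dual of $(U_k,\mathbb{H}^{k+1})$ for some integer $k\geq 0$; (e) the dual of $(V_k,\mathbb{H}^{2k+1})$ for some integer $k\geq 0$.
   Context: All vector spaces are finite-dimensional. $\mathbb{H}$ denotes the quaternions with units $\mathrm{i},\mathrm{j},\mathrm{k}$, and $S^2$ the set of unit imaginary quaternions; $\mathbb{C}=\mathbb{R}+\mathbb{R}\mathrm{i}\subseteq\mathbb{H}$. Quaternionic vector spaces. A linear hypercomplex structure on a real vector space $E$ is a morphism of unital associative algebras $\rho:\mathbb{H}\to\mathrm{End}(E)$. The group $\mathrm{SO}(3,\mathbb{R})=\mathrm{Aut}(\mathbb{H})$ acts on the set of these by precomposition; a linear quaternionic structure on $E$ is a (nonempty) orbit of this action, and a quaternionic vector space is a real vector space endowed with a linear quaternionic structure. If $\rho$ represents the structure, $Z=\rho(S^2)$ is the space of admissible linear complex structures on $E$; it depends only on the quaternionic structure, and carries the metric and orientation transported from $S^2$ by $\rho$. $\mathbb{H}^k$ is a quaternionic vector space by left multiplication. A linear quaternionic map $t:E\to E'$ between quaternionic vector spaces (with spaces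 of admissible structures $Z,Z'$) is a real linear map for which there is a function $T:Z\to Z'$ with $t\circ J=T(J)\circ t$ for all $J\in Z$ (if $t\neq0$, $T$ is unique and is an orientation preserving isometry). Pairs. A pair $(U,E)$ consists of a quaternionic vector space $E$ and a real vector subspace $U\subseteq E$. A morphism $(U,E)\to(U',E')$ is a linear quaternionic map $t:E\to E'$ with $t(U)\subseteq U'$; an isomorphism is an invertible morphism (so $t(U)=U'$). Duals. If $\rho$ represents the structure of $E$, then $E^*$ has the quaternionic structure represented by $q\mapsto$ transpose of $\rho(\overline{q})$. The dual of $(U,E)$ is $(\mathrm{Ann}\,U,E^* )$, where $\mathrm{Ann}\,U=\{\alpha\in E^*:\alpha|_U=0\}$. Products. Let $E,E'$ be quaternionic vector spaces, $T:Z\to Z'$ an orientation preserving isometry, and $\rho$ a representative of the structure of $E$. Then $T$ is the restriction of a unique linear map $\widetilde{T}:\rho(\mathbb{H})\to\mathrm{End}(E')$ such that $\widetilde{T}\circ\rho$ represents the structure of $E'$; the product quaternionic structure on $E\times E'$ with respect to $T$ is represented by $q\mapsto(\rho(q),\widetilde{T}(\rho(q)))$. The product of pairs is $(U,E)\times(U',E')=(U\times U',E\times E')$, with respect to such a $T$; products of several pairs are defined likewise. A decomposition of $(U,E)$ as a product means an isomorphism of $(U,E)$ with a product of pairs formed with respect to some choice of such isometries. The subspaces $U_k$. $U_0=\mathbb{R}\subseteq\mathbb{H}$. For $k\geq1$, let $q_1,\ldots,q_{k+1}\in S^2$ be such that $q_i\neq\pm q_j$ if $i\neq j$; for $j=1,\ldots,k$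 let $e_j=(0,\ldots,0,q_j,q_{j+1},0,\ldots,0)\in\mathbb{H}^{k+1}$ ($j-1$ zeros before $q_j$ and $k-j$ zeros after $q_{j+1}$), and $U_k=\mathbb{R}^{k+1}+\mathbb{R}e_1+\cdots+\mathbb{R}e_k\subseteq\mathbb{H}^{k+1}$ (the choice of the $q_i$ is suppressed from the notation). The subspaces $V_k$. $V_0=\{0\}\subseteq\mathbb{H}$. For $k\geq1$, $V_k\subseteq\mathbb{H}^{2k+1}$ is the real subspace of all vectors $$(z_1,\ \overline{z_1}+z_2\mathrm{j},\ z_3-\overline{z_2}\mathrm{j},\ \ldots,\ \overline{z_{2k-1}}+z_{2k}\mathrm{j},\ -\overline{z_{2k}}\mathrm{j}),\qquad z_1,\ldots,z_{2k}\in\mathbb{C}.$$ The subspaces $W_{k,q}$. For $k\geq1$ and $q\in S^2$, $q\neq\pm\mathrm{i}$, $W_{k,q}\subseteq\mathbb{H}^k$ is the real subspace of all vectors $$(a_1+b_1q+b_2\mathrm{i},\ a_2+b_2q+b_3\mathrm{i},\ \ldots,\ a_{k-1}+b_{k-1}q+b_k\mathrm{i},\ a_k+b_kq),\qquad a_1,b_1,\ldots,a_k,b_k\in\mathbb{R};$$ if $q=\pm\mathrm{i}$, then $\mathrm{i}$ is replaced by $\mathrm{j}$ in this formula. *)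

theory Defs
  imports "HOL-Analysis.Analysis" "HOL-Library.Function_Algebras"
begin

text \<open>The additive structure comes from Function_Algebras. It makes
  \<open>nat \<Rightarrow> 'a\<close> (tuples), \<open>'a \<Rightarrow> real\<close> (linear forms) and \<open>'a \<Rightarrow> 'a\<close> (endomorphisms)
  real vector spaces.\<close>

instantiation "fun" :: (type, real_vector) real_vector
begin

definition scaleR_fun :: "real \<Rightarrow> ('a \<Rightarrow> 'b) \<Rightarrow> 'a \<Rightarrow> 'b" where
  "scaleR_fun c f = (\<lambda>x. c *\<^sub>R f x)"

instance
  by standard (auto simp: scaleR_fun_def plus_fun_def fun_eq_iff algebra_simps)

end

datatype quat = Quat (qRe: real) (qI: real) (qJ: real) (qK: real)

lemma quat_eq_iff: "p = q \<longleftrightarrow> qRe p = qRe q \<and> qI p = qI q \<and> qJ p = qJ q \<and> qK p = qK q"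
  by (cases p; cases q) auto

instantiation quat :: real_algebra_1
begin

definition "0 = Quat 0 0 0 0"
definition "1 = Quat 1 0 0 0"
definition "p + q = Quat (qRe p + qRe q) (qI p + qI q) (qJ p + qJ q) (qK p + qK q)"
definition "- q = Quat (- qRe q) (- qI q) (- qJ q) (- qK q)"
definition "p - q = Quat (qRe p - qRe q) (qI p - qI q) (qJ p - qJ q) (qK p - qK q)"
definition "c *\<^sub>R q = Quat (c * qRe q) (c * qI q) (c * qJ q) (c * qK q)"
definition "p * q = Quat
   (qRe p * qRe q - qI p * qI q - qJ p * qJ q - qK p * qK q)
   (qRe p * qI q + qI p * qRe q + qJ p * qK q - qK p * qJ q)
   (qRe p * qJ q - qI p * qK q + qJ p * qRe q + qK p * qI q)
   (qRe p * qK q + qI p * qJ q - qJ p * qI q + qK p * qRe q)"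

instance
  by standard
    (simp_all add: zero_quat_def one_quat_def plus_quat_def uminus_quat_def minus_quat_def
      scaleR_quat_def times_quat_def algebra_simps quat_eq_iff)

end

instantiation quat :: real_normed_vector
begin

definition "norm q = sqrt ((qRe q)\<^sup>2 + (qI q)\<^sup>2 + (qJ q)\<^sup>2 + (qK q)\<^sup>2)"
definition sgn_quat_def: "sgn (q :: quat) = q /\<^sub>R norm q"
definition dist_quat_def: "dist (p :: quat) q = norm (p - q)"
definition uniformity_quat_def:
  "(uniformity :: (quat \<times> quat) filter) = (INF e\<in>{0<..}. principal {(x, y). dist x y < e})"
definition open_quat_def:
  "open (U :: quat set) \<longleftrightarrow> (\<forall>x\<in>U. eventually (\<lambda>(x', y). x' = x \<longrightarrow> y \<in> U) uniformity)"

instance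
proof
  fix p q :: quat and c :: real
  have norm_eq: "norm r = norm ((qRe r, qI r), (qJ r, qK r))" for r :: quat
    by (simp add: norm_quat_def norm_prod_def add.assoc)
  show "norm p = 0 \<longleftrightarrow> p = 0"
    by (auto simp: norm_eq quat_eq_iff zero_quat_def norm_eq_zero prod_eq_iff simp del: norm_Pair)
  show "norm (p + q) \<le> norm p + norm q"
    using norm_triangle_ineq[of "((qRe p, qI p), (qJ p, qK p))" "((qRe q, qI q), (qJ q, qK q))"]
    by (simp add: norm_eq plus_quat_def)
  show "norm (c *\<^sub>R p) = \<bar>c\<bar> * norm p"
    using norm_scaleR[of c "((qRe p, qI p), (qJ p, qK p))"]
    by (simp add: norm_eq scaleR_quat_def)
qed (simp_all add: sgn_quat_def dist_quat_def uniformity_quat_def open_quat_def)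

end

instantiation quat :: real_inner
begin

definition "p \<bullet> q = qRe p * qRe q + qI p * qI q + qJ p * qJ q + qK p * qK q"

instance
  by standard
    (auto simp: inner_quat_def norm_quat_def plus_quat_def scaleR_quat_def zero_quat_def
      quat_eq_iff add_nonneg_eq_0_iff algebra_simps power2_eq_square)

end

definition quat_i :: quat where "quat_i = Quat 0 1 0 0"
definition quat_j :: quat where "quat_j = Quat 0 0 1 0"

definition quat_of_complex :: "complex \<Rightarrow> quat" where
  "quat_of_complex z = Quat (Re z) (Im z) 0 0"

definition qcnj :: "quat \<Rightarrow> quat" where
  "qcnj q = Quat (qRe q) (- qI q) (- qJ q) (- qK q)"

definition S2 :: "quat set" where
  "S2 = {q. qRe q = 0 \<and> norm q = 1}"

text \<open>Acting on the imaginary quaternions, this group is \<open>SO(3,\<real>)\<close>.\<close>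

definition Aut_quat :: "(quat \<Rightarrow> quat) set" where
  "Aut_quat = {\<sigma>. bij \<sigma> \<and> linear \<sigma> \<and> \<sigma> 1 = 1 \<and> (\<forall>p q. \<sigma> (p * q) = \<sigma> p * \<sigma> q)}"

text \<open>For imaginary quaternions \<open>(p * q) \<bullet> r\<close> is the triple product of \<open>p\<close>, \<open>q\<close>, \<open>r\<close>. An
  isometry of the sphere is the restriction of an orthogonal map of the space of imaginary
  quaternions, and it preserves the orientation of the sphere if and only if that map
  preserves the sign of triple products.\<close>

definition S2_oriented_isometry :: "(quat \<Rightarrow> quat) \<Rightarrow> bool" where
  "S2_oriented_isometry f \<longleftrightarrow> f ` S2 = S2 \<and>
     (\<forall>p\<in>S2. \<forall>q\<in>S2. dist (f p) (f q) = dist p q) \<and>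
     (\<forall>p\<in>S2. \<forall>q\<in>S2. \<forall>r\<in>S2. (p * q) \<bullet> r > 0 \<longrightarrow> (f p * f q) \<bullet> f r > 0)"

text \<open>Vector spaces are subspaces of real vector space types. A linear map between subspaces
  \<open>E\<close> and \<open>F\<close> whose equality matters is represented by the function that is \<open>0\<close> outside \<open>E\<close>.\<close>

definition linear_from :: "'a::real_vector set \<Rightarrow> ('a \<Rightarrow> 'b::real_vector) \<Rightarrow> bool" where
  "linear_from E f \<longleftrightarrow>
     (\<forall>x\<in>E. \<forall>y\<in>E. f (x + y) = f x + f y) \<and> (\<forall>c. \<forall>x\<in>E. f (c *\<^sub>R x) = c *\<^sub>R f x)"

definition zero_ext :: "'a set \<Rightarrow> ('a \<Rightarrow> 'b::zero) \<Rightarrow> 'a \<Rightarrow> 'b" where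
  "zero_ext E f = (\<lambda>x. if x \<in> E then f x else 0)"

definition Hom :: "'a::real_vector set \<Rightarrow> 'b::real_vector set \<Rightarrow> ('a \<Rightarrow> 'b) set" where
  "Hom E F = {f. linear_from E f \<and> f ` E \<subseteq> F \<and> (\<forall>x. x \<notin> E \<longrightarrow> f x = 0)}"

definition hypercomplex :: "'a::real_vector set \<Rightarrow> (quat \<Rightarrow> 'a \<Rightarrow> 'a) \<Rightarrow> bool" where
  "hypercomplex E \<rho> \<longleftrightarrow> (\<forall>q. \<rho> q \<in> Hom E E) \<and> linear \<rho> \<and>
     \<rho> 1 = zero_ext E id \<and> (\<forall>p q. \<rho> (p * q) = \<rho> p \<circ> \<rho> q)"

definition orbit :: "(quat \<Rightarrow> 'a \<Rightarrow> 'a) \<Rightarrow> (quat \<Rightarrow> 'a \<Rightarrow> 'a) set" where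
  "orbit \<rho> = {\<rho> \<circ> \<sigma> |\<sigma>. \<sigma> \<in> Aut_quat}"

record 'a qspace =
  vspace :: "'a set"
  qstruct :: "(quat \<Rightarrow> 'a \<Rightarrow> 'a) set"

definition quaternionic_space :: "'a::real_vector qspace \<Rightarrow> bool" where
  "quaternionic_space E \<longleftrightarrow> (\<exists>B. finite B \<and> vspace E = span B) \<and>
     (\<exists>\<rho>. hypercomplex (vspace E) \<rho> \<and> qstruct E = orbit \<rho>)"

definition admissible_structures :: "'a qspace \<Rightarrow> ('a \<Rightarrow> 'a) set" where
  "admissible_structures E = {\<rho> q |\<rho> q. \<rho> \<in> qstruct E \<and> q \<in> S2}"

definition quaternionic_map ::
    "'a::real_vector qspace \<Rightarrow> 'b::real_vector qspace \<Rightarrow> ('a \<Rightarrow> 'b) \<Rightarrow> bool" where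
  "quaternionic_map E E' t \<longleftrightarrow> linear_from (vspace E) t \<and> t ` vspace E \<subseteq> vspace E' \<and>
     (\<exists>T. T ` admissible_structures E \<subseteq> admissible_structures E' \<and>
        (\<forall>J\<in>admissible_structures E. \<forall>x\<in>vspace E. t (J x) = T J (t x)))"

text \<open>The metric and the orientation of \<open>admissible_structures E\<close> are transported from
  the sphere by any representative of the structure (different
  representatives differ by a rotation).\<close>

definition oriented_isometry ::
    "'a qspace \<Rightarrow> 'b qspace \<Rightarrow> (('a \<Rightarrow> 'a) \<Rightarrow> ('b \<Rightarrow> 'b)) \<Rightarrow> bool" where
  "oriented_isometry E E' T \<longleftrightarrow> (\<exists>\<rho>\<in>qstruct E. \<exists>\<rho>'\<in>qstruct E'. \<exists>f.
     S2_oriented_isometry f \<and> (\<forall>q\<in>S2. T (\<rho> q) = \<rho>' (f q)))"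

type_synonym 'a qpair = "'a set \<times> 'a qspace"

definition is_pair :: "'a::real_vector qpair \<Rightarrow> bool" where
  "is_pair = (\<lambda>(U, E). quaternionic_space E \<and> subspace U \<and> U \<subseteq> vspace E)"

definition pair_morphism ::
    "'a::real_vector qpair \<Rightarrow> 'b::real_vector qpair \<Rightarrow> ('a \<Rightarrow> 'b) \<Rightarrow> bool" where
  "pair_morphism = (\<lambda>(U, E) (U', E') t. quaternionic_map E E' t \<and> t ` U \<subseteq> U')"

definition isomorphic :: "'a::real_vector qpair \<Rightarrow> 'b::real_vector qpair \<Rightarrow> bool" where
  "isomorphic P P' \<longleftrightarrow> is_pair P \<and> is_pair P' \<and>
     (\<exists>t s. pair_morphism P P' t \<and> pair_morphism P' P s \<and>
        (\<forall>x\<in>vspace (snd P). s (t x) = x) \<and> (\<forall>y\<in>vspace (snd P'). t (s y) = y))"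

definition dual_space :: "'a::real_vector qspace \<Rightarrow> ('a \<Rightarrow> real) qspace" where
  "dual_space E = (let E' = Hom (vspace E) UNIV in
     \<lparr>vspace = E', qstruct = {\<lambda>q. zero_ext E' (\<lambda>\<alpha>. \<alpha> \<circ> \<rho> (qcnj q)) |\<rho>. \<rho> \<in> qstruct E}\<rparr>)"

definition dual_pair :: "'a::real_vector qpair \<Rightarrow> ('a \<Rightarrow> real) qpair" where
  "dual_pair = (\<lambda>(U, E). ({\<alpha> \<in> vspace (dual_space E). \<forall>x\<in>U. \<alpha> x = 0}, dual_space E))"

text \<open>The product of a list of sets: sequences, extended by \<open>0\<close> beyond the length of the list.\<close>

definition seq_product :: "'a::zero set list \<Rightarrow> (nat \<Rightarrow> 'a) set" where
  "seq_product Es = {x. (\<forall>i<length Es. x i \<in> Es ! i) \<and> (\<forall>i\<ge>length Es. x i = 0)}"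

definition product_rep ::
    "'a::zero set list \<Rightarrow> (nat \<Rightarrow> quat \<Rightarrow> 'a \<Rightarrow> 'a) \<Rightarrow> quat \<Rightarrow> (nat \<Rightarrow> 'a) \<Rightarrow> nat \<Rightarrow> 'a" where
  "product_rep Es \<rho> q =
     zero_ext (seq_product Es) (\<lambda>x i. if i < length Es then \<rho> i q (x i) else 0)"

text \<open>\<open>R\<close> is a product quaternionic structure on the product of the list \<open>Es\<close>, with respect to
  orientation preserving isometries \<open>T i\<close> from the space of admissible structures of the first
  factor \<open>Es ! 0\<close> to that of \<open>Es ! i\<close>; here \<open>T 0\<close> is the identity, and \<open>Tt i\<close> is the linear
  extension of \<open>T i\<close> to the image of the representative \<open>\<rho>\<close> of the structure of \<open>Es ! 0\<close>.
  The product of no factors is the zero space with its unique structure.\<close>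

definition product_structure ::
    "'a::real_vector qspace list \<Rightarrow> (quat \<Rightarrow> (nat \<Rightarrow> 'a) \<Rightarrow> nat \<Rightarrow> 'a) set \<Rightarrow> bool" where
  "product_structure Es R \<longleftrightarrow>
     (if Es = [] then R = orbit (\<lambda>q x. 0)
      else \<exists>T Tt. \<exists>\<rho>\<in>qstruct (Es ! 0). T 0 = id \<and>
        (\<forall>i<length Es. oriented_isometry (Es ! 0) (Es ! i) (T i) \<and>
           linear_from (range \<rho>) (Tt i) \<and>
           (\<forall>J\<in>admissible_structures (Es ! 0). Tt i J = T i J) \<and>
           Tt i \<circ> \<rho> \<in> qstruct (Es ! i)) \<and>
        R = orbit (product_rep (map vspace Es) (\<lambda>i. Tt i \<circ> \<rho>)))"

definition is_product :: "'a::real_vector qpair list \<Rightarrow> (nat \<Rightarrow> 'a) qpair \<Rightarrow> bool" where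
  "is_product Ps P \<longleftrightarrow> (\<exists>R. product_structure (map snd Ps) R \<and>
     P = (seq_product (map fst Ps),
          \<lparr>vspace = seq_product (map (vspace \<circ> snd) Ps), qstruct = R\<rparr>))"

text \<open>Quaternionic tuples are indexed from \<open>0\<close> and vanish beyond their length.\<close>

definition quat_tuples :: "nat \<Rightarrow> (nat \<Rightarrow> quat) set" where
  "quat_tuples n = {x. \<forall>i\<ge>n. x i = 0}"

definition quat_space :: "nat \<Rightarrow> (nat \<Rightarrow> quat) qspace" where
  "quat_space n = \<lparr>vspace = quat_tuples n,
     qstruct = orbit (\<lambda>q. zero_ext (quat_tuples n) (\<lambda>x i. q * x i))\<rparr>"

text \<open>The subspace \<open>U\<^sub>k\<close> depends on \<open>q\<^sub>1, \<dots>, q\<^bsub>k+1\<^esub>\<close>, here \<open>c 0, \<dots>, c k\<close>.\<close>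

definition U_sub :: "nat \<Rightarrow> (nat \<Rightarrow> quat) \<Rightarrow> (nat \<Rightarrow> quat) set" where
  "U_sub k c = span ({x \<in> quat_tuples (k + 1). \<forall>i. x i \<in> \<real>} \<union>
     {\<lambda>i. if i = j \<or> i = j + 1 then c i else 0 |j. j < k})"

definition admissible_choice :: "(nat \<Rightarrow> nat \<Rightarrow> quat) \<Rightarrow> bool" where
  "admissible_choice c \<longleftrightarrow> (\<forall>k\<ge>1. (\<forall>i\<le>k. c k i \<in> S2) \<and>
     (\<forall>i\<le>k. \<forall>j\<le>k. i \<noteq> j \<longrightarrow> c k i \<noteq> c k j \<and> c k i \<noteq> - c k j))"

text \<open>With the conventions \<open>z\<^sub>0 = 0\<close> and \<open>z\<^bsub>2k+1\<^esub> = 0\<close>, which also cover \<open>k = 0\<close>.\<close>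

definition V_sub :: "nat \<Rightarrow> (nat \<Rightarrow> quat) set" where
  "V_sub k = {x \<in> quat_tuples (2 * k + 1). \<exists>z :: nat \<Rightarrow> complex. z 0 = 0 \<and> z (2 * k + 1) = 0 \<and>
     (\<forall>i\<le>2 * k. x i =
        (if even i then quat_of_complex (z (i + 1)) - quat_of_complex (cnj (z i)) * quat_j
         else quat_of_complex (cnj (z i)) + quat_of_complex (z (i + 1)) * quat_j))}"

text \<open>Here \<open>a i\<close>, \<open>b i\<close> are \<open>a\<^bsub>i+1\<^esub>\<close>, \<open>b\<^bsub>i+1\<^esub>\<close>, with the convention \<open>b\<^bsub>k+1\<^esub> = 0\<close>.\<close>

definition W_sub :: "nat \<Rightarrow> quat \<Rightarrow> (nat \<Rightarrow> quat) set" where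
  "W_sub k q = (let p = (if q = quat_i \<or> q = - quat_i then quat_j else quat_i) in
     {x \<in> quat_tuples k. \<exists>a b :: nat \<Rightarrow> real. b k = 0 \<and>
        (\<forall>i<k. x i = of_real (a i) + b i *\<^sub>R q + b (i + 1) *\<^sub>R p)})"

text \<open>The argument \<open>c\<close> is the choice, for each \<open>k\<close>, of the quaternions in the definition of
  \<open>U\<^sub>k\<close>. Membership is up to isomorphism of pairs, as the dual pairs live in a type of
  their own.\<close>

definition listed :: "(nat \<Rightarrow> nat \<Rightarrow> quat) \<Rightarrow> 'a::real_vector qpair \<Rightarrow> bool" where
  "listed c P \<longleftrightarrow>
     (\<exists>k. isomorphic P (U_sub k (c k), quat_space (k + 1))) \<or>
     (\<exists>k. isomorphic P (V_sub k, quat_space (2 * k + 1))) \<or>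
     (\<exists>k q. k \<ge> 1 \<and> q \<in> S2 \<and> isomorphic P (W_sub k q, quat_space k)) \<or>
     (\<exists>k. isomorphic P (dual_pair (U_sub k (c k), quat_space (k + 1)))) \<or>
     (\<exists>k. isomorphic P (dual_pair (V_sub k, quat_space (2 * k + 1))))"

definition decomposition ::
    "(nat \<Rightarrow> nat \<Rightarrow> quat) \<Rightarrow> 'a::real_vector qpair \<Rightarrow> 'b::real_vector qpair list \<Rightarrow> bool" where
  "decomposition c P Ps \<longleftrightarrow> (\<forall>F\<in>set Ps. listed c F) \<and> (\<exists>R. is_product Ps R \<and> isomorphic P R)"

definition same_factors :: "'a::real_vector qpair list \<Rightarrow> 'b::real_vector qpair list \<Rightarrow> bool" where
  "same_factors Ps Ps' \<longleftrightarrow> (\<exists>\<pi>. bij_betw \<pi> {..<length Ps} {..<length Ps'} \<and>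
     (\<forall>i<length Ps. isomorphic (Ps ! i) (Ps' ! \<pi> i)))"

end

theory Submission
  imports Defs "HOL-Computational_Algebra.Fundamental_Theorem_Algebra"
begin

text \<open>Choose a basis, so that \<open>E\<close> is a quaternionic subspace of some \<open>H\<^sup>n\<close>. The slope of a nonzero
  quaternionic subspace \<open>K\<close> is \<open>dim (U \<inter> K) / dim K\<close>, in real dimensions, and a pair is stable if its
  proper nonzero quaternionic subspaces have smaller slope than the whole.

  For existence it suffices to find in every nonzero pair a listed pair as a direct summand
  (\<open>listed_summand\<close>). There are three cases.

  If some slope exceeds \<open>1/2\<close>, let \<open>K\<close> be of maximal slope. The orthogonal complements of the
  \<open>U_k\<close> and \<open>V_k\<close> form a family of stable pairs \<open>P\<^sub>l\<close>, \<open>l \<ge> 1\<close>, of slope \<open>1/2 + 1/(2l)\<close>, and there is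
  an \<open>l\<close> such that the slope of \<open>K\<close> is at most that of \<open>P\<^sub>l\<close> and greater than \<open>1/2 + 1/(2(l + 1))\<close>.
  Counting parameters (\<open>nonzero_hom_exists\<close>) gives a nonzero morphism from \<open>P\<^sub>l\<close> to \<open>K\<close>. By
  stability it is injective and its image has the maximal slope. A quaternionic subspace of maximal slope
  greater than \<open>1/2\<close> is a direct summand, as the obstruction to splitting vanishes
  (\<open>hom_correction\<close>, \<open>split_off\<close>, \<open>positive_summand\<close>).

  If a slope of the orthogonal complement of \<open>U\<close> exceeds \<open>1/2\<close>, the previous case and
  adjunction give a summand \<open>U_k\<close> or \<open>V_k\<close> (\<open>negative_summand\<close>).

  Otherwise \<open>dim E = 2 dim U\<close> and \<open>E = U \<oplus> qU\<close> for some \<open>q \<in> S2\<close> (\<open>regular_direction_exists\<close>), while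
  the fundamental theorem of algebra gives a \<open>p \<in> S2\<close> with \<open>U \<inter> pU \<noteq> 0\<close> (\<open>singular_direction_exists\<close>).
  On \<open>U\<close>, multiplication by \<open>p\<close> is \<open>A + qN\<close> with commuting \<open>A\<close> and \<open>N\<close>; a longest Jordan chain of \<open>N\<close> for
  the eigenvalue 0, together with its image under \<open>A\<close>, is a direct summand of \<open>U\<close> and a copy of some \<open>W_{k,q}\<close> (\<open>regular_summand\<close>).

  Uniqueness is the theorem of Krull and Schmidt (\<open>krull_schmidt\<close>), because all listed pairs have local
  endomorphism rings: nonzero endomorphisms of a stable pair are invertible, and an endomorphism of
  \<open>W_{k,q}\<close> is triangular with constant diagonal. To apply it, isomorphisms of pairs are
  turned into maps that commute with the action of the quaternions, by precomposing a representative of one of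
  the two structures with an automorphism (\<open>objiso_of_isomorphic\<close>).\<close>

section \<open>Finite-dimensional subspaces of real vector spaces\<close>

text \<open>\<open>dim\<close> is 0 on a subspace without a finite basis, so results that compare dimensions
  need this predicate.\<close>

definition fin_dim :: "'a::real_vector set \<Rightarrow> bool" where
  "fin_dim S \<longleftrightarrow> (\<exists>B. finite B \<and> S \<subseteq> span B)"

lemma fin_dim_mono: "fin_dim T \<Longrightarrow> S \<subseteq> T \<Longrightarrow> fin_dim S"
  unfolding fin_dim_def by blast

lemma fin_dim_basis:
  assumes "fin_dim S"
  obtains B where "B \<subseteq> S" "independent B" "S \<subseteq> span B" "finite B" "card B = dim S"
proof -
  obtain B where B: "B \<subseteq> S" "independent B" "S \<subseteq> span B" "card B = dim S"
    using basis_exists[of S] by blast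
  obtain C where C: "finite C" "S \<subseteq> span C" using assms fin_dim_def by blast
  have "finite B" using independent_span_bound[OF C(1) B(2)] B(1) C(2) by blast
  with B that show thesis by blast
qed

lemma dim_mono_fin: 
  assumes "fin_dim T" "S \<subseteq> T" shows "dim S \<le> dim T"
proof -
  obtain B where B: "B \<subseteq> T" "independent B" "T \<subseteq> span B" "finite B" "card B = dim T"
    using fin_dim_basis[OF assms(1)] .
  show ?thesis using dim_le_card[of S B] B assms(2) by auto
qed

lemma dim_card_le_fin: 
  assumes "fin_dim S" "independent B" "B \<subseteq> S" shows "finite B \<and> card B \<le> dim S"
proof -
  obtain C where C: "C \<subseteq> S" "independent C" "S \<subseteq> span C" "finite C" "card C = dim S"
    using fin_dim_basis[OF assms(1)] .
  show ?thesis using independent_span_bound[OF C(4) assms(2)] C assms(3) by auto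
qed

lemma subspace_eq_of_dim_le:
  assumes "fin_dim T" "subspace S" "subspace T" "S \<subseteq> T" "dim T \<le> dim S" shows "S = T"
proof (rule ccontr)
  assume "S \<noteq> T"
  then obtain x where x: "x \<in> T" "x \<notin> S" using assms by blast
  obtain B where B: "B \<subseteq> S" "independent B" "S \<subseteq> span B" "finite B" "card B = dim S"
    using fin_dim_basis[OF fin_dim_mono[OF assms(1,4)]] .
  have sp: "span B \<subseteq> S" using B(1) assms(2) by (simp add: span_minimal)
  then have "x \<notin> span B" using x by blast
  then have "independent (insert x B)" "x \<notin> B" using B(2) independent_insertI span_superset by blast+
  moreover have "insert x B \<subseteq> T" using x B assms by blast
  ultimately have "card (insert x B) \<le> dim T" using dim_card_le_fin[OF assms(1)] by blast
  then show False using B \<open>x \<notin> B\<close> assms(5) by simp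
qed

lemma dim_image_inj:
  fixes f :: "'a::real_vector \<Rightarrow> 'b::real_vector"
  assumes "linear f" "subspace S" "fin_dim S" "\<And>x. x \<in> S \<Longrightarrow> f x = 0 \<Longrightarrow> x = 0"
  shows "dim (f ` S) = dim S"
proof -
  obtain B where B: "B \<subseteq> S" "independent B" "S \<subseteq> span B" "finite B" "card B = dim S"
    using fin_dim_basis[OF assms(3)] .
  have sp: "span B = S" using B assms(2) by (simp add: span_minimal subset_antisym)
  have inj: "inj_on f S"
  proof (rule inj_onI)
    fix x y assume "x \<in> S" "y \<in> S" "f x = f y"
    then have "x - y \<in> S" "f (x - y) = 0" using assms(1,2) by (simp_all add: subspace_diff linear_diff)
    then show "x = y" using assms(4) by fastforce
  qed
  have "independent (f ` B)" using linear_independent_injective_image[OF assms(1) B(2)] inj sp by simp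
  moreover have "f ` S = span (f ` B)" using sp linear_span_image[OF assms(1)] by simp
  ultimately have "dim (f ` S) = card (f ` B)" by (simp add: dim_eq_card_independent)
  also have "\<dots> = card B" using inj B(1) by (meson card_image inj_on_subset)
  finally show ?thesis using B by simp
qed

definition ssum :: "'a::plus set \<Rightarrow> 'a set \<Rightarrow> 'a set" (infixl "\<oplus>\<^sub>s" 65) where
  "S \<oplus>\<^sub>s T = {x + y |x y. x \<in> S \<and> y \<in> T}"

lemma ssumI: "x \<in> S \<Longrightarrow> y \<in> T \<Longrightarrow> x + y \<in> S \<oplus>\<^sub>s T" unfolding ssum_def by blast
lemma ssumE: "z \<in> S \<oplus>\<^sub>s T \<Longrightarrow> (\<And>x y. z = x + y \<Longrightarrow> x \<in> S \<Longrightarrow> y \<in> T \<Longrightarrow> P) \<Longrightarrow> P" unfolding ssum_def by blast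

lemma subspace_ssum: "subspace S \<Longrightarrow> subspace T \<Longrightarrow> subspace (S \<oplus>\<^sub>s T)"
  unfolding ssum_def by (rule subspace_sums)

lemma ssum_sup1: "subspace T \<Longrightarrow> S \<subseteq> S \<oplus>\<^sub>s T" for S :: "'a::real_vector set"
  using ssumI[of _ S 0 T] subspace_0 by fastforce
lemma ssum_sup2: "subspace S \<Longrightarrow> T \<subseteq> S \<oplus>\<^sub>s T" for S :: "'a::real_vector set"
  using ssumI[of 0 S _ T] subspace_0 by fastforce
lemma ssum_least: "subspace R \<Longrightarrow> S \<subseteq> R \<Longrightarrow> T \<subseteq> R \<Longrightarrow> S \<oplus>\<^sub>s T \<subseteq> R" for S :: "'a::real_vector set"
  unfolding ssum_def using subspace_add by blast

lemma fin_dim_ssum: assumes "fin_dim S" "fin_dim T" shows "fin_dim (S \<oplus>\<^sub>s T)"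
proof -
  obtain A B where "finite A" "S \<subseteq> span A" "finite B" "T \<subseteq> span B" using assms unfolding fin_dim_def by blast
  then have "finite (A \<union> B)" "S \<oplus>\<^sub>s T \<subseteq> span (A \<union> B)"
    using span_mono[of A "A \<union> B"] span_mono[of B "A \<union> B"] ssum_least[OF subspace_span, of S "A \<union> B" T] by auto
  then show ?thesis unfolding fin_dim_def by blast
qed

lemma dim_direct_sum:
  assumes "subspace S" "subspace T" "fin_dim S" "fin_dim T" "S \<inter> T = {0}"
  shows "dim (S \<oplus>\<^sub>s T) = dim S + dim T"
proof -
  obtain A where A: "A \<subseteq> S" "independent A" "S \<subseteq> span A" "finite A" "card A = dim S"
    using fin_dim_basis[OF assms(3)] .
  obtain B where B: "B \<subseteq> T" "independent B" "T \<subseteq> span B" "finite B" "card B = dim T"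
    using fin_dim_basis[OF assms(4)] .
  have sA: "span A = S" using A assms by (simp add: span_minimal subset_antisym)
  have sB: "span B = T" using B assms by (simp add: span_minimal subset_antisym)
  have dj: "A \<inter> B = {}" 
  proof -
    have "x = 0" if "x \<in> A" "x \<in> B" for x using that A(1) B(1) assms(5) by auto
    then show ?thesis using A(2) dependent_zero[of A] by auto
  qed
  have "independent (A \<union> B)"
  proof (rule independent_if_scalars_zero)
    fix f x assume z: "(\<Sum>x\<in>A \<union> B. f x *\<^sub>R x) = 0" and x: "x \<in> A \<union> B"
    let ?a = "\<Sum>x\<in>A. f x *\<^sub>R x" and ?b = "\<Sum>x\<in>B. f x *\<^sub>R x"
    have "?a + ?b = 0" using z A B dj by (simp add: sum.union_disjoint)
    moreover have a: "?a \<in> S" and b: "?b \<in> T"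
      unfolding sA[symmetric] sB[symmetric] by (blast intro: span_sum span_scale span_base)+
    ultimately have "?a = - ?b" by (simp add: eq_neg_iff_add_eq_0)
    then have "?a \<in> T" using b assms(2) by (simp add: subspace_neg)
    then have a0: "?a = 0" using a assms(5) by blast
    then have b0: "?b = 0" using \<open>?a + ?b = 0\<close> by simp
    have "\<forall>v\<in>A. f v = 0" "\<forall>v\<in>B. f v = 0"
      using a0 b0 A(2,4) B(2,4) unfolding independent_explicit_finite_subsets by blast+
    then show "f x = 0" using x by blast
  qed (use A(4) B(4) in simp)
  moreover have "S \<oplus>\<^sub>s T = span (A \<union> B)"
    unfolding ssum_def span_Un sA sB by auto
  ultimately have "dim (S \<oplus>\<^sub>s T) = card (A \<union> B)" by (simp add: dim_eq_card_independent)
  then show ?thesis using A B dj by (simp add: card_Un_disjoint)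
qed

lemma dim_zero_space [simp]: "dim {0::'a::real_vector} = 0"
  using dim_unique[of "{}" "{0::'a}" 0] by (simp add: independent_empty)

lemma fin_dim_zero [simp]: "fin_dim {0}" unfolding fin_dim_def by (rule exI[of _ "{}"]) simp

lemma dim_eq_0_fin: assumes "fin_dim S" "subspace S" "dim S = 0" shows "S = {0}"
  using subspace_eq_of_dim_le[of S "{0}"] assms by (auto simp: subspace_0)

lemma fin_dim_image: assumes "fin_dim S" "linear f" shows "fin_dim (f ` S)"
proof -
  obtain B where B: "finite B" "S \<subseteq> span B" using assms unfolding fin_dim_def by blast
  then have "f ` S \<subseteq> span (f ` B)" unfolding linear_span_image[OF assms(2)] by blast
  then show ?thesis unfolding fin_dim_def using B by blast
qed

lemma rank_nullity:
  fixes f :: "'a::real_vector \<Rightarrow> 'b::real_vector"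
  assumes "linear f" "subspace S" "fin_dim S"
  shows "dim S = dim (f ` S) + dim {x \<in> S. f x = 0}"
proof -
  obtain g where g: "range g \<subseteq> S" "linear g" "\<And>v. v \<in> f ` S \<Longrightarrow> f (g v) = v"
    using linear_exists_right_inverse_on[OF assms(1,2)] by auto
  let ?K = "{x \<in> S. f x = 0}" and ?G = "g ` f ` S"
  have sK: "subspace ?K" using assms by (auto simp: subspace_def linear_0 linear_add linear_scale)
  have sI: "subspace (f ` S)" using assms linear_subspace_image by blast
  have sG: "subspace ?G" using linear_subspace_image[OF g(2) sI] .
  have fG: "fin_dim ?G" using g(1) by (intro fin_dim_mono[OF assms(3)]) auto
  have fK: "fin_dim ?K" by (intro fin_dim_mono[OF assms(3)]) auto
  have int: "?K \<inter> ?G = {0}"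
  proof -
    have "x = 0" if "x \<in> ?K" "x \<in> ?G" for x
      using that g(3) linear_0[OF g(2)] by fastforce
    then show ?thesis using subspace_0[OF sK] subspace_0[OF sG] by blast
  qed
  have S: "S = ?K \<oplus>\<^sub>s ?G"
  proof
    show "S \<subseteq> ?K \<oplus>\<^sub>s ?G"
    proof
      fix x assume x: "x \<in> S"
      have "x - g (f x) \<in> ?K" using x g assms
        by (auto simp: linear_diff subspace_diff range_subsetD)
      moreover have "g (f x) \<in> ?G" using x by blast
      ultimately have "x - g (f x) + g (f x) \<in> ?K \<oplus>\<^sub>s ?G" by (rule ssumI)
      then show "x \<in> ?K \<oplus>\<^sub>s ?G" by simp
    qed
    show "?K \<oplus>\<^sub>s ?G \<subseteq> S" using g(1) assms(2) by (intro ssum_least) auto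
  qed
  have "dim S = dim ?K + dim ?G" using dim_direct_sum[OF sK sG fK fG int] S by simp
  moreover have "dim ?G = dim (f ` S)"
    using dim_image_inj[OF g(2) sI fin_dim_image[OF assms(3,1)]] g(3) linear_0[OF assms(1)] by metis
  ultimately show ?thesis by simp
qed

lemma linear_with_kernel:
  fixes S :: "'a::real_vector set" assumes "subspace S"
  shows "\<exists>g :: 'a \<Rightarrow> 'a. linear g \<and> (\<forall>x. g x = 0 \<longleftrightarrow> x \<in> S)"
proof -
  obtain B where B: "B \<subseteq> S" "independent B" "S \<subseteq> span B" using maximal_independent_subset by blast
  have sB: "span B = S" using B assms by (simp add: span_minimal subset_antisym)
  obtain C where C: "B \<subseteq> C" "C \<subseteq> UNIV" "independent C" "UNIV \<subseteq> span C"
    using maximal_independent_subset_extend[OF subset_UNIV B(2)] .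
  obtain g where g: "linear g" "\<forall>x\<in>C. g x = (if x \<in> B then 0 else x)"
    using linear_independent_extend[OF C(3), of "\<lambda>x. if x \<in> B then 0 else x"] by blast
  have g0: "g x = 0" if "x \<in> S" for x
  proof (rule linear_eq_0_on_span[OF g(1)])
    show "x \<in> span B" using that sB by simp
    show "g y = 0" if "y \<in> B" for y using that g(2) C(1) by auto
  qed
  have gC: "g x = x" if "x \<in> span (C - B)" for x
  proof -
    have "g x = id x"
      by (rule linear_eq_on[OF g(1) linear_id that]) (use g(2) in auto)
    then show ?thesis by simp
  qed
  have "x \<in> S" if "g x = 0" for x
  proof -
    have "B \<union> (C - B) = C" using C(1) by blast
    then have "x \<in> span (B \<union> (C - B))" using C(4) by auto
    then obtain b d where bd: "b \<in> span B" "d \<in> span (C - B)" "x = b + d" unfolding span_Un by blast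
    then have "g x = d" using g0 gC sB linear_add[OF g(1)] by simp
    then show ?thesis using that bd sB by simp
  qed
  then show ?thesis using g g0 by blast
qed

lemma dim_ssum_Int:
  assumes "subspace S" "subspace T" "fin_dim S" "fin_dim T"
  shows "dim (S \<oplus>\<^sub>s T) + dim (S \<inter> T) = dim S + dim T"
proof -
  obtain g :: "'a \<Rightarrow> 'a" where g: "linear g" "\<And>x. g x = 0 \<longleftrightarrow> x \<in> S" using linear_with_kernel[OF assms(1)] by blast
  have "g ` (S \<oplus>\<^sub>s T) = g ` T"
  proof
    show "g ` (S \<oplus>\<^sub>s T) \<subseteq> g ` T"
    proof
      fix z assume "z \<in> g ` (S \<oplus>\<^sub>s T)"
      then obtain x y where "x \<in> S" "y \<in> T" "z = g (x + y)" by (auto elim!: ssumE)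
      then show "z \<in> g ` T" using g(2)[of x] linear_add[OF g(1), of x y] by simp
    qed
    show "g ` T \<subseteq> g ` (S \<oplus>\<^sub>s T)" using ssum_sup2[OF assms(1), of T] by (rule image_mono)
  qed
  moreover have "{x \<in> S \<oplus>\<^sub>s T. g x = 0} = S" using g ssum_sup1[OF assms(2), of S] by blast
  moreover have "{x \<in> T. g x = 0} = S \<inter> T" using g by blast
  ultimately show ?thesis
    using rank_nullity[OF g(1) subspace_ssum[OF assms(1,2)] fin_dim_ssum[OF assms(3,4)]]
      rank_nullity[OF g(1) assms(2,4)] by simp
qed

text \<open>The condition \<open>L x \<in> U\<close> costs at most the codimension of \<open>U\<close> in \<open>E\<close>.\<close>

lemma dim_preimage_ge:
  fixes L :: "'a::real_vector \<Rightarrow> 'b::real_vector"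
  assumes "linear L" "subspace T" "fin_dim T" "L ` T \<subseteq> E" "subspace U" "U \<subseteq> E" "fin_dim E" "subspace E"
  shows "dim T + dim U \<le> dim {x \<in> T. L x \<in> U} + dim E"
proof -
  let ?V = "{x \<in> T. L x \<in> U}"
  have sV: "subspace ?V" using assms by (auto simp: subspace_def linear_0 linear_add linear_scale)
  have fV: "fin_dim ?V" by (intro fin_dim_mono[OF assms(3)]) auto
  have sI: "subspace (L ` T)" using assms linear_subspace_image by blast
  have fI: "fin_dim (L ` T)" and fU: "fin_dim U" by (auto intro: fin_dim_mono[OF assms(7)] assms(4)[THEN subsetD] assms(6)[THEN subsetD])
  have 1: "L ` ?V = L ` T \<inter> U" by blast
  have 2: "{x \<in> ?V. L x = 0} = {x \<in> T. L x = 0}" using assms(5) subspace_0 by auto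
  have 3: "dim (L ` T \<oplus>\<^sub>s U) \<le> dim E"
    using dim_mono_fin[OF assms(7)] ssum_least[OF assms(8,4,6)] by blast
  show ?thesis
    using rank_nullity[OF assms(1-3)] rank_nullity[OF assms(1) sV fV] 1 2 3
      dim_ssum_Int[OF sI assms(5) fI fU] by simp
qed

lemma separating_functional:
  fixes S :: "'a::real_vector set" assumes "subspace S" "x \<notin> S"
  shows "\<exists>g :: 'a \<Rightarrow> real. linear g \<and> (\<forall>y\<in>S. g y = 0) \<and> g x = 1"
proof -
  obtain B where B: "B \<subseteq> S" "independent B" "S \<subseteq> span B" using maximal_independent_subset by blast
  have sB: "span B = S" using B assms by (simp add: span_minimal subset_antisym)
  then have "x \<notin> span B" using assms by simp
  then have ind: "independent (insert x B)" "x \<notin> B" using B(2) independent_insertI span_superset by blast+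
  obtain g :: "'a \<Rightarrow> real" where g: "linear g" "\<forall>y\<in>insert x B. g y = (if y = x then 1 else 0)"
    using linear_independent_extend[OF ind(1), of "\<lambda>y. if y = x then 1 else 0 :: real"] by blast
  have "g y = 0" if "y \<in> S" for y
  proof (rule linear_eq_0_on_span[OF g(1)])
    show "y \<in> span B" using that sB by simp
    show "g z = 0" if "z \<in> B" for z using that g(2) ind(2) by auto
  qed
  then show ?thesis using g by auto
qed

lemma fun_scaleR [simp]: "(c *\<^sub>R f) x = c *\<^sub>R f x" by (simp add: scaleR_fun_def)
lemma fun_sum [simp]: "(\<Sum>i\<in>A. f i) x = (\<Sum>i\<in>A. f i x)" for f :: "'i \<Rightarrow> 'a \<Rightarrow> 'b::ab_group_add"
  by (induction A rule: infinite_finite_induct) auto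

section \<open>Spaces of finitely supported functions\<close>

definition fun_space :: "'i set \<Rightarrow> 'a::real_vector set \<Rightarrow> ('i \<Rightarrow> 'a) set" where
  "fun_space A E = {f. (\<forall>i\<in>A. f i \<in> E) \<and> (\<forall>i. i \<notin> A \<longrightarrow> f i = 0)}"

definition single :: "'i \<Rightarrow> 'a::real_vector \<Rightarrow> 'i \<Rightarrow> 'a" where
  "single a v = (\<lambda>i. if i = a then v else 0)"

lemma linear_single: "linear (single a)"
  by (rule linearI) (auto simp: single_def fun_eq_iff)

lemma single_apply: "single a v i = (if i = a then v else 0)" by (simp add: single_def)

lemma subspace_fun_space: "subspace E \<Longrightarrow> subspace (fun_space A E)"
  by (auto simp: subspace_def fun_space_def)

lemma dim_fun_space:
  fixes A :: "'i set" and E :: "'a::real_vector set"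
  assumes "finite A" "subspace E" "fin_dim E"
  shows "fin_dim (fun_space A E) \<and> dim (fun_space A E) = card A * dim E"
  using assms(1)
proof (induction A)
  case empty
  have "fun_space ({} :: 'i set) E = {0}" by (auto simp: fun_space_def fun_eq_iff)
  then show ?case by simp
next
  case (insert a A)
  let ?S = "single a ` E" and ?T = "fun_space A E"
  have eq: "fun_space (insert a A) E = ?S \<oplus>\<^sub>s ?T"
  proof
    show "fun_space (insert a A) E \<subseteq> ?S \<oplus>\<^sub>s ?T"
    proof
      fix f assume f: "f \<in> fun_space (insert a A) E"
      have "single a (f a) \<in> ?S" using f by (auto simp: fun_space_def)
      moreover have "f - single a (f a) \<in> ?T"
        using f insert(2) by (auto simp: fun_space_def single_def)
      ultimately have "single a (f a) + (f - single a (f a)) \<in> ?S \<oplus>\<^sub>s ?T" by (rule ssumI)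
      then show "f \<in> ?S \<oplus>\<^sub>s ?T" by simp
    qed
    show "?S \<oplus>\<^sub>s ?T \<subseteq> fun_space (insert a A) E"
      using insert(2) by (auto elim!: ssumE simp: fun_space_def single_def)
  qed
  have sS: "subspace ?S" using linear_subspace_image[OF linear_single assms(2)] .
  have fS: "fin_dim ?S" using fin_dim_image[OF assms(3) linear_single] .
  have dS: "dim ?S = dim E"
  proof (rule dim_image_inj[OF linear_single assms(2,3)])
    fix x assume "single a x = 0"
    then show "x = 0" by (auto simp: single_def fun_eq_iff split: if_splits)
  qed
  have sT: "subspace ?T" using subspace_fun_space[OF assms(2)] .
  have "x = 0" if "x \<in> ?S" "x \<in> ?T" for x using that insert(2)
    by (auto simp: fun_space_def single_def fun_eq_iff)
  then have int: "?S \<inter> ?T = {0}" using subspace_0[OF sS] subspace_0[OF sT] by blast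
  have fT: "fin_dim ?T" and dT: "dim ?T = card A * dim E" using insert by auto
  show ?case unfolding eq
    using fin_dim_ssum[OF fS fT] dim_direct_sum[OF sS sT fS fT int] dS dT insert by simp
qed

section \<open>Quaternions\<close>

lemma quat_sel [simp]:
  "qRe 0 = 0" "qI 0 = 0" "qJ 0 = 0" "qK 0 = 0"
  "qRe 1 = 1" "qI 1 = 0" "qJ 1 = 0" "qK 1 = 0"
  "qRe (p + q) = qRe p + qRe q" "qI (p + q) = qI p + qI q" "qJ (p + q) = qJ p + qJ q" "qK (p + q) = qK p + qK q"
  "qRe (p - q) = qRe p - qRe q" "qI (p - q) = qI p - qI q" "qJ (p - q) = qJ p - qJ q" "qK (p - q) = qK p - qK q"
  "qRe (- q) = - qRe q" "qI (- q) = - qI q" "qJ (- q) = - qJ q" "qK (- q) = - qK q"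
  "qRe (c *\<^sub>R q) = c * qRe q" "qI (c *\<^sub>R q) = c * qI q" "qJ (c *\<^sub>R q) = c * qJ q" "qK (c *\<^sub>R q) = c * qK q"
  by (simp_all add: zero_quat_def one_quat_def plus_quat_def minus_quat_def uminus_quat_def scaleR_quat_def)

lemma quat_sel_mult:
  "qRe (p * q) = qRe p * qRe q - qI p * qI q - qJ p * qJ q - qK p * qK q"
  "qI (p * q) = qRe p * qI q + qI p * qRe q + qJ p * qK q - qK p * qJ q"
  "qJ (p * q) = qRe p * qJ q - qI p * qK q + qJ p * qRe q + qK p * qI q"
  "qK (p * q) = qRe p * qK q + qI p * qJ q - qJ p * qI q + qK p * qRe q"
  by (simp_all add: times_quat_def)

lemma qcnj_sel [simp]: "qRe (qcnj q) = qRe q" "qI (qcnj q) = - qI q" "qJ (qcnj q) = - qJ q" "qK (qcnj q) = - qK q"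
  by (simp_all add: qcnj_def)

definition quat_k :: quat where "quat_k = Quat 0 0 0 1"

lemma quat_unit_sel [simp]:
  "qRe quat_i = 0" "qI quat_i = 1" "qJ quat_i = 0" "qK quat_i = 0"
  "qRe quat_j = 0" "qI quat_j = 0" "qJ quat_j = 1" "qK quat_j = 0"
  "qRe quat_k = 0" "qI quat_k = 0" "qJ quat_k = 0" "qK quat_k = 1"
  by (simp_all add: quat_i_def quat_j_def quat_k_def)

lemma quat_of_real_sel [simp]: "qRe (of_real r) = r" "qI (of_real r) = 0" "qJ (of_real r) = 0" "qK (of_real r) = 0"
  by (simp_all add: of_real_def)

lemmas quat_simps = quat_eq_iff quat_sel_mult inner_quat_def

lemma norm_quat_sq: "(norm q)\<^sup>2 = (qRe q)\<^sup>2 + (qI q)\<^sup>2 + (qJ q)\<^sup>2 + (qK q)\<^sup>2"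
  by (simp add: norm_quat_def)

lemma qcnj_mult: "qcnj (p * q) = qcnj q * qcnj p" by (simp add: quat_simps)
lemma qcnj_qcnj [simp]: "qcnj (qcnj q) = q" by (simp add: quat_simps)
lemma qcnj_add: "qcnj (p + q) = qcnj p + qcnj q" by (simp add: quat_simps)
lemma qcnj_scaleR: "qcnj (c *\<^sub>R p) = c *\<^sub>R qcnj p" by (simp add: quat_simps)
lemma qcnj_0 [simp]: "qcnj 0 = 0" by (simp add: quat_simps)
lemma qcnj_1 [simp]: "qcnj 1 = 1" by (simp add: quat_simps)
lemma quat_mult_cnj: "q * qcnj q = ((norm q)\<^sup>2) *\<^sub>R 1" "qcnj q * q = ((norm q)\<^sup>2) *\<^sub>R 1"
  by (simp_all add: quat_simps norm_quat_sq) (simp_all add: power2_eq_square)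

instantiation quat :: real_div_algebra
begin
definition inverse_quat_def: "inverse (q :: quat) = qcnj q /\<^sub>R (norm q)\<^sup>2"
definition divide_quat_def: "(p :: quat) div q = p * inverse q"
instance
proof
  fix a b :: quat
  show "a \<noteq> 0 \<Longrightarrow> inverse a * a = 1" "a \<noteq> 0 \<Longrightarrow> a * inverse a = 1"
    by (simp_all add: inverse_quat_def quat_mult_cnj)
  show "a div b = a * inverse b" by (rule divide_quat_def)
  show "inverse (0::quat) = 0" by (simp add: inverse_quat_def)
qed
end

lemma inner_quat_mult: "(q * x) \<bullet> y = x \<bullet> (qcnj q * y)" "(x * q) \<bullet> y = x \<bullet> (y * qcnj q)" for q :: quat
  by (simp_all add: quat_simps algebra_simps)

lemma S2_iff: "q \<in> S2 \<longleftrightarrow> qRe q = 0 \<and> (qI q)\<^sup>2 + (qJ q)\<^sup>2 + (qK q)\<^sup>2 = 1"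
  by (auto simp: S2_def norm_quat_def)

lemma S2_square: "q \<in> S2 \<Longrightarrow> q * q = -1"
  by (simp add: S2_iff quat_simps power2_eq_square)

lemma S2_square_iff: "q \<in> S2 \<longleftrightarrow> q * q = -1"
proof
  assume h: "q * q = -1"
  have e: "qRe q * qRe q - qI q * qI q - qJ q * qJ q - qK q * qK q = -1"
    "qRe q * qI q = 0" "qRe q * qJ q = 0" "qRe q * qK q = 0"
    using h by (auto simp: quat_simps)
  have "qRe q = 0"
  proof (rule ccontr)
    assume "qRe q \<noteq> 0"
    then have "qRe q * qRe q = -1" using e by simp
    moreover have "qRe q * qRe q \<ge> 0" by simp
    ultimately show False by linarith
  qed
  then show "q \<in> S2" using e(1) by (simp add: S2_iff power2_eq_square)
qed (rule S2_square)

lemma S2_nonzero: "q \<in> S2 \<Longrightarrow> q \<noteq> 0" by (auto simp: S2_iff)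
lemma unit_S2 [simp]: "quat_i \<in> S2" "quat_j \<in> S2" "quat_k \<in> S2" by (simp_all add: S2_iff)

lemma quat_polar: obtains a b q where "p = of_real a + b *\<^sub>R q" "q \<in> S2"
proof (cases "norm (p - of_real (qRe p)) = 0")
  case True
  then have "p = of_real (qRe p) + 0 *\<^sub>R quat_i" by simp
  then show thesis using that unit_S2 by blast
next
  case False
  let ?v = "p - of_real (qRe p)"
  have "?v /\<^sub>R norm ?v \<in> S2" using False by (auto simp: S2_def)
  moreover have "p = of_real (qRe p) + norm ?v *\<^sub>R (?v /\<^sub>R norm ?v)" using False by simp
  ultimately show thesis using that by blast
qed

lemma quat_span: "q = qRe q *\<^sub>R 1 + qI q *\<^sub>R quat_i + qJ q *\<^sub>R quat_j + qK q *\<^sub>R quat_k"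
  by (simp add: quat_simps)

lemma quat_basis: "independent {1, quat_i, quat_j, quat_k}" "span {1, quat_i, quat_j, quat_k} = UNIV"
  "card {1, quat_i, quat_j, quat_k} = 4"
proof -
  have d: "1 \<noteq> quat_i" "1 \<noteq> quat_j" "1 \<noteq> quat_k" "quat_i \<noteq> quat_j" "quat_i \<noteq> quat_k" "quat_j \<noteq> quat_k"
    by (simp_all add: quat_simps)
  then show "card {1, quat_i, quat_j, quat_k} = 4" by simp
  show "span {1, quat_i, quat_j, quat_k} = UNIV"
  proof -
    have "q \<in> span {1, quat_i, quat_j, quat_k}" for q
      by (subst quat_span[of q]) (intro span_add span_scale span_base; simp)
    then show ?thesis by blast
  qed
  show "independent {1, quat_i, quat_j, quat_k}"
  proof (rule independent_if_scalars_zero)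
    fix f x assume "(\<Sum>x\<in>{1, quat_i, quat_j, quat_k}. f x *\<^sub>R x) = 0" and x: "x \<in> {1, quat_i, quat_j, quat_k}"
    then have "f 1 = 0" "f quat_i = 0" "f quat_j = 0" "f quat_k = 0" using d by (simp_all add: quat_simps)
    then show "f x = 0" using x by auto
  qed simp
qed

lemma fin_dim_quat: "fin_dim (S :: quat set)"
  unfolding fin_dim_def using quat_basis(2) by (intro exI[of _ "{1, quat_i, quat_j, quat_k}"]) simp

lemma dim_quat: "dim (UNIV :: quat set) = 4"
  using dim_unique[of "{1, quat_i, quat_j, quat_k}" UNIV 4] quat_basis by simp

section \<open>Quaternionic subspaces of tuples\<close>

definition hmul :: "quat \<Rightarrow> ('i \<Rightarrow> quat) \<Rightarrow> 'i \<Rightarrow> quat" where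
  "hmul q x = (\<lambda>i. q * x i)"

lemma hmul_apply [simp]: "hmul q x i = q * x i" by (simp add: hmul_def)

lemma hmul_simps:
  "hmul (p + q) x = hmul p x + hmul q x" "hmul q (x + y) = hmul q x + hmul q y"
  "hmul (p * q) x = hmul p (hmul q x)" "hmul (c *\<^sub>R q) x = c *\<^sub>R hmul q x" "hmul q (c *\<^sub>R x) = c *\<^sub>R hmul q x"
  "hmul (p - q) x = hmul p x - hmul q x" "hmul q (x - y) = hmul q x - hmul q y"
  "hmul (- q) x = - hmul q x" "hmul q (- x) = - hmul q x"
  by (simp_all add: fun_eq_iff algebra_simps)

lemma hmul_1 [simp]: "hmul 1 x = x" "hmul 0 x = 0" "hmul q 0 = 0" "hmul (of_real r) x = r *\<^sub>R x"
  by (simp_all add: fun_eq_iff of_real_def)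

lemma linear_hmul: "linear (hmul q)" by (rule linearI) (simp_all add: hmul_simps)
lemma linear_hmul_left: "linear (\<lambda>q. hmul q x)" by (rule linearI) (simp_all add: hmul_simps)
lemma hmul_sum: "hmul q (\<Sum>i\<in>A. f i) = (\<Sum>i\<in>A. hmul q (f i))"
  by (rule linear_sum[OF linear_hmul])
lemma hmul_sum_left: "hmul (\<Sum>i\<in>A. f i) x = (\<Sum>i\<in>A. hmul (f i) x)"
  by (rule linear_sum[OF linear_hmul_left])

lemma hmul_eq_0: "hmul q x = 0 \<longleftrightarrow> q = 0 \<or> x = 0"
  by (auto simp: fun_eq_iff)

text \<open>The type \<open>nat \<Rightarrow> quat\<close> contains \<open>quat_tuples n\<close> for every \<open>n\<close>, so the predicate does not fix the number of
  coordinates.\<close>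

definition hsub :: "(nat \<Rightarrow> quat) set \<Rightarrow> bool" where
  "hsub S \<longleftrightarrow> subspace S \<and> (\<forall>q. \<forall>x\<in>S. hmul q x \<in> S)"

lemma hsub_subspace: "hsub S \<Longrightarrow> subspace S" by (simp add: hsub_def)
lemma hsub_hmul: "hsub S \<Longrightarrow> x \<in> S \<Longrightarrow> hmul q x \<in> S" by (simp add: hsub_def)

lemma hsubI: "0 \<in> S \<Longrightarrow> (\<And>x y. x \<in> S \<Longrightarrow> y \<in> S \<Longrightarrow> x + y \<in> S) \<Longrightarrow> (\<And>q x. x \<in> S \<Longrightarrow> hmul q x \<in> S) \<Longrightarrow> hsub S"
  unfolding hsub_def subspace_def by (metis hmul_1(4))

lemma hsub_ssum: "hsub S \<Longrightarrow> hsub T \<Longrightarrow> hsub (S \<oplus>\<^sub>s T)"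
  by (force simp: hsub_def subspace_ssum hmul_simps elim!: ssumE intro: ssumI)
lemma hsub_zero [simp]: "hsub {0}" by (rule hsubI) auto
lemma hsub_tuples [simp]: "hsub (quat_tuples n)" by (rule hsubI) (auto simp: quat_tuples_def)
lemma subspace_tuples [simp]: "subspace (quat_tuples n)" using hsub_tuples hsub_subspace by blast

lemma quat_tuples_fun_space: "quat_tuples n = fun_space {..<n} UNIV"
  by (auto simp: quat_tuples_def fun_space_def not_less)

lemma fin_dim_tuples [simp]: "fin_dim (quat_tuples n)" and dim_tuples: "dim (quat_tuples n) = 4 * n"
  using dim_fun_space[of "{..<n}" "UNIV :: quat set"] by (auto simp: quat_tuples_fun_space fin_dim_quat dim_quat)

definition hline :: "(nat \<Rightarrow> quat) \<Rightarrow> (nat \<Rightarrow> quat) set" where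
  "hline x = range (\<lambda>q. hmul q x)"

lemma hsub_hline: "hsub (hline x)"
  by (rule hsubI) (auto simp: hline_def simp flip: hmul_simps intro: image_eqI[of _ _ 0])

lemma hline_subset: "hsub S \<Longrightarrow> x \<in> S \<Longrightarrow> hline x \<subseteq> S" by (auto simp: hline_def hsub_def)

lemma fin_dim_hline: "fin_dim (hline x)"
  unfolding hline_def by (rule fin_dim_image[OF fin_dim_quat linear_hmul_left])

lemma dim_hline: assumes "x \<noteq> 0" shows "dim (hline x) = 4"
  unfolding hline_def using dim_image_inj[OF linear_hmul_left subspace_UNIV fin_dim_quat] assms
  by (auto simp: dim_quat hmul_eq_0)

lemma hline_Int: assumes "hsub S" "x \<notin> S" shows "hline x \<inter> S = {0}"
proof -
  have "hmul q x = 0" if "hmul q x \<in> S" for q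
  proof (rule ccontr)
    assume "hmul q x \<noteq> 0"
    then have "q \<noteq> 0" by auto
    then have "hmul (inverse q) (hmul q x) = x" by (simp flip: hmul_simps)
    then show False using hsub_hmul[OF assms(1) that] assms(2) by metis
  qed
  then show ?thesis using hsub_subspace[OF hsub_hline, THEN subspace_0] hsub_subspace[OF assms(1), THEN subspace_0]
    unfolding hline_def by auto
qed

section \<open>Orthogonal complements\<close>

definition ip :: "nat \<Rightarrow> (nat \<Rightarrow> quat) \<Rightarrow> (nat \<Rightarrow> quat) \<Rightarrow> real" where
  "ip n x y = (\<Sum>i<n. x i \<bullet> y i)"

lemma ip_simps: "ip n (x + y) z = ip n x z + ip n y z" "ip n z (x + y) = ip n z x + ip n z y"
  "ip n (c *\<^sub>R x) z = c * ip n x z" "ip n z (c *\<^sub>R x) = c * ip n z x"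
  "ip n (x - y) z = ip n x z - ip n y z" "ip n z (x - y) = ip n z x - ip n z y"
  "ip n 0 z = 0" "ip n z 0 = 0"
  by (simp_all add: ip_def inner_simps sum.distrib sum_distrib_left sum_subtractf)

lemma ip_commute: "ip n x y = ip n y x" by (simp add: ip_def inner_commute)
lemma ip_hmul: "ip n (hmul q x) y = ip n x (hmul (qcnj q) y)" by (simp add: ip_def inner_quat_mult)

lemma ip_pos: assumes "x \<in> quat_tuples n" "ip n x x = 0" shows "x = 0"
proof -
  have "\<forall>i<n. x i \<bullet> x i = 0" using assms(2) unfolding ip_def by (subst (asm) sum_nonneg_eq_0_iff) auto
  then show ?thesis using assms(1) by (auto simp: fun_eq_iff quat_tuples_def) (metis not_less)
qed

lemma orth_projection_exists:
  assumes "finite B" "B \<subseteq> quat_tuples n"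
  shows "\<exists>s\<in>span B. \<forall>b\<in>span B. ip n (x - s) b = 0"
  using assms
proof (induction B arbitrary: x rule: finite_induct)
  case empty
  have "\<forall>b\<in>span {}. ip n (x - 0) b = 0" by (simp add: ip_def)
  then show ?case by (intro bexI[of _ 0] span_zero)
next
  case (insert c B)
  obtain s where s: "s \<in> span B" "\<forall>b\<in>span B. ip n (x - s) b = 0" using insert by blast
  obtain t where t: "t \<in> span B" "\<forall>b\<in>span B. ip n (c - t) b = 0" using insert by blast
  define d where "d = c - t"
  have dt: "d \<in> quat_tuples n"
  proof -
    have "span B \<subseteq> quat_tuples n" using insert.prems by (intro span_minimal) auto
    then show ?thesis using t(1) insert.prems unfolding d_def by (auto intro: subspace_diff)
  qed
  define r where "r = s + (ip n (x - s) d / ip n d d) *\<^sub>R d"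
  have sub: "span B \<subseteq> span (insert c B)" by (intro span_mono) auto
  have din: "d \<in> span (insert c B)" unfolding d_def using t(1) sub by (auto intro: span_diff span_base)
  have "r \<in> span (insert c B)" unfolding r_def using s(1) sub din by (auto intro: span_add span_scale)
  moreover have "ip n (x - r) b = 0" if b: "b \<in> span (insert c B)" for b
  proof -
    obtain k where "b - k *\<^sub>R c \<in> span B" using b unfolding span_insert by blast
    then have "(b - k *\<^sub>R c) + k *\<^sub>R t \<in> span B" using t(1) by (intro span_add span_scale)
    moreover have "(b - k *\<^sub>R c) + k *\<^sub>R t = b - k *\<^sub>R d" unfolding d_def by (simp only: scaleR_diff_right) (simp only: diff_diff_eq2 diff_add_eq)
    ultimately have e: "b - k *\<^sub>R d \<in> span B" by (rule back_subst)
    have z: "ip n (x - r) d = 0"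
    proof (cases "ip n d d = 0")
      case True then have "d = 0" using ip_pos[OF dt] by simp
      then show ?thesis by (simp add: ip_simps)
    next
      case False then show ?thesis unfolding r_def by (simp add: ip_simps)
    qed
    have "ip n (x - r) (b - k *\<^sub>R d) = 0"
    proof -
      have "ip n (x - s) (b - k *\<^sub>R d) = 0" "ip n d (b - k *\<^sub>R d) = 0"
        using s(2) t(2) e unfolding d_def[symmetric] by blast+
      moreover have "ip n (x - r) y = ip n (x - s) y - (ip n (x - s) d / ip n d d) * ip n d y" for y
        unfolding r_def by (simp add: ip_simps)
      ultimately show ?thesis by simp
    qed
    then show ?thesis using z by (simp add: ip_simps)
  qed
  ultimately show ?case by blast
qed

definition perp :: "nat \<Rightarrow> (nat \<Rightarrow> quat) set \<Rightarrow> (nat \<Rightarrow> quat) set \<Rightarrow> (nat \<Rightarrow> quat) set" where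
  "perp n E U = {x \<in> E. \<forall>u\<in>U. ip n x u = 0}"

lemma perp_subset: "perp n E U \<subseteq> E" by (auto simp: perp_def)

lemma subspace_perp: "subspace E \<Longrightarrow> subspace (perp n E U)"
  by (auto simp: perp_def subspace_def ip_simps)

lemma hsub_perp: "hsub E \<Longrightarrow> hsub F \<Longrightarrow> hsub (perp n E F)"
  unfolding hsub_def by (auto simp: subspace_perp) (auto simp: perp_def ip_hmul)

lemma fin_dim_sub_tuples: "E \<subseteq> quat_tuples n \<Longrightarrow> fin_dim E"
  using fin_dim_mono[OF fin_dim_tuples] .

lemma perp_decomp:
  assumes "E \<subseteq> quat_tuples n" "subspace E" "subspace U" "U \<subseteq> E"
  shows "U \<inter> perp n E U = {0}" "E = U \<oplus>\<^sub>s perp n E U" "dim E = dim U + dim (perp n E U)"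
proof -
  show 1: "U \<inter> perp n E U = {0}"
    using assms ip_pos subspace_0[OF assms(2)] subspace_0[OF assms(3)] by (auto simp: perp_def ip_simps)
  have "fin_dim U" by (rule fin_dim_sub_tuples[of _ n]) (use assms in auto)
  then obtain B where B: "B \<subseteq> U" "independent B" "U \<subseteq> span B" "finite B" "card B = dim U" by (rule fin_dim_basis)
  have sB: "span B = U" using B assms by (simp add: span_minimal subset_antisym)
  show 2: "E = U \<oplus>\<^sub>s perp n E U"
  proof
    show "E \<subseteq> U \<oplus>\<^sub>s perp n E U"
    proof
      fix x assume x: "x \<in> E"
      have "B \<subseteq> quat_tuples n" using B assms by blast
      then obtain s where s: "s \<in> U" "\<forall>b\<in>U. ip n (x - s) b = 0" using orth_projection_exists[OF B(4), of n x] sB by auto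
      then have "x - s \<in> perp n E U" using x assms by (auto simp: perp_def subspace_diff)
      then have "s + (x - s) \<in> U \<oplus>\<^sub>s perp n E U" by (rule ssumI[OF s(1)])
      then show "x \<in> U \<oplus>\<^sub>s perp n E U" by simp
    qed
    show "U \<oplus>\<^sub>s perp n E U \<subseteq> E" using assms perp_subset by (intro ssum_least) auto
  qed
  have f: "fin_dim E" using assms fin_dim_sub_tuples by blast
  have "dim (U \<oplus>\<^sub>s perp n E U) = dim U + dim (perp n E U)"
    by (rule dim_direct_sum[OF assms(3) subspace_perp[OF assms(2)] fin_dim_mono[OF f assms(4)] fin_dim_mono[OF f perp_subset] 1])
  then show "dim E = dim U + dim (perp n E U)" using 2 by simp
qed

lemma perp_perp:
  assumes "E \<subseteq> quat_tuples n" "subspace E" "subspace U" "U \<subseteq> E"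
  shows "perp n E (perp n E U) = U"
proof -
  have s: "subspace (perp n E U)" "perp n E U \<subseteq> E" using subspace_perp[OF assms(2)] perp_subset by auto
  have "U \<subseteq> perp n E (perp n E U)" using assms(4) by (auto simp: perp_def ip_commute)
  moreover have "dim (perp n E (perp n E U)) \<le> dim U"
    using perp_decomp(3)[OF assms] perp_decomp(3)[OF assms(1,2) s] by simp
  moreover have "fin_dim (perp n E (perp n E U))" using assms(1) by (intro fin_dim_sub_tuples[of _ n]) (auto simp: perp_def)
  ultimately show ?thesis using subspace_eq_of_dim_le[of "perp n E (perp n E U)" U] assms(3) subspace_perp[OF assms(2)] by blast
qed

text \<open>A nonzero quaternionic subspace splits into a line, of real dimension 4, and its
  orthogonal complement.\<close>

lemma hsub_dim_dvd:
  assumes "hsub S" "S \<subseteq> quat_tuples n" shows "4 dvd dim S"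
  using assms
proof (induction "dim S" arbitrary: S rule: less_induct)
  case less
  show ?case
  proof (cases "S = {0}")
    case False
    then obtain x where x: "x \<in> S" "x \<noteq> 0" using less.prems hsub_subspace subspace_0 by blast
    have L: "hline x \<subseteq> S" using hline_subset less.prems x by blast
    have d: "dim S = 4 + dim (perp n S (hline x))"
      using perp_decomp(3)[OF less.prems(2) hsub_subspace[OF less.prems(1)] hsub_subspace[OF hsub_hline] L] dim_hline[OF x(2)] by simp
    have "4 dvd dim (perp n S (hline x))"
      by (rule less.hyps) (use d less.prems hsub_perp[OF less.prems(1) hsub_hline] perp_subset[of n S "hline x"] in \<open>auto dest: subsetD\<close>)
    then show ?thesis using d by simp
  qed simp
qed

definition hlin :: "((nat \<Rightarrow> quat) \<Rightarrow> (nat \<Rightarrow> quat)) \<Rightarrow> bool" where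
  "hlin f \<longleftrightarrow> linear f \<and> (\<forall>q x. f (hmul q x) = hmul q (f x))"

lemma hlin_linear: "hlin f \<Longrightarrow> linear f" by (simp add: hlin_def)
lemma hlin_hmul: "hlin f \<Longrightarrow> f (hmul q x) = hmul q (f x)" by (simp add: hlin_def)

lemma hsub_image: assumes "hlin f" "hsub S" shows "hsub (f ` S)"
  unfolding hsub_def
proof (intro conjI allI ballI)
  show "subspace (f ` S)" using assms linear_subspace_image hsub_def hlin_def by blast
  fix q y assume "y \<in> f ` S"
  then obtain x where "x \<in> S" "y = f x" by blast
  then have "hmul q y = f (hmul q x)" "hmul q x \<in> S" 
    using hlin_hmul[OF assms(1)] hsub_hmul[OF assms(2)] by auto
  then show "hmul q y \<in> f ` S" by simp
qed

lemma hsub_kernel: assumes "hlin f" "hsub S" shows "hsub {x \<in> S. f x = 0}"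
  using assms hsub_subspace[OF assms(2)] unfolding hlin_def
  by (intro hsubI) (auto simp: linear_0 linear_add hsub_hmul subspace_add subspace_0)

lemma hlin_0: "hlin (\<lambda>x. 0)" by (simp add: hlin_def linear_zero)
lemma hlin_id: "hlin (\<lambda>x. x)" by (simp add: hlin_def linear_ident)
lemma hlin_add: "hlin f \<Longrightarrow> hlin g \<Longrightarrow> hlin (\<lambda>x. f x + g x)"
  by (simp add: hlin_def linear_compose_add hmul_simps)
lemma hlin_scaleR: "hlin f \<Longrightarrow> hlin (\<lambda>x. c *\<^sub>R f x)"
  by (auto simp: hlin_def linear_compose_scale_right hmul_simps)

text \<open>The inequality of the slopes \<open>dim (U \<inter> K) / dim K\<close> and \<open>dim U / dim E\<close>, multiplied out to
  stay within the natural numbers.\<close>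

definition slope_stable :: "(nat \<Rightarrow> quat) set \<Rightarrow> (nat \<Rightarrow> quat) set \<Rightarrow> bool" where
  "slope_stable U E \<longleftrightarrow> hsub E \<and> E \<noteq> {0} \<and> subspace U \<and> U \<subseteq> E \<and>
     (\<forall>K. hsub K \<longrightarrow> K \<subseteq> E \<longrightarrow> K \<noteq> {0} \<longrightarrow> K \<noteq> E \<longrightarrow> dim (U \<inter> K) * dim E < dim U * dim K)"

text \<open>A proper nonzero kernel would have smaller slope than \<open>E\<close>, so the image would have larger slope
  than \<open>E\<close>, against \<open>bound\<close>.\<close>

lemma slope_stable_injective:
  fixes g :: "(nat \<Rightarrow> quat) \<Rightarrow> 'b::real_vector"
  assumes st: "slope_stable U E" and E: "E \<subseteq> quat_tuples n" and g: "linear g"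
    and ker: "hsub {x \<in> E. g x = 0}"
    and bound: "dim (g ` U) * dim E \<le> dim U * dim (g ` E)"
    and nz: "\<exists>x\<in>E. g x \<noteq> 0" and x: "x \<in> E" "g x = 0"
  shows "x = 0"
proof (rule ccontr)
  assume "x \<noteq> 0"
  let ?K = "{x \<in> E. g x = 0}"
  have s: "subspace U" "subspace E" "U \<subseteq> E"
    using st hsub_subspace[of E] unfolding slope_stable_def by auto
  have fE: "fin_dim E" by (rule fin_dim_sub_tuples[OF E])
  have fU: "fin_dim U" by (rule fin_dim_mono[OF fE s(3)])
  have "?K \<noteq> {0}" "?K \<noteq> E" using \<open>x \<noteq> 0\<close> x nz by auto
  then have 1: "dim (U \<inter> ?K) * dim E < dim U * dim ?K"
    using st ker unfolding slope_stable_def by blast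
  have "{x \<in> U. g x = 0} = U \<inter> ?K" using s(3) by blast
  then have 2: "dim U = dim (g ` U) + dim (U \<inter> ?K)" using rank_nullity[OF g s(1) fU] by simp
  have 3: "dim E = dim (g ` E) + dim ?K" using rank_nullity[OF g s(2) fE] .
  have arith: False if "x * e < d * y" "d = a + x" "e = b + y" "a * e \<le> d * b" for x y a b d e :: nat
  proof -
    have "d * e = a * e + x * e" using that(2) by (simp add: algebra_simps)
    also have "\<dots> < d * b + d * y" using that(1,4) by (rule add_le_less_mono[rotated])
    also have "\<dots> = d * e" using that(3) by (simp add: algebra_simps)
    finally show False by simp
  qed
  show False by (rule arith[OF 1 2 3 bound])
qed

section \<open>Quaternionic linear maps from tuples\<close>

text \<open>The quaternionic linear map that sends the basis vectors of \<open>quat_tuples N\<close> to the \<open>v r\<close>.\<close>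

definition comb :: "nat \<Rightarrow> (nat \<Rightarrow> nat \<Rightarrow> quat) \<Rightarrow> (nat \<Rightarrow> quat) \<Rightarrow> nat \<Rightarrow> quat" where
  "comb N v x = (\<Sum>r<N. hmul (x r) (v r))"

lemma hlin_comb: "hlin (comb N v)"
  unfolding hlin_def comb_def
  by (auto intro!: linearI simp: hmul_simps sum.distrib scaleR_sum_right hmul_sum)

lemma linear_comb_left: "linear (\<lambda>v. comb N v x)"
  unfolding comb_def by (auto intro!: linearI simp: hmul_simps sum.distrib scaleR_sum_right)

lemmas comb_left_simps = linear_0[OF linear_comb_left] linear_add[OF linear_comb_left] linear_scale[OF linear_comb_left]

lemma comb_in: assumes "hsub E" "\<And>r. r < N \<Longrightarrow> v r \<in> E" shows "comb N v x \<in> E"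
  unfolding comb_def using assms by (auto intro!: subspace_sum hsub_hmul hsub_subspace)

lemma comb_unit: assumes "r < N" shows "comb N v (single r q) = hmul q (v r)"
proof -
  have "comb N v (single r q) = (\<Sum>s<N. if s = r then hmul q (v r) else 0)"
    unfolding comb_def single_def by (intro sum.cong) auto
  then show ?thesis using assms by simp
qed

lemma single_in_tuples: "r < N \<Longrightarrow> single r q \<in> quat_tuples N"
  by (auto simp: quat_tuples_def single_def)

text \<open>A quaternionic linear map from \<open>H\<^sup>N\<close> to \<open>E\<close> has \<open>N * dim E\<close> real parameters, and each vector of a basis
  of \<open>UP\<close> imposes \<open>dim E - dim U\<close> conditions on it.\<close>

lemma nonzero_hom_exists:
  assumes UP: "subspace UP" "UP \<subseteq> quat_tuples N" and E: "hsub E" "E \<subseteq> quat_tuples n"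
    and U: "subspace U" "U \<subseteq> E"
    and euler: "dim UP * dim E < N * dim E + dim UP * dim U"
  shows "\<exists>v. (\<forall>r<N. v r \<in> E) \<and> comb N v ` UP \<subseteq> U \<and> (\<exists>x\<in>quat_tuples N. comb N v x \<noteq> 0)"
proof -
  have fE: "fin_dim E" using E(2) fin_dim_sub_tuples by blast
  have sE: "subspace E" using E(1) hsub_subspace by blast
  let ?T = "fun_space {..<N} E"
  have fT: "fin_dim ?T" and dT: "dim ?T = N * dim E" using dim_fun_space[OF _ sE fE, of "{..<N}"] by auto
  have sT: "subspace ?T" by (rule subspace_fun_space[OF sE])
  obtain B where B: "B \<subseteq> UP" "independent B" "UP \<subseteq> span B" "finite B" "card B = dim UP"
    using fin_dim_basis[OF fin_dim_sub_tuples[OF UP(2)]] .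
  define V where "V C = {v \<in> ?T. \<forall>b\<in>C. comb N v b \<in> U}" for C
  have V: "subspace (V C)" "fin_dim (V C)" for C
  proof -
    show "subspace (V C)" using sT U(1) unfolding V_def
      by (auto simp: subspace_def comb_left_simps)
    show "fin_dim (V C)" by (rule fin_dim_mono[OF fT]) (auto simp: V_def)
  qed
  have "dim ?T + card C * dim U \<le> dim (V C) + card C * dim E" if "finite C" for C
    using that
  proof (induction C)
    case empty then show ?case by (simp add: V_def)
  next
    case (insert b C)
    have eq: "V (insert b C) = {v \<in> V C. comb N v b \<in> U}" by (auto simp: V_def)
    have im: "(\<lambda>v. comb N v b) ` V C \<subseteq> E" using comb_in[OF E(1)] by (auto simp: V_def fun_space_def)
    have "dim (V C) + dim U \<le> dim (V (insert b C)) + dim E"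
      unfolding eq by (rule dim_preimage_ge[OF linear_comb_left V im U fE sE])
    then show ?case using insert by simp
  qed
  from this[OF B(4)] have "dim (V B) > 0" using euler unfolding B(5) dT by linarith
  then have "V B \<noteq> {0}" by (metis dim_zero_space less_irrefl)
  then obtain v where v: "v \<in> V B" "v \<noteq> 0" using subspace_0[OF V(1)[of B]] by blast
  have vE: "v r \<in> E" if "r < N" for r using v(1) that by (auto simp: V_def fun_space_def)
  have "comb N v x \<in> U" if "x \<in> UP" for x
  proof -
    have "x \<in> span B" using B(3) that by blast
    then show ?thesis
    proof (induction rule: span_induct)
      case base
      show ?case using U(1) hlin_linear[OF hlin_comb[of N v]]
        by (auto simp: subspace_def linear_0 linear_add linear_scale)
    next
      case (step x) then show ?case using v(1) by (auto simp: V_def)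
    qed
  qed
  moreover have "\<exists>x\<in>quat_tuples N. comb N v x \<noteq> 0"
  proof -
    obtain r where r: "v r \<noteq> 0" using v(2) by (auto simp: fun_eq_iff zero_fun_def)
    then have "r < N" using v(1) unfolding V_def fun_space_def by auto
    then show ?thesis using r comb_unit[of r N v 1] single_in_tuples[of r N 1] by auto
  qed
  ultimately show ?thesis using vE by blast
qed

section \<open>Splitting off a subspace of maximal slope\<close>

text \<open>The numerical core of \<open>hom_correction\<close>. For \<open>x = e - e0\<close> the hypotheses give
  \<open>f * e \<le> (e - a) * x\<close> and \<open>a * x \<le> (4 * a - e) * f\<close>, hence \<open>x * (2 * a - e)\<^sup>2 \<le> 0\<close>; as \<open>e < 2 * a\<close>, this
  leaves \<open>x = 0\<close>.\<close>

lemma slope_arith: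
  fixes a e e0 e3 f z :: real
  assumes "0 \<le> f" "e0 \<le> e" "e < 2 * a" "a \<le> e" "f + a + e0 \<le> e + z" "z * e \<le> a * e0" "f * e \<le> a * e3"
    "e3 + e \<le> 4 * f + e0" "0 < e"
  shows "e0 = e"
proof -
  define x where "x = e - e0"
  have x: "x \<ge> 0" using assms x_def by simp
  have "(f + a + e0) * e \<le> (e + z) * e" using assms(5,9) by (intro mult_right_mono) auto
  then have 1: "f * e \<le> (e - a) * x" using assms(6) unfolding x_def by (simp add: algebra_simps)
  have "a * e3 \<le> a * (4 * f - x)" using assms unfolding x_def by (intro mult_left_mono) auto
  then have 2: "a * x \<le> (4 * a - e) * f" using assms(7) by (simp add: algebra_simps)
  have "a * x * e \<le> (4 * a - e) * (f * e)" using mult_right_mono[OF 2, of e] assms(9) by (simp add: algebra_simps)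
  also have "\<dots> \<le> (4 * a - e) * ((e - a) * x)" using 1 assms(3,4) by (intro mult_left_mono) auto
  finally have "x * (2 * a - e)\<^sup>2 \<le> 0" by (simp add: algebra_simps power2_eq_square)
  moreover have "(2 * a - e)\<^sup>2 > 0" using assms(3) by simp
  ultimately have "x \<le> 0" by (simp add: mult_le_0_iff)
  then show ?thesis using x x_def by simp
qed

lemma linear_dual_basis:
  assumes "independent (Y :: 'a::real_vector set)" "finite Y"
  shows "\<exists>c :: 'a \<Rightarrow> 'a \<Rightarrow> real. (\<forall>y. linear (c y)) \<and> (\<forall>z\<in>span Y. (\<Sum>y\<in>Y. c y z *\<^sub>R y) = z)"
proof -
  have "\<exists>g :: 'a \<Rightarrow> real. linear g \<and> (\<forall>z\<in>Y. g z = (if z = y then 1 else 0))" for y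
    using linear_independent_extend[OF assms(1), of "\<lambda>z. if z = y then 1 else 0 :: real"] by blast
  then obtain c :: "'a \<Rightarrow> 'a \<Rightarrow> real" where c: "\<And>y. linear (c y)" "\<And>y z. z \<in> Y \<Longrightarrow> c y z = (if z = y then 1 else 0)"
    by metis
  have l: "linear (\<lambda>z. \<Sum>y\<in>Y. c y z *\<^sub>R y)"
    by (rule linearI) (simp_all add: linear_add[OF c(1)] linear_scale[OF c(1)] scaleR_add_left sum.distrib scaleR_sum_right)
  have "(\<Sum>y\<in>Y. c y z *\<^sub>R y) = z" if "z \<in> span Y" for z
  proof -
    have "(\<lambda>z. \<Sum>y\<in>Y. c y z *\<^sub>R y) z = id z"
    proof (rule linear_eq_on[OF l linear_id that])
      fix b assume b: "b \<in> Y"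
      have "(\<Sum>y\<in>Y. c y b *\<^sub>R y) = (\<Sum>y\<in>Y. if y = b then b else 0)"
        using b by (intro sum.cong) (auto simp: c(2))
      then show "(\<Sum>y\<in>Y. c y b *\<^sub>R y) = id b" using b assms(2) by simp
    qed
    then show ?thesis by simp
  qed
  then show ?thesis using c(1) by blast
qed

definition units :: "quat set" where "units = {1, quat_i, quat_j, quat_k}"

lemma units_facts: "finite units" "1 \<noteq> quat_i" "1 \<noteq> quat_j" "1 \<noteq> quat_k" "quat_i \<noteq> quat_j" "quat_i \<noteq> quat_k" "quat_j \<noteq> quat_k"
  by (simp_all add: units_def quat_simps)

lemma sum_units: "(\<Sum>\<epsilon>\<in>units. f \<epsilon>) = f 1 + f quat_i + f quat_j + f quat_k"
  using units_facts by (simp add: units_def add.assoc)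

text \<open>The sum over \<open>units\<close> is the quaternionic linear functional with real part \<open>\<theta>\<close>.\<close>

lemma hlin_of_functional:
  assumes "linear \<theta>"
  shows "hlin (\<lambda>x. hmul (\<Sum>\<epsilon>\<in>units. \<theta> (hmul (qcnj \<epsilon>) x) *\<^sub>R \<epsilon>) v)"
proof -
  define l where "l x = (\<Sum>\<epsilon>\<in>units. \<theta> (hmul (qcnj \<epsilon>) x) *\<^sub>R \<epsilon>)" for x
  have ladd: "l (x + y) = l x + l y" for x y
    unfolding l_def by (simp add: hmul_simps linear_add[OF assms] scaleR_add_left sum.distrib)
  have th: "\<theta> (hmul p x) = qRe p * \<theta> x + qI p * \<theta> (hmul quat_i x) + qJ p * \<theta> (hmul quat_j x) + qK p * \<theta> (hmul quat_k x)" for p x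
    by (subst quat_span[of p]) (simp add: hmul_simps linear_add[OF assms] linear_scale[OF assms])
  have lq: "l (hmul q x) = q * l x" for q x
    unfolding l_def sum_units hmul_simps(3)[symmetric]
    by (subst (1 2 3 4 5 6 7 8) th) (simp add: quat_simps algebra_simps)
  have "l (c *\<^sub>R x) = c *\<^sub>R l x" for c x using lq[of "of_real c" x] by (simp add: of_real_def hmul_simps)
  then have "linear l" using ladd by (intro linearI) auto
  then have "linear (\<lambda>x. hmul (l x) v)"
    using linear_compose[OF _ linear_hmul_left[of v]] by (simp add: o_def)
  then show ?thesis unfolding l_def[symmetric] hlin_def by (simp add: lq hmul_simps)
qed

lemma units_sum_hmul: "hmul (\<Sum>\<epsilon>\<in>units. f \<epsilon> *\<^sub>R \<epsilon>) v = (\<Sum>\<epsilon>\<in>units. f \<epsilon> *\<^sub>R hmul \<epsilon> v)"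
  by (simp add: hmul_sum_left hmul_simps)

text \<open>This says that extensions of \<open>(U2, E0)\<close> by \<open>(U', I)\<close> split when the slope of \<open>I\<close> exceeds
  \<open>1/2\<close> and bounds the slopes inside \<open>E0\<close> and \<open>I\<close>.

  If it failed, some functional on the maps from a basis \<open>B\<close> of \<open>U2\<close> to \<open>I\<close> would vanish on
  all maps with values in \<open>U'\<close> and on all restrictions of quaternionic linear maps, but not on \<open>F\<close>. It
  amounts to a linear map \<open>\<phi>\<close> from \<open>I\<close> to \<open>U2\<close> that kills \<open>U'\<close> and satisfies
  \<open>(\<Sum>\<epsilon>\<in>units. qcnj \<epsilon> * \<phi> (\<epsilon> * v)) = 0\<close> for all \<open>v \<in> I\<close>. Let \<open>N0\<close> be the largest quaternionic subspace of the kernel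
  of \<open>\<phi>\<close>, and \<open>E3\<close> the quaternionic span of the image \<open>U3\<close> of \<open>\<phi>\<close>. The last identity gives a space of real dimension
  \<open>dim I - dim N0\<close> of relations with quaternionic coefficients between the elements of a basis of \<open>U3\<close>, whence
  \<open>dim E3 \<le> 4 * dim U3 - (dim I - dim N0)\<close>. The slopes of \<open>E3\<close> and \<open>N0\<close> are bounded by assumption, and
  \<open>slope_arith\<close> leaves only \<open>N0 = I\<close>, that is \<open>\<phi> = 0\<close>.\<close>

lemma hom_correction:
  assumes I: "hsub I" "I \<subseteq> quat_tuples n" and U': "subspace U'" "U' \<subseteq> I"
    and E0: "hsub E0" "E0 \<subseteq> quat_tuples n" and U2: "subspace U2" "U2 \<subseteq> E0"
    and pos: "dim I < 2 * dim U'"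
    and slopeI: "\<And>K. hsub K \<Longrightarrow> K \<subseteq> I \<Longrightarrow> dim (U' \<inter> K) * dim I \<le> dim U' * dim K"
    and slopeX: "\<And>K. hsub K \<Longrightarrow> K \<subseteq> E0 \<Longrightarrow> dim (U2 \<inter> K) * dim I \<le> dim U' * dim K"
    and F: "linear F" "F ` U2 \<subseteq> I"
  shows "\<exists>h. hlin h \<and> h ` E0 \<subseteq> I \<and> (\<forall>y\<in>U2. F y - h y \<in> U')"
proof -
  have sI: "subspace I" and sE0: "subspace E0" using I E0 hsub_subspace by blast+
  have fI: "fin_dim I" and fE0: "fin_dim E0" using I E0 fin_dim_sub_tuples by blast+
  have fU2: "fin_dim U2" using fin_dim_mono[OF fE0 U2(2)] .
  obtain B where B: "B \<subseteq> U2" "independent B" "U2 \<subseteq> span B" "finite B" "card B = dim U2"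
    using fin_dim_basis[OF fU2] .
  have spB: "span B = U2" using B U2 by (simp add: span_minimal subset_antisym)
  \<comment> \<open>The correctable maps; only their values on the basis \<open>B\<close> matter.\<close>
  define S where "S = {G. \<exists>h. hlin h \<and> h ` E0 \<subseteq> I \<and> (\<forall>b\<in>B. G b - h b \<in> U')}"
  have SI: "G \<in> S" if "hlin h" "h ` E0 \<subseteq> I" "\<And>b. b \<in> B \<Longrightarrow> G b - h b \<in> U'" for G h
    using that by (auto simp: S_def)
  have SE: "\<exists>h. hlin h \<and> h ` E0 \<subseteq> I \<and> (\<forall>b\<in>B. G b - h b \<in> U')" if "G \<in> S" for G
    using that by (simp add: S_def)
  have sS: "subspace S"
    unfolding subspace_def
  proof (intro conjI ballI allI)
    show "0 \<in> S" by (rule SI[OF hlin_0]) (use subspace_0[OF sI] subspace_0[OF U'(1)] in auto)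
    fix G G' assume "G \<in> S" "G' \<in> S"
    obtain h where h: "hlin h" "h ` E0 \<subseteq> I" "\<forall>b\<in>B. G b - h b \<in> U'" using SE[OF \<open>G \<in> S\<close>] by auto
    obtain h' where h': "hlin h'" "h' ` E0 \<subseteq> I" "\<forall>b\<in>B. G' b - h' b \<in> U'" using SE[OF \<open>G' \<in> S\<close>] by auto
    show "G + G' \<in> S"
    proof (rule SI[OF hlin_add[OF h(1) h'(1)]])
      show "(\<lambda>x. h x + h' x) ` E0 \<subseteq> I" 
        using h(2) h'(2) by (intro image_subsetI subspace_add[OF sI]; blast)
      show "(G + G') b - (h b + h' b) \<in> U'" if "b \<in> B" for b
        using subspace_add[OF U'(1) bspec[OF h(3) that] bspec[OF h'(3) that]] by (simp add: algebra_simps)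
    qed
  next
    fix c G assume "G \<in> S"
    obtain h where h: "hlin h" "h ` E0 \<subseteq> I" "\<forall>b\<in>B. G b - h b \<in> U'" using SE[OF \<open>G \<in> S\<close>] by auto
    show "c *\<^sub>R G \<in> S"
    proof (rule SI[OF hlin_scaleR[OF h(1), of c]])
      show "(\<lambda>x. c *\<^sub>R h x) ` E0 \<subseteq> I" 
        using h(2) by (intro image_subsetI subspace_scale[OF sI]) blast
      show "(c *\<^sub>R G) b - c *\<^sub>R h b \<in> U'" if "b \<in> B" for b
        using subspace_scale[OF U'(1) bspec[OF h(3) that], of c] by (simp add: algebra_simps)
    qed
  qed
  have "F \<in> S"
  proof (rule ccontr)
    assume "F \<notin> S"
    then obtain g :: "((nat \<Rightarrow> quat) \<Rightarrow> (nat \<Rightarrow> quat)) \<Rightarrow> real" where g: "linear g" "\<And>G. G \<in> S \<Longrightarrow> g G = 0" "g F = 1"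
      using separating_functional[OF sS] by blast
    define gb where "gb b v = g (single b v)" for b v
    have lgb: "linear (gb b)" for b
      unfolding gb_def using linear_compose[OF linear_single g(1), of b] by (simp add: o_def)
    have gexp: "g G = (\<Sum>b\<in>B. gb b (G b))" for G
    proof -
      have "G - (\<Sum>b\<in>B. single b (G b)) \<in> S"
      proof (rule SI[OF hlin_0])
        fix b assume "b \<in> B"
        have "(\<Sum>b'\<in>B. single b' (G b') b) = (\<Sum>b'\<in>B. if b' = b then G b else 0)"
          by (intro sum.cong) (auto simp: single_apply)
        also have "\<dots> = G b" using \<open>b \<in> B\<close> B(4) by simp
        finally show "(G - (\<Sum>b\<in>B. single b (G b))) b - 0 \<in> U'" using subspace_0[OF U'(1)] by simp
      qed (use subspace_0[OF sI] in auto)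
      then have "g (G - (\<Sum>b\<in>B. single b (G b))) = 0" by (rule g(2))
      then show ?thesis by (simp add: linear_diff[OF g(1)] linear_sum[OF g(1)] gb_def)
    qed
    have gbU: "gb b u = 0" if "u \<in> U'" for b u
      unfolding gb_def
    proof (rule g(2), rule SI[OF hlin_0])
      show "single b u b' - 0 \<in> U'" for b' using that subspace_0[OF U'(1)] by (simp add: single_apply)
    qed (use subspace_0[OF sI] in auto)
    have gbh: "(\<Sum>b\<in>B. gb b (h b)) = 0" if "hlin h" "h ` E0 \<subseteq> I" for h
      using g(2)[OF SI[OF that, of h]] subspace_0[OF U'(1)] gexp[of h] by simp
    define \<phi> where "\<phi> v = (\<Sum>b\<in>B. gb b v *\<^sub>R b)" for v
    have l\<phi>: "linear \<phi>"
      unfolding \<phi>_def by (rule linearI) (simp_all add: linear_add[OF lgb] linear_scale[OF lgb] scaleR_add_left sum.distrib scaleR_sum_right)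
    have \<phi>U2: "\<phi> v \<in> U2" for v
      unfolding \<phi>_def using B(1) by (intro subspace_sum[OF U2(1)] subspace_scale[OF U2(1)]) auto
    \<comment> \<open>Test with the maps \<open>x \<mapsto> l x * v\<close> of rank one, where \<open>l\<close> is a quaternionic functional with
      arbitrary real part \<open>\<theta>\<close>.\<close>
    have trace: "(\<Sum>\<epsilon>\<in>units. hmul (qcnj \<epsilon>) (\<phi> (hmul \<epsilon> v))) = 0" if v: "v \<in> I" for v
    proof (rule ccontr)
      define c where "c = (\<Sum>\<epsilon>\<in>units. hmul (qcnj \<epsilon>) (\<phi> (hmul \<epsilon> v)))"
      assume "(\<Sum>\<epsilon>\<in>units. hmul (qcnj \<epsilon>) (\<phi> (hmul \<epsilon> v))) \<noteq> 0"
      then have "c \<notin> {0}" by (simp add: c_def)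
      then obtain \<theta> :: "(nat \<Rightarrow> quat) \<Rightarrow> real" where th: "linear \<theta>" "\<theta> c = 1"
        using separating_functional[OF subspace_single_0, of c] by blast
      let ?h = "\<lambda>x. hmul (\<Sum>\<epsilon>\<in>units. \<theta> (hmul (qcnj \<epsilon>) x) *\<^sub>R \<epsilon>) v"
      have "(\<Sum>b\<in>B. gb b (?h b)) = 0"
        by (rule gbh[OF hlin_of_functional[OF th(1)]]) (auto intro: hsub_hmul[OF I(1) v])
      also have "(\<Sum>b\<in>B. gb b (?h b)) = (\<Sum>b\<in>B. \<Sum>\<epsilon>\<in>units. \<theta> (hmul (qcnj \<epsilon>) b) * gb b (hmul \<epsilon> v))"
        by (simp add: units_sum_hmul linear_sum[OF lgb] linear_scale[OF lgb])
      also have "\<dots> = \<theta> c"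
        unfolding c_def \<phi>_def
        by (subst sum.swap) (simp add: linear_sum[OF th(1)] hmul_sum hmul_simps linear_scale[OF th(1)] mult.commute)
      finally show False using th(2) by simp
    qed
    define U3 where "U3 = \<phi> ` I"
    have sU3: "subspace U3" unfolding U3_def by (rule linear_subspace_image[OF l\<phi> sI])
    have U3: "U3 \<subseteq> U2" unfolding U3_def using \<phi>U2 by blast
    obtain Y where Y: "Y \<subseteq> U3" "independent Y" "U3 \<subseteq> span Y" "finite Y" "card Y = dim U3"
      using fin_dim_basis[OF fin_dim_mono[OF fU2 U3]] .
    obtain co :: "(nat \<Rightarrow> quat) \<Rightarrow> (nat \<Rightarrow> quat) \<Rightarrow> real" where co: "\<And>y. linear (co y)" "\<And>z. z \<in> span Y \<Longrightarrow> (\<Sum>y\<in>Y. co y z *\<^sub>R y) = z"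
      using linear_dual_basis[OF Y(2,4)] by blast
    define N0 where "N0 = {v \<in> I. \<forall>q. \<phi> (hmul q v) = 0}"
    have hN0: "hsub N0" unfolding N0_def
      using sI by (intro hsubI) (auto simp: hmul_simps linear_0[OF l\<phi>] linear_add[OF l\<phi>] subspace_0 subspace_add hsub_hmul[OF I(1)] simp flip: hmul_simps(3))
    have N0I: "N0 \<subseteq> I" by (auto simp: N0_def)
    let ?FY = "fun_space Y (UNIV :: quat set)"
    have fFY: "fin_dim ?FY" and dFY: "dim ?FY = 4 * dim U3"
      using dim_fun_space[OF Y(4), of "UNIV :: quat set"] by (auto simp: fin_dim_quat dim_quat Y(5))
    have sFY: "subspace ?FY" by (rule subspace_fun_space) simp
    define \<Psi> where "\<Psi> q = (\<Sum>y\<in>Y. hmul (q y) y)" for q :: "(nat \<Rightarrow> quat) \<Rightarrow> quat"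
    have l\<Psi>: "linear \<Psi>" unfolding \<Psi>_def by (rule linearI) (simp_all add: hmul_simps sum.distrib scaleR_sum_right)
    define E3 where "E3 = \<Psi> ` ?FY"
    have hE3: "hsub E3" unfolding hsub_def
    proof (intro conjI allI ballI)
      show "subspace E3" unfolding E3_def by (rule linear_subspace_image[OF l\<Psi> sFY])
      fix p x assume "x \<in> E3"
      then obtain q where q: "q \<in> ?FY" "x = \<Psi> q" unfolding E3_def by blast
      have "hmul p x = \<Psi> (\<lambda>y. p * q y)" unfolding q(2) \<Psi>_def by (simp add: hmul_sum hmul_simps)
      moreover have "(\<lambda>y. p * q y) \<in> ?FY" using q(1) by (auto simp: fun_space_def)
      ultimately show "hmul p x \<in> E3" unfolding E3_def by blast
    qed
    have E3E0: "E3 \<subseteq> E0" unfolding E3_def \<Psi>_def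
      using Y(1) U3 U2(2) by (intro image_subsetI subspace_sum[OF sE0] hsub_hmul[OF E0(1)]) blast
    have U3E3: "U3 \<subseteq> E3"
    proof
      fix z assume z: "z \<in> U3"
      have "\<Psi> (\<lambda>y. if y \<in> Y then of_real (co y z) else 0) = z"
        unfolding \<Psi>_def using co(2)[of z] z Y(3) by (auto simp: if_distrib cong: sum.cong)
      moreover have "(\<lambda>y. if y \<in> Y then of_real (co y z) else 0) \<in> ?FY" by (auto simp: fun_space_def)
      ultimately show "z \<in> E3" unfolding E3_def by (rule image_eqI[OF sym])
    qed
    \<comment> \<open>\<open>trace\<close> as a relation between the basis vectors \<open>Y\<close> of \<open>U3\<close>: \<open>\<kappa> v\<close> is its tuple of
      coefficients, so it lies in the kernel of \<open>\<Psi>\<close>.\<close>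
    define \<kappa> where "\<kappa> v = (\<lambda>y. if y \<in> Y then \<Sum>\<epsilon>\<in>units. co y (\<phi> (hmul \<epsilon> v)) *\<^sub>R qcnj \<epsilon> else 0)" for v
    have l\<kappa>: "linear \<kappa>" unfolding \<kappa>_def
      by (rule linearI) (auto simp: fun_eq_iff hmul_simps linear_add[OF l\<phi>] linear_scale[OF l\<phi>]
        linear_add[OF co(1)] linear_scale[OF co(1)] scaleR_add_left sum.distrib scaleR_sum_right)
    have in_span: "\<phi> (hmul \<epsilon> v) \<in> span Y" if "v \<in> I" for \<epsilon> v
      using hsub_hmul[OF I(1) that] Y(3) unfolding U3_def by blast
    have \<kappa>ker: "\<kappa> ` I \<subseteq> {q \<in> ?FY. \<Psi> q = 0}"
    proof (rule image_subsetI)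
      fix v assume v: "v \<in> I"
      have "\<Psi> (\<kappa> v) = (\<Sum>y\<in>Y. hmul (\<Sum>\<epsilon>\<in>units. co y (\<phi> (hmul \<epsilon> v)) *\<^sub>R qcnj \<epsilon>) y)"
        unfolding \<Psi>_def \<kappa>_def by (intro sum.cong) auto
      also have "\<dots> = (\<Sum>\<epsilon>\<in>units. hmul (qcnj \<epsilon>) (\<Sum>y\<in>Y. co y (\<phi> (hmul \<epsilon> v)) *\<^sub>R y))"
        by (simp add: hmul_sum_left hmul_simps hmul_sum sum.swap[of _ units])
      also have "\<dots> = 0" using trace[OF v] by (simp add: co(2)[OF in_span[OF v]])
      finally show "\<kappa> v \<in> {q \<in> ?FY. \<Psi> q = 0}" by (auto simp: fun_space_def \<kappa>_def)
    qed
    have N0ker: "{v \<in> I. \<kappa> v = 0} \<subseteq> N0"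
    proof
      fix v assume "v \<in> {v \<in> I. \<kappa> v = 0}"
      then have v: "v \<in> I" "\<kappa> v = 0" by auto
      have "\<phi> (hmul \<epsilon> v) = 0" if "\<epsilon> \<in> units" for \<epsilon>
      proof -
        have "co y (\<phi> (hmul \<epsilon> v)) = 0" if y: "y \<in> Y" for y
        proof -
          have "\<kappa> v y = 0" using v(2) by simp
          then have "(\<Sum>\<epsilon>\<in>units. co y (\<phi> (hmul \<epsilon> v)) *\<^sub>R qcnj \<epsilon>) = 0" using y by (simp add: \<kappa>_def)
          then have "co y (\<phi> (hmul 1 v)) = 0 \<and> co y (\<phi> (hmul quat_i v)) = 0 \<and>
              co y (\<phi> (hmul quat_j v)) = 0 \<and> co y (\<phi> (hmul quat_k v)) = 0"
            unfolding sum_units by (simp add: quat_simps)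
          then show ?thesis using \<open>\<epsilon> \<in> units\<close> unfolding units_def by blast
        qed
        then show ?thesis using co(2)[OF in_span[OF v(1)], of \<epsilon>] by simp
      qed
      then have u: "\<phi> v = 0" "\<phi> (hmul quat_i v) = 0" "\<phi> (hmul quat_j v) = 0" "\<phi> (hmul quat_k v) = 0"
        unfolding units_def by (force simp: units_def)+
      have "\<phi> (hmul q v) = 0" for q
        by (subst quat_span[of q]) (simp add: hmul_simps linear_add[OF l\<phi>] linear_scale[OF l\<phi>] u)
      then show "v \<in> N0" using v(1) by (simp add: N0_def)
    qed
    have fN0: "fin_dim N0" using fin_dim_mono[OF fI N0I] .
    have d1: "dim I \<le> dim (\<kappa> ` I) + dim N0"
      using rank_nullity[OF l\<kappa> sI fI] dim_mono_fin[OF fN0 N0ker] by simp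
    have "dim (\<kappa> ` I) \<le> dim {q \<in> ?FY. \<Psi> q = 0}"
      by (rule dim_mono_fin[OF _ \<kappa>ker]) (rule fin_dim_mono[OF fFY], auto)
    then have d2: "dim E3 + dim I \<le> 4 * dim U3 + dim N0"
      using rank_nullity[OF l\<Psi> sFY fFY] d1 dFY unfolding E3_def by simp
    have "dim U3 \<le> dim (U2 \<inter> E3)"
      by (rule dim_mono_fin) (use fin_dim_mono[OF fU2, of "U2 \<inter> E3"] U3 U3E3 in auto)
    then have d3: "dim U3 * dim I \<le> dim U' * dim E3"
      using slopeX[OF hE3 E3E0] by (meson le_trans mult_le_mono1)
    have fU': "fin_dim U'" using fin_dim_mono[OF fI U'(2)] .
    \<comment> \<open>\<open>\<phi>\<close> vanishes on both \<open>U'\<close> and \<open>N0\<close>.\<close>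
    have d4: "dim U3 + dim U' + dim N0 \<le> dim I + dim (U' \<inter> N0)"
    proof -
      have z: "\<phi> u = 0" if "u \<in> U'" for u using gbU[OF that] by (simp add: \<phi>_def)
      have z0: "\<phi> u = 0" if "u \<in> N0" for u
      proof -
        have "\<phi> (hmul 1 u) = 0" using that unfolding N0_def by blast
        then show ?thesis by simp
      qed
      have "U' \<oplus>\<^sub>s N0 \<subseteq> {v \<in> I. \<phi> v = 0}"
      proof
        fix x assume "x \<in> U' \<oplus>\<^sub>s N0"
        then obtain u w where uw: "x = u + w" "u \<in> U'" "w \<in> N0" by (rule ssumE)
        have "u \<in> I" "w \<in> I" using uw U'(2) N0I by blast+
        then have "u + w \<in> I" by (rule subspace_add[OF sI])
        then show "x \<in> {v \<in> I. \<phi> v = 0}" using uw by (simp add: linear_add[OF l\<phi>] z z0)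
      qed
      then have "dim (U' \<oplus>\<^sub>s N0) \<le> dim {v \<in> I. \<phi> v = 0}"
        by (rule dim_mono_fin[rotated]) (rule fin_dim_mono[OF fI], auto)
      then show ?thesis
        using dim_ssum_Int[OF U'(1) hsub_subspace[OF hN0] fU' fN0] rank_nullity[OF l\<phi> sI fI] unfolding U3_def by simp
    qed
    have "real (dim N0) = real (dim I)"
    proof (rule slope_arith[of "real (dim U3)" _ _ "real (dim U')" "real (dim (U' \<inter> N0))" "real (dim E3)"])
      show "real (dim N0) \<le> real (dim I)" using dim_mono_fin[OF fI N0I] by simp
      show "real (dim I) < 2 * real (dim U')" using pos by linarith
      show "real (dim U') \<le> real (dim I)" using dim_mono_fin[OF fI U'(2)] by simp
      show "real (dim U3) + real (dim U') + real (dim N0) \<le> real (dim I) + real (dim (U' \<inter> N0))"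
        using d4 by linarith
      show "real (dim (U' \<inter> N0)) * real (dim I) \<le> real (dim U') * real (dim N0)"
        using slopeI[OF hN0 N0I] by (metis of_nat_le_iff of_nat_mult)
      show "real (dim U3) * real (dim I) \<le> real (dim U') * real (dim E3)"
        using d3 by (metis of_nat_le_iff of_nat_mult)
      show "real (dim E3) + real (dim I) \<le> 4 * real (dim U3) + real (dim N0)" using d2 by linarith
      show "0 < real (dim I)" using pos dim_mono_fin[OF fI U'(2)] by linarith
    qed simp
    then have NI: "N0 = I" using subspace_eq_of_dim_le[OF fI hsub_subspace[OF hN0] sI N0I] by simp
    have gbz: "gb b v = 0" if v: "v \<in> I" and b: "b \<in> B" for b v
    proof -
      have "v \<in> N0" using v NI by simp
      then have "\<phi> (hmul 1 v) = 0" unfolding N0_def by blast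
      then have "(\<Sum>b\<in>B. gb b v *\<^sub>R b) = 0" by (simp add: \<phi>_def)
      then show ?thesis using independentD[OF B(2,4) subset_refl, of "\<lambda>b. gb b v" b] b by simp
    qed
    have "gb b (F b) = 0" if b: "b \<in> B" for b
    proof (rule gbz[OF _ b])
      show "F b \<in> I" using F(2) B(1) b by blast
    qed
    then have "g F = 0" by (simp add: gexp)
    then show False using g(3) by simp
  qed
  obtain h where h: "hlin h" "h ` E0 \<subseteq> I" "\<forall>b\<in>B. F b - h b \<in> U'" using SE[OF \<open>F \<in> S\<close>] by auto
  have "F y - h y \<in> U'" if "y \<in> U2" for y
  proof -
    have "y \<in> span B" using that spB by simp
    then show ?thesis
    proof (induction rule: span_induct)
      case base
      have l: "linear (\<lambda>y. F y - h y)" by (intro linear_compose_sub F hlin_linear h)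
      show ?case using linear_subspace_vimage[OF l U'(1)] unfolding vimage_def .
    next
      case (step x) show ?case by (rule bspec[OF h(3) step])
    qed
  qed
  then show ?thesis using h by blast
qed

lemma projection_exists:
  fixes I E0 :: "'a::real_vector set"
  assumes "subspace I" "subspace E0" "I \<inter> E0 = {0}"
  shows "\<exists>p :: 'a \<Rightarrow> 'a. linear p \<and> range p \<subseteq> E0 \<and> (\<forall>x\<in>I. p x = 0) \<and> (\<forall>x\<in>E0. p x = x)"
proof -
  obtain g :: "'a \<Rightarrow> 'a" where g: "linear g" "\<And>x. g x = 0 \<longleftrightarrow> x \<in> I" using linear_with_kernel[OF assms(1)] by blast
  have inj: "inj_on g E0"
  proof (rule inj_onI)
    fix x y assume xy: "x \<in> E0" "y \<in> E0" "g x = g y"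
    then have "g (x - y) = 0" by (simp add: linear_diff[OF g(1)])
    then have "x - y \<in> I \<inter> E0" using g(2) xy subspace_diff[OF assms(2)] by blast
    then show "x = y" using assms(3) by simp
  qed
  obtain l where l: "l ` UNIV \<subseteq> E0" "linear l" "\<forall>v\<in>E0. l (g v) = v"
    using linear_exists_left_inverse_on[OF g(1) assms(2) inj] by blast
  show ?thesis
  proof (intro exI[of _ "l \<circ> g"] conjI ballI)
    show "linear (l \<circ> g)" by (rule linear_compose[OF g(1) l(2)])
    show "range (l \<circ> g) \<subseteq> E0" using l(1) by auto
    show "(l \<circ> g) x = 0" if "x \<in> I" for x using that g(2) linear_0[OF l(2)] by (metis comp_apply)
    show "(l \<circ> g) x = x" if "x \<in> E0" for x using that l(3) by simp
  qed
qed

definition splits :: "(nat \<Rightarrow> quat) set \<Rightarrow> (nat \<Rightarrow> quat) set \<Rightarrow> (nat \<Rightarrow> quat) set \<Rightarrow> (nat \<Rightarrow> quat) set \<Rightarrow> bool" where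
  "splits U E I J \<longleftrightarrow> hsub I \<and> hsub J \<and> I \<inter> J = {0} \<and> E = I \<oplus>\<^sub>s J \<and> U = (U \<inter> I) \<oplus>\<^sub>s (U \<inter> J)"

text \<open>Project \<open>U\<close> along \<open>I\<close> to \<open>U2\<close> in the orthogonal complement \<open>E0\<close> of \<open>I\<close>. A linear section of \<open>U\<close> over
  \<open>U2\<close> differs from the inclusion by a map \<open>F\<close> from \<open>U2\<close> to \<open>I\<close>. By \<open>hom_correction\<close> it agrees up to \<open>U \<inter> I\<close> with a
  quaternionic linear \<open>h\<close>, and the graph of \<open>h\<close> is the complement. The slope of \<open>U2\<close> on a subspace
  \<open>K\<close> of \<open>E0\<close> is controlled by that of \<open>U\<close> on \<open>I \<oplus>\<^sub>s K\<close>.\<close>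

lemma split_off:
  assumes E: "hsub E" "E \<subseteq> quat_tuples n" and U: "subspace U" "U \<subseteq> E"
    and I: "hsub I" "I \<subseteq> E"
    and slope: "\<And>K. hsub K \<Longrightarrow> K \<subseteq> E \<Longrightarrow> dim (U \<inter> K) * dim I \<le> dim (U \<inter> I) * dim K"
    and pos: "dim I < 2 * dim (U \<inter> I)"
  shows "\<exists>J. splits U E I J"
proof -
  have sE: "subspace E" and sI: "subspace I" using E I hsub_subspace by blast+
  have It: "I \<subseteq> quat_tuples n" using I E by blast
  define E0 where "E0 = perp n E I"
  have E0: "hsub E0" "E0 \<subseteq> E" unfolding E0_def using hsub_perp[OF E(1) I(1)] perp_subset by auto
  have E0t: "E0 \<subseteq> quat_tuples n" using E0 E by blast
  have sE0: "subspace E0" using E0 hsub_subspace by blast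
  have dec: "I \<inter> E0 = {0}" "E = I \<oplus>\<^sub>s E0" using perp_decomp[OF E(2) sE sI I(2)] by (simp_all add: E0_def)
  have fE: "fin_dim E" using fin_dim_sub_tuples[OF E(2)] .
  have fI: "fin_dim I" and fE0: "fin_dim E0" using fin_dim_sub_tuples[OF It] fin_dim_sub_tuples[OF E0t] by auto
  obtain p where p: "linear p" "range p \<subseteq> E0" "\<And>x. x \<in> I \<Longrightarrow> p x = 0" "\<And>x. x \<in> E0 \<Longrightarrow> p x = x"
    using projection_exists[OF sI sE0 dec(1)] by blast
  have pI: "x - p x \<in> I" if "x \<in> E" for x
  proof -
    have "x \<in> I \<oplus>\<^sub>s E0" using that dec(2) by simp
    then obtain a b where "x = a + b" "a \<in> I" "b \<in> E0" by (rule ssumE)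
    then show ?thesis using p(3)[of a] p(4)[of b] by (simp add: linear_add[OF p(1)])
  qed
  have p0: "x \<in> I" if "x \<in> E" "p x = 0" for x using pI[OF that(1)] that(2) by simp
  define U2 where "U2 = p ` U"
  have U2: "subspace U2" "U2 \<subseteq> E0" unfolding U2_def using linear_subspace_image[OF p(1) U(1)] p(2) by auto
  obtain s where s: "s ` UNIV \<subseteq> U" "linear s" "\<And>v. v \<in> p ` U \<Longrightarrow> p (s v) = v"
    using linear_exists_right_inverse_on[OF p(1) U(1)] by auto
  define F where "F y = s y - y" for y
  have F: "linear F" unfolding F_def using linear_compose_sub[OF s(2) linear_ident] .
  have sU: "s y \<in> U" for y using s(1) by blast
  have FI: "F ` U2 \<subseteq> I"
  proof (rule image_subsetI)
    fix y assume y: "y \<in> U2"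
    then have "y \<in> E0" using U2 by blast
    have "F y \<in> E" unfolding F_def using sU[of y] U(2) \<open>y \<in> E0\<close> E0(2) by (intro subspace_diff[OF sE]) auto
    moreover have "p (F y) = 0" unfolding F_def
      using s(3)[of y] y p(4)[OF \<open>y \<in> E0\<close>] by (simp add: U2_def linear_diff[OF p(1)])
    ultimately show "F y \<in> I" by (rule p0)
  qed
  have sUI: "subspace (U \<inter> I)" using U sI by (intro subspace_inter)
  have fUI: "fin_dim (U \<inter> I)" by (rule fin_dim_mono[OF fI]) auto
  have "\<exists>h. hlin h \<and> h ` E0 \<subseteq> I \<and> (\<forall>y\<in>U2. F y - h y \<in> U \<inter> I)"
  proof (rule hom_correction[OF I(1) It sUI _ E0(1) E0t U2 pos _ _ F FI])
    fix K assume K: "hsub K" "K \<subseteq> I"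
    have "U \<inter> I \<inter> K = U \<inter> K" using K by blast
    then show "dim (U \<inter> I \<inter> K) * dim I \<le> dim (U \<inter> I) * dim K" using slope[OF K(1)] K(2) I(2) by auto
  next
    fix K assume K: "hsub K" "K \<subseteq> E0"
    have sK: "subspace K" using K hsub_subspace by blast
    have fK: "fin_dim K" using fin_dim_mono[OF fE0 K(2)] .
    let ?L = "I \<oplus>\<^sub>s K"
    have hL: "hsub ?L" using hsub_ssum[OF I(1) K(1)] .
    have LE: "?L \<subseteq> E" using I(2) K(2) E0(2) by (intro ssum_least[OF sE]) auto
    have dL: "dim ?L = dim I + dim K"
      using dec(1) K(2) subspace_0[OF sK] subspace_0[OF sI] by (intro dim_direct_sum[OF sI sK fI fK]) blast
    have fUL: "fin_dim (U \<inter> ?L)" by (rule fin_dim_mono[OF fE]) (use LE in blast)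
    have "dim (U \<inter> ?L) = dim (p ` (U \<inter> ?L)) + dim {x \<in> U \<inter> ?L. p x = 0}"
      by (rule rank_nullity[OF p(1) subspace_inter[OF U(1) hsub_subspace[OF hL]] fUL])
    moreover have "dim (U2 \<inter> K) \<le> dim (p ` (U \<inter> ?L))"
    proof (rule dim_mono_fin[OF fin_dim_image[OF fUL p(1)]])
      show "U2 \<inter> K \<subseteq> p ` (U \<inter> ?L)"
      proof
        fix y assume y: "y \<in> U2 \<inter> K"
        then obtain u where u: "u \<in> U" "y = p u" unfolding U2_def by blast
        have "u - p u \<in> I" using pI u(1) U(2) by blast
        then have "(u - p u) + p u \<in> ?L" using y u by (intro ssumI) auto
        then show "y \<in> p ` (U \<inter> ?L)" using u by auto
      qed
    qed
    moreover have "dim (U \<inter> I) \<le> dim {x \<in> U \<inter> ?L. p x = 0}"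
    proof (rule dim_mono_fin)
      show "fin_dim {x \<in> U \<inter> ?L. p x = 0}" by (rule fin_dim_mono[OF fUL]) auto
      show "U \<inter> I \<subseteq> {x \<in> U \<inter> ?L. p x = 0}" using p(3) ssum_sup1[OF sK, of I] by blast
    qed
    ultimately have "dim (U2 \<inter> K) + dim (U \<inter> I) \<le> dim (U \<inter> ?L)" by linarith
    then have "(dim (U2 \<inter> K) + dim (U \<inter> I)) * dim I \<le> dim (U \<inter> ?L) * dim I" by (rule mult_le_mono1)
    also have "\<dots> \<le> dim (U \<inter> I) * (dim I + dim K)" using slope[OF hL LE] dL by simp
    finally show "dim (U2 \<inter> K) * dim I \<le> dim (U \<inter> I) * dim K" by (simp add: algebra_simps)
  qed auto
  then obtain h where h: "hlin h" "h ` E0 \<subseteq> I" "\<forall>y\<in>U2. F y - h y \<in> U \<inter> I" by auto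
  have hl: "linear h" using hlin_linear[OF h(1)] .
  define J where "J = (\<lambda>x. x + h x) ` E0"
  have hJ: "hsub J" unfolding J_def by (rule hsub_image[OF hlin_add[OF hlin_id h(1)] E0(1)])
  have hI: "h x \<in> I" if "x \<in> E0" for x using h(2) that by blast
  have IJ: "I \<inter> J = {0}"
  proof -
    have "x = 0" if x: "x \<in> I" "x \<in> J" for x
    proof -
      obtain y where y: "y \<in> E0" "x = y + h y" using x(2) unfolding J_def by blast
      have "y = x - h y" using y(2) by simp
      then have "y \<in> I" using subspace_diff[OF sI x(1) hI[OF y(1)]] by simp
      then have "y = 0" using y(1) dec(1) by blast
      then show ?thesis using y(2) linear_0[OF hl] by simp
    qed
    then show ?thesis using subspace_0[OF sI] subspace_0[OF hsub_subspace[OF hJ]] by blast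
  qed
  have EJ: "E = I \<oplus>\<^sub>s J"
  proof
    show "E \<subseteq> I \<oplus>\<^sub>s J"
    proof
      fix x assume "x \<in> E"
      then have "x \<in> I \<oplus>\<^sub>s E0" using dec(2) by simp
      then obtain a b where ab: "x = a + b" "a \<in> I" "b \<in> E0" by (rule ssumE)
      have "(a - h b) + (b + h b) \<in> I \<oplus>\<^sub>s J"
        using ab hI[OF ab(3)] by (intro ssumI subspace_diff[OF sI]) (auto simp: J_def)
      then show "x \<in> I \<oplus>\<^sub>s J" using ab(1) by (simp add: algebra_simps)
    qed
    have "J \<subseteq> E" unfolding J_def using hI E0(2) I(2) by (intro image_subsetI subspace_add[OF sE]) auto
    then show "I \<oplus>\<^sub>s J \<subseteq> E" using I(2) by (intro ssum_least[OF sE])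
  qed
  have UJ: "U = (U \<inter> I) \<oplus>\<^sub>s (U \<inter> J)"
  proof
    show "U \<subseteq> (U \<inter> I) \<oplus>\<^sub>s (U \<inter> J)"
    proof
      fix u assume u: "u \<in> U"
      have pu: "p u \<in> U2" using u by (simp add: U2_def)
      have pE: "p u \<in> E0" using pu U2(2) by blast
      let ?w = "p u + h (p u)"
      have "F (p u) - h (p u) \<in> U" using h(3) pu by blast
      then have "s (p u) - (F (p u) - h (p u)) \<in> U" by (rule subspace_diff[OF U(1) sU])
      then have w: "?w \<in> U" by (simp add: F_def algebra_simps)
      have wJ: "?w \<in> J" using pE by (simp add: J_def)
      have "u - p u - h (p u) \<in> I" using u U(2) by (intro subspace_diff[OF sI] pI hI[OF pE]) auto
      then have "u - ?w \<in> I" by (simp add: algebra_simps)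
      moreover have "u - ?w \<in> U" using u w by (intro subspace_diff[OF U(1)])
      ultimately have "(u - ?w) + ?w \<in> (U \<inter> I) \<oplus>\<^sub>s (U \<inter> J)" using w wJ by (intro ssumI) auto
      then show "u \<in> (U \<inter> I) \<oplus>\<^sub>s (U \<inter> J)" by simp
    qed
    show "(U \<inter> I) \<oplus>\<^sub>s (U \<inter> J) \<subseteq> U" by (intro ssum_least[OF U(1)]) auto
  qed
  show ?thesis unfolding splits_def using I(1) hJ IJ EJ UJ by blast
qed

text \<open>Numerator and denominator of a slope are at most \<open>dim E\<close>, so there are only finitely many slopes.\<close>

lemma max_slope_exists:
  assumes "hsub E" "E \<subseteq> quat_tuples n" "E \<noteq> {0}"
  shows "\<exists>K. hsub K \<and> K \<subseteq> E \<and> K \<noteq> {0} \<and> (\<forall>L. hsub L \<longrightarrow> L \<subseteq> E \<longrightarrow> dim (U \<inter> L) * dim K \<le> dim (U \<inter> K) * dim L)"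
proof -
  have fE: "fin_dim E" using fin_dim_sub_tuples[OF assms(2)] .
  let ?M = "{K. hsub K \<and> K \<subseteq> E \<and> K \<noteq> {0}}"
  define r where "r K = real (dim (U \<inter> K)) / real (dim K)" for K :: "(nat \<Rightarrow> quat) set"
  have "r ` ?M \<subseteq> (\<lambda>(a, b). real a / real b) ` ({..dim E} \<times> {..dim E})"
  proof (rule image_subsetI)
    fix K assume K: "K \<in> ?M"
    then have "dim K \<le> dim E" "dim (U \<inter> K) \<le> dim E"
      by (auto intro!: dim_mono_fin[OF fE])
    then show "r K \<in> (\<lambda>(a, b). real a / real b) ` ({..dim E} \<times> {..dim E})"
      unfolding r_def by (intro image_eqI[of _ _ "(dim (U \<inter> K), dim K)"]) auto
  qed
  then have fin: "finite (r ` ?M)" by (rule finite_subset) simp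
  have ne: "r ` ?M \<noteq> {}" using assms by auto
  obtain K where K: "Max (r ` ?M) = r K" "K \<in> ?M" using Max_in[OF fin ne] by (rule imageE)
  have dpos: "dim L > 0" if "L \<in> ?M" for L
    using that dim_eq_0_fin[OF fin_dim_mono[OF fE], of L] hsub_subspace[of L] by auto
  have "dim (U \<inter> L) * dim K \<le> dim (U \<inter> K) * dim L" if L: "hsub L" "L \<subseteq> E" for L
  proof (cases "L = {0}")
    case True
    then have "dim (U \<inter> L) \<le> dim L" by (intro dim_mono_fin) auto
    then show ?thesis using True by simp
  next
    case False
    then have "r L \<le> r K" unfolding K(1)[symmetric] using L by (intro Max_ge[OF fin]) auto
    then have "real (dim (U \<inter> L)) * real (dim K) \<le> real (dim (U \<inter> K)) * real (dim L)"
      using dpos[of L] dpos[OF K(2)] L False unfolding r_def by (simp add: field_simps)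
    then show ?thesis by (metis of_nat_le_iff of_nat_mult)
  qed
  then show ?thesis using K(2) by blast
qed

text \<open>\<open>Pr\<close> stands for a family of stable pairs of slopes \<open>(l + 1) / (2 l)\<close>. Let \<open>K\<close> have maximal slope
  \<open>s > 1/2\<close> and choose \<open>l\<close> with \<open>l \<le> 1 / (2 s - 1) < l + 1\<close>. The right inequality makes the parameter count
  positive, so there is a nonzero morphism to \<open>K\<close>. The left one says that the family member has slope at least \<open>s\<close>; so the
  morphism is injective, and its image has slope exactly \<open>s\<close> and splits off.\<close>

lemma positive_summand:
  fixes Pr :: "nat \<Rightarrow> (nat \<Rightarrow> quat) set \<Rightarrow> bool"
  assumes fam: "\<And>l. l \<ge> 1 \<Longrightarrow> \<exists>N UP. Pr N UP \<and> slope_stable UP (quat_tuples N) \<and> 2 * l * dim UP = (l + 1) * (4 * N)"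
    and E: "hsub E" "E \<subseteq> quat_tuples n" and U: "subspace U" "U \<subseteq> E"
    and K0: "hsub K0" "K0 \<subseteq> E" "dim K0 < 2 * dim (U \<inter> K0)"
  shows "\<exists>N UP v J. Pr N UP \<and> slope_stable UP (quat_tuples N) \<and>
    (\<forall>x\<in>quat_tuples N. comb N v x = 0 \<longrightarrow> x = 0) \<and> comb N v ` UP = U \<inter> comb N v ` quat_tuples N \<and>
    splits U E (comb N v ` quat_tuples N) J"
proof -
  have fE: "fin_dim E" using fin_dim_sub_tuples[OF E(2)] .
  have "K0 \<noteq> {0}"
  proof
    assume "K0 = {0}"
    moreover have "dim (U \<inter> {0}) \<le> dim {0 :: nat \<Rightarrow> quat}" by (intro dim_mono_fin) auto
    ultimately show False using K0(3) by simp
  qed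
  then have "E \<noteq> {0}" using K0(1,2) subspace_0[OF hsub_subspace[OF K0(1)]] by blast
  then obtain K where K: "hsub K" "K \<subseteq> E" "K \<noteq> {0}"
    and mx: "\<And>L. hsub L \<Longrightarrow> L \<subseteq> E \<Longrightarrow> dim (U \<inter> L) * dim K \<le> dim (U \<inter> K) * dim L"
    using max_slope_exists[OF E, of U] by auto
  define a where "a = dim (U \<inter> K)"
  define e where "e = dim K"
  have fK: "fin_dim K" using fin_dim_mono[OF fE K(2)] .
  have sK: "subspace K" using K hsub_subspace by blast
  have epos: "e > 0" using dim_eq_0_fin[OF fK sK] K(3) unfolding e_def by blast
  have ae: "a \<le> e" unfolding a_def e_def by (rule dim_mono_fin[OF fK]) auto
  have a2: "e < 2 * a"
  proof (rule ccontr)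
    assume "\<not> e < 2 * a"
    then have "2 * (dim (U \<inter> K0) * e) \<le> e * dim K0"
      using mx[OF K0(1,2)] mult_le_mono1[of "2 * a" e "dim K0"] unfolding a_def e_def by linarith
    then have "e * (2 * dim (U \<inter> K0)) \<le> e * dim K0" by (simp add: ac_simps)
    then show False using epos K0(3) by simp
  qed
  \<comment> \<open>\<open>e / D\<close> is \<open>1 / (2 s - 1)\<close> for the maximal slope \<open>s = a / e\<close>.\<close>
  define D where "D = 2 * a - e"
  define l where "l = e div D"
  have D: "D > 0" "D \<le> e" using a2 ae by (auto simp: D_def)
  have l: "l \<ge> 1" "l * D \<le> e" "e < (l + 1) * D"
    using D by (simp_all add: l_def Suc_le_eq div_greater_zero_iff div_times_less_eq_dividend dividend_less_div_times)
  obtain N UP where P: "Pr N UP" "slope_stable UP (quat_tuples N)" and dP: "2 * l * dim UP = (l + 1) * (4 * N)"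
    using fam[OF l(1)] by blast
  have UP: "subspace UP" "UP \<subseteq> quat_tuples N" and Nne: "quat_tuples N \<noteq> {0}" using P(2) by (auto simp: slope_stable_def)
  have Npos: "N > 0" using Nne dim_tuples[of N] by (cases N) (auto simp: quat_tuples_def fun_eq_iff)
  have euler: "dim UP * e < N * e + dim UP * a"
  proof -
    have "2 * a = e + D" using a2 by (simp add: D_def)
    have "(2 * l * dim UP) * (2 * e) < (2 * l) * (2 * (N * e)) + (2 * l * dim UP) * (2 * a)"
    proof -
      have "(l + 1) * (4 * N) * (2 * e) < (2 * l) * (2 * (N * e)) + (l + 1) * (4 * N) * (e + D)"
      proof -
        have "e * (4 * N) < (l + 1) * D * (4 * N)" using l(3) Npos by (intro mult_strict_right_mono) auto
        then show ?thesis by (simp add: algebra_simps)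
      qed
      then show ?thesis unfolding dP \<open>2 * a = e + D\<close> .
    qed
    then have "(4 * l) * (dim UP * e) < (4 * l) * (N * e + dim UP * a)" by (simp add: algebra_simps)
    then show ?thesis by simp
  qed
  obtain v where v: "\<forall>r<N. v r \<in> K" "comb N v ` UP \<subseteq> U \<inter> K" "\<exists>x\<in>quat_tuples N. comb N v x \<noteq> 0"
    using nonzero_hom_exists[OF UP K(1) subset_trans[OF K(2) E(2)] subspace_inter[OF U(1) sK] Int_lower2 euler[unfolded e_def a_def]]
    by blast
  define h where "h = comb N v"
  have h: "hlin h" "linear h" unfolding h_def using hlin_comb hlin_linear by auto
  define I where "I = h ` quat_tuples N"
  have hI: "hsub I" unfolding I_def by (rule hsub_image[OF h(1) hsub_tuples])
  have IK: "I \<subseteq> K" unfolding I_def h_def using comb_in[OF K(1)] v(1) by blast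
  have IE: "I \<subseteq> E" using IK K(2) by blast
  have fUI: "fin_dim (U \<inter> I)" by (rule fin_dim_mono[OF fE]) (use IE in blast)
  have hU: "h ` UP \<subseteq> U \<inter> I" using v(2) UP(2) unfolding I_def h_def by blast
  \<comment> \<open>The slope of the family member is at least the maximal slope.\<close>
  have sl: "a * (4 * N) \<le> e * dim UP"
  proof -
    have "2 * l * a = l * (e + D)" using a2 by (simp add: D_def)
    also have "\<dots> \<le> (l + 1) * e" using l(2) by (simp add: algebra_simps)
    finally have "2 * l * a * (4 * N) \<le> (l + 1) * e * (4 * N)" by (rule mult_le_mono1)
    also have "\<dots> = e * (2 * l * dim UP)" unfolding dP by (simp add: algebra_simps)
    finally have "(2 * l) * (a * (4 * N)) \<le> (2 * l) * (e * dim UP)" by (simp add: ac_simps)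
    then show ?thesis using l(1) by (simp add: ac_simps)
  qed
  have slI: "dim (U \<inter> I) * (4 * N) \<le> dim UP * dim I"
  proof -
    have "e * (dim (U \<inter> I) * (4 * N)) \<le> a * dim I * (4 * N)"
      using mult_le_mono1[OF mx[OF hI IE], of "4 * N"] unfolding a_def e_def by (simp add: ac_simps)
    also have "\<dots> \<le> e * (dim UP * dim I)" using mult_le_mono1[OF sl, of "dim I"] by (simp add: ac_simps)
    finally show ?thesis using epos by simp
  qed
  have inj: "x = 0" if "x \<in> quat_tuples N" "h x = 0" for x
  proof (rule slope_stable_injective[OF P(2) subset_refl h(2)])
    show "hsub {x \<in> quat_tuples N. h x = 0}" by (rule hsub_kernel[OF h(1) hsub_tuples])
    have "dim (h ` UP) * (4 * N) \<le> dim (U \<inter> I) * (4 * N)" by (intro mult_le_mono1 dim_mono_fin[OF fUI hU])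
    then show "dim (h ` UP) * dim (quat_tuples N) \<le> dim UP * dim (h ` quat_tuples N)"
      using slI unfolding dim_tuples I_def by linarith
    show "\<exists>x\<in>quat_tuples N. h x \<noteq> 0" using v(3) unfolding h_def .
  qed (use that in auto)
  have dI: "dim I = 4 * N" unfolding I_def using dim_image_inj[OF h(2) subspace_tuples fin_dim_tuples inj] dim_tuples by simp
  have fUP: "fin_dim UP" using fin_dim_sub_tuples[OF UP(2)] .
  have dhU: "dim (h ` UP) = dim UP" using inj UP by (intro dim_image_inj[OF h(2) UP(1) fUP]) auto
  have dUI: "dim (U \<inter> I) \<le> dim UP" using slI Npos dI by simp
  have eq: "h ` UP = U \<inter> I"
    using subspace_eq_of_dim_le[OF fUI linear_subspace_image[OF h(2) UP(1)] subspace_inter[OF U(1) hsub_subspace[OF hI]] hU]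
      dUI dhU by simp
  then have dUI': "dim (U \<inter> I) = dim UP" using dhU by simp
  have sl2: "dim (U \<inter> L) * dim I \<le> dim (U \<inter> I) * dim L" if L: "hsub L" "L \<subseteq> E" for L
  proof -
    have "e * (dim (U \<inter> L) * (4 * N)) \<le> a * dim L * (4 * N)"
      using mult_le_mono1[OF mx[OF L], of "4 * N"] unfolding a_def e_def by (simp add: ac_simps)
    also have "\<dots> \<le> e * (dim UP * dim L)" using mult_le_mono1[OF sl, of "dim L"] by (simp add: ac_simps)
    finally show ?thesis using epos unfolding dI dUI' by simp
  qed
  have pos: "dim I < 2 * dim (U \<inter> I)"
  proof -
    have "l * (4 * N) < (l + 1) * (4 * N)" using Npos by simp
    also have "\<dots> = l * (2 * dim UP)" using dP by simp
    finally show ?thesis unfolding dI dUI' using l(1) by simp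
  qed
  obtain J where "splits U E I J" using split_off[OF E U hI IE sl2 pos] by blast
  then show ?thesis using P inj eq unfolding I_def h_def by blast
qed

section \<open>Duality by orthogonal complements\<close>

text \<open>\<open>perp n E U \<inter> K\<close> is the orthogonal complement of \<open>U \<oplus>\<^sub>s perp n E K\<close>, so the inequality for \<open>K\<close>
  is the one for \<open>U\<close> and \<open>perp n E K\<close>.\<close>

lemma slope_stable_perp:
  assumes st: "slope_stable U E" and E: "E \<subseteq> quat_tuples n"
  shows "slope_stable (perp n E U) E"
proof -
  have h: "hsub E" "E \<noteq> {0}" "subspace U" "U \<subseteq> E" using st unfolding slope_stable_def by auto
  have sE: "subspace E" using h(1) hsub_subspace by blast
  have fE: "fin_dim E" by (rule fin_dim_sub_tuples[OF E])
  have dU: "dim E = dim U + dim (perp n E U)" by (rule perp_decomp(3)[OF E sE h(3,4)])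
  show ?thesis unfolding slope_stable_def
  proof (intro conjI allI impI)
    show "hsub E" "E \<noteq> {0}" "subspace (perp n E U)" "perp n E U \<subseteq> E"
      using h subspace_perp[OF sE] perp_subset by auto
    fix K assume K: "hsub K" "K \<subseteq> E" "K \<noteq> {0}" "K \<noteq> E"
    let ?K' = "perp n E K"
    have sK: "subspace K" using K hsub_subspace by blast
    have K': "hsub ?K'" "?K' \<subseteq> E" using hsub_perp[OF h(1) K(1)] perp_subset by auto
    have sK': "subspace ?K'" using K' hsub_subspace by blast
    have KK: "perp n E ?K' = K" by (rule perp_perp[OF E sE sK K(2)])
    have dK: "dim E = dim K + dim ?K'" by (rule perp_decomp(3)[OF E sE sK K(2)])
    have ne: "?K' \<noteq> {0}" "?K' \<noteq> E"
    proof -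
      show "?K' \<noteq> {0}"
      proof
        assume "?K' = {0}" then have "perp n E ?K' = E" by (auto simp: perp_def ip_simps)
        then show False using KK K(4) by simp
      qed
      show "?K' \<noteq> E"
      proof
        assume "?K' = E" then have "dim K = 0" using dK by simp
        then show False using dim_eq_0_fin[OF fin_dim_mono[OF fE K(2)] sK] K(3) by blast
      qed
    qed
    have fU: "fin_dim U" and fK': "fin_dim ?K'" using fin_dim_mono[OF fE] h(4) K'(2) by auto
    let ?S = "U \<oplus>\<^sub>s ?K'"
    have sS: "subspace ?S" by (rule subspace_ssum[OF h(3) sK'])
    have SE: "?S \<subseteq> E" by (rule ssum_least[OF sE h(4) K'(2)])
    have "perp n E U \<inter> K = perp n E ?S"
    proof
      have "K \<subseteq> perp n E ?K'" using KK by simp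
      then show "perp n E U \<inter> K \<subseteq> perp n E ?S"
        unfolding perp_def by (auto elim!: ssumE simp: ip_simps subset_iff)
      have "perp n E ?S \<subseteq> perp n E ?K'" using ssum_sup2[OF h(3), of ?K'] unfolding perp_def by auto
      moreover have "perp n E ?S \<subseteq> perp n E U" using ssum_sup1[OF sK', of U] unfolding perp_def by auto
      ultimately show "perp n E ?S \<subseteq> perp n E U \<inter> K" using KK by blast
    qed
    then have 1: "dim E = dim ?S + dim (perp n E U \<inter> K)" using perp_decomp(3)[OF E sE sS SE] by simp
    have 2: "dim ?S + dim (U \<inter> ?K') = dim U + dim ?K'" by (rule dim_ssum_Int[OF h(3) sK' fU fK'])
    have 3: "dim (U \<inter> ?K') * dim E < dim U * dim ?K'" using st K' ne unfolding slope_stable_def by blast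
    have arith: "x * e < w * k" if "e = d + w" "e = k + k'" "e = s + x" "s + z = d + k'" "z * e < d * k'"
      for x e w k k' d s z :: nat
    proof -
      have s: "int x = int k + int z - int d" "int w = int e - int d" "int k' = int e - int k" using that by linarith+
      have "int z * int e < int d * int k'" using that(5) by (metis of_nat_less_iff of_nat_mult)
      then have "int z * int e < int d * (int e - int k)" unfolding s(3) .
      then have "int x * int e < int w * int k" unfolding s(1,2) by (simp add: algebra_simps)
      then show ?thesis by (metis of_nat_less_iff of_nat_mult)
    qed
    show "dim (perp n E U \<inter> K) * dim E < dim (perp n E U) * dim K" by (rule arith[OF dU dK 1 2 3])
  qed
qed

lemma splits_perp:
  assumes E: "hsub E" "E \<subseteq> quat_tuples n" and W: "subspace W" "W \<subseteq> E" and sp: "splits W E I J"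
  shows "splits (perp n E W) E (perp n E J) (perp n E I)"
proof -
  have h: "hsub I" "hsub J" "I \<inter> J = {0}" "E = I \<oplus>\<^sub>s J" "W = (W \<inter> I) \<oplus>\<^sub>s (W \<inter> J)" using sp unfolding splits_def by auto
  have s: "subspace E" "subspace I" "subspace J" using E h hsub_subspace by auto
  have IE: "I \<subseteq> E" "J \<subseteq> E" using h(4) ssum_sup1[OF s(3), of I] ssum_sup2[OF s(2), of J] by auto
  have fE: "fin_dim E" by (rule fin_dim_sub_tuples[OF E(2)])
  have fI: "fin_dim I" "fin_dim J" using fin_dim_mono[OF fE] IE by auto
  let ?A = "perp n E J" and ?B = "perp n E I"
  have hA: "hsub ?A" "hsub ?B" using hsub_perp[OF E(1)] h by auto
  have sA: "subspace ?A" "subspace ?B" using hA hsub_subspace by auto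
  have sub: "?A \<subseteq> E" "?B \<subseteq> E" using perp_subset by auto
  have fA: "fin_dim ?A" "fin_dim ?B" using fin_dim_mono[OF fE] sub by auto
  have int: "?A \<inter> ?B = {0}"
  proof -
    have "x = 0" if x: "x \<in> ?A" "x \<in> ?B" for x
    proof -
      have xE: "x \<in> E" using x sub by blast
      then have "x \<in> I \<oplus>\<^sub>s J" using h(4) by simp
      then obtain a b where ab: "x = a + b" "a \<in> I" "b \<in> J" by (rule ssumE)
      have "ip n x x = ip n x a + ip n x b" by (subst (2) ab(1)) (simp add: ip_simps)
      also have "\<dots> = 0" using x ab by (auto simp: perp_def)
      finally show ?thesis using ip_pos[of x n] xE E(2) by blast
    qed
    then show ?thesis using subspace_0[OF sA(1)] subspace_0[OF sA(2)] by blast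
  qed
  have dIJ: "dim E = dim I + dim J" using dim_direct_sum[OF s(2,3) fI h(3)] h(4) by simp
  have "dim (?A \<oplus>\<^sub>s ?B) = dim ?A + dim ?B" by (rule dim_direct_sum[OF sA fA int])
  then have "dim E \<le> dim (?A \<oplus>\<^sub>s ?B)"
    using dIJ perp_decomp(3)[OF E(2) s(1,2) IE(1)] perp_decomp(3)[OF E(2) s(1,3) IE(2)] by linarith
  then have AB: "E = ?A \<oplus>\<^sub>s ?B"
    using subspace_eq_of_dim_le[OF fE subspace_ssum[OF sA] s(1) ssum_least[OF s(1) sub]] by simp
  have PW: "subspace (perp n E W)" by (rule subspace_perp[OF s(1)])
  have "perp n E W = (perp n E W \<inter> ?A) \<oplus>\<^sub>s (perp n E W \<inter> ?B)"
  proof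
    show "perp n E W \<subseteq> (perp n E W \<inter> ?A) \<oplus>\<^sub>s (perp n E W \<inter> ?B)"
    proof
      fix x assume x: "x \<in> perp n E W"
      then have "x \<in> E" using perp_subset by blast
      then have "x \<in> ?A \<oplus>\<^sub>s ?B" using AB by simp
      then obtain a b where ab: "x = a + b" "a \<in> ?A" "b \<in> ?B" by (rule ssumE)
      have "ip n a w = 0" if w: "w \<in> W" for w
      proof -
        have "w \<in> (W \<inter> I) \<oplus>\<^sub>s (W \<inter> J)" using w h(5) by simp
        then obtain w1 w2 where ww: "w = w1 + w2" "w1 \<in> W \<inter> I" "w2 \<in> W \<inter> J" by (rule ssumE)
        have "ip n a w2 = 0" "ip n b w1 = 0" "ip n x w1 = 0" using ab ww x by (auto simp: perp_def)
        then show ?thesis unfolding ww(1) using ab(1) by (simp add: ip_simps)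
      qed
      then have aP: "a \<in> perp n E W" using ab(2) sub by (auto simp: perp_def)
      have "b = x - a" using ab(1) by simp
      then have "b \<in> perp n E W" using subspace_diff[OF PW x aP] by simp
      then show "x \<in> (perp n E W \<inter> ?A) \<oplus>\<^sub>s (perp n E W \<inter> ?B)" unfolding ab(1) using aP ab by (intro ssumI) auto
    qed
    show "(perp n E W \<inter> ?A) \<oplus>\<^sub>s (perp n E W \<inter> ?B) \<subseteq> perp n E W" by (intro ssum_least[OF PW]) auto
  qed
  then show ?thesis unfolding splits_def using hA int AB by blast
qed

text \<open>The adjoint of \<open>comb N v\<close> with respect to \<open>ip\<close>.\<close>

definition adj :: "nat \<Rightarrow> nat \<Rightarrow> (nat \<Rightarrow> nat \<Rightarrow> quat) \<Rightarrow> (nat \<Rightarrow> quat) \<Rightarrow> nat \<Rightarrow> quat" where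
  "adj n N v x = (\<lambda>r. if r < N then \<Sum>i<n. x i * qcnj (v r i) else 0)"

lemma hlin_adj: "hlin (adj n N v)"
  unfolding hlin_def adj_def
  by (auto intro!: linearI simp: fun_eq_iff algebra_simps sum.distrib scaleR_sum_right sum_distrib_left)

lemma adj_in_tuples: "adj n N v x \<in> quat_tuples N" by (auto simp: adj_def quat_tuples_def)

lemma ip_adj: "ip N (adj n N v x) y = ip n x (comb N v y)"
proof -
  have "ip N (adj n N v x) y = (\<Sum>r<N. \<Sum>i<n. (x i * qcnj (v r i)) \<bullet> y r)"
    unfolding ip_def adj_def by (simp add: inner_sum_left)
  also have "\<dots> = (\<Sum>r<N. \<Sum>i<n. x i \<bullet> (y r * v r i))" by (simp only: inner_quat_mult(2) qcnj_qcnj)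
  also have "\<dots> = ip n x (comb N v y)"
    unfolding ip_def comb_def by (subst sum.swap) (simp add: inner_sum_right)
  finally show ?thesis .
qed

definition hiso :: "(nat \<Rightarrow> quat) set \<Rightarrow> (nat \<Rightarrow> quat) set \<Rightarrow> (nat \<Rightarrow> quat) set \<Rightarrow> (nat \<Rightarrow> quat) set \<Rightarrow> bool" where
  "hiso U E U' E' \<longleftrightarrow> (\<exists>f. hlin f \<and> (\<forall>x\<in>E. f x = 0 \<longrightarrow> x = 0) \<and> f ` E = E' \<and> f ` U = U')"

text \<open>The dual of \<open>positive_summand\<close>: apply it to the orthogonal complement \<open>W\<close> of \<open>U\<close>. The adjoint of the
  embedding of a family member as \<open>I\<close> with complement \<open>J\<close> is an isomorphism on the orthogonal complement
  of \<open>J\<close>, and takes the part of \<open>U\<close> there to the orthogonal complement of the family member.\<close>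

lemma negative_summand:
  fixes Md :: "nat \<Rightarrow> (nat \<Rightarrow> quat) set \<Rightarrow> bool"
  assumes fam: "\<And>l. l \<ge> 1 \<Longrightarrow> \<exists>N UM. Md N UM \<and> slope_stable UM (quat_tuples N) \<and>
      2 * l * dim (perp N (quat_tuples N) UM) = (l + 1) * (4 * N)"
    and E: "hsub E" "E \<subseteq> quat_tuples n" and U: "subspace U" "U \<subseteq> E"
    and K0: "hsub K0" "K0 \<subseteq> E" "dim K0 < 2 * dim (perp n E U \<inter> K0)"
  shows "\<exists>N UM A B. Md N UM \<and> slope_stable UM (quat_tuples N) \<and> splits U E A B \<and> hiso (U \<inter> A) A UM (quat_tuples N)"
proof -
  have sE: "subspace E" using E hsub_subspace by blast
  have fE: "fin_dim E" by (rule fin_dim_sub_tuples[OF E(2)])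
  define W where "W = perp n E U"
  have W: "subspace W" "W \<subseteq> E" unfolding W_def using subspace_perp[OF sE] perp_subset by auto
  have UW: "perp n E W = U" unfolding W_def by (rule perp_perp[OF E(2) sE U])
  let ?Pr = "\<lambda>N UP. \<exists>UM. Md N UM \<and> slope_stable UM (quat_tuples N) \<and> UP = perp N (quat_tuples N) UM"
  have "\<exists>N UP v J. ?Pr N UP \<and> slope_stable UP (quat_tuples N) \<and>
    (\<forall>x\<in>quat_tuples N. comb N v x = 0 \<longrightarrow> x = 0) \<and> comb N v ` UP = W \<inter> comb N v ` quat_tuples N \<and>
    splits W E (comb N v ` quat_tuples N) J"
  proof (rule positive_summand[OF _ E W K0(1,2)])
    show "dim K0 < 2 * dim (W \<inter> K0)" using K0(3) unfolding W_def .
    fix l :: nat assume "l \<ge> 1"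
    then show "\<exists>N UP. ?Pr N UP \<and> slope_stable UP (quat_tuples N) \<and> 2 * l * dim UP = (l + 1) * (4 * N)"
      using fam[of l] slope_stable_perp[OF _ subset_refl] by blast
  qed
  then obtain N UM UP v J where P: "Md N UM" "slope_stable UM (quat_tuples N)" "UP = perp N (quat_tuples N) UM"
    and inj: "\<forall>x\<in>quat_tuples N. comb N v x = 0 \<longrightarrow> x = 0"
    and hU: "comb N v ` UP = W \<inter> comb N v ` quat_tuples N"
    and sp: "splits W E (comb N v ` quat_tuples N) J"
    by (elim exE conjE) (rule that; assumption)
  define I where "I = comb N v ` quat_tuples N"
  have sp': "splits W E I J" using sp unfolding I_def .
  define A where "A = perp n E J"
  have hJ: "hsub J" and hI: "hsub I" and IJ: "I \<inter> J = {0}" "E = I \<oplus>\<^sub>s J" and WIJ: "W = (W \<inter> I) \<oplus>\<^sub>s (W \<inter> J)"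
    using sp' unfolding splits_def by auto
  have sJ: "subspace J" "subspace I" using hJ hI hsub_subspace by auto
  have JE: "J \<subseteq> E" "I \<subseteq> E" using IJ(2) ssum_sup1[OF sJ(1), of I] ssum_sup2[OF sJ(2), of J] by auto
  have split: "splits U E A (perp n E I)" unfolding A_def using splits_perp[OF E W sp'] UW by simp
  have sA: "subspace A" "A \<subseteq> E" unfolding A_def using subspace_perp[OF sE] perp_subset by auto
  have fA: "fin_dim A" by (rule fin_dim_mono[OF fE sA(2)])
  have UM: "subspace UM" "UM \<subseteq> quat_tuples N" using P(2) unfolding slope_stable_def by auto
  have UMUP: "perp N (quat_tuples N) UP = UM" unfolding P(3) by (rule perp_perp[OF subset_refl subspace_tuples UM])
  let ?f = "adj n N v"
  have lf: "linear ?f" using hlin_adj hlin_linear by blast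
  have finj: "x = 0" if x: "x \<in> A" "?f x = 0" for x
  proof -
    have z: "ip n x (comb N v y) = 0" for y using ip_adj[of N n v x y] x(2) by (simp add: ip_simps)
    have xE: "x \<in> E" using x(1) sA by blast
    then have "x \<in> I \<oplus>\<^sub>s J" using IJ by simp
    then obtain a b where ab: "x = a + b" "a \<in> I" "b \<in> J" by (rule ssumE)
    have "ip n x x = ip n x a + ip n x b" by (subst (2) ab(1)) (simp add: ip_simps)
    also have "\<dots> = 0" using x(1) ab z by (auto simp: A_def perp_def I_def)
    finally show ?thesis using ip_pos[of x n] xE E(2) by blast
  qed
  have dI: "dim I = dim (quat_tuples N)" unfolding I_def
    using inj by (intro dim_image_inj[OF hlin_linear[OF hlin_comb] subspace_tuples fin_dim_tuples]) auto
  have "dim E = dim I + dim J"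
    using dim_direct_sum[OF sJ(2,1) fin_dim_mono[OF fE JE(2)] fin_dim_mono[OF fE JE(1)] IJ(1)] IJ(2) by simp
  moreover have "dim E = dim J + dim A" unfolding A_def by (rule perp_decomp(3)[OF E(2) sE sJ(1) JE(1)])
  ultimately have dA: "dim A = dim (quat_tuples N)" using dI by linarith
  have fAim: "?f ` A = quat_tuples N"
  proof (rule subspace_eq_of_dim_le[OF fin_dim_tuples linear_subspace_image[OF lf sA(1)] subspace_tuples])
    show "?f ` A \<subseteq> quat_tuples N" using adj_in_tuples by blast
    show "dim (quat_tuples N) \<le> dim (?f ` A)" using dim_image_inj[OF lf sA(1) fA finj] dA by simp
  qed
  have "?f ` (U \<inter> A) = UM"
  proof
    show "?f ` (U \<inter> A) \<subseteq> UM"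
    proof (rule image_subsetI)
      fix x assume x: "x \<in> U \<inter> A"
      have "ip N (?f x) y = 0" if "y \<in> UP" for y
      proof -
        have "comb N v y \<in> W" using hU that by blast
        then show ?thesis unfolding ip_adj using x unfolding UW[symmetric] perp_def by blast
      qed
      then show "?f x \<in> UM" unfolding UMUP[symmetric] using adj_in_tuples by (auto simp: perp_def)
    qed
    show "UM \<subseteq> ?f ` (U \<inter> A)"
    proof
      fix y assume y: "y \<in> UM"
      then have "y \<in> ?f ` A" using fAim UM by blast
      then obtain x where x: "x \<in> A" "y = ?f x" by blast
      have "ip n x w = 0" if w: "w \<in> W" for w
      proof -
        have "w \<in> (W \<inter> I) \<oplus>\<^sub>s (W \<inter> J)" using w WIJ by simp
        then obtain w1 w2 where ww: "w = w1 + w2" "w1 \<in> W \<inter> I" "w2 \<in> W \<inter> J" by (rule ssumE)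
        obtain t where t: "t \<in> UP" "w1 = comb N v t" using ww(2) hU unfolding I_def by blast
        have "ip n x w1 = ip N y t" unfolding t(2) x(2) ip_adj ..
        also have "\<dots> = 0" using t(1) y unfolding P(3) by (auto simp: perp_def ip_commute)
        finally have "ip n x w1 = 0" .
        moreover have "ip n x w2 = 0" using x(1) ww(3) by (auto simp: A_def perp_def)
        ultimately show ?thesis unfolding ww(1) by (simp add: ip_simps)
      qed
      then have "x \<in> U" using x(1) sA unfolding UW[symmetric] by (auto simp: perp_def)
      then show "y \<in> ?f ` (U \<inter> A)" using x by blast
    qed
  qed
  then have "hiso (U \<inter> A) A UM (quat_tuples N)"
    unfolding hiso_def using hlin_adj finj fAim by blast
  then show ?thesis using P(1,2) split by blast
qed

section \<open>Stability of the pairs \<open>U_k\<close>\<close>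

definition cline :: "quat \<Rightarrow> quat set" where "cline q = range (\<lambda>(a, b). of_real a + b *\<^sub>R q)"

lemma clineI: "of_real a + b *\<^sub>R q \<in> cline q" unfolding cline_def by (rule image_eqI[of _ _ "(a, b)"]) auto
lemma clineE: assumes "z \<in> cline q" obtains a b where "z = of_real a + b *\<^sub>R q" using assms unfolding cline_def by auto

lemma subspace_cline: "subspace (cline q)"
proof (rule subspaceI)
  show "0 \<in> cline q" using clineI[of 0 0 q] by simp
  fix x y assume "x \<in> cline q" "y \<in> cline q"
  then obtain a b c d where "x = of_real a + b *\<^sub>R q" "y = of_real c + d *\<^sub>R q" by (metis clineE)
  then show "x + y \<in> cline q" using clineI[of "a + c" "b + d" q] by (simp add: algebra_simps)
next
  fix r x assume "x \<in> cline q"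
  then obtain a b where "x = of_real a + b *\<^sub>R q" by (metis clineE)
  then show "r *\<^sub>R x \<in> cline q" using clineI[of "r * a" "r * b" q] by (simp add: algebra_simps of_real_def)
qed

lemma dim_cline: assumes "q \<in> S2" shows "dim (cline q) = 2"
proof -
  have "cline q = span {1, q}"
  proof
    show "cline q \<subseteq> span {1, q}"
    proof
      fix z assume "z \<in> cline q"
      then obtain a b where z: "z = of_real a + b *\<^sub>R q" by (rule clineE)
      have "a *\<^sub>R 1 + b *\<^sub>R q \<in> span {1, q}"
        by (rule span_add[OF span_scale[OF span_base] span_scale[OF span_base]]) auto
      then show "z \<in> span {1, q}" unfolding z of_real_def .
    qed
    show "span {1, q} \<subseteq> cline q"
      using clineI[of 1 0 q] clineI[of 0 1 q] by (intro span_minimal[OF _ subspace_cline]) auto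
  qed
  moreover have "independent {1, q}" "card {1, q} = 2"
  proof -
    have "q \<noteq> k *\<^sub>R 1" for k using assms by (auto simp: quat_simps S2_iff)
    then have "q \<notin> span {1}" by (auto simp: span_singleton)
    then show "independent {1, q}" using independent_insertI[of q "{1}"] by (simp add: insert_commute)
    show "card {1, q} = 2" using \<open>q \<noteq> _ *\<^sub>R 1\<close>[of 1] by auto
  qed
  ultimately show ?thesis by (simp add: dim_eq_card_independent)
qed

text \<open>For \<open>z \<noteq> 0\<close>, \<open>q\<close> would lie in the field \<open>cline p\<close>, where \<open>p\<close> and \<open>- p\<close> are the
  only square roots of \<open>-1\<close>.\<close>

lemma cline_mult_imp_zero:
  assumes "p \<in> S2" "q \<in> S2" "q \<noteq> p" "q \<noteq> - p" "z \<in> cline p" "q * z \<in> cline p"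
  shows "z = 0"
proof (rule ccontr)
  assume "z \<noteq> 0"
  obtain a b where z: "z = of_real a + b *\<^sub>R p" using assms(5) by (rule clineE)
  obtain c d where qz: "q * z = of_real c + d *\<^sub>R p" using assms(6) by (rule clineE)
  have pp: "p * p = -1" using S2_square assms(1) by blast
  let ?w = "of_real a - b *\<^sub>R p"
  define r where "r = a * a + b * b"
  have "z * ?w = of_real r"
    unfolding z r_def by (simp add: algebra_simps pp of_real_def)
  moreover have "r \<noteq> 0"
  proof
    assume "r = 0"
    then have "a = 0" "b = 0" unfolding r_def by (simp_all add: add_nonneg_eq_0_iff)
    then show False using z \<open>z \<noteq> 0\<close> by simp
  qed
  ultimately have "r *\<^sub>R q = q * z * ?w" by (simp add: mult.assoc of_real_def)
  also have "\<dots> = of_real (c * a + d * b) + (d * a - c * b) *\<^sub>R p"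
    unfolding qz by (simp add: algebra_simps pp of_real_def)
  finally have e: "r *\<^sub>R q = of_real (c * a + d * b) + (d * a - c * b) *\<^sub>R p" .
  define t where "t = (d * a - c * b) / r"
  have "c * a + d * b = 0" using e assms(1,2) by (simp add: quat_simps S2_iff)
  then have "r *\<^sub>R q = r *\<^sub>R (t *\<^sub>R p)" using e \<open>r \<noteq> 0\<close> by (simp add: t_def)
  then have qt: "q = t *\<^sub>R p" using \<open>r \<noteq> 0\<close> scaleR_cancel_left[of r q "t *\<^sub>R p"] by blast
  then have "t\<^sup>2 = 1" using assms(1,2) by (simp add: S2_iff power_mult_distrib flip: distrib_left)
  then have "t = 1 \<or> t = -1" by (simp add: power2_eq_1_iff)
  then show False using qt assms(3,4) by auto
qed

text \<open>The product of the complex lines \<open>cline (c i)\<close>; \<open>U_sub k c\<close> is a hyperplane in it for \<open>n = k + 1\<close>.\<close>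

definition Wc :: "(nat \<Rightarrow> quat) \<Rightarrow> nat \<Rightarrow> (nat \<Rightarrow> quat) set" where
  "Wc c n = {x \<in> quat_tuples n. \<forall>i<n. x i \<in> cline (c i)}"

lemma subspace_Wc: "subspace (Wc c n)"
  using subspace_cline subspace_tuples[of n] unfolding Wc_def subspace_def by auto

lemma Wc_Suc: "{x \<in> Wc c (Suc n). x n = 0} = Wc c n"
proof (intro set_eqI iffI)
  fix x assume x: "x \<in> {x \<in> Wc c (Suc n). x n = 0}"
  have "x i = 0" if "i \<ge> n" for i using x that by (cases "i = n") (auto simp: Wc_def quat_tuples_def)
  then show "x \<in> Wc c n" using x by (auto simp: Wc_def quat_tuples_def)
next
  fix x assume x: "x \<in> Wc c n"
  then have n: "x n = 0" by (simp add: Wc_def quat_tuples_def)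
  have "x i \<in> cline (c i)" if "i < Suc n" for i
    using x that n subspace_0[OF subspace_cline] by (cases "i = n") (auto simp: Wc_def)
  then show "x \<in> {x \<in> Wc c (Suc n). x n = 0}" using x n by (auto simp: Wc_def quat_tuples_def)
qed

lemma linear_eval: "linear (\<lambda>x :: nat \<Rightarrow> quat. x i)" by (rule linearI) auto

lemma fin_dim_Wc: "fin_dim (Wc c n)" by (rule fin_dim_sub_tuples[of _ n]) (auto simp: Wc_def)

lemma single_in_Wc: "i < n \<Longrightarrow> z \<in> cline (c i) \<Longrightarrow> single i z \<in> Wc c n"
  using subspace_0[OF subspace_cline] by (auto simp: Wc_def quat_tuples_def single_def)

lemma dim_Wc: assumes "\<And>i. i < n \<Longrightarrow> c i \<in> S2" shows "dim (Wc c n) = 2 * n"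
  using assms
proof (induction n)
  case 0
  have "Wc c 0 = {0}" by (auto simp: Wc_def quat_tuples_def fun_eq_iff)
  then show ?case by simp
next
  case (Suc n)
  have "(\<lambda>x. x n) ` Wc c (Suc n) = cline (c n)"
  proof
    show "cline (c n) \<subseteq> (\<lambda>x. x n) ` Wc c (Suc n)"
    proof
      fix z assume "z \<in> cline (c n)"
      then show "z \<in> (\<lambda>x. x n) ` Wc c (Suc n)" by (intro image_eqI[of _ _ "single n z"] single_in_Wc) (auto simp: single_def)
    qed
  qed (auto simp: Wc_def)
  then show ?case using rank_nullity[OF linear_eval[of n] subspace_Wc fin_dim_Wc, of c "Suc n"] Wc_Suc[of c n] Suc dim_cline[of "c n"]
    by simp
qed

text \<open>Induction on \<open>n\<close>, with \<open>K0\<close> the kernel of the last coordinate on \<open>K\<close>. If that coordinate is nonzero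
  on \<open>K\<close>, then \<open>K\<close> has 4 dimensions more than \<open>K0\<close>, but its intersection with \<open>Wc\<close> at most 2 more,
  because the coordinate takes values in \<open>cline (c n)\<close> there. Equality with \<open>K0 = {0}\<close> means that \<open>K\<close> is a
  line containing a \<open>w\<close> with last coordinate 1 such that \<open>w\<close> and \<open>c n * w\<close> are in \<open>Wc\<close>; by
  \<open>cline_mult_imp_zero\<close> the other coordinates of \<open>w\<close> are zero.\<close>

lemma Wc_bound:
  assumes "\<And>i. i < n \<Longrightarrow> c i \<in> S2" "\<And>i j. i < n \<Longrightarrow> j < n \<Longrightarrow> i \<noteq> j \<Longrightarrow> c i \<noteq> c j \<and> c i \<noteq> - c j"
    and "hsub K" "K \<subseteq> quat_tuples n"
  shows "2 * dim (Wc c n \<inter> K) \<le> dim K \<and> (2 * dim (Wc c n \<inter> K) = dim K \<longrightarrow> K \<noteq> {0} \<longrightarrow> (\<exists>i<n. single i 1 \<in> K))"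
  using assms
proof (induction n arbitrary: K)
  case 0
  have K0: "K = {0}" using 0(4) subspace_0[OF hsub_subspace[OF 0(3)]] by (auto simp: quat_tuples_def fun_eq_iff)
  have "dim (Wc c 0 \<inter> K) \<le> dim K" by (rule dim_mono_fin) (simp only: K0 fin_dim_zero, blast)
  moreover have "dim K = 0" by (simp only: K0 dim_zero_space)
  ultimately show ?case using K0 by auto
next
  case (Suc n)
  let ?p = "\<lambda>x :: nat \<Rightarrow> quat. x n"
  define K0 where "K0 = {x \<in> K. ?p x = 0}"
  have sK: "subspace K" using hsub_subspace Suc.prems by blast
  have K0t: "K0 \<subseteq> quat_tuples n"
  proof
    fix x assume x: "x \<in> K0"
    have "x i = 0" if "i \<ge> n" for i using x that Suc.prems(4) by (cases "i = n") (auto simp: K0_def quat_tuples_def)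
    then show "x \<in> quat_tuples n" by (simp add: quat_tuples_def)
  qed
  have hK0: "hsub K0" unfolding K0_def using Suc.prems(3) sK
    by (intro hsubI) (auto simp: subspace_0 subspace_add hsub_hmul)
  have IH: "2 * dim (Wc c n \<inter> K0) \<le> dim K0 \<and> (2 * dim (Wc c n \<inter> K0) = dim K0 \<longrightarrow> K0 \<noteq> {0} \<longrightarrow> (\<exists>i<n. single i 1 \<in> K0))"
    by (rule Suc.IH[OF _ _ hK0 K0t]) (use Suc.prems in auto)
  have fK: "fin_dim K" by (rule fin_dim_sub_tuples[OF Suc.prems(4)])
  have dK: "dim K = dim (?p ` K) + dim K0" unfolding K0_def by (rule rank_nullity[OF linear_eval sK fK])
  let ?W = "Wc c (Suc n) \<inter> K"
  have sW: "subspace ?W" and fW: "fin_dim ?W"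
    using subspace_inter[OF subspace_Wc sK] fin_dim_mono[OF fK, of ?W] by auto
  have "{x \<in> ?W. ?p x = 0} = Wc c n \<inter> K0" using Wc_Suc[of c n] unfolding K0_def by blast
  then have dW: "dim ?W = dim (?p ` ?W) + dim (Wc c n \<inter> K0)" using rank_nullity[OF linear_eval[of n] sW fW] by simp
  have pW: "?p ` ?W \<subseteq> cline (c n)" by (auto simp: Wc_def)
  have cn: "c n \<in> S2" using Suc.prems(1) by simp
  have dpW: "dim (?p ` ?W) \<le> 2" using dim_mono_fin[OF fin_dim_quat pW] dim_cline[OF cn] by simp
  show ?case
  proof (cases "\<exists>x\<in>K. x n \<noteq> 0")
    case False
    then have "K0 = K" "?p ` ?W \<subseteq> {0}" unfolding K0_def by auto
    moreover from this(2) have "dim (?p ` ?W) = 0" using dim_mono_fin[OF fin_dim_zero, of "?p ` ?W"] by simp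
    ultimately show ?thesis using IH dW by (metis add_0 less_Suc_eq)
  next
    case True
    then obtain x where x: "x \<in> K" "x n \<noteq> 0" by blast
    have "?p ` K = UNIV"
    proof -
      have "z \<in> ?p ` K" for z
        by (rule image_eqI[of _ _ "hmul (z * inverse (x n)) x"]) (use x hsub_hmul[OF Suc.prems(3)] in \<open>auto simp: mult.assoc\<close>)
      then show ?thesis by blast
    qed
    then have dK4: "dim K = 4 + dim K0" using dK dim_quat by simp
    have "\<exists>i<Suc n. single i 1 \<in> K" if eq: "2 * dim ?W = dim K"
    proof (cases "K0 = {0}")
      case False
      have "2 * dim (Wc c n \<inter> K0) = dim K0" using eq dK4 dW dpW IH by linarith
      then obtain i where "i < n" "single i 1 \<in> K0" using IH False by blast
      then show ?thesis unfolding K0_def by (intro exI[of _ i]) auto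
    next
      case True
      have "dim (?p ` ?W) = 2" using eq dK4 dW dpW IH by linarith
      then have full: "?p ` ?W = cline (c n)"
        using subspace_eq_of_dim_le[OF fin_dim_quat linear_subspace_image[OF linear_eval sW] subspace_cline pW] dim_cline[OF cn] by simp
      have "1 \<in> ?p ` ?W" using full clineI[of 1 0 "c n"] by simp
      then obtain w where w: "w \<in> ?W" "w n = 1" by auto
      have "c n \<in> ?p ` ?W" using full clineI[of 0 1 "c n"] by simp
      then obtain w' where w': "w' \<in> ?W" "w' n = c n" by auto
      have "w' - hmul (c n) w \<in> K0" unfolding K0_def
        using w w' hsub_hmul[OF Suc.prems(3), of w "c n"] by (auto intro: subspace_diff[OF sK])
      then have ww: "w' = hmul (c n) w" using True by simp
      have "w i = 0" if i: "i < n" for i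
      proof (rule cline_mult_imp_zero[of "c i" "c n"])
        show "w i \<in> cline (c i)" using w(1) i by (auto simp: Wc_def)
        have "w' i \<in> cline (c i)" using w'(1) i by (auto simp: Wc_def)
        then show "c n * w i \<in> cline (c i)" using ww by simp
      qed (use Suc.prems(1)[of i] Suc.prems(2)[of n i] i cn in auto)
      moreover have "w i = 0" if "i > n" for i using w(1) that by (auto simp: Wc_def quat_tuples_def)
      ultimately have "w = single n 1" using w(2) by (auto simp: fun_eq_iff single_def) (metis linorder_neqE_nat)
      then show ?thesis using w(1) by auto
    qed
    moreover have "2 * dim ?W \<le> dim K" using dK4 dW dpW IH by linarith
    ultimately show ?thesis by blast
  qed
qed

lemma U_sub_facts:
  assumes S2: "\<forall>i\<le>k. c i \<in> S2"
  shows "U_sub k c \<subseteq> Wc c (k + 1)" "subspace (U_sub k c)" "dim (U_sub k c) = 2 * k + 1"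
    "i \<le> k \<Longrightarrow> single i (c i) \<notin> U_sub k c"
proof -
  have S: "c i \<in> S2" if "i \<le> k" for i using S2 that by blast
  let ?R = "{x \<in> quat_tuples (k + 1). \<forall>i. x i \<in> \<real>}" and ?e = "\<lambda>j i. if i = j \<or> i = j + 1 then c i else 0"
  let ?G = "?R \<union> {?e j |j. j < k}"
  have U: "U_sub k c = span ?G" unfolding U_sub_def ..
  show sU: "subspace (U_sub k c)" unfolding U by simp
  have sW: "subspace (Wc c (k + 1))" by (rule subspace_Wc)
  have RW: "?R \<subseteq> Wc c (k + 1)"
  proof
    fix x assume x: "x \<in> ?R"
    have "x i \<in> cline (c i)" for i
    proof -
      obtain r where "x i = of_real r" using x by (auto elim: Reals_cases)
      then show ?thesis using clineI[of r 0 "c i"] by simp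
    qed
    then show "x \<in> Wc c (k + 1)" using x by (auto simp: Wc_def)
  qed
  have eW: "?e j \<in> Wc c (k + 1)" if "j < k" for j
    using that clineI[of 0 1] clineI[of 0 0] by (auto simp: Wc_def quat_tuples_def)
  show UW: "U_sub k c \<subseteq> Wc c (k + 1)" unfolding U
    using RW eW by (intro span_minimal[OF _ sW]) auto
  \<comment> \<open>The equation of \<open>U_sub k c\<close> in \<open>Wc c (k + 1)\<close>: it holds on real vectors because the \<open>c i\<close> are
    imaginary, and on the \<open>e_j\<close> because of the alternating sign.\<close>
  define \<xi> where "\<xi> x = (\<Sum>i<k+1. (-1) ^ i * (c i \<bullet> x i))" for x
  have l\<xi>: "linear \<xi>" unfolding \<xi>_def
    by (rule linearI) (simp_all add: inner_simps algebra_simps sum.distrib sum_distrib_left)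
  have cc: "c i \<bullet> c i = 1" if "i \<le> k" for i using S[OF that] by (simp add: S2_iff inner_quat_def power2_eq_square)
  have \<xi>0: "\<xi> x = 0" if x: "x \<in> U_sub k c" for x
  proof -
    have "x \<in> span ?G" using x U by simp
    then show ?thesis
    proof (rule linear_eq_0_on_span[OF l\<xi>, rotated])
      fix y assume "y \<in> ?G"
      then consider "y \<in> ?R" | j where "j < k" "y = ?e j" by blast
      then show "\<xi> y = 0"
      proof cases
        case 1
        have "c i \<bullet> y i = 0" if i: "i < k + 1" for i
        proof -
          obtain r where "y i = of_real r" using 1 by (auto elim: Reals_cases)
          then show ?thesis using S[of i] i by (simp add: inner_quat_def S2_iff)
        qed
        then show ?thesis unfolding \<xi>_def by simp
      next
        case 2
        have "\<xi> y = (\<Sum>i<k+1. (if i = j then (-1) ^ j else 0) + (if i = j + 1 then (-1) ^ (j + 1) else 0))"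
          unfolding \<xi>_def 2(2) using cc 2(1) by (intro sum.cong) auto
        also have "\<dots> = 0" using 2(1) by (simp add: sum.distrib)
        finally show ?thesis .
      qed
    qed
  qed
  show notin: "single i (c i) \<notin> U_sub k c" if i: "i \<le> k" for i
  proof
    assume "single i (c i) \<in> U_sub k c"
    then have "\<xi> (single i (c i)) = 0" by (rule \<xi>0)
    moreover have "\<xi> (single i (c i)) = (\<Sum>s<k+1. if s = i then (-1) ^ i else 0)"
      unfolding \<xi>_def single_def using cc[OF i] by (intro sum.cong) auto
    moreover have "(\<Sum>s<k+1. if s = i then (-1) ^ i else 0) = ((-1) ^ i :: real)" using i by (subst sum.delta) auto
    ultimately show False by simp
  qed
  have dW: "dim (Wc c (k + 1)) = 2 * (k + 1)" by (rule dim_Wc) (use S in auto)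
  have fU: "fin_dim (U_sub k c)" by (rule fin_dim_mono[OF fin_dim_Wc UW])
  have "dim (U_sub k c) < 2 * (k + 1)"
  proof (rule ccontr)
    assume "\<not> ?thesis"
    then have "dim (Wc c (k + 1)) \<le> dim (U_sub k c)" using dW by linarith
    then have "U_sub k c = Wc c (k + 1)" by (rule subspace_eq_of_dim_le[OF fin_dim_Wc sU sW UW])
    moreover have "single 0 (c 0) \<in> Wc c (k + 1)" using clineI[of 0 1 "c 0"] by (intro single_in_Wc) auto
    ultimately show False using notin[of 0] by simp
  qed
  \<comment> \<open>One more vector suffices to generate \<open>Wc c (k + 1)\<close> from \<open>U_sub k c\<close>.\<close>
  moreover have "2 * (k + 1) \<le> dim (U_sub k c) + 1"
  proof -
    let ?L = "span {single (0::nat) (c 0)}"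
    let ?X = "U_sub k c \<oplus>\<^sub>s ?L"
    have sX: "subspace ?X" by (rule subspace_ssum[OF sU]) simp
    have UX: "U_sub k c \<subseteq> ?X" by (rule ssum_sup1) simp
    have r: "single i (of_real r) \<in> ?X" if "i \<le> k" for i r
    proof -
      have "single i (of_real r) \<in> ?R" using that by (auto simp: quat_tuples_def single_def)
      then have "single i (of_real r) \<in> U_sub k c" unfolding U by (intro span_base) blast
      then show ?thesis using UX by blast
    qed
    have q: "single i (c i) \<in> ?X" if "i \<le> k" for i
      using that
    proof (induction i)
      case 0 show ?case using ssum_sup2[OF sU, of ?L] span_base[of "single 0 (c 0)" "{single 0 (c 0)}"] by blast
    next
      case (Suc i)
      have "?e i \<in> U_sub k c" unfolding U using Suc.prems by (intro span_base) auto
      then have "?e i - single i (c i) \<in> ?X" using Suc UX by (intro subspace_diff[OF sX]) auto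
      moreover have "?e i - single i (c i) = single (Suc i) (c (Suc i))" by (auto simp: fun_eq_iff single_def)
      ultimately show ?case by simp
    qed
    have "Wc c (k + 1) \<subseteq> ?X"
    proof
      fix x assume x: "x \<in> Wc c (k + 1)"
      have "single i (x i) \<in> ?X" if i: "i \<le> k" for i
      proof -
        have "x i \<in> cline (c i)" using x i by (auto simp: Wc_def)
        then obtain a b where ab: "x i = of_real a + b *\<^sub>R c i" by (rule clineE)
        have "single i (of_real a) + b *\<^sub>R single i (c i) \<in> ?X"
          by (intro subspace_add[OF sX] subspace_scale[OF sX] r q i)
        moreover have "single i (of_real a) + b *\<^sub>R single i (c i) = single i (x i)"
          unfolding ab by (auto simp: fun_eq_iff single_def)
        ultimately show ?thesis by simp
      qed
      then have "(\<Sum>i\<le>k. single i (x i)) \<in> ?X" by (intro subspace_sum[OF sX]) auto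
      moreover have "(\<Sum>i\<le>k. single i (x i)) = x"
      proof
        fix j
        have "(\<Sum>i\<le>k. single i (x i)) j = (\<Sum>i\<le>k. if i = j then x j else 0)" by (simp add: single_def if_distrib cong: sum.cong)
        also have "\<dots> = x j" using x by (auto simp: Wc_def quat_tuples_def)
        finally show "(\<Sum>i\<le>k. single i (x i)) j = x j" .
      qed
      ultimately show "x \<in> ?X" by simp
    qed
    moreover have fL: "fin_dim ?L" unfolding fin_dim_def by (rule exI[of _ "{single 0 (c 0)}"]) simp
    ultimately have "2 * (k + 1) \<le> dim ?X" using dim_mono_fin[OF fin_dim_ssum[OF fU fL]] dW by metis
    also have "\<dots> \<le> dim (U_sub k c) + dim ?L" using dim_ssum_Int[OF sU subspace_span fU fL] by linarith
    also have "dim ?L \<le> 1" using dim_le_card[of ?L "{single 0 (c 0)}"] by simp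
    finally show ?thesis by simp
  qed
  ultimately show "dim (U_sub k c) = 2 * k + 1" by simp
qed

text \<open>If \<open>2 * dim (U \<inter> K) = dim K\<close>, \<open>Wc_bound\<close> puts a basis vector, and hence its multiple by \<open>c i\<close>,
  into \<open>K\<close>; that multiple is in \<open>Wc\<close> but not in \<open>U_sub\<close>. So the inequality of \<open>Wc_bound\<close> is strict for \<open>U_sub\<close>, and the
  slope of \<open>K\<close> is small because \<open>dim K\<close> is a multiple of 4.\<close>

lemma U_sub_stable:
  assumes S: "\<And>i. i \<le> k \<Longrightarrow> c i \<in> S2" and D: "\<And>i j. i \<le> k \<Longrightarrow> j \<le> k \<Longrightarrow> i \<noteq> j \<Longrightarrow> c i \<noteq> c j \<and> c i \<noteq> - c j"
  shows "slope_stable (U_sub k c) (quat_tuples (k + 1))"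
  unfolding slope_stable_def
proof (intro conjI allI impI)
  have S': "\<forall>i\<le>k. c i \<in> S2" using S by blast
  note F = U_sub_facts[OF S']
  have ne: "dim (quat_tuples (k + 1)) > 0" by (simp add: dim_tuples)
  then show "quat_tuples (k + 1) \<noteq> {0}" by (metis dim_zero_space less_irrefl)
  show "hsub (quat_tuples (k + 1))" by simp
  show "subspace (U_sub k c)" by (rule F(2))
  have UW: "U_sub k c \<subseteq> Wc c (k + 1)" by (rule F(1))
  then show "U_sub k c \<subseteq> quat_tuples (k + 1)" by (auto simp: Wc_def)
  fix K assume K: "hsub K" "K \<subseteq> quat_tuples (k + 1)" "K \<noteq> {0}" "K \<noteq> quat_tuples (k + 1)"
  have sK: "subspace K" using K hsub_subspace by blast
  have fK: "fin_dim K" by (rule fin_dim_sub_tuples[OF K(2)])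
  have B: "2 * dim (Wc c (k + 1) \<inter> K) \<le> dim K \<and> (2 * dim (Wc c (k + 1) \<inter> K) = dim K \<longrightarrow> K \<noteq> {0} \<longrightarrow> (\<exists>i<k+1. single i 1 \<in> K))"
    by (rule Wc_bound[OF _ _ K(1,2)]) (use S D in auto)
  have fWK: "fin_dim (Wc c (k + 1) \<inter> K)" by (rule fin_dim_mono[OF fK]) auto
  have le: "dim (U_sub k c \<inter> K) \<le> dim (Wc c (k + 1) \<inter> K)" using UW by (intro dim_mono_fin[OF fWK]) auto
  have lt: "2 * dim (U_sub k c \<inter> K) < dim K"
  proof (rule ccontr)
    assume "\<not> ?thesis"
    then have eq: "2 * dim (Wc c (k + 1) \<inter> K) = dim K" "dim (Wc c (k + 1) \<inter> K) \<le> dim (U_sub k c \<inter> K)" using B le by linarith+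
    then obtain i where i: "i < k + 1" "single i 1 \<in> K" using B K(3) by blast
    have "hmul (c i) (single i 1) = single i (c i)" by (auto simp: fun_eq_iff single_def)
    then have 1: "single i (c i) \<in> K" using hsub_hmul[OF K(1) i(2), of "c i"] by simp
    have 2: "single i (c i) \<in> Wc c (k + 1)" using clineI[of 0 1 "c i"] i(1) by (intro single_in_Wc) auto
    have "U_sub k c \<inter> K = Wc c (k + 1) \<inter> K"
      by (rule subspace_eq_of_dim_le[OF fWK subspace_inter[OF F(2) sK] subspace_inter[OF subspace_Wc sK] _ eq(2)]) (use UW in auto)
    then have "single i (c i) \<in> U_sub k c" using 1 2 by blast
    then show False using F(4)[of i] i(1) by simp
  qed
  obtain m where m: "dim K = 4 * m" using hsub_dim_dvd[OF K(1,2)] by (auto elim: dvdE)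
  have "m < k + 1"
  proof (rule ccontr)
    assume "\<not> ?thesis"
    then have "K = quat_tuples (k + 1)" by (intro subspace_eq_of_dim_le[OF fin_dim_tuples sK subspace_tuples K(2)]) (simp add: dim_tuples m)
    then show False using K(4) by simp
  qed
  have "dim (U_sub k c \<inter> K) + 1 \<le> 2 * m" using lt m by simp
  then have "(dim (U_sub k c \<inter> K) + 1) * (4 * (k + 1)) \<le> 2 * m * (4 * (k + 1))" by (rule mult_le_mono1)
  then have "dim (U_sub k c \<inter> K) * (4 * (k + 1)) < (2 * k + 1) * (4 * m)" using \<open>m < k + 1\<close> by (simp add: algebra_simps)
  then show "dim (U_sub k c \<inter> K) * dim (quat_tuples (k + 1)) < dim (U_sub k c) * dim K"
    unfolding F(3) m dim_tuples .
qed

section \<open>Stability of the pairs \<open>V_k\<close>\<close>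

type_synonym cseq = "nat \<Rightarrow> complex"

definition muli :: "cseq \<Rightarrow> cseq" where "muli y = (\<lambda>i. \<i> * y i)"
definition shift :: "cseq \<Rightarrow> cseq" where "shift y = (\<lambda>i. if i = 0 then 0 else y (i - 1))"

lemma linear_muli: "linear muli" unfolding muli_def by (rule linearI) (auto simp: fun_eq_iff algebra_simps)
lemma linear_shift: "linear shift" unfolding shift_def by (rule linearI) (auto simp: fun_eq_iff)
lemma shift_0: "shift y = 0 \<Longrightarrow> y = 0"
proof -
  assume h: "shift y = 0"
  have "y i = 0" for i using fun_cong[OF h, of "Suc i"] by (simp add: shift_def)
  then show "y = 0" by (auto simp: fun_eq_iff)
qed

lemma fin_dim_complex: "fin_dim (S :: complex set)"
  unfolding fin_dim_def by (rule exI[of _ Basis]) simp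

abbreviation (input) cs where "cs m \<equiv> fun_space {..<m :: nat} (UNIV :: complex set)"

lemma fin_dim_cs: "fin_dim (cs m)" and dim_cs: "dim (cs m) = 2 * m"
  using dim_fun_space[of "{..<m}" "UNIV :: complex set"] by (auto simp: fin_dim_complex)

text \<open>Let \<open>s \<in> S\<close> have its first nonzero entry at the lowest index at which \<open>S\<close> has nonzero entries.
  The complex multiples of \<open>s\<close> lie in \<open>S\<close>, but meet \<open>shift ` S\<close> only in 0.\<close>

lemma shift_growth:
  assumes S: "subspace S" "S \<subseteq> cs m" "muli ` S \<subseteq> S" "S \<noteq> {0}"
  shows "dim S + 2 \<le> dim (S \<oplus>\<^sub>s shift ` S)"
proof -
  have fS: "fin_dim S" by (rule fin_dim_mono[OF fin_dim_cs S(2)])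
  obtain y where y: "y \<in> S" "y \<noteq> 0" using S(1,4) subspace_0 by blast
  then obtain j where "y j \<noteq> 0" by (auto simp: fun_eq_iff)
  then have ex: "\<exists>i. \<exists>s\<in>S. s i \<noteq> 0" using y(1) by blast
  define i0 where "i0 = (LEAST i. \<exists>s\<in>S. s i \<noteq> 0)"
  obtain s where s: "s \<in> S" "s i0 \<noteq> 0" using LeastI_ex[OF ex] unfolding i0_def by blast
  have low: "t i = 0" if "t \<in> S" "i < i0" for t i using not_less_Least[of i "\<lambda>i. \<exists>s\<in>S. s i \<noteq> 0"] that unfolding i0_def by blast
  define g where "g w = (\<lambda>i. w * s i)" for w :: complex
  have lg: "linear g" unfolding g_def by (rule linearI) (auto simp: fun_eq_iff algebra_simps)
  have sL: "subspace (range g)" by (rule linear_subspace_image[OF lg subspace_UNIV])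
  have fL: "fin_dim (range g)" by (rule fin_dim_image[OF fin_dim_complex lg])
  have dL: "dim (range g) = 2"
  proof -
    have "dim (range g) = dim (UNIV :: complex set)"
    proof (rule dim_image_inj[OF lg subspace_UNIV fin_dim_complex])
      fix w assume "g w = 0"
      then have "g w i0 = 0" by simp
      then show "w = 0" using s(2) by (simp add: g_def)
    qed
    then show ?thesis by simp
  qed
  have LS: "range g \<subseteq> S"
  proof (rule image_subsetI)
    fix w
    have "g w = Re w *\<^sub>R s + Im w *\<^sub>R muli s"
      by (auto simp: g_def muli_def fun_eq_iff complex_eq_iff)
    then show "g w \<in> S" using S(3) s(1) by (auto intro!: subspace_add[OF S(1)] subspace_scale[OF S(1)])
  qed
  have sS: "subspace (shift ` S)" by (rule linear_subspace_image[OF linear_shift S(1)])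
  have fsS: "fin_dim (shift ` S)" by (rule fin_dim_image[OF fS linear_shift])
  have dsS: "dim (shift ` S) = dim S" by (rule dim_image_inj[OF linear_shift S(1) fS shift_0])
  have int: "range g \<inter> shift ` S = {0}"
  proof -
    have "x = 0" if x: "x \<in> range g" "x \<in> shift ` S" for x
    proof -
      obtain w where w: "x = g w" using x(1) by blast
      obtain t where t: "t \<in> S" "x = shift t" using x(2) by blast
      have "shift t i0 = 0" using low[OF t(1), of "i0 - 1"] by (simp add: shift_def)
      then have "w * s i0 = 0" using w t(2) by (metis g_def)
      then show ?thesis using s(2) w linear_0[OF lg] by simp
    qed
    then show ?thesis using subspace_0[OF sL] subspace_0[OF sS] by blast
  qed
  have sub: "range g \<oplus>\<^sub>s shift ` S \<subseteq> S \<oplus>\<^sub>s shift ` S"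
    using LS unfolding ssum_def by blast
  have "dim (range g \<oplus>\<^sub>s shift ` S) = 2 + dim S" using dim_direct_sum[OF sL sS fL fsS int] dL dsS by simp
  then show ?thesis using dim_mono_fin[OF fin_dim_ssum[OF fS fsS] sub] by linarith
qed

text \<open>The components of \<open>x i\<close> in \<open>C + C j\<close>, in an order that depends on the parity of \<open>i\<close>. With this
  choice, \<open>V_sub\<close> is the real subspace on which \<open>\<delta>\<close> is determined by \<open>\<gamma>\<close>, and multiplication by \<open>j\<close> becomes a
  shift of \<open>\<gamma>\<close>.\<close>

definition \<gamma> :: "(nat \<Rightarrow> quat) \<Rightarrow> cseq" where
  "\<gamma> x = (\<lambda>i. if even i then Complex (qRe (x i)) (qI (x i)) else Complex (qJ (x i)) (qK (x i)))"
definition \<delta> :: "(nat \<Rightarrow> quat) \<Rightarrow> cseq" where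
  "\<delta> x = (\<lambda>i. if even i then Complex (qJ (x i)) (qK (x i)) else Complex (qRe (x i)) (qI (x i)))"
definition alt :: "nat \<Rightarrow> complex" where "alt i = (if even i then -1 else 1)"

lemma linear_\<gamma>: "linear \<gamma>" unfolding \<gamma>_def by (rule linearI) (auto simp: fun_eq_iff complex_eq_iff)
lemma linear_\<delta>: "linear \<delta>" unfolding \<delta>_def by (rule linearI) (auto simp: fun_eq_iff complex_eq_iff)

lemma \<gamma>_\<delta>_zero: "\<gamma> x = 0 \<Longrightarrow> \<delta> x = 0 \<Longrightarrow> x = 0"
  by (auto simp: fun_eq_iff \<gamma>_def \<delta>_def complex_eq_iff quat_eq_iff split: if_splits)

lemma \<gamma>_i: "\<gamma> (hmul quat_i x) = muli (\<gamma> x)" and \<delta>_i: "\<delta> (hmul quat_i x) = muli (\<delta> x)"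
  by (auto simp: fun_eq_iff \<gamma>_def \<delta>_def muli_def complex_eq_iff quat_sel_mult)

lemma \<gamma>_j: "\<gamma> (hmul quat_j x) i = alt i * cnj (\<delta> x i)" and \<delta>_j: "\<delta> (hmul quat_j x) i = - alt i * cnj (\<gamma> x i)"
  by (auto simp: \<gamma>_def \<delta>_def alt_def complex_eq_iff quat_sel_mult)

lemma V_sub_iff: "x \<in> V_sub k \<longleftrightarrow> x \<in> quat_tuples (2 * k + 1) \<and> \<gamma> x (2 * k) = 0 \<and>
    (\<forall>i\<le>2 * k. \<delta> x i = alt i * cnj (shift (\<gamma> x) i))"
proof
  assume x: "x \<in> V_sub k"
  then obtain z where z: "z 0 = 0" "z (2 * k + 1) = 0" "\<And>i. i \<le> 2 * k \<Longrightarrow> x i =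
        (if even i then quat_of_complex (z (i + 1)) - quat_of_complex (cnj (z i)) * quat_j
         else quat_of_complex (cnj (z i)) + quat_of_complex (z (i + 1)) * quat_j)"
    unfolding V_sub_def by blast
  have g: "\<gamma> x i = z (i + 1)" if "i \<le> 2 * k" for i
    using z(3)[OF that] by (auto simp: \<gamma>_def complex_eq_iff quat_sel_mult quat_of_complex_def)
  have d: "\<delta> x i = alt i * cnj (z i)" if "i \<le> 2 * k" for i
    using z(3)[OF that] by (auto simp: \<delta>_def alt_def complex_eq_iff quat_sel_mult quat_of_complex_def)
  have "shift (\<gamma> x) i = z i" if "i \<le> 2 * k" for i
    using g[of "i - 1"] that z(1) by (auto simp: shift_def)
  then show "x \<in> quat_tuples (2 * k + 1) \<and> \<gamma> x (2 * k) = 0 \<and> (\<forall>i\<le>2 * k. \<delta> x i = alt i * cnj (shift (\<gamma> x) i))"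
    using x g[of "2 * k"] z(2) d by (auto simp: V_sub_def)
next
  assume x: "x \<in> quat_tuples (2 * k + 1) \<and> \<gamma> x (2 * k) = 0 \<and> (\<forall>i\<le>2 * k. \<delta> x i = alt i * cnj (shift (\<gamma> x) i))"
  define z where "z = shift (\<gamma> x)"
  have z: "z 0 = 0" "z (2 * k + 1) = 0" "\<And>i. z (i + 1) = \<gamma> x i" using x by (auto simp: z_def shift_def)
  have "x i = (if even i then quat_of_complex (z (i + 1)) - quat_of_complex (cnj (z i)) * quat_j
         else quat_of_complex (cnj (z i)) + quat_of_complex (z (i + 1)) * quat_j)" if i: "i \<le> 2 * k" for i
  proof -
    have d: "\<delta> x i = alt i * cnj (z i)" using x i by (simp add: z_def)
    show ?thesis
    proof (cases "even i")
      case True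
      then show ?thesis using d unfolding z(3)
        by (simp add: \<gamma>_def \<delta>_def alt_def quat_simps quat_of_complex_def complex_eq_iff)
    next
      case False
      then show ?thesis using d unfolding z(3)
        by (simp add: \<gamma>_def \<delta>_def alt_def quat_simps quat_of_complex_def complex_eq_iff)
    qed
  qed
  then show "x \<in> V_sub k" unfolding V_sub_def using x z(1,2) by blast
qed

lemma V_sub_\<gamma>:
  assumes "x \<in> V_sub k"
  shows "\<gamma> x \<in> cs (2 * k)" "\<gamma> (hmul quat_j x) = shift (\<gamma> x)" "\<delta> x = (\<lambda>i. alt i * cnj (shift (\<gamma> x) i))" "\<gamma> x = 0 \<Longrightarrow> x = 0"
proof -
  have x: "x \<in> quat_tuples (2 * k + 1)" "\<gamma> x (2 * k) = 0" "\<And>i. i \<le> 2 * k \<Longrightarrow> \<delta> x i = alt i * cnj (shift (\<gamma> x) i)"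
    using assms unfolding V_sub_iff by auto
  have hi: "\<gamma> x i = 0" if "i \<ge> 2 * k" for i
  proof (cases "i = 2 * k")
    case False
    then have "x i = 0" using x(1) that by (simp add: quat_tuples_def)
    then show ?thesis by (simp add: \<gamma>_def complex_eq_iff)
  qed (use x in simp)
  then show 1: "\<gamma> x \<in> cs (2 * k)" by (simp add: fun_space_def)
  have "\<delta> x i = alt i * cnj (shift (\<gamma> x) i)" for i
  proof (cases "i \<le> 2 * k")
    case False
    then have "x i = 0" using x(1) by (simp add: quat_tuples_def)
    moreover have "shift (\<gamma> x) i = 0" using hi[of "i - 1"] False by (simp add: shift_def)
    ultimately show ?thesis by (simp add: \<delta>_def complex_eq_iff)
  qed (rule x)
  then show 3: "\<delta> x = (\<lambda>i. alt i * cnj (shift (\<gamma> x) i))" by blast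
  have "\<gamma> (hmul quat_j x) i = shift (\<gamma> x) i" for i
    unfolding \<gamma>_j 3 by (simp add: alt_def)
  then show "\<gamma> (hmul quat_j x) = shift (\<gamma> x)" by blast
  assume "\<gamma> x = 0"
  then have "\<delta> x = 0" unfolding 3 by (auto simp: shift_def fun_eq_iff)
  then show "x = 0" using \<gamma>_\<delta>_zero \<open>\<gamma> x = 0\<close> by blast
qed

lemma subspace_V_sub: "subspace (V_sub k)"
proof -
  have s: "shift 0 = 0" "shift (x + y) = shift x + shift y" "shift (r *\<^sub>R x) = r *\<^sub>R shift x" for x y r
    using linear_shift by (simp_all add: linear_0 linear_add linear_scale)
  have g: "\<gamma> 0 = 0" "\<gamma> (x + y) = \<gamma> x + \<gamma> y" "\<gamma> (r *\<^sub>R x) = r *\<^sub>R \<gamma> x" for x y r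
    using linear_\<gamma> by (simp_all add: linear_0 linear_add linear_scale)
  have d: "\<delta> 0 = 0" "\<delta> (x + y) = \<delta> x + \<delta> y" "\<delta> (r *\<^sub>R x) = r *\<^sub>R \<delta> x" for x y r
    using linear_\<delta> by (simp_all add: linear_0 linear_add linear_scale)
  note t = subspace_0[OF subspace_tuples] subspace_add[OF subspace_tuples] subspace_scale[OF subspace_tuples]
  show ?thesis
    by (rule subspaceI) (simp_all add: V_sub_iff s g d t distrib_left)
qed

lemma V_sub_tuples: "V_sub k \<subseteq> quat_tuples (2 * k + 1)" using V_sub_iff by blast

lemma dim_V_sub: "dim (V_sub k) = 4 * k"
proof -
  have fV: "fin_dim (V_sub k)" by (rule fin_dim_sub_tuples[OF V_sub_tuples])
  have "\<gamma> ` V_sub k = cs (2 * k)"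
  proof
    show "\<gamma> ` V_sub k \<subseteq> cs (2 * k)" using V_sub_\<gamma>(1) by blast
    show "cs (2 * k) \<subseteq> \<gamma> ` V_sub k"
    proof
      fix y :: cseq assume y: "y \<in> cs (2 * k)"
      define d where "d i = alt i * cnj (shift y i)" for i
      define x where "x i = (if even i then Quat (Re (y i)) (Im (y i)) (Re (d i)) (Im (d i)) else Quat (Re (d i)) (Im (d i)) (Re (y i)) (Im (y i)))" for i
      have gx: "\<gamma> x = y" and dx: "\<delta> x = d" by (auto simp: \<gamma>_def \<delta>_def x_def fun_eq_iff)
      have y0: "y i = 0" if "i \<ge> 2 * k" for i using y that by (simp add: fun_space_def)
      have d0: "d i = 0" if "i \<ge> 2 * k + 1" for i using y0[of "i - 1"] that by (auto simp: d_def shift_def)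
      have "x \<in> V_sub k" unfolding V_sub_iff gx dx
        using y0 d0 by (auto simp: quat_tuples_def x_def quat_eq_iff; simp add: d_def)
      then show "y \<in> \<gamma> ` V_sub k" using gx by blast
    qed
  qed
  then show ?thesis using dim_image_inj[OF linear_\<gamma> subspace_V_sub fV V_sub_\<gamma>(4)] dim_cs[of "2 * k"] by simp
qed

text \<open>Let \<open>Y\<close> be the isomorphic image of \<open>V_sub k \<inter> K\<close> under \<open>\<gamma>\<close>. The dimensions of the complex subspaces
  \<open>YC = Y + i Y\<close> and \<open>D = Y \<inter> i Y\<close> add up to \<open>2 * dim Y\<close>. Multiplication by \<open>i\<close> and \<open>j\<close> shows that \<open>\<gamma> ` K\<close> contains
  \<open>YC\<close> and its shift, and that the kernel \<open>M\<close> of \<open>\<gamma>\<close> on \<open>K\<close> contains a copy of \<open>D\<close> and its shift. By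
  \<open>shift_growth\<close> this yields 2 dimensions more than \<open>dim YC\<close>, and than \<open>dim D\<close>, unless they are 0, while
  neither exceeds \<open>4 * k\<close>.\<close>

lemma V_sub_bound:
  assumes K: "hsub K" "K \<subseteq> quat_tuples (2 * k + 1)"
  shows "(2 * k + 1) * dim (V_sub k \<inter> K) \<le> k * dim K"
proof -
  let ?X = "V_sub k \<inter> K"
  have sK: "subspace K" using K hsub_subspace by blast
  have fK: "fin_dim K" by (rule fin_dim_sub_tuples[OF K(2)])
  have sX: "subspace ?X" by (rule subspace_inter[OF subspace_V_sub sK])
  have fX: "fin_dim ?X" by (rule fin_dim_mono[OF fK]) auto
  define Y where "Y = \<gamma> ` ?X"
  have Ycs: "Y \<subseteq> cs (2 * k)" unfolding Y_def using V_sub_\<gamma>(1) by blast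
  have sY: "subspace Y" unfolding Y_def by (rule linear_subspace_image[OF linear_\<gamma> sX])
  have dY: "dim Y = dim ?X" unfolding Y_def using V_sub_\<gamma>(4) by (intro dim_image_inj[OF linear_\<gamma> sX fX]) auto
  have fY: "fin_dim Y" by (rule fin_dim_mono[OF fin_dim_cs Ycs])
  define iY where "iY = muli ` Y"
  have sI: "subspace iY" unfolding iY_def by (rule linear_subspace_image[OF linear_muli sY])
  have fI: "fin_dim iY" unfolding iY_def by (rule fin_dim_image[OF fY linear_muli])
  have mm: "muli (muli y) = - y" for y by (auto simp: muli_def fun_eq_iff)
  have dI: "dim iY = dim Y" unfolding iY_def
  proof (rule dim_image_inj[OF linear_muli sY fY])
    fix x assume "muli x = 0"
    then have "muli (muli x) = 0" by (simp add: linear_0[OF linear_muli])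
    then show "x = 0" by (simp add: mm)
  qed
  have sc: "subspace (cs (2 * k))" by (rule subspace_fun_space) simp
  have Ics: "iY \<subseteq> cs (2 * k)" unfolding iY_def using Ycs by (auto simp: muli_def fun_space_def)
  have mI: "muli y \<in> Y" if "y \<in> iY" for y
  proof -
    obtain x where x: "x \<in> Y" "y = muli x" using \<open>y \<in> iY\<close> unfolding iY_def by blast
    show ?thesis unfolding x(2) mm using x(1) sY by (rule subspace_neg[rotated])
  qed
  have mY: "muli y \<in> iY" if "y \<in> Y" for y using that unfolding iY_def by blast
  define YC where "YC = Y \<oplus>\<^sub>s iY"
  define D where "D = Y \<inter> iY"
  have sYC: "subspace YC" unfolding YC_def by (rule subspace_ssum[OF sY sI])
  have sD: "subspace D" unfolding D_def by (rule subspace_inter[OF sY sI])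
  have YCcs: "YC \<subseteq> cs (2 * k)" unfolding YC_def by (rule ssum_least[OF sc Ycs Ics])
  have Dcs: "D \<subseteq> cs (2 * k)" using Ycs by (auto simp: D_def)
  have dsum: "dim YC + dim D = 2 * dim ?X" unfolding YC_def D_def using dim_ssum_Int[OF sY sI fY fI] dI dY by simp
  have mYC: "muli ` YC \<subseteq> YC"
  proof (rule image_subsetI)
    fix y assume "y \<in> YC"
    then obtain a b where ab: "y = a + b" "a \<in> Y" "b \<in> iY" unfolding YC_def by (rule ssumE)
    have "muli b + muli a \<in> YC" unfolding YC_def by (rule ssumI[OF mI[OF ab(3)] mY[OF ab(2)]])
    then show "muli y \<in> YC" unfolding ab(1) by (simp add: linear_add[OF linear_muli] add.commute)
  qed
  have mD: "muli ` D \<subseteq> D" using mI mY unfolding D_def by blast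
  have fYC: "fin_dim YC" and fD: "fin_dim D" using fin_dim_mono[OF fin_dim_cs] YCcs Dcs by auto
  have dYC4: "dim YC \<le> 4 * k" "dim D \<le> 4 * k" using dim_mono_fin[OF fin_dim_cs YCcs] dim_mono_fin[OF fin_dim_cs Dcs] dim_cs[of "2 * k"] by simp_all
  have sgK: "subspace (\<gamma> ` K)" by (rule linear_subspace_image[OF linear_\<gamma> sK])
  have YgK: "Y \<subseteq> \<gamma> ` K" unfolding Y_def by blast
  have gKi: "muli y \<in> \<gamma> ` K" if "y \<in> \<gamma> ` K" for y
  proof -
    obtain x where "x \<in> K" "y = \<gamma> x" using \<open>y \<in> \<gamma> ` K\<close> by blast
    then show ?thesis using hsub_hmul[OF K(1)] by (intro image_eqI[of _ _ "hmul quat_i x"]) (auto simp: \<gamma>_i)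
  qed
  have shY: "shift y \<in> \<gamma> ` K" if "y \<in> Y" for y
  proof -
    obtain x where "x \<in> V_sub k" "x \<in> K" "y = \<gamma> x" using \<open>y \<in> Y\<close> unfolding Y_def by blast
    then show ?thesis using hsub_hmul[OF K(1)] V_sub_\<gamma>(2) by (intro image_eqI[of _ _ "hmul quat_j x"]) auto
  qed
  have sm: "shift (muli y) = muli (shift y)" for y by (auto simp: shift_def muli_def fun_eq_iff)
  have "YC \<oplus>\<^sub>s shift ` YC \<subseteq> \<gamma> ` K"
  proof (rule ssum_least[OF sgK])
    have "iY \<subseteq> \<gamma> ` K" unfolding iY_def using gKi YgK by blast
    then show "YC \<subseteq> \<gamma> ` K" unfolding YC_def by (rule ssum_least[OF sgK YgK])
    show "shift ` YC \<subseteq> \<gamma> ` K"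
    proof (rule image_subsetI)
      fix y assume "y \<in> YC"
      then obtain a b where ab: "y = a + b" "a \<in> Y" "b \<in> iY" unfolding YC_def by (rule ssumE)
      obtain b' where b': "b' \<in> Y" "b = muli b'" using ab(3) unfolding iY_def by blast
      have "shift y = shift a + muli (shift b')" unfolding ab(1) b'(2) by (simp add: linear_add[OF linear_shift] sm)
      also have "\<dots> \<in> \<gamma> ` K" by (rule subspace_add[OF sgK shY[OF ab(2)] gKi[OF shY[OF b'(1)]]])
      finally show "shift y \<in> \<gamma> ` K" .
    qed
  qed
  then have c1: "dim (YC \<oplus>\<^sub>s shift ` YC) \<le> dim (\<gamma> ` K)" by (rule dim_mono_fin[OF fin_dim_image[OF fK linear_\<gamma>]])
  define M where "M = {x \<in> K. \<gamma> x = 0}"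
  have sM: "subspace M" unfolding M_def subspace_def using sK
    by (auto simp: subspace_0 subspace_add subspace_scale linear_0[OF linear_\<gamma>] linear_add[OF linear_\<gamma>] linear_scale[OF linear_\<gamma>])
  have fM: "fin_dim M" unfolding M_def by (rule fin_dim_mono[OF fK]) auto
  define \<theta> where "\<theta> y = (\<lambda>i. -2 * alt i * cnj (y i))" for y :: cseq
  have l\<theta>: "linear \<theta>" unfolding \<theta>_def by (rule linearI) (auto simp: fun_eq_iff algebra_simps)
  have inj\<theta>: "y = 0" if "\<theta> y = 0" for y
  proof -
    have "y i = 0" for i using fun_cong[OF that, of i] by (auto simp: \<theta>_def alt_def split: if_splits)
    then show ?thesis by (auto simp: fun_eq_iff)
  qed
  have sdM: "subspace (\<delta> ` M)" by (rule linear_subspace_image[OF linear_\<delta> sM])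
  \<comment> \<open>An element of \<open>D\<close> is \<open>\<gamma> u' = i \<gamma> u\<close> with \<open>u\<close> and \<open>u'\<close> in \<open>V_sub k \<inter> K\<close>;
    the combinations \<open>?m1\<close> and \<open>?m2\<close> of their multiples vanish under \<open>\<gamma>\<close>.\<close>
  have key: "\<theta> (shift y) \<in> \<delta> ` M \<and> \<theta> y \<in> \<delta> ` M" if y: "y \<in> D" for y
  proof -
    obtain u' where u': "u' \<in> V_sub k" "u' \<in> K" "y = \<gamma> u'" using y unfolding D_def Y_def by blast
    obtain u where u: "u \<in> V_sub k" "u \<in> K" "y = muli (\<gamma> u)" using y unfolding D_def iY_def Y_def by blast
    have gu: "\<gamma> u = - muli y" using u(3) mm[of "\<gamma> u"] by simp
    have eu: "\<gamma> u' = y" using u' by simp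
    let ?m1 = "hmul quat_i u - u'" and ?m2 = "hmul quat_j u' - hmul quat_i (hmul quat_j u)"
    have "\<gamma> ?m1 = 0" using u(3) eu by (simp add: linear_diff[OF linear_\<gamma>] \<gamma>_i)
    then have m1: "?m1 \<in> M" unfolding M_def using hsub_hmul[OF K(1) u(2)] u'(2) subspace_diff[OF sK] by auto
    have "\<gamma> ?m2 = shift y - muli (shift (- muli y))"
      by (simp add: linear_diff[OF linear_\<gamma>] \<gamma>_i V_sub_\<gamma>(2)[OF u(1)] V_sub_\<gamma>(2)[OF u'(1)] gu eu)
    also have "\<dots> = 0" by (auto simp: fun_eq_iff shift_def muli_def)
    finally have m2: "?m2 \<in> M" unfolding M_def using hsub_hmul[OF K(1)] u(2) u'(2) subspace_diff[OF sK] by auto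
    have "\<delta> ?m1 = muli (\<lambda>i. alt i * cnj (shift (- muli y) i)) - (\<lambda>i. alt i * cnj (shift y i))"
      unfolding linear_diff[OF linear_\<delta>] \<delta>_i V_sub_\<gamma>(3)[OF u(1)] V_sub_\<gamma>(3)[OF u'(1)] gu eu ..
    also have "\<dots> = \<theta> (shift y)" by (auto simp: fun_eq_iff shift_def muli_def \<theta>_def alt_def)
    finally have 1: "\<theta> (shift y) \<in> \<delta> ` M" using m1 by (metis image_eqI)
    have dj: "\<delta> (hmul quat_j x) = (\<lambda>i. - alt i * cnj (\<gamma> x i))" for x using \<delta>_j by blast
    have "\<delta> ?m2 = (\<lambda>i. - alt i * cnj (y i)) - muli (\<lambda>i. - alt i * cnj ((- muli y) i))"
      unfolding linear_diff[OF linear_\<delta>] \<delta>_i dj gu eu ..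
    also have "\<dots> = \<theta> y" by (auto simp: fun_eq_iff muli_def \<theta>_def alt_def)
    finally have "\<theta> y \<in> \<delta> ` M" using m2 by (metis image_eqI)
    then show ?thesis using 1 by blast
  qed
  have "\<theta> ` (D \<oplus>\<^sub>s shift ` D) \<subseteq> \<delta> ` M"
  proof (rule image_subsetI)
    fix y assume "y \<in> D \<oplus>\<^sub>s shift ` D"
    then obtain a b where ab: "y = a + b" "a \<in> D" "b \<in> shift ` D" by (rule ssumE)
    obtain b' where b': "b' \<in> D" "b = shift b'" using ab(3) by blast
    have "\<theta> a + \<theta> (shift b') \<in> \<delta> ` M" using key ab(2) b'(1) by (intro subspace_add[OF sdM]) auto
    then show "\<theta> y \<in> \<delta> ` M" unfolding ab(1) b'(2) by (simp add: linear_add[OF l\<theta>])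
  qed
  then have "dim (\<theta> ` (D \<oplus>\<^sub>s shift ` D)) \<le> dim (\<delta> ` M)" by (rule dim_mono_fin[OF fin_dim_image[OF fM linear_\<delta>]])
  moreover have "dim (\<theta> ` (D \<oplus>\<^sub>s shift ` D)) = dim (D \<oplus>\<^sub>s shift ` D)"
    by (rule dim_image_inj[OF l\<theta> subspace_ssum[OF sD linear_subspace_image[OF linear_shift sD]]
          fin_dim_ssum[OF fD fin_dim_image[OF fD linear_shift]] inj\<theta>])
  moreover have "dim (\<delta> ` M) \<le> dim M" using rank_nullity[OF linear_\<delta> sM fM] by linarith
  ultimately have c2: "dim (D \<oplus>\<^sub>s shift ` D) \<le> dim M" by linarith
  have dK: "dim K = dim (\<gamma> ` K) + dim M" unfolding M_def by (rule rank_nullity[OF linear_\<gamma> sK fK])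
  have g1: "YC \<noteq> {0} \<Longrightarrow> dim YC + 2 \<le> dim (\<gamma> ` K)" using shift_growth[OF sYC YCcs mYC] c1 by linarith
  have g2: "D \<noteq> {0} \<Longrightarrow> dim D + 2 \<le> dim M" using shift_growth[OF sD Dcs mD] c2 by linarith
  have arith: "(2 * k + 1) * d \<le> k * e" if "2 * d + 2 * t \<le> e" "d \<le> 2 * k * t" for d e t :: nat
  proof -
    have "(2 * k + 1) * d \<le> 2 * k * d + 2 * k * t" using that(2) by (simp add: algebra_simps)
    also have "\<dots> = k * (2 * d + 2 * t)" by (simp add: algebra_simps)
    also have "\<dots> \<le> k * e" by (rule mult_le_mono2[OF that(1)])
    finally show ?thesis .
  qed
  show ?thesis
  proof (cases "YC = {0}")
    case True
    have "YC = {0} \<Longrightarrow> D = {0}" using ssum_sup1[OF sI, of Y] subspace_0[OF sD] unfolding YC_def D_def by blast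
    then have "dim YC = 0" "dim D = 0" using True by (simp_all only: dim_zero_space)
    then show ?thesis using dsum by simp
  next
    case False
    show ?thesis
    proof (cases "D = {0}")
      case True
      then have "dim D = 0" by (simp only: dim_zero_space)
      then show ?thesis using g1[OF False] dK dsum dYC4 by (intro arith[of _ 1]) linarith+
    next
      case False2: False
      show ?thesis using g1[OF False] g2[OF False2] dK dsum dYC4 by (intro arith[of _ 2]) linarith+
    qed
  qed
qed

text \<open>Equality in \<open>V_sub_bound\<close> would force \<open>2 * k + 1\<close> to divide the quaternionic dimension of \<open>K\<close>, which is
  strictly between 0 and \<open>2 * k + 1\<close>.\<close>

lemma V_sub_stable: "slope_stable (V_sub k) (quat_tuples (2 * k + 1))"
  unfolding slope_stable_def
proof (intro conjI allI impI)
  have ne: "dim (quat_tuples (2 * k + 1)) > 0" by (simp add: dim_tuples)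
  then show "quat_tuples (2 * k + 1) \<noteq> {0}" by (metis dim_zero_space less_irrefl)
  show "hsub (quat_tuples (2 * k + 1))" by simp
  show "subspace (V_sub k)" by (rule subspace_V_sub)
  show "V_sub k \<subseteq> quat_tuples (2 * k + 1)" by (rule V_sub_tuples)
  fix K assume K: "hsub K" "K \<subseteq> quat_tuples (2 * k + 1)" "K \<noteq> {0}" "K \<noteq> quat_tuples (2 * k + 1)"
  have sK: "subspace K" using K hsub_subspace by blast
  have fK: "fin_dim K" by (rule fin_dim_sub_tuples[OF K(2)])
  obtain m where m: "dim K = 4 * m" using hsub_dim_dvd[OF K(1,2)] by (auto elim: dvdE)
  have m1: "m < 2 * k + 1"
  proof (rule ccontr)
    assume "\<not> ?thesis"
    then have "K = quat_tuples (2 * k + 1)" by (intro subspace_eq_of_dim_le[OF fin_dim_tuples sK subspace_tuples K(2)]) (simp add: dim_tuples m)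
    then show False using K(4) by simp
  qed
  have m0: "m > 0"
  proof (rule ccontr)
    assume "\<not> m > 0"
    then have "K = {0}" using m by (intro dim_eq_0_fin[OF fK sK]) simp
    then show False using K(3) by simp
  qed
  have B: "(2 * k + 1) * dim (V_sub k \<inter> K) \<le> k * (4 * m)" using V_sub_bound[OF K(1,2)] m by simp
  have "(2 * k + 1) * dim (V_sub k \<inter> K) \<noteq> k * (4 * m)"
  proof
    assume "(2 * k + 1) * dim (V_sub k \<inter> K) = k * (4 * m)"
    then have "2 * k + 1 dvd (4 * k) * m" by (metis dvd_triv_left mult.assoc mult.commute)
    moreover have "coprime (2 * k + 1) (4 * k)"
    proof -
      have "coprime (2 * k + 1) ((2::nat) ^ 2)" by (simp only: coprime_power_right_iff) simp
      then have "coprime (2 * k + 1) (4::nat)" by simp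
      moreover have "coprime (2 * k + 1) k" by (metis coprime_Suc_left_nat coprime_commute coprime_mult_left_iff Suc_eq_plus1)
      ultimately show ?thesis by simp
    qed
    ultimately have "2 * k + 1 dvd m" by (simp add: coprime_dvd_mult_right_iff)
    then show False using m0 m1 by (auto dest: dvd_imp_le)
  qed
  then have "(2 * k + 1) * dim (V_sub k \<inter> K) < k * (4 * m)" using B by linarith
  then show "dim (V_sub k \<inter> K) * dim (quat_tuples (2 * k + 1)) < dim (V_sub k) * dim K"
    unfolding dim_tuples dim_V_sub m by (simp add: algebra_simps)
qed

text \<open>The listed pairs of slope less than \<open>1/2\<close>.\<close>

definition model :: "(nat \<Rightarrow> nat \<Rightarrow> quat) \<Rightarrow> nat \<Rightarrow> (nat \<Rightarrow> quat) set \<Rightarrow> bool" where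
  "model c N UM \<longleftrightarrow> (\<exists>k. N = k + 1 \<and> UM = U_sub k (c k)) \<or> (\<exists>k. N = 2 * k + 1 \<and> UM = V_sub k)"

lemma U_sub_admissible:
  assumes "admissible_choice c"
  shows "slope_stable (U_sub k (c k)) (quat_tuples (k + 1))" "dim (U_sub k (c k)) = 2 * k + 1"
proof -
  have "slope_stable (U_sub k (c k)) (quat_tuples (k + 1)) \<and> dim (U_sub k (c k)) = 2 * k + 1"
  proof (cases "k = 0")
    case True
    \<comment> \<open>\<open>admissible_choice\<close> says nothing about \<open>c 0\<close>, but \<open>U_sub 0\<close> does not depend on it.\<close>
    have "U_sub 0 (c 0) = U_sub 0 (\<lambda>_. quat_i)" by (simp add: U_sub_def)
    then show ?thesis using U_sub_stable[of 0 "\<lambda>_. quat_i"] U_sub_facts(3)[of 0 "\<lambda>_. quat_i"] True by simp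
  next
    case False
    then have 1: "\<forall>i\<le>k. c k i \<in> S2" and 2: "\<And>i j. i \<le> k \<Longrightarrow> j \<le> k \<Longrightarrow> i \<noteq> j \<Longrightarrow> c k i \<noteq> c k j \<and> c k i \<noteq> - c k j"
      using assms unfolding admissible_choice_def by auto
    show ?thesis using U_sub_stable[of k "c k"] U_sub_facts(3)[OF 1] 1 2 by blast
  qed
  then show "slope_stable (U_sub k (c k)) (quat_tuples (k + 1))" "dim (U_sub k (c k)) = 2 * k + 1" by auto
qed

lemma model_stable: "admissible_choice c \<Longrightarrow> model c N UM \<Longrightarrow> slope_stable UM (quat_tuples N)"
  unfolding model_def using U_sub_admissible(1) V_sub_stable by blast

text \<open>The complement of \<open>V_k\<close> provides \<open>l = 2 k + 1\<close>, that of \<open>U_k\<close> provides \<open>l = 2 k + 2\<close>.\<close>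

lemma model_family:
  assumes "admissible_choice c" "l \<ge> 1"
  shows "\<exists>N UM. model c N UM \<and> slope_stable UM (quat_tuples N) \<and> 2 * l * dim (perp N (quat_tuples N) UM) = (l + 1) * (4 * N)"
proof -
  have dp: "4 * N = dim UM + dim (perp N (quat_tuples N) UM)" if "slope_stable UM (quat_tuples N)" for N UM
    using perp_decomp(3)[OF subset_refl subspace_tuples, of UM N] that unfolding slope_stable_def dim_tuples by simp
  show ?thesis
  proof (cases "even l")
    case True
    then obtain k' where "l = 2 * k'" by (auto elim: evenE)
    then obtain k where k: "l = 2 * k + 2" using assms(2) by (cases k') auto
    note U = U_sub_admissible[OF assms(1), of k]
    have d: "dim (perp (k + 1) (quat_tuples (k + 1)) (U_sub k (c k))) = 2 * k + 3" using dp[OF U(1)] U(2) by simp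
    show ?thesis
    proof (intro exI conjI)
      show "model c (k + 1) (U_sub k (c k))" unfolding model_def by blast
      show "2 * l * dim (perp (k + 1) (quat_tuples (k + 1)) (U_sub k (c k))) = (l + 1) * (4 * (k + 1))"
        unfolding d k by (simp add: algebra_simps)
    qed (rule U(1))
  next
    case False
    then obtain k where k: "l = 2 * k + 1" by (auto elim: oddE)
    have d: "dim (perp (2 * k + 1) (quat_tuples (2 * k + 1)) (V_sub k)) = 4 * k + 4"
      using dp[OF V_sub_stable, of k] dim_V_sub[of k] by simp
    show ?thesis
    proof (intro exI conjI)
      show "model c (2 * k + 1) (V_sub k)" unfolding model_def by blast
      show "2 * l * dim (perp (2 * k + 1) (quat_tuples (2 * k + 1)) (V_sub k)) = (l + 1) * (4 * (2 * k + 1))"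
        unfolding d k by (simp add: algebra_simps)
    qed (rule V_sub_stable)
  qed
qed

lemma indefinite_summand:
  assumes c: "admissible_choice c" and E: "hsub E" "E \<subseteq> quat_tuples n" and U: "subspace U" "U \<subseteq> E"
    and K0: "hsub K0" "K0 \<subseteq> E" "dim K0 < 2 * dim (U \<inter> K0) \<or> dim K0 < 2 * dim (perp n E U \<inter> K0)"
  shows "\<exists>N UM A B. model c N UM \<and> splits U E A B \<and>
    (hiso (U \<inter> A) A UM (quat_tuples N) \<or> hiso (perp N (quat_tuples N) UM) (quat_tuples N) (U \<inter> A) A)"
  using K0(3)
proof
  assume h: "dim K0 < 2 * dim (U \<inter> K0)"
  let ?Pr = "\<lambda>N UP. \<exists>UM. model c N UM \<and> UP = perp N (quat_tuples N) UM"
  have "\<exists>N UP v J. ?Pr N UP \<and> slope_stable UP (quat_tuples N) \<and>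
    (\<forall>x\<in>quat_tuples N. comb N v x = 0 \<longrightarrow> x = 0) \<and> comb N v ` UP = U \<inter> comb N v ` quat_tuples N \<and>
    splits U E (comb N v ` quat_tuples N) J"
  proof (rule positive_summand[OF _ E U K0(1,2) h])
    fix l :: nat assume "l \<ge> 1"
    then show "\<exists>N UP. ?Pr N UP \<and> slope_stable UP (quat_tuples N) \<and> 2 * l * dim UP = (l + 1) * (4 * N)"
      using model_family[OF c, of l] slope_stable_perp[OF _ subset_refl] by blast
  qed
  then obtain N UM UP v J where P: "model c N UM" "UP = perp N (quat_tuples N) UM"
    and inj: "\<forall>x\<in>quat_tuples N. comb N v x = 0 \<longrightarrow> x = 0"
    and hU: "comb N v ` UP = U \<inter> comb N v ` quat_tuples N"
    and sp: "splits U E (comb N v ` quat_tuples N) J"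
    by (elim exE conjE) (rule that; assumption)
  have "hiso (perp N (quat_tuples N) UM) (quat_tuples N) (U \<inter> comb N v ` quat_tuples N) (comb N v ` quat_tuples N)"
    unfolding hiso_def using hlin_comb inj hU P(2) by blast
  then show ?thesis using P(1) sp by blast
next
  assume h: "dim K0 < 2 * dim (perp n E U \<inter> K0)"
  show ?thesis using negative_summand[OF model_family[OF c] E U K0(1,2) h] by blast
qed

section \<open>Pairs of slope one half\<close>

text \<open>An infinite family of pairwise non-proportional elements of \<open>S2\<close>.\<close>

definition qdir :: "nat \<Rightarrow> quat" where
  "qdir t = Quat 0 (1 / sqrt (1 + (real t)\<^sup>2)) (real t / sqrt (1 + (real t)\<^sup>2)) 0"

lemma qdir: "qdir t \<in> S2" "s \<noteq> t \<Longrightarrow> qdir s \<noteq> qdir t \<and> qdir s \<noteq> - qdir t"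
proof -
  have p: "1 + (real t)\<^sup>2 > 0" for t by (simp add: add_pos_nonneg)
  then have "1 + (real t)\<^sup>2 \<noteq> 0" for t by (metis less_irrefl)
  then show "qdir t \<in> S2" by (simp add: qdir_def S2_iff power_divide flip: add_divide_distrib)
  have r: "qI (qdir t) > 0" "qJ (qdir t) = real t * qI (qdir t)" for t using p[of t] by (simp_all add: qdir_def)
  assume "s \<noteq> t"
  show "qdir s \<noteq> qdir t \<and> qdir s \<noteq> - qdir t"
  proof (intro conjI notI)
    assume "qdir s = qdir t"
    then have "real s * qI (qdir t) = real t * qI (qdir t)" using r(2)[of s] r(2)[of t] by metis
    then have "real s = real t" using r(1)[of t] by (metis less_irrefl mult_right_cancel)
    then show False using \<open>s \<noteq> t\<close> by simp
  next
    assume "qdir s = - qdir t"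
    then have "qI (qdir s) = - qI (qdir t)" by simp
    then show False using r(1)[of s] r(1)[of t] by linarith
  qed
qed

text \<open>Otherwise every \<open>q\<^sub>r = qdir r\<close> has a nonzero \<open>u\<^sub>r \<in> U\<close> with \<open>q\<^sub>r u\<^sub>r \<in> U\<close>. The lines through the \<open>u\<^sub>r\<close> turn out
  to be independent, against finite dimension: by \<open>semi\<close>, the sum \<open>F\<close> of the first lines meets \<open>U\<close> only in the sum of the
  \<open>cline q\<^sub>s u\<^sub>s\<close>. So no further direction is singular within \<open>F\<close>, and the next \<open>u\<close> is outside \<open>F\<close>.\<close>

lemma regular_direction_exists:
  assumes E: "hsub E" "E \<subseteq> quat_tuples n" and U: "subspace U" "U \<subseteq> E"
    and semi: "\<And>K. hsub K \<Longrightarrow> K \<subseteq> E \<Longrightarrow> 2 * dim (U \<inter> K) \<le> dim K"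
  shows "\<exists>q\<in>S2. \<forall>u\<in>U. hmul q u \<in> U \<longrightarrow> u = 0"
proof (rule ccontr)
  assume neg: "\<not> ?thesis"
  have fE: "fin_dim E" by (rule fin_dim_sub_tuples[OF E(2)])
  have sE: "subspace E" using E hsub_subspace by blast
  have "\<exists>F. hsub F \<and> F \<subseteq> E \<and> dim F = 4 * r \<and> dim (U \<inter> F) = 2 * r \<and>
    (\<forall>q\<in>S2. (\<forall>s<r. q \<noteq> qdir s \<and> q \<noteq> - qdir s) \<longrightarrow> (\<forall>u\<in>F. u \<in> U \<longrightarrow> hmul q u \<in> U \<longrightarrow> u = 0))" for r
  proof (induction r)
    case 0
    have "U \<inter> {0} = {0}" using subspace_0[OF U(1)] by blast
    then have "dim (U \<inter> {0}) = 0" by (simp only: dim_zero_space)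
    then show ?case using subspace_0[OF sE] by (intro exI[of _ "{0}"]) auto
  next
    case (Suc r)
    then obtain F where F: "hsub F" "F \<subseteq> E" "dim F = 4 * r" "dim (U \<inter> F) = 2 * r"
      and nonpar: "\<forall>q\<in>S2. (\<forall>s<r. q \<noteq> qdir s \<and> q \<noteq> - qdir s) \<longrightarrow> (\<forall>u\<in>F. u \<in> U \<longrightarrow> hmul q u \<in> U \<longrightarrow> u = 0)"
      by (elim exE conjE) (rule that; assumption)
    let ?q = "qdir r"
    obtain u where u: "u \<in> U" "hmul ?q u \<in> U" "u \<noteq> 0" using neg qdir(1)[of r] by blast
    have uF: "u \<notin> F"
    proof
      assume "u \<in> F"
      moreover have "\<forall>s<r. ?q \<noteq> qdir s \<and> ?q \<noteq> - qdir s" using qdir(2)[of r] by auto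
      ultimately show False using nonpar qdir(1)[of r] u by blast
    qed
    have sF: "subspace F" using F(1) hsub_subspace by blast
    have fF: "fin_dim F" by (rule fin_dim_mono[OF fE F(2)])
    have sh: "subspace (hline u)" using hsub_hline hsub_subspace by blast
    have hE: "hline u \<subseteq> E" using hline_subset[OF E(1)] u(1) U(2) by blast
    have int: "hline u \<inter> F = {0}" by (rule hline_Int[OF F(1) uF])
    define F' where "F' = F \<oplus>\<^sub>s hline u"
    have hF': "hsub F'" unfolding F'_def by (rule hsub_ssum[OF F(1) hsub_hline])
    have F'E: "F' \<subseteq> E" unfolding F'_def by (rule ssum_least[OF sE F(2) hE])
    have dF': "dim F' = 4 * Suc r" unfolding F'_def
      using dim_direct_sum[OF sF sh fF fin_dim_hline] int F(3) dim_hline[OF u(3)] by (simp add: Int_commute)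
    define C where "C = (\<lambda>z. hmul z u) ` cline ?q"
    have sC: "subspace C" unfolding C_def by (rule linear_subspace_image[OF linear_hmul_left subspace_cline])
    have fC: "fin_dim C" unfolding C_def by (rule fin_dim_image[OF fin_dim_quat linear_hmul_left])
    have "dim ((\<lambda>z. hmul z u) ` cline ?q) = dim (cline ?q)"
      by (rule dim_image_inj[OF linear_hmul_left subspace_cline fin_dim_quat]) (use u(3) in \<open>auto simp: hmul_eq_0\<close>)
    then have dC: "dim C = 2" unfolding C_def by (simp only: dim_cline[OF qdir(1)])
    have Ch: "C \<subseteq> hline u" unfolding C_def hline_def by blast
    have CU: "C \<subseteq> U"
    proof
      fix x assume "x \<in> C"
      then obtain z where z: "z \<in> cline ?q" "x = hmul z u" unfolding C_def by blast
      obtain a b where "z = of_real a + b *\<^sub>R ?q" using z(1) by (rule clineE)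
      then show "x \<in> U" using z(2) u by (auto simp: hmul_simps intro!: subspace_add[OF U(1)] subspace_scale[OF U(1)])
    qed
    have sUF: "subspace (U \<inter> F)" by (rule subspace_inter[OF U(1) sF])
    have fUF: "fin_dim (U \<inter> F)" by (rule fin_dim_mono[OF fF]) auto
    have "dim ((U \<inter> F) \<oplus>\<^sub>s C) = 2 * Suc r"
      using dim_direct_sum[OF sUF sC fUF fC] int Ch F(4) dC subspace_0[OF sC] subspace_0[OF sUF] by auto
    moreover have sub: "(U \<inter> F) \<oplus>\<^sub>s C \<subseteq> U \<inter> F'"
    proof (rule ssum_least)
      show "subspace (U \<inter> F')" by (rule subspace_inter[OF U(1) hsub_subspace[OF hF']])
      show "U \<inter> F \<subseteq> U \<inter> F'" unfolding F'_def using ssum_sup1[OF sh, of F] by blast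
      show "C \<subseteq> U \<inter> F'" unfolding F'_def using ssum_sup2[OF sF, of "hline u"] Ch CU by blast
    qed
    moreover have fUF': "fin_dim (U \<inter> F')" by (rule fin_dim_mono[OF fE]) (use F'E in blast)
    moreover have le: "dim (U \<inter> F') \<le> 2 * Suc r" using semi[OF hF' F'E] dF' by simp
    ultimately have eq: "(U \<inter> F) \<oplus>\<^sub>s C = U \<inter> F'"
      by (intro subspace_eq_of_dim_le subspace_ssum sUF sC subspace_inter[OF U(1) hsub_subspace[OF hF']]) auto
    have dUF': "dim (U \<inter> F') = 2 * Suc r" using \<open>dim ((U \<inter> F) \<oplus>\<^sub>s C) = 2 * Suc r\<close> eq by simp
    have "v = 0" if q: "q \<in> S2" "\<forall>s<Suc r. q \<noteq> qdir s \<and> q \<noteq> - qdir s" and v: "v \<in> F'" "v \<in> U" "hmul q v \<in> U" for q v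
    proof -
      have "v \<in> (U \<inter> F) \<oplus>\<^sub>s C" using v eq by blast
      then obtain x y where xy: "v = x + y" "x \<in> U \<inter> F" "y \<in> C" by (rule ssumE)
      obtain z where z: "z \<in> cline ?q" "y = hmul z u" using xy(3) unfolding C_def by blast
      have "hmul q v \<in> (U \<inter> F) \<oplus>\<^sub>s C" using v(3) hsub_hmul[OF hF' v(1)] eq by blast
      then obtain x' y' where xy': "hmul q v = x' + y'" "x' \<in> U \<inter> F" "y' \<in> C" by (rule ssumE)
      obtain z' where z': "z' \<in> cline ?q" "y' = hmul z' u" using xy'(3) unfolding C_def by blast
      have dx: "hmul (q * z - z') u = x' - hmul q x"
        using xy'(1) unfolding xy(1) z(2) z'(2) by (simp add: hmul_simps algebra_simps)
      have "x' - hmul q x \<in> F" using xy(2) xy'(2) hsub_hmul[OF F(1)] by (intro subspace_diff[OF sF]) auto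
      then have "hmul (q * z - z') u \<in> F" unfolding dx .
      moreover have "hmul (q * z - z') u \<in> hline u" unfolding hline_def by blast
      ultimately have "hmul (q * z - z') u \<in> hline u \<inter> F" by simp
      then have "hmul (q * z - z') u = 0" unfolding int by simp
      then have "q * z = z'" using u(3) by (simp add: hmul_eq_0)
      moreover have "q \<noteq> ?q" "q \<noteq> - ?q" using q(2) by auto
      ultimately have "z = 0" using cline_mult_imp_zero[OF qdir(1) q(1) _ _ z(1)] z'(1) by simp
      then have vx: "v = x" using xy(1) z(2) by simp
      have "\<forall>s<r. q \<noteq> qdir s \<and> q \<noteq> - qdir s" using q(2) by auto
      then show ?thesis using nonpar q(1) xy(2) v vx by blast
    qed
    then show ?case using hF' F'E dF' dUF' by (intro exI[of _ F']) blast
  qed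
  from this[of "Suc (dim E)"] obtain F where "F \<subseteq> E" "dim F = 4 * Suc (dim E)"
    by (elim exE conjE) (rule that; assumption)
  then show False using dim_mono_fin[OF fE, of F] by simp
qed

text \<open>\<open>J\<close> turns \<open>E\<close> into a complex vector space on which \<open>\<Phi>\<close> is complex linear. Take a complex polynomial \<open>P\<close>
  of least degree such that \<open>P \<Phi>\<close> annihilates a nonzero vector; if \<open>r\<close> is a root of \<open>P = (X - r) Q\<close>, then
  \<open>Q \<Phi>\<close> maps that vector to an eigenvector for \<open>r\<close>.\<close>

lemma complex_eigenvector:
  fixes \<Phi> J :: "'a::real_vector \<Rightarrow> 'a"
  assumes E: "subspace E" "fin_dim E" "E \<noteq> {0}" and \<Phi>: "linear \<Phi>" "\<And>x. x \<in> E \<Longrightarrow> \<Phi> x \<in> E"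
    and J: "linear J" "\<And>x. x \<in> E \<Longrightarrow> J x \<in> E" "\<And>x. x \<in> E \<Longrightarrow> J (J x) = - x"
    and comm: "\<And>x. x \<in> E \<Longrightarrow> \<Phi> (J x) = J (\<Phi> x)"
  shows "\<exists>x\<in>E. x \<noteq> 0 \<and> (\<exists>a b. \<Phi> x = a *\<^sub>R x + b *\<^sub>R J x)"
proof -
  \<comment> \<open>Multiplication by the complex number \<open>z\<close>.\<close>
  define cm where "cm z x = Re z *\<^sub>R x + Im z *\<^sub>R J x" for z x
  have cmE: "cm z x \<in> E" if "x \<in> E" for z x
    unfolding cm_def using that J(2) by (intro subspace_add[OF E(1)] subspace_scale[OF E(1)])
  have cm_add: "cm (z + w) x = cm z x + cm w x" for z w x by (simp add: cm_def algebra_simps)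
  have cm_mult: "cm (z * w) x = cm z (cm w x)" if "x \<in> E" for z w x
    using J(3)[OF that] by (simp add: cm_def linear_add[OF J(1)] linear_scale[OF J(1)] algebra_simps)
  have cm_\<Phi>: "\<Phi> (cm z x) = cm z (\<Phi> x)" if "x \<in> E" for z x
    using comm[OF that] by (simp add: cm_def linear_add[OF \<Phi>(1)] linear_scale[OF \<Phi>(1)])
  have cm_sum: "cm z (\<Sum>i\<in>I. f i) = (\<Sum>i\<in>I. cm z (f i))" for z f and I :: "nat set"
    by (simp add: cm_def linear_sum[OF J(1)] scaleR_sum_right sum.distrib)
  have cm_0 [simp]: "cm 0 x = 0" for x by (simp add: cm_def)
  have pE: "(\<Phi> ^^ i) x \<in> E" if "x \<in> E" for i x using that by (induction i) (auto simp: \<Phi>(2))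
  define act where "act d P x = (\<Sum>i\<le>d. cm (coeff P i) ((\<Phi> ^^ i) x))" for d P x
  have actE: "act d P x \<in> E" if "x \<in> E" for d P x
    unfolding act_def by (intro subspace_sum[OF E(1)] cmE pE that)
  \<comment> \<open>A polynomial with real coefficients shows that some \<open>d\<close> is good.\<close>
  define good where "good d \<longleftrightarrow> (\<exists>P. P \<noteq> 0 \<and> degree P = d \<and> (\<exists>x\<in>E. x \<noteq> 0 \<and> act d P x = 0))" for d
  have "\<exists>d. good d"
  proof -
    obtain x where x: "x \<in> E" "x \<noteq> 0" using E(1,3) subspace_0 by blast
    let ?T = "fun_space {..dim E} (UNIV :: real set)"
    have fr: "fin_dim (UNIV :: real set)" unfolding fin_dim_def using span_Basis[where 'a = real] by (metis finite_Basis order_refl)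
    have T: "fin_dim ?T" "dim ?T = dim E + 1" "subspace ?T"
      using dim_fun_space[of "{..dim E}" "UNIV :: real set"] fr subspace_fun_space[OF subspace_UNIV] by auto
    define L where "L a = (\<Sum>i\<le>dim E. a i *\<^sub>R (\<Phi> ^^ i) x)" for a :: "nat \<Rightarrow> real"
    have lL: "linear L" unfolding L_def by (rule linearI) (simp_all add: scaleR_add_left sum.distrib scaleR_sum_right)
    have "L ` ?T \<subseteq> E" unfolding L_def using x pE by (auto intro!: subspace_sum[OF E(1)] subspace_scale[OF E(1)])
    then have "dim (L ` ?T) \<le> dim E" by (rule dim_mono_fin[OF E(2)])
    then have "dim {a \<in> ?T. L a = 0} > 0" using rank_nullity[OF lL T(3,1)] T(2) by linarith
    then have "{a \<in> ?T. L a = 0} \<noteq> {0}" by (metis dim_zero_space less_irrefl)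
    moreover have "0 \<in> {a \<in> ?T. L a = 0}" using subspace_0[OF T(3)] linear_0[OF lL] by simp
    ultimately obtain a where a: "a \<in> ?T" "L a = 0" "a \<noteq> 0" by blast
    define P where "P = (\<Sum>i\<le>dim E. monom (complex_of_real (a i)) i)"
    have cP: "coeff P i = complex_of_real (a i)" for i
    proof -
      have "coeff P i = (\<Sum>s\<le>dim E. if s = i then complex_of_real (a i) else 0)"
        unfolding P_def coeff_sum by (intro sum.cong) auto
      also have "\<dots> = complex_of_real (a i)" using a(1) by (auto simp: fun_space_def)
      finally show ?thesis .
    qed
    obtain i where "a i \<noteq> 0" using a(3) by (auto simp: fun_eq_iff)
    then have "P \<noteq> 0" using cP[of i] by auto
    have dP: "degree P \<le> dim E" using a(1) cP by (intro degree_le) (auto simp: fun_space_def)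
    have a_deg: "a i = 0" if "\<not> i \<le> degree P" for i using cP[of i] coeff_eq_0[of P i] that by simp
    have "act (degree P) P x = L a" unfolding act_def L_def
      using dP by (intro sum.mono_neutral_cong_left) (auto simp: cP cm_def a_deg)
    then have "good (degree P)" unfolding good_def using \<open>P \<noteq> 0\<close> x a(2) by auto
    then show ?thesis by blast
  qed
  then have gl: "good (LEAST d. good d)" by (rule LeastI_ex)
  define d where "d = (LEAST d. good d)"
  have min: "\<not> good d'" if "d' < d" for d' using not_less_Least that unfolding d_def by blast
  obtain P x where P: "P \<noteq> 0" "degree P = d" and x: "x \<in> E" "x \<noteq> 0" and z: "act d P x = 0"
    using gl[folded d_def, unfolded good_def] by (elim exE conjE bexE) (rule that; assumption)
  have "d \<noteq> 0"
  proof
    assume "d = 0"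
    then have e: "cm (coeff P 0) x = 0" using z unfolding act_def by simp
    have "coeff P 0 \<noteq> 0" using P \<open>d = 0\<close> by (metis leading_coeff_0_iff)
    then have "x = cm (inverse (coeff P 0) * coeff P 0) x" by (simp add: cm_def)
    also have "\<dots> = 0" unfolding cm_mult[OF x(1)] e by (simp add: cm_def linear_0[OF J(1)])
    finally show False using x(2) by simp
  qed
  then have "\<not> constant (poly P)" using P(2) by (simp add: constant_degree)
  then obtain r where "poly P r = 0" using fundamental_theorem_of_algebra by blast
  then obtain Q where Q: "P = [:- r, 1:] * Q" using poly_eq_0_iff_dvd[of P r] by (auto elim: dvdE)
  have "Q \<noteq> 0" using P(1) Q by auto
  have dQ: "d = Suc (degree Q)" using P(2) \<open>Q \<noteq> 0\<close> unfolding Q by (subst (asm) degree_mult_eq) auto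
  let ?e = "degree Q"
  define y where "y = act ?e Q x"
  have y: "y \<in> E" unfolding y_def by (rule actE[OF x(1)])
  have "y \<noteq> 0" using min[of ?e] dQ \<open>Q \<noteq> 0\<close> x unfolding good_def y_def by blast
  have cf: "coeff P i = (- r) * coeff Q i + (if i = 0 then 0 else coeff Q (i - 1))" for i
    unfolding Q by (cases i) auto
  have "act d P x = (\<Sum>i\<le>d. cm (- r) (cm (coeff Q i) ((\<Phi> ^^ i) x))) + (\<Sum>i\<le>d. cm (if i = 0 then 0 else coeff Q (i - 1)) ((\<Phi> ^^ i) x))"
    unfolding act_def cf by (simp only: cm_add cm_mult[OF pE[OF x(1)]] sum.distrib)
  also have "(\<Sum>i\<le>d. cm (- r) (cm (coeff Q i) ((\<Phi> ^^ i) x))) = cm (- r) y"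
    unfolding y_def act_def dQ cm_sum by (simp add: coeff_eq_0 cm_def linear_0[OF J(1)])
  also have "(\<Sum>i\<le>d. cm (if i = 0 then 0 else coeff Q (i - 1)) ((\<Phi> ^^ i) x)) = (\<Sum>i\<le>?e. cm (coeff Q i) ((\<Phi> ^^ Suc i) x))"
    unfolding dQ sum.atMost_Suc_shift by simp
  also have "\<dots> = \<Phi> y" unfolding y_def act_def linear_sum[OF \<Phi>(1)] by (simp add: cm_\<Phi>[OF pE[OF x(1)]])
  finally have "cm (- r) y + \<Phi> y = 0" using z by simp
  then have "\<Phi> y = Re r *\<^sub>R y + Im r *\<^sub>R J y" by (simp add: cm_def add_eq_0_iff2 algebra_simps)
  then show ?thesis using y \<open>y \<noteq> 0\<close> by blast
qed

definition conj_by :: "quat \<Rightarrow> quat \<Rightarrow> quat" where "conj_by g x = g * x * inverse g"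

lemma conj_by_Aut: assumes "g \<noteq> 0" shows "conj_by g \<in> Aut_quat"
proof -
  have "linear (conj_by g)" by (rule linearI) (simp_all add: conj_by_def algebra_simps)
  moreover have "conj_by g 1 = 1" using assms by (simp add: conj_by_def)
  moreover have "conj_by g (p * q) = conj_by g p * conj_by g q" for p q
  proof -
    have "inverse g * (g * z) = z" for z using assms by (simp flip: mult.assoc)
    then show ?thesis by (simp add: conj_by_def mult.assoc)
  qed
  moreover have "bij (conj_by g)"
  proof (rule o_bij[of "\<lambda>x. inverse g * x * g"])
    show "(\<lambda>x. inverse g * x * g) \<circ> conj_by g = id" "conj_by g \<circ> (\<lambda>x. inverse g * x * g) = id"
      using assms by (auto simp: fun_eq_iff conj_by_def mult.assoc) (auto simp flip: mult.assoc)
  qed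
  ultimately show ?thesis by (simp add: Aut_quat_def)
qed

lemma rotation_to:
  assumes "q \<in> S2" shows "\<exists>\<tau>\<in>Aut_quat. \<tau> quat_i = q"
proof -
  have "\<exists>g. g \<noteq> 0 \<and> g * quat_i = q * g"
  proof (cases "q = - quat_i")
    case True
    then have "quat_j \<noteq> 0 \<and> quat_j * quat_i = q * quat_j" by (simp add: quat_simps)
    then show ?thesis by blast
  next
    case False
    \<comment> \<open>\<open>?g\<close> intertwines \<open>quat_i\<close> and \<open>q\<close>, and is 0 only for \<open>q = - quat_i\<close>.\<close>
    let ?g = "1 - q * quat_i"
    have qq: "q * q = -1" "quat_i * quat_i = -1" using S2_square assms by auto
    have "?g * quat_i = q * ?g"
    proof -
      have "q * (q * quat_i) = - quat_i" "q * quat_i * quat_i = - q" by (simp_all add: qq mult.assoc flip: mult.assoc[of q q])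
      then show ?thesis by (simp add: left_diff_distrib right_diff_distrib)
    qed
    moreover have "?g \<noteq> 0"
    proof
      assume "?g = 0"
      then have "q * quat_i * quat_i = quat_i" by simp
      then have "- q = quat_i" by (simp add: mult.assoc qq)
      then show False using False by (metis minus_minus)
    qed
    ultimately show ?thesis by blast
  qed
  then obtain g where g: "g \<noteq> 0" "g * quat_i = q * g" by blast
  have "conj_by g quat_i = q" unfolding conj_by_def g(2) using g(1) by (simp add: mult.assoc)
  then show ?thesis using conj_by_Aut[OF g(1)] by blast
qed

lemma Aut_S2: assumes "\<sigma> \<in> Aut_quat" "q \<in> S2" shows "\<sigma> q \<in> S2"
proof -
  have s: "linear \<sigma>" "\<sigma> 1 = 1" "\<And>p q. \<sigma> (p * q) = \<sigma> p * \<sigma> q" using assms(1) by (auto simp: Aut_quat_def)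
  have "\<sigma> q * \<sigma> q = \<sigma> (-1)" using s(3)[of q q] S2_square[OF assms(2)] by simp
  also have "\<dots> = -1" using linear_neg[OF s(1), of 1] s(2) by simp
  finally show ?thesis by (simp add: S2_square_iff)
qed

lemma S2_hmul_square: "q \<in> S2 \<Longrightarrow> hmul q (hmul q x) = - x"
  by (simp add: S2_square hmul_simps(8) flip: hmul_simps(3))

text \<open>Let \<open>\<kappa>\<close> be the reflection of \<open>E\<close> that is 1 on \<open>U\<close> and \<open>-1\<close> on \<open>q0 U\<close>; it anticommutes with \<open>q0\<close>. For
  a \<open>j \<in> S2\<close> that anticommutes with \<open>q0\<close>, the map \<open>\<Phi> = j \<kappa>\<close> commutes with \<open>q0\<close>, so it has an eigenvector
  \<open>u + q0 v\<close> over the field \<open>cline q0\<close>. The equation \<open>j (u - q0 v) = \<mu> (u + q0 v)\<close> can be solved as \<open>v = h u\<close> with a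
  non-real quaternion \<open>h\<close>, and \<open>p\<close> is the direction of the imaginary part of \<open>h\<close>.\<close>

lemma singular_direction_exists:
  assumes E: "hsub E" "E \<subseteq> quat_tuples n" "E \<noteq> {0}" and U: "subspace U" "U \<subseteq> E"
    and q0: "q0 \<in> S2" "\<And>u. u \<in> U \<Longrightarrow> hmul q0 u \<in> U \<Longrightarrow> u = 0"
    and dec: "E = U \<oplus>\<^sub>s hmul q0 ` U"
  shows "\<exists>p\<in>S2. \<exists>u\<in>U. u \<noteq> 0 \<and> hmul p u \<in> U"
proof -
  obtain \<tau> where tau: "\<tau> \<in> Aut_quat" "\<tau> quat_i = q0" using rotation_to[OF q0(1)] by blast
  have \<tau>: "linear \<tau>" "\<And>p q. \<tau> (p * q) = \<tau> p * \<tau> q" using tau(1) by (auto simp: Aut_quat_def)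
  define j where "j = \<tau> quat_j"
  have jS: "j \<in> S2" unfolding j_def by (rule Aut_S2[OF tau(1)]) simp
  have anti: "j * q0 = - (q0 * j)"
  proof -
    have "quat_j * quat_i = - (quat_i * quat_j)" by (simp add: quat_simps)
    then have "\<tau> (quat_j * quat_i) = - \<tau> (quat_i * quat_j)" using linear_neg[OF \<tau>(1)] by metis
    then show ?thesis by (simp add: \<tau>(2) tau(2) j_def)
  qed
  have q00: "q0 * q0 = -1" using S2_square[OF q0(1)] .
  have nc: False if "j * q0 = q0 * j"
  proof -
    have "q0 * j = - (q0 * j)" using that anti by simp
    then have "2 *\<^sub>R (q0 * j) = 0" by (simp add: scaleR_2 eq_neg_iff_add_eq_0)
    then show False using S2_nonzero q0(1) jS by simp
  qed
  have sE: "subspace E" using E hsub_subspace by blast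
  have sQ: "subspace (hmul q0 ` U)" by (rule linear_subspace_image[OF linear_hmul U(1)])
  have int: "U \<inter> hmul q0 ` U = {0}"
  proof -
    have "x = 0" if x: "x \<in> U" "x \<in> hmul q0 ` U" for x
    proof -
      obtain y where y: "y \<in> U" "x = hmul q0 y" using x(2) by blast
      then have "y = 0" using q0(2)[of y] x(1) by simp
      then show ?thesis using y(2) by simp
    qed
    then show ?thesis using subspace_0[OF U(1)] subspace_0[OF sQ] by blast
  qed
  have "hmul q0 ` U \<inter> U = {0}" using int by (simp only: Int_commute)
  then obtain pU where pU: "linear pU" "\<forall>x\<in>hmul q0 ` U. pU x = 0" "\<forall>x\<in>U. pU x = x"
    using projection_exists[OF sQ U(1)] by blast
  define \<kappa> where "\<kappa> x = 2 *\<^sub>R pU x - x" for x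
  have l\<kappa>: "linear \<kappa>" unfolding \<kappa>_def by (intro linear_compose_sub linear_compose_scale_right pU(1) linear_ident)
  have \<kappa>uv: "\<kappa> (u + hmul q0 v) = u - hmul q0 v" if "u \<in> U" "v \<in> U" for u v
    using bspec[OF pU(2), of "hmul q0 v"] bspec[OF pU(3), of u] that by (simp add: \<kappa>_def linear_add[OF pU(1)] scaleR_2)
  define \<Phi> where "\<Phi> x = hmul j (\<kappa> x)" for x
  have l\<Phi>: "linear \<Phi>" unfolding \<Phi>_def using linear_compose[OF l\<kappa> linear_hmul[of j]] by (simp add: o_def)
  have uv: "\<exists>u v. x = u + hmul q0 v \<and> u \<in> U \<and> v \<in> U" if "x \<in> E" for x
  proof -
    have "x \<in> U \<oplus>\<^sub>s hmul q0 ` U" using that dec by simp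
    then show ?thesis by (auto elim!: ssumE)
  qed
  have QE: "hmul q v \<in> E" if "v \<in> U" for q v using hsub_hmul[OF E(1)] that U(2) by blast
  have \<Phi>E: "\<Phi> x \<in> E" if "x \<in> E" for x
  proof -
    obtain u v where x: "x = u + hmul q0 v" "u \<in> U" "v \<in> U" using uv[OF \<open>x \<in> E\<close>] by blast
    have "\<kappa> x \<in> E" unfolding x(1) \<kappa>uv[OF x(2,3)] using x U(2) QE by (intro subspace_diff[OF sE]) auto
    then show ?thesis unfolding \<Phi>_def by (rule hsub_hmul[OF E(1)])
  qed
  have comm: "\<Phi> (hmul q0 x) = hmul q0 (\<Phi> x)" if "x \<in> E" for x
  proof -
    obtain u v where x: "x = u + hmul q0 v" "u \<in> U" "v \<in> U" using uv[OF \<open>x \<in> E\<close>] by blast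
    have "hmul q0 x = (- v) + hmul q0 u" unfolding x(1) hmul_simps(2) S2_hmul_square[OF q0(1)] by simp
    then have "\<kappa> (hmul q0 x) = (- v) - hmul q0 u" using \<kappa>uv[of "- v" u] x subspace_neg[OF U(1)] by simp
    also have "\<dots> = - hmul q0 (\<kappa> x)" unfolding x(1) \<kappa>uv[OF x(2,3)]
      by (simp add: hmul_simps(7) S2_hmul_square[OF q0(1)])
    finally have "\<Phi> (hmul q0 x) = - hmul (j * q0) (\<kappa> x)" unfolding \<Phi>_def by (simp add: hmul_simps)
    also have "\<dots> = hmul q0 (\<Phi> x)" unfolding anti \<Phi>_def by (simp add: hmul_simps)
    finally show ?thesis .
  qed
  have "\<exists>x\<in>E. x \<noteq> 0 \<and> (\<exists>a b. \<Phi> x = a *\<^sub>R x + b *\<^sub>R hmul q0 x)"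
  proof (rule complex_eigenvector[OF sE fin_dim_sub_tuples[OF E(2)] E(3) l\<Phi> \<Phi>E linear_hmul hsub_hmul[OF E(1)] _ comm])
    show "hmul q0 (hmul q0 x) = - x" for x by (rule S2_hmul_square[OF q0(1)])
  qed
  then obtain x a b where x: "x \<in> E" "x \<noteq> 0" "\<Phi> x = a *\<^sub>R x + b *\<^sub>R hmul q0 x" by blast
  obtain u v where xuv: "x = u + hmul q0 v" and u: "u \<in> U" and v: "v \<in> U" using uv[OF x(1)] by blast
  define \<mu> where "\<mu> = of_real a + b *\<^sub>R q0"
  have \<mu>q: "\<mu> * q0 = q0 * \<mu>" by (simp add: \<mu>_def algebra_simps of_real_def)
  have eig: "hmul j (u - hmul q0 v) = hmul \<mu> (u + hmul q0 v)"
    using x(3) unfolding \<Phi>_def xuv \<kappa>uv[OF u v] \<mu>_def by (simp add: hmul_simps algebra_simps)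
  define g where "g = (j + \<mu>) * q0"
  have eq: "hmul (j - \<mu>) u = hmul g v"
    using eig unfolding g_def by (simp add: hmul_simps algebra_simps)
  have gne: "g \<noteq> 0"
  proof
    assume "g = 0"
    then have "j = - \<mu>" using S2_nonzero[OF q0(1)] by (auto simp: g_def add_eq_0_iff2)
    then show False using nc \<mu>q by simp
  qed
  have "u \<noteq> 0"
  proof
    assume "u = 0"
    then have "hmul g v = 0" using eq by simp
    then have "v = 0" using gne by (simp add: hmul_eq_0)
    then show False using x(2) xuv \<open>u = 0\<close> by simp
  qed
  define h where "h = inverse g * (j - \<mu>)"
  have "hmul h u = hmul (inverse g * g) v" unfolding h_def hmul_simps(3) eq ..
  then have vh: "v = hmul h u" using gne by simp
  obtain r s p where h: "h = of_real r + s *\<^sub>R p" "p \<in> S2" by (rule quat_polar)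
  \<comment> \<open>If \<open>h\<close> were real, \<open>j\<close> would lie in \<open>cline q0\<close> and commute with \<open>q0\<close>.\<close>
  have "s \<noteq> 0"
  proof
    assume "s = 0"
    have "g * h = j - \<mu>" unfolding h_def using gne by (simp flip: mult.assoc)
    then have e: "r *\<^sub>R ((j + \<mu>) * q0) = j - \<mu>" using h(1) \<open>s = 0\<close> by (simp add: g_def of_real_def)
    have "j * (1 - r *\<^sub>R q0) = \<mu> * (1 + r *\<^sub>R q0)"
      using e by (simp add: algebra_simps)
    then have "j * (1 - r *\<^sub>R q0) * (1 + r *\<^sub>R q0) = \<mu> * (1 + r *\<^sub>R q0) * (1 + r *\<^sub>R q0)" by simp
    moreover have "(1 - r *\<^sub>R q0) * (1 + r *\<^sub>R q0) = (1 + r * r) *\<^sub>R 1" by (simp add: algebra_simps q00)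
    ultimately have "(1 + r * r) *\<^sub>R j = \<mu> * (1 + r *\<^sub>R q0) * (1 + r *\<^sub>R q0)" by (simp add: mult.assoc)
    moreover have "\<mu> * (1 + r *\<^sub>R q0) * (1 + r *\<^sub>R q0) * q0 = q0 * (\<mu> * (1 + r *\<^sub>R q0) * (1 + r *\<^sub>R q0))"
    proof -
      have "(1 + r *\<^sub>R q0) * q0 = q0 * (1 + r *\<^sub>R q0)" by (simp add: algebra_simps)
      then show ?thesis using \<mu>q by (metis mult.assoc)
    qed
    ultimately have "(1 + r * r) *\<^sub>R j * q0 = q0 * ((1 + r * r) *\<^sub>R j)" by simp
    then have "(1 + r * r) *\<^sub>R (j * q0) = (1 + r * r) *\<^sub>R (q0 * j)" by simp
    moreover have "1 + r * r \<noteq> 0" using zero_le_square[of r] by linarith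
    ultimately have "j * q0 = q0 * j" using scaleR_cancel_left by blast
    then show False by (rule nc)
  qed
  have "v = r *\<^sub>R u + s *\<^sub>R hmul p u" using vh h(1) by (simp add: hmul_simps)
  then have "hmul p u = inverse s *\<^sub>R (v - r *\<^sub>R u)" using \<open>s \<noteq> 0\<close> by simp
  also have "\<dots> \<in> U" using u v by (intro subspace_scale[OF U(1)] subspace_diff[OF U(1)])
  finally show ?thesis using h(2) u \<open>u \<noteq> 0\<close> by blast
qed

text \<open>\<open>A\<close> plays the role of the imaginary unit, so that \<open>y\<close> is a tuple of complex coordinates.\<close>

definition jordan_span :: "(nat \<Rightarrow> 'a) \<Rightarrow> ('a \<Rightarrow> 'a) \<Rightarrow> nat \<Rightarrow> cseq \<Rightarrow> 'a::real_vector" where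
  "jordan_span e A m y = (\<Sum>i<m. Re (y i) *\<^sub>R e i + Im (y i) *\<^sub>R A (e i))"

lemma linear_jordan_span: "linear (jordan_span e A m)"
  unfolding jordan_span_def by (rule linearI) (simp_all add: algebra_simps sum.distrib scaleR_sum_right)

text \<open>Let \<open>m\<close> be the step at which the kernels of the powers of \<open>N\<close> become constant and \<open>u\<close> a vector killed by \<open>N ^^ m\<close>
  but not by \<open>N ^^ (m - 1)\<close>. Take a functional \<open>\<phi>\<close> that is 1 on \<open>w = (N ^^ (m - 1)) u\<close> and 0 on the image of
  \<open>N ^^ m\<close>. The complement of the Jordan block of \<open>u\<close> is the common kernel \<open>C\<close> of the functionals \<open>\<phi> \<circ> N ^^ j\<close> and
  \<open>\<phi> \<circ> N ^^ j \<circ> A\<close>. It is invariant under \<open>A\<close> because of the formula for \<open>A (A x)\<close>, and disjoint from the block because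
  \<open>A\<close> squares to \<open>-1\<close> on the kernel of \<open>N\<close>.\<close>

lemma jordan_block_splits:
  fixes A N :: "'a::real_vector \<Rightarrow> 'a"
  assumes U: "subspace U" "fin_dim U"
    and A: "linear A" "\<And>x. x \<in> U \<Longrightarrow> A x \<in> U" and N: "linear N" "\<And>x. x \<in> U \<Longrightarrow> N x \<in> U"
    and rel: "\<forall>x\<in>U. A (N x) = N (A x) \<and> A (A x) = - x + c *\<^sub>R N x - N (N x)"
    and u0: "u0 \<in> U" "u0 \<noteq> 0" "N u0 = 0"
  shows "\<exists>m e C. m \<ge> 1 \<and> (\<forall>i<m. e i \<in> U) \<and> N (e 0) = 0 \<and> (\<forall>i. Suc i < m \<longrightarrow> N (e (Suc i)) = - e i) \<and>
    (\<forall>y\<in>cs m. jordan_span e A m y = 0 \<longrightarrow> y = 0) \<and>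
    subspace C \<and> C \<subseteq> U \<and> A ` C \<subseteq> C \<and> N ` C \<subseteq> C \<and>
    jordan_span e A m ` cs m \<inter> C = {0} \<and> U = jordan_span e A m ` cs m \<oplus>\<^sub>s C"
proof -
  have comm: "A (N x) = N (A x)" and sq: "A (A x) = - x + c *\<^sub>R N x - N (N x)" if "x \<in> U" for x
    using rel that by blast+
  have pN: "linear (N ^^ j)" for j
  proof (induction j)
    case 0 show ?case using linear_id by (simp add: id_def)
  next
    case (Suc j) show ?case unfolding funpow.simps by (rule linear_compose[OF Suc N(1)])
  qed
  have pU: "(N ^^ j) x \<in> U" if "x \<in> U" for j x using that N(2) by (induction j) auto
  have pA: "(N ^^ j) (A x) = A ((N ^^ j) x)" if "x \<in> U" for j x
    using comm[OF pU[OF that]] by (induction j) auto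
  define Kr where "Kr j = {x \<in> U. (N ^^ j) x = 0}" for j
  have sK: "subspace (Kr j)" for j unfolding Kr_def subspace_def using U(1)
    by (auto simp: subspace_0 subspace_add subspace_scale linear_0[OF pN] linear_add[OF pN] linear_scale[OF pN])
  have Kmono: "Kr j \<subseteq> Kr (Suc j)" for j unfolding Kr_def using linear_0[OF N(1)] by auto
  have fK: "fin_dim (Kr j)" for j by (rule fin_dim_mono[OF U(2)]) (auto simp: Kr_def)
  have ex: "\<exists>j. Kr j = Kr (Suc j)"
  proof (rule ccontr)
    assume neg: "\<not> ?thesis"
    have "j \<le> dim (Kr j)" for j
    proof (induction j)
      case (Suc j)
      have "dim (Kr j) < dim (Kr (Suc j))"
      proof (rule ccontr)
        assume "\<not> ?thesis"
        then have "Kr j = Kr (Suc j)" by (intro subspace_eq_of_dim_le fK sK Kmono) simp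
        then show False using neg by blast
      qed
      then show ?case using Suc by simp
    qed simp
    moreover have "dim (Kr j) \<le> dim U" for j by (rule dim_mono_fin[OF U(2)]) (auto simp: Kr_def)
    ultimately show False by (metis Suc_n_not_le_n le_trans)
  qed
  define m where "m = (LEAST j. Kr j = Kr (Suc j))"
  have Km: "Kr m = Kr (Suc m)" unfolding m_def by (rule LeastI_ex[OF ex])
  have Kl: "Kr j \<noteq> Kr (Suc j)" if "j < m" for j using not_less_Least[of j "\<lambda>j. Kr j = Kr (Suc j)"] that unfolding m_def by blast
  have m1: "m \<ge> 1"
  proof (rule ccontr)
    assume "\<not> ?thesis"
    then have "Kr 0 = Kr (Suc 0)" using Km by (simp add: not_less_eq_eq)
    then show False using u0 unfolding Kr_def by auto
  qed
  then obtain m' where m': "m = Suc m'" by (cases m) auto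
  obtain u where u: "u \<in> Kr m" "u \<notin> Kr m'" using Kl[of m'] Kmono[of m'] m' by blast
  have uU: "u \<in> U" and Nmu: "(N ^^ m) u = 0" using u(1) by (auto simp: Kr_def)
  define w where "w = (N ^^ m') u"
  have w: "w \<in> U" "w \<noteq> 0" "N w = 0" using u uU Nmu pU unfolding w_def m' Kr_def by auto
  have hi: "(N ^^ j) u = 0" if "j \<ge> m" for j
  proof -
    have "(N ^^ j) u = (N ^^ (j - m)) ((N ^^ m) u)" using that by (metis comp_apply funpow_add le_add_diff_inverse2)
    then show ?thesis using Nmu linear_0[OF pN] by simp
  qed
  have sI: "subspace ((N ^^ m) ` U)" by (rule linear_subspace_image[OF pN U(1)])
  have "w \<notin> (N ^^ m) ` U"
  proof
    assume "w \<in> (N ^^ m) ` U"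
    then obtain y where y: "y \<in> U" "w = (N ^^ m) y" by blast
    then have "y \<in> Kr (Suc m)" using w(3) by (simp add: Kr_def)
    then have "y \<in> Kr m" using Km by simp
    then show False using y(2) w(2) by (simp add: Kr_def)
  qed
  then obtain \<phi> :: "'a \<Rightarrow> real" where \<phi>: "linear \<phi>" "\<forall>y\<in>(N ^^ m) ` U. \<phi> y = 0" "\<phi> w = 1"
    using separating_functional[OF sI] by blast
  have \<phi>hi: "\<phi> ((N ^^ j) x) = 0" if "j \<ge> m" "x \<in> U" for j x
  proof -
    have "(N ^^ j) x = (N ^^ m) ((N ^^ (j - m)) x)" using that by (metis comp_apply funpow_add le_add_diff_inverse)
    then show ?thesis using \<phi>(2) pU[OF that(2)] by auto
  qed
  define C where "C = {v \<in> U. \<forall>j. \<phi> ((N ^^ j) v) = 0 \<and> \<phi> ((N ^^ j) (A v)) = 0}"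
  have CI: "v \<in> C" if "v \<in> U" "\<And>j. \<phi> ((N ^^ j) v) = 0" "\<And>j. \<phi> ((N ^^ j) (A v)) = 0" for v
    using that by (simp add: C_def)
  have sC: "subspace C" unfolding C_def subspace_def using U(1)
    by (auto simp: subspace_0 subspace_add subspace_scale linear_0[OF pN] linear_add[OF pN] linear_scale[OF pN]
      linear_0[OF A(1)] linear_add[OF A(1)] linear_scale[OF A(1)] linear_0[OF \<phi>(1)] linear_add[OF \<phi>(1)] linear_scale[OF \<phi>(1)])
  have CU: "C \<subseteq> U" by (auto simp: C_def)
  have NC: "N ` C \<subseteq> C"
  proof (rule image_subsetI)
    fix v assume v: "v \<in> C"
    then have vU: "v \<in> U" and z: "\<And>j. \<phi> ((N ^^ j) v) = 0" "\<And>j. \<phi> ((N ^^ j) (A v)) = 0" by (auto simp: C_def)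
    have s: "(N ^^ j) (N v) = (N ^^ Suc j) v" "(N ^^ j) (A (N v)) = (N ^^ Suc j) (A v)" for j
      using comm[OF vU] by (simp_all add: funpow_swap1)
    show "N v \<in> C" by (rule CI[OF N(2)[OF vU]]) (simp_all only: s z)
  qed
  have AC: "A ` C \<subseteq> C"
  proof (rule image_subsetI)
    fix v assume v: "v \<in> C"
    then have vU: "v \<in> U" and z: "\<And>j. \<phi> ((N ^^ j) v) = 0" "\<And>j. \<phi> ((N ^^ j) (A v)) = 0" by (auto simp: C_def)
    have "(N ^^ j) (A (A v)) = - (N ^^ j) v + c *\<^sub>R (N ^^ Suc j) v - (N ^^ Suc (Suc j)) v" for j
      unfolding sq[OF vU] linear_diff[OF pN] linear_add[OF pN] linear_neg[OF pN] linear_scale[OF pN]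
      by (simp add: funpow_swap1)
    then have "\<phi> ((N ^^ j) (A (A v))) = 0" for j
      by (simp only: linear_diff[OF \<phi>(1)] linear_add[OF \<phi>(1)] linear_neg[OF \<phi>(1)] linear_scale[OF \<phi>(1)] z) simp
    then show "A v \<in> C" by (rule CI[OF A(2)[OF vU] z(2)])
  qed
  \<comment> \<open>The signs make \<open>N\<close> act on the chain by \<open>e (Suc i) \<mapsto> - e i\<close>, the form of the chain in \<open>W_sub\<close>.\<close>
  define e where "e i = (-1) ^ (m' - i) *\<^sub>R (N ^^ (m' - i)) u" for i
  have eU: "e i \<in> U" for i unfolding e_def by (intro subspace_scale[OF U(1)] pU uU)
  have Ne0: "N (e 0) = 0" unfolding e_def using Nmu by (simp add: m' linear_scale[OF N(1)])
  have NeS: "N (e (Suc i)) = - e i" if "Suc i < m" for i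
  proof -
    have s: "m' - i = Suc (m' - Suc i)" using that by (simp add: m')
    show ?thesis unfolding e_def s by (simp add: linear_scale[OF N(1)])
  qed
  let ?G = "jordan_span e A m"
  have GU: "?G y \<in> U" for y unfolding jordan_span_def
    by (intro subspace_sum[OF U(1)] subspace_add[OF U(1)] subspace_scale[OF U(1)] A(2) eU)
  have Npe: "(N ^^ j) (e i) = (if i < j then 0 else if i = j then (-1) ^ (m' - j) *\<^sub>R w else (N ^^ j) (e i))" if "i \<le> m'" for i j
  proof -
    have e1: "(N ^^ j) (e i) = (-1) ^ (m' - i) *\<^sub>R (N ^^ (j + (m' - i))) u"
      unfolding e_def by (simp add: linear_scale[OF pN] funpow_add)
    show ?thesis
    proof (cases "i < j")
      case True
      then have "j + (m' - i) \<ge> m" using that by (simp add: m')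
      then show ?thesis using True e1 hi by simp
    next
      case False
      show ?thesis
      proof (cases "i = j")
        case True
        then have "j + (m' - i) = m'" using that by simp
        then show ?thesis using True e1 by (simp add: w_def)
      qed (use False in simp)
    qed
  qed
  \<comment> \<open>Apply \<open>N ^^ j\<close> for the highest \<open>j\<close> with \<open>y j \<noteq> 0\<close>; only a multiple of \<open>w\<close> and \<open>A w\<close> survives.\<close>
  have inj: "y = 0" if y: "y \<in> cs m" and GC: "?G y \<in> C" for y
  proof (rule ccontr)
    assume "y \<noteq> 0"
    then obtain i where "y i \<noteq> 0" by (auto simp: fun_eq_iff)
    define S where "S = {i. i < m \<and> y i \<noteq> 0}"
    have fS: "finite S" unfolding S_def by simp
    have "i < m" using \<open>y i \<noteq> 0\<close> y by (auto simp: fun_space_def)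
    then have neS: "S \<noteq> {}" using \<open>y i \<noteq> 0\<close> by (auto simp: S_def)
    define j where "j = Max S"
    have j: "j < m" "y j \<noteq> 0" using Max_in[OF fS neS] by (auto simp: S_def j_def)
    have jx: "y i = 0" if "i > j" "i < m" for i
    proof (rule ccontr)
      assume "y i \<noteq> 0"
      then have "i \<in> S" using that by (simp add: S_def)
      then have "i \<le> j" unfolding j_def by (rule Max_ge[OF fS])
      then show False using that by simp
    qed
    define s :: real where "s = (-1) ^ (m' - j)"
    have s0: "s \<noteq> 0" by (simp add: s_def)
    have "(N ^^ j) (?G y) = (\<Sum>i<m. Re (y i) *\<^sub>R (N ^^ j) (e i) + Im (y i) *\<^sub>R A ((N ^^ j) (e i)))"
      unfolding jordan_span_def by (simp add: linear_sum[OF pN] linear_add[OF pN] linear_scale[OF pN] pA[OF eU])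
    also have "\<dots> = (\<Sum>i<m. if i = j then Re (y j) *\<^sub>R s *\<^sub>R w + Im (y j) *\<^sub>R A (s *\<^sub>R w) else 0)"
    proof (rule sum.cong[OF refl])
      fix i assume i: "i \<in> {..<m}"
      consider "i < j" | "i = j" | "i > j" by linarith
      then show "Re (y i) *\<^sub>R (N ^^ j) (e i) + Im (y i) *\<^sub>R A ((N ^^ j) (e i)) =
        (if i = j then Re (y j) *\<^sub>R s *\<^sub>R w + Im (y j) *\<^sub>R A (s *\<^sub>R w) else 0)"
      proof cases
        case 1 then show ?thesis using Npe[of i j] i linear_0[OF A(1)] by (simp add: m')
      next
        case 2 then show ?thesis using Npe[of i j] i by (simp add: m' s_def)
      next
        case 3 then show ?thesis using jx[of i] i by simp
      qed
    qed
    also have "\<dots> = s *\<^sub>R (Re (y j) *\<^sub>R w + Im (y j) *\<^sub>R A w)"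
      using j(1) by (simp add: linear_scale[OF A(1)] scaleR_add_right mult.commute)
    finally have g: "(N ^^ j) (?G y) = s *\<^sub>R (Re (y j) *\<^sub>R w + Im (y j) *\<^sub>R A w)" .
    have "\<phi> ((N ^^ j) (?G y)) = 0" "\<phi> ((N ^^ j) (A (?G y))) = 0" using GC by (auto simp: C_def)
    then have e1: "\<phi> (s *\<^sub>R (Re (y j) *\<^sub>R w + Im (y j) *\<^sub>R A w)) = 0"
      and e2: "\<phi> (A (s *\<^sub>R (Re (y j) *\<^sub>R w + Im (y j) *\<^sub>R A w))) = 0" unfolding pA[OF GU] g by auto
    have AAw: "A (A w) = - w" using sq[OF w(1)] w(3) linear_0[OF N(1)] by simp
    define t where "t = \<phi> (A w)"
    have f1: "Re (y j) + Im (y j) * t = 0"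
      using e1 s0 \<phi>(3) by (simp add: linear_add[OF \<phi>(1)] linear_scale[OF \<phi>(1)] t_def)
    have f2: "Re (y j) * t - Im (y j) = 0"
      using e2 s0 \<phi>(3) by (simp add: linear_add[OF \<phi>(1)] linear_diff[OF \<phi>(1)] linear_scale[OF \<phi>(1)] linear_neg[OF \<phi>(1)]
        linear_add[OF A(1)] linear_scale[OF A(1)] AAw t_def)
    have im: "Im (y j) = Re (y j) * t" using f2 by simp
    have "Re (y j) * (1 + t * t) = 0" using f1 unfolding im by (simp add: algebra_simps)
    moreover have "1 + t * t \<noteq> 0" using zero_le_square[of t] by linarith
    ultimately have "Re (y j) = 0" by simp
    then show False using j(2) im by (simp add: complex_eq_iff)
  qed
  let ?B = "?G ` cs m"
  have scs: "subspace (cs m)" by (rule subspace_fun_space) simp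
  have sB: "subspace ?B" by (rule linear_subspace_image[OF linear_jordan_span scs])
  have fB: "fin_dim ?B" by (rule fin_dim_image[OF fin_dim_cs linear_jordan_span])
  have inj0: "y = 0" if "y \<in> cs m" "?G y = 0" for y
    using inj[OF that(1)] that(2) subspace_0[OF sC] by simp
  have dB: "dim ?B = 2 * m" using dim_image_inj[OF linear_jordan_span scs fin_dim_cs inj0] dim_cs[of m] by simp
  have BC: "?B \<inter> C = {0}"
  proof -
    have "x = 0" if x: "x \<in> ?B" "x \<in> C" for x
    proof -
      obtain y where y: "y \<in> cs m" "x = ?G y" using x(1) by blast
      have "y = 0" using inj[OF y(1)] x(2) y(2) by simp
      then show ?thesis using y(2) linear_0[OF linear_jordan_span] by simp
    qed
    then show ?thesis using subspace_0[OF sB] subspace_0[OF sC] by blast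
  qed
  define T where "T v = (\<lambda>j. if j < m then Complex (\<phi> ((N ^^ j) v)) (\<phi> ((N ^^ j) (A v))) else 0)" for v
  have lT: "linear T" unfolding T_def
    by (rule linearI) (auto simp: fun_eq_iff complex_eq_iff linear_add[OF pN] linear_scale[OF pN]
      linear_add[OF A(1)] linear_scale[OF A(1)] linear_add[OF \<phi>(1)] linear_scale[OF \<phi>(1)])
  have "{x \<in> U. T x = 0} \<subseteq> C"
  proof
    fix x assume "x \<in> {x \<in> U. T x = 0}"
    then have x: "x \<in> U" "T x = 0" by auto
    have "\<phi> ((N ^^ j) x) = 0 \<and> \<phi> ((N ^^ j) (A x)) = 0" for j
    proof (cases "j < m")
      case True
      have "T x j = 0" using x(2) by simp
      then show ?thesis using True by (simp add: T_def complex_eq_iff)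
    next
      case False then show ?thesis using \<phi>hi x(1) A(2) by simp
    qed
    then show "x \<in> C" using x(1) by (simp add: C_def)
  qed
  then have "dim {x \<in> U. T x = 0} \<le> dim C" by (rule dim_mono_fin[OF fin_dim_mono[OF U(2) CU]])
  moreover have "dim (T ` U) \<le> 2 * m"
  proof -
    have "T ` U \<subseteq> cs m" by (auto simp: T_def fun_space_def)
    then have "dim (T ` U) \<le> dim (cs m)" by (rule dim_mono_fin[OF fin_dim_cs])
    then show ?thesis by (simp only: dim_cs)
  qed
  moreover have fC: "fin_dim C" by (rule fin_dim_mono[OF U(2) CU])
  ultimately have "dim U \<le> dim (?B \<oplus>\<^sub>s C)"
    using dim_direct_sum[OF sB sC fB fC BC] rank_nullity[OF lT U] dB by linarith
  moreover have "?B \<subseteq> U" using GU by blast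
  ultimately have UBC: "U = ?B \<oplus>\<^sub>s C"
    using subspace_eq_of_dim_le[OF U(2) subspace_ssum[OF sB sC] U(1) ssum_least[OF U(1) _ CU]] by simp
  show ?thesis
    using m1 eU Ne0 NeS inj0 sC CU AC NC BC UBC
    by (intro exI[of _ m] exI[of _ e] exI[of _ C]) simp
qed

text \<open>As \<open>q \<noteq> quat_i, - quat_i\<close>, the elements \<open>quat_i\<close> and \<open>q\<close> generate all quaternions.\<close>

lemma quat_generated:
  assumes S: "subspace S" and q: "q \<in> S2" "q \<noteq> quat_i" "q \<noteq> - quat_i" and \<tau>: "\<tau> \<in> Aut_quat"
    and i: "\<And>x. x \<in> S \<Longrightarrow> hmul (\<tau> quat_i) x \<in> S" and p: "\<And>x. x \<in> S \<Longrightarrow> hmul (\<tau> q) x \<in> S"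
  shows "hsub S"
proof -
  have t: "linear \<tau>" "\<And>a b. \<tau> (a * b) = \<tau> a * \<tau> b" "\<tau> 1 = 1" "surj \<tau>" using \<tau> by (auto simp: Aut_quat_def bij_is_surj)
  define a b c where "a = qI q" and "b = qJ q" and "c = qK q"
  define r where "r = b * b + c * c"
  have "r \<noteq> 0"
  proof
    assume "r = 0"
    then have "b = 0" "c = 0" unfolding r_def by (simp_all add: add_nonneg_eq_0_iff)
    moreover from this have "a = 1 \<or> a = -1" using q(1) by (simp add: S2_iff a_def b_def c_def power2_eq_1_iff)
    ultimately show False using q unfolding a_def b_def c_def by (auto simp: quat_simps S2_iff)
  qed
  have j: "quat_j = inverse r *\<^sub>R (b *\<^sub>R (q - a *\<^sub>R quat_i) - c *\<^sub>R (quat_i * q + a *\<^sub>R 1))"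
  proof -
    have "r *\<^sub>R quat_j = b *\<^sub>R (q - a *\<^sub>R quat_i) - c *\<^sub>R (quat_i * q + a *\<^sub>R 1)"
      using q(1) by (simp add: quat_simps S2_iff r_def a_def b_def c_def)
    then show ?thesis using \<open>r \<noteq> 0\<close> by (metis scaleR_scaleR left_inverse scaleR_one)
  qed
  define R where "R = {z. \<forall>x\<in>S. hmul (\<tau> z) x \<in> S}"
  have RI: "quat_i \<in> R" "q \<in> R" "1 \<in> R" using i p by (auto simp: R_def t(3))
  have Rm: "z * w \<in> R" if "z \<in> R" "w \<in> R" for z w using that by (auto simp: R_def t(2) hmul_simps)
  have sR: "subspace R" unfolding subspace_def R_def using S
    by (auto simp: linear_0[OF t(1)] linear_add[OF t(1)] linear_scale[OF t(1)] hmul_simps subspace_0 subspace_add subspace_scale)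
  have rj: "quat_j \<in> R"
    by (subst j) (intro subspace_scale[OF sR] subspace_diff[OF sR] subspace_add[OF sR] Rm RI)
  have "quat_k = quat_i * quat_j" by (simp add: quat_simps)
  then have rk: "quat_k \<in> R" using Rm[OF RI(1) rj] by simp
  have all: "z \<in> R" for z
    by (subst quat_span[of z]) (intro subspace_add[OF sR] subspace_scale[OF sR] RI rj rk)
  show ?thesis unfolding hsub_def
  proof (intro conjI allI ballI S)
    fix z x assume x: "x \<in> S"
    obtain z' where "z = \<tau> z'" using t(4) by (metis surjD)
    then show "hmul z x \<in> S" using all[of z'] x by (simp add: R_def)
  qed
qed

text \<open>Take \<open>q0\<close> with \<open>E = U \<oplus> q0 U\<close> and \<open>p\<close> with \<open>p u0 \<in> U\<close> for some nonzero \<open>u0 \<in> U\<close>, and write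
  \<open>p x = A x + q0 (N x)\<close> on \<open>U\<close>. Since \<open>p (p x) = - x\<close> and \<open>p q0 + q0 p\<close> is real, \<open>A\<close> and \<open>N\<close> commute and satisfy the quadratic
  relation of \<open>jordan_block_splits\<close>; moreover \<open>N u0 = 0\<close>. A Jordan block \<open>B\<close> of \<open>N\<close> has a basis
  \<open>e i, p (e i) + q0 (e (i - 1))\<close>, which after a rotation of \<open>q0\<close> to \<open>i\<close> is the basis of some \<open>W_{m,q}\<close>. Its complement \<open>C\<close> in
  \<open>U\<close> gives the complement \<open>C \<oplus> q0 C\<close> in \<open>E\<close>.\<close>

lemma regular_summand:
  assumes E: "hsub E" "E \<subseteq> quat_tuples n" "E \<noteq> {0}" and U: "subspace U" "U \<subseteq> E"
    and half: "2 * dim U = dim E"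
    and semi: "\<And>K. hsub K \<Longrightarrow> K \<subseteq> E \<Longrightarrow> 2 * dim (U \<inter> K) \<le> dim K"
  shows "\<exists>k q \<tau> f I J. k \<ge> 1 \<and> q \<in> S2 \<and> splits U E I J \<and> \<tau> \<in> Aut_quat \<and> linear f \<and>
    (\<forall>x\<in>quat_tuples k. f x = 0 \<longrightarrow> x = 0) \<and> f ` quat_tuples k = I \<and> f ` W_sub k q = U \<inter> I \<and>
    (\<forall>p x. f (hmul p x) = hmul (\<tau> p) (f x))"
proof -
  have sE: "subspace E" using E hsub_subspace by blast
  have fE: "fin_dim E" by (rule fin_dim_sub_tuples[OF E(2)])
  have fU: "fin_dim U" by (rule fin_dim_mono[OF fE U(2)])
  obtain q0 where q0: "q0 \<in> S2" "\<forall>u\<in>U. hmul q0 u \<in> U \<longrightarrow> u = 0"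
    using regular_direction_exists[OF E(1,2) U semi] by blast
  let ?Q = "hmul q0 ` U"
  have sQ: "subspace ?Q" by (rule linear_subspace_image[OF linear_hmul U(1)])
  have fQ: "fin_dim ?Q" by (rule fin_dim_image[OF fU linear_hmul])
  have int: "?Q \<inter> U = {0}"
  proof -
    have "x = 0" if x: "x \<in> ?Q" "x \<in> U" for x
    proof -
      obtain y where y: "y \<in> U" "x = hmul q0 y" using x(1) by blast
      then have "y = 0" using q0(2) x(2) by blast
      then show ?thesis using y(2) by simp
    qed
    then show ?thesis using subspace_0[OF sQ] subspace_0[OF U(1)] by blast
  qed
  have QE: "?Q \<subseteq> E" using hsub_hmul[OF E(1)] U(2) by blast
  have dQ: "dim ?Q = dim U" by (rule dim_image_inj[OF linear_hmul U(1) fU]) (use S2_nonzero[OF q0(1)] in \<open>simp add: hmul_eq_0\<close>)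
  have int': "U \<inter> ?Q = {0}" using int by (simp only: Int_commute)
  have "dim (U \<oplus>\<^sub>s ?Q) = dim E" using dim_direct_sum[OF U(1) sQ fU fQ int'] dQ half by simp
  then have dec: "E = U \<oplus>\<^sub>s ?Q"
    using subspace_eq_of_dim_le[OF fE subspace_ssum[OF U(1) sQ] sE ssum_least[OF sE U(2) QE]] by simp
  obtain p u0 where p: "p \<in> S2" and u0: "u0 \<in> U" "u0 \<noteq> 0" "hmul p u0 \<in> U"
    using singular_direction_exists[OF E U q0(1) q0(2)[rule_format] dec] by blast
  obtain pU where pU: "linear pU" "range pU \<subseteq> U" "\<forall>x\<in>?Q. pU x = 0" "\<forall>x\<in>U. pU x = x"
    using projection_exists[OF sQ U(1) int] by blast
  have pUU: "pU x \<in> U" for x using pU(2) by blast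
  define A where "A x = pU (hmul p x)" for x
  define N where "N x = - pU (hmul q0 (hmul p x))" for x
  have lA: "linear A" unfolding A_def using linear_compose[OF linear_hmul pU(1), of p] by (simp only: o_def)
  have lN: "linear N" unfolding N_def
    by (rule linearI) (simp_all add: hmul_simps linear_add[OF pU(1)] linear_scale[OF pU(1)])
  have AU: "A x \<in> U" and NU: "N x \<in> U" for x unfolding A_def N_def using pUU subspace_neg[OF U(1)] by auto
  have pAN: "hmul p x = A x + hmul q0 (N x)" if x: "x \<in> U" for x
  proof -
    have "hmul p x \<in> U \<oplus>\<^sub>s ?Q" using dec hsub_hmul[OF E(1)] x U(2) by blast
    then obtain y z where yz: "hmul p x = y + z" "y \<in> U" "z \<in> ?Q" by (rule ssumE)
    obtain v where v: "v \<in> U" "z = hmul q0 v" using yz(3) by blast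
    have "pU z = 0" "pU y = y" using yz(2,3) pU(3,4) by blast+
    then have "A x = y" unfolding A_def yz(1) by (simp add: linear_add[OF pU(1)])
    moreover have "N x = v"
    proof -
      have e: "hmul q0 (hmul p x) = hmul q0 y - v" unfolding yz(1) v(2) by (simp add: hmul_simps(2) S2_hmul_square[OF q0(1)])
      have "pU (hmul q0 y) = 0" using yz(2) pU(3) by blast
      then show ?thesis unfolding N_def e using v(1) pU(4) by (simp add: linear_diff[OF pU(1)])
    qed
    ultimately show ?thesis using yz(1) v(2) by simp
  qed
  have uniq: "a = 0 \<and> b = 0" if "a \<in> U" "b \<in> U" "a + hmul q0 b = 0" for a b
  proof -
    have e: "hmul q0 b = - a" using that(3) by (simp add: eq_neg_iff_add_eq_0 add.commute)
    then have "hmul q0 b \<in> U" using subspace_neg[OF U(1) that(1)] by simp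
    then have "b = 0" using q0(2) that(2) by blast
    then show ?thesis using e by simp
  qed
  define c where "c = 2 * (q0 \<bullet> p)"
  have pq: "p * q0 = - (c *\<^sub>R 1) - q0 * p"
    using p q0(1) by (simp add: quat_simps S2_iff c_def)
  have pq0: "hmul p (hmul q0 x) = - (c *\<^sub>R x) - hmul q0 (hmul p x)" for x
    unfolding hmul_simps(3)[symmetric] pq by (simp add: hmul_simps(4,6,8))
  \<comment> \<open>Compare the components of \<open>p (p x) = - x\<close> in \<open>U \<oplus> q0 U\<close>.\<close>
  have rel: "A (N x) = N (A x) \<and> A (A x) = - x + c *\<^sub>R N x - N (N x)" if x: "x \<in> U" for x
  proof -
    have "- x = hmul p (A x) + hmul p (hmul q0 (N x))"
      using S2_hmul_square[OF p, of x] unfolding pAN[OF x] by (simp add: hmul_simps(2))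
    also have "\<dots> = (A (A x) + hmul q0 (N (A x))) + (- (c *\<^sub>R N x) - hmul q0 (A (N x) + hmul q0 (N (N x))))"
      unfolding pq0 pAN[OF AU] pAN[OF NU] ..
    also have "\<dots> = (A (A x) - c *\<^sub>R N x + N (N x)) + hmul q0 (N (A x) - A (N x))"
      by (simp add: hmul_simps(2,7) S2_hmul_square[OF q0(1)])
    finally have "(x + (A (A x) - c *\<^sub>R N x + N (N x))) + hmul q0 (N (A x) - A (N x)) = 0"
      by (simp add: add.assoc eq_neg_iff_add_eq_0 neg_eq_iff_add_eq_0)
    then have "x + (A (A x) - c *\<^sub>R N x + N (N x)) = 0 \<and> N (A x) - A (N x) = 0"
      by (rule uniq[rotated 2]) (intro subspace_add[OF U(1)] subspace_diff[OF U(1)] subspace_scale[OF U(1)] AU NU x)+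
    then show ?thesis by (simp add: algebra_simps eq_neg_iff_add_eq_0 add_eq_0_iff)
  qed
  then have rel': "\<forall>x\<in>U. A (N x) = N (A x) \<and> A (A x) = - x + c *\<^sub>R N x - N (N x)" by blast
  have Nu0: "N u0 = 0"
  proof -
    have "hmul q0 (N u0) = hmul p u0 - A u0" using pAN[OF u0(1)] by simp
    also have "\<dots> \<in> U" by (rule subspace_diff[OF U(1) u0(3) AU])
    finally show ?thesis using q0(2) NU by blast
  qed
  obtain m e C where m: "m \<ge> 1" and e: "\<forall>i<m. e i \<in> U" and Ne0: "N (e 0) = 0"
    and NeS: "\<forall>i. Suc i < m \<longrightarrow> N (e (Suc i)) = - e i"
    and ginj: "\<forall>y\<in>cs m. jordan_span e A m y = 0 \<longrightarrow> y = 0"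
    and C: "subspace C" "C \<subseteq> U" "A ` C \<subseteq> C" "N ` C \<subseteq> C"
    and BC: "jordan_span e A m ` cs m \<inter> C = {0}" and UBC: "U = jordan_span e A m ` cs m \<oplus>\<^sub>s C"
    using jordan_block_splits[OF U(1) fU lA AU lN NU rel' u0(1,2) Nu0]
    by (elim exE conjE) (rule that; assumption)
  define B where "B = jordan_span e A m ` cs m"
  obtain \<tau> where tau: "\<tau> \<in> Aut_quat" "\<tau> quat_i = q0" using rotation_to[OF q0(1)] by blast
  have \<tau>: "linear \<tau>" "\<And>a b. \<tau> (a * b) = \<tau> a * \<tau> b" "\<tau> 1 = 1" "surj \<tau>" using tau(1) by (auto simp: Aut_quat_def bij_is_surj)
  obtain q where q: "\<tau> q = p" using \<tau>(4) by (metis surjD)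
  have \<tau>inj: "inj \<tau>" using tau(1) by (auto simp: Aut_quat_def bij_is_inj)
  have qS: "q \<in> S2"
  proof -
    have "\<tau> (q * q) = \<tau> (-1)" using S2_square[OF p] linear_neg[OF \<tau>(1), of 1] by (simp add: \<tau>(2,3) q)
    then have "q * q = -1" using \<tau>inj by (simp add: inj_eq)
    then show ?thesis by (simp add: S2_square_iff)
  qed
  have qi: "q \<noteq> quat_i"
  proof
    assume "q = quat_i"
    then have "p = q0" using q tau(2) by simp
    then show False using q0(2) u0 by blast
  qed
  have qi': "q \<noteq> - quat_i"
  proof
    assume "q = - quat_i"
    then have "p = - q0" using q tau(2) linear_neg[OF \<tau>(1), of quat_i] by simp
    then have "hmul q0 u0 \<in> U" using subspace_neg[OF U(1) u0(3)] by (simp add: hmul_simps(8))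
    then show False using q0(2) u0 by blast
  qed
  define f where "f x = (\<Sum>l<m. hmul (\<tau> (x l)) (e l))" for x
  have lf: "linear f" unfolding f_def
    by (rule linearI) (simp_all add: linear_add[OF \<tau>(1)] linear_scale[OF \<tau>(1)] hmul_simps(1,4) sum.distrib scaleR_sum_right)
  have ftw: "f (hmul z x) = hmul (\<tau> z) (f x)" for z x
    unfolding f_def by (simp add: \<tau>(2) hmul_simps(3) hmul_sum)
  have \<tau>r: "\<tau> (of_real r) = of_real r" for r using linear_scale[OF \<tau>(1), of r 1] \<tau>(3) by (simp add: of_real_def)
  \<comment> \<open>The general element of \<open>W_sub\<close>, with \<open>quat_i\<close> and \<open>q\<close> rotated to \<open>q0\<close> and \<open>p\<close>. The terms in \<open>q0\<close> are
    moved up by one index to meet those in \<open>p\<close>.\<close>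
  have chain: "f x = jordan_span e A m (\<lambda>i. if i < m then Complex (a i) (b i) else 0)"
    if b: "b m = 0" and x: "\<And>i. i < m \<Longrightarrow> x i = of_real (a i) + b i *\<^sub>R q + b (i + 1) *\<^sub>R quat_i" for x a b
  proof -
    define e' where "e' i = (if i = 0 then 0 else e (i - 1))" for i
    have pe: "hmul p (e i) + hmul q0 (e' i) = A (e i)" if i: "i < m" for i
    proof (cases i)
      case 0 then show ?thesis using pAN[of "e 0"] e i Ne0 by (simp add: e'_def)
    next
      case (Suc i') then show ?thesis using pAN[of "e i"] e i NeS by (simp add: e'_def hmul_simps(9))
    qed
    have s1: "(\<Sum>i<m. b (i + 1) *\<^sub>R hmul q0 (e i)) = (\<Sum>i<m. b i *\<^sub>R hmul q0 (e' i))"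
    proof -
      have "(\<Sum>i<Suc m. b i *\<^sub>R hmul q0 (e' i)) = (\<Sum>i<m. b (i + 1) *\<^sub>R hmul q0 (e i))"
        unfolding sum.lessThan_Suc_shift by (simp add: e'_def)
      then show ?thesis using b by simp
    qed
    have "f x = (\<Sum>i<m. a i *\<^sub>R e i + b i *\<^sub>R hmul p (e i) + b (i + 1) *\<^sub>R hmul q0 (e i))"
      unfolding f_def using x
      by (intro sum.cong) (simp_all add: linear_add[OF \<tau>(1)] linear_scale[OF \<tau>(1)] \<tau>r q tau(2) hmul_simps(1,4))
    also have "\<dots> = (\<Sum>i<m. a i *\<^sub>R e i + b i *\<^sub>R hmul p (e i)) + (\<Sum>i<m. b i *\<^sub>R hmul q0 (e' i))"
      unfolding sum.distrib s1 ..
    also have "\<dots> = (\<Sum>i<m. a i *\<^sub>R e i + b i *\<^sub>R (hmul p (e i) + hmul q0 (e' i)))"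
      by (simp add: sum.distrib scaleR_add_right add.assoc)
    also have "\<dots> = (\<Sum>i<m. a i *\<^sub>R e i + b i *\<^sub>R A (e i))" using pe by (intro sum.cong) auto
    also have "\<dots> = jordan_span e A m (\<lambda>i. if i < m then Complex (a i) (b i) else 0)"
      unfolding jordan_span_def by (intro sum.cong) auto
    finally show ?thesis .
  qed
  have W: "W_sub m q = {x \<in> quat_tuples m. \<exists>a b :: nat \<Rightarrow> real. b m = 0 \<and>
      (\<forall>i<m. x i = of_real (a i) + b i *\<^sub>R q + b (i + 1) *\<^sub>R quat_i)}"
    unfolding W_sub_def using qi qi' by simp
  have fW: "f ` W_sub m q = B"
  proof
    show "f ` W_sub m q \<subseteq> B"
    proof (rule image_subsetI)
      fix x assume "x \<in> W_sub m q"
      then obtain a b :: "nat \<Rightarrow> real" where ab: "b m = 0" "\<forall>i<m. x i = of_real (a i) + b i *\<^sub>R q + b (i + 1) *\<^sub>R quat_i"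
        unfolding W by blast
      have "f x = jordan_span e A m (\<lambda>i. if i < m then Complex (a i) (b i) else 0)" by (rule chain) (use ab in auto)
      then show "f x \<in> B" unfolding B_def by (auto simp: fun_space_def)
    qed
    show "B \<subseteq> f ` W_sub m q"
    proof
      fix z assume "z \<in> B"
      then obtain y where y: "y \<in> cs m" "z = jordan_span e A m y" unfolding B_def by blast
      define x where "x i = (if i < m then of_real (Re (y i)) + Im (y i) *\<^sub>R q + Im (y (i + 1)) *\<^sub>R quat_i else 0)" for i
      have "f x = jordan_span e A m (\<lambda>i. if i < m then Complex (Re (y i)) (Im (y i)) else 0)"
        by (rule chain) (use y(1) in \<open>auto simp: fun_space_def x_def\<close>)
      also have "(\<lambda>i. if i < m then Complex (Re (y i)) (Im (y i)) else 0) = y" using y(1) by (auto simp: fun_space_def fun_eq_iff)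
      finally have "z = f x" using y(2) by simp
      moreover have "\<exists>a b :: nat \<Rightarrow> real. b m = 0 \<and> (\<forall>i<m. x i = of_real (a i) + b i *\<^sub>R q + b (i + 1) *\<^sub>R quat_i)"
        by (rule exI[of _ "\<lambda>i. Re (y i)"], rule exI[of _ "\<lambda>i. Im (y i)"]) (use y(1) in \<open>auto simp: x_def fun_space_def\<close>)
      then have "x \<in> W_sub m q" unfolding W by (simp add: quat_tuples_def x_def)
      ultimately show "z \<in> f ` W_sub m q" by blast
    qed
  qed
  define I where "I = f ` quat_tuples m"
  have sI: "subspace I" unfolding I_def by (rule linear_subspace_image[OF lf subspace_tuples])
  have hI: "hsub I"
  proof (rule quat_generated[OF sI qS qi qi' tau(1)])
    have "hmul (\<tau> z) y \<in> I" if "y \<in> I" for z y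
      using that hsub_hmul[OF hsub_tuples] ftw unfolding I_def by (metis (no_types, lifting) image_iff)
    then show "\<And>x. x \<in> I \<Longrightarrow> hmul (\<tau> quat_i) x \<in> I" "\<And>x. x \<in> I \<Longrightarrow> hmul (\<tau> q) x \<in> I" by auto
  qed
  have scs: "subspace (cs m)" by (rule subspace_fun_space) simp
  have sB: "subspace B" unfolding B_def by (rule linear_subspace_image[OF linear_jordan_span scs])
  have BU: "B \<subseteq> U" unfolding UBC B_def[symmetric] by (rule ssum_sup1[OF C(1)])
  have fB: "fin_dim B" by (rule fin_dim_mono[OF fU BU])
  have "dim B = dim (cs m)" unfolding B_def
    by (rule dim_image_inj[OF linear_jordan_span scs fin_dim_cs]) (use ginj in blast)
  then have dB: "dim B = 2 * m" by (simp only: dim_cs)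
  have BI: "B \<subseteq> I" unfolding fW[symmetric] I_def W by blast
  let ?QB = "hmul q0 ` B"
  have sQB: "subspace ?QB" by (rule linear_subspace_image[OF linear_hmul sB])
  have fQB: "fin_dim ?QB" by (rule fin_dim_image[OF fB linear_hmul])
  have dQB: "dim ?QB = 2 * m" using dim_image_inj[OF linear_hmul sB fB, of q0] S2_nonzero[OF q0(1)] dB by (simp add: hmul_eq_0)
  have "B \<inter> ?QB = {0}" using int' BU subspace_0[OF sB] subspace_0[OF sQB] by blast
  then have dBQ: "dim (B \<oplus>\<^sub>s ?QB) = 4 * m" using dim_direct_sum[OF sB sQB fB fQB] dB dQB by simp
  have fI: "fin_dim I" unfolding I_def by (rule fin_dim_image[OF fin_dim_tuples lf])
  have rn: "4 * m = dim I + dim {x \<in> quat_tuples m. f x = 0}"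
    unfolding I_def dim_tuples[symmetric] by (rule rank_nullity[OF lf subspace_tuples fin_dim_tuples])
  have BQI: "B \<oplus>\<^sub>s ?QB \<subseteq> I" using BI hsub_hmul[OF hI] by (intro ssum_least[OF sI BI]) blast
  have dI: "dim I = 4 * m" using rn dim_mono_fin[OF fI BQI] dBQ by linarith
  have Ieq: "I = B \<oplus>\<^sub>s ?QB"
    using subspace_eq_of_dim_le[OF fI subspace_ssum[OF sB sQB] sI BQI] dI dBQ by simp
  have "dim {x \<in> quat_tuples m. f x = 0} = 0" using rn dI by simp
  moreover have "subspace {x \<in> quat_tuples m. f x = 0}"
    unfolding subspace_def using subspace_tuples[of m]
    by (auto simp: subspace_0 subspace_add subspace_scale linear_0[OF lf] linear_add[OF lf] linear_scale[OF lf])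
  ultimately have "{x \<in> quat_tuples m. f x = 0} = {0}"
    by (intro dim_eq_0_fin fin_dim_mono[OF fin_dim_tuples[of m]]) auto
  then have finj: "\<forall>x\<in>quat_tuples m. f x = 0 \<longrightarrow> x = 0" by blast
  have UI: "U \<inter> I = B"
  proof
    show "B \<subseteq> U \<inter> I" using BU BI by blast
    show "U \<inter> I \<subseteq> B"
    proof
      fix x assume x: "x \<in> U \<inter> I"
      then have "x \<in> B \<oplus>\<^sub>s ?QB" using Ieq by simp
      then obtain b z where bz: "x = b + z" "b \<in> B" "z \<in> ?QB" by (rule ssumE)
      have "z = x - b" using bz(1) by simp
      then have "z \<in> U" using x bz(2) BU subspace_diff[OF U(1), of x b] by auto
      then have "z = 0" using bz(3) BU int by blast
      then show "x \<in> B" using bz by simp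
    qed
  qed
  let ?QC = "hmul q0 ` C"
  define J where "J = C \<oplus>\<^sub>s ?QC"
  have sQC: "subspace ?QC" by (rule linear_subspace_image[OF linear_hmul C(1)])
  have sJ: "subspace J" unfolding J_def by (rule subspace_ssum[OF C(1) sQC])
  have CJ: "C \<subseteq> J" unfolding J_def by (rule ssum_sup1[OF sQC])
  have QCJ: "hmul q0 x \<in> J" if "x \<in> C" for x using ssum_sup2[OF C(1), of ?QC] that unfolding J_def by blast
  have hJ: "hsub J"
  proof (rule quat_generated[OF sJ qS qi qi' tau(1)])
    fix x assume "x \<in> J"
    then obtain y z where yz: "x = y + z" "y \<in> C" "z \<in> ?QC" unfolding J_def by (rule ssumE)
    obtain w where w: "w \<in> C" "z = hmul q0 w" using yz(3) by blast
    have "hmul q0 x = hmul q0 y - w" unfolding yz(1) w(2) by (simp add: hmul_simps(2) S2_hmul_square[OF q0(1)])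
    then show "hmul (\<tau> quat_i) x \<in> J" unfolding tau(2) using QCJ[OF yz(2)] w(1) CJ by (auto intro: subspace_diff[OF sJ])
    have py: "hmul p v = A v + hmul q0 (N v)" "A v \<in> C" "N v \<in> C" if "v \<in> C" for v
      using pAN C that by auto
    have pJ: "hmul p v \<in> J" if "v \<in> C" for v unfolding py(1)[OF that]
      using py(2,3)[OF that] CJ QCJ by (auto intro: subspace_add[OF sJ])
    have "hmul p z = - (c *\<^sub>R w) - hmul q0 (A w) + N w"
      unfolding w(2) pq0 py(1)[OF w(1)] by (simp add: hmul_simps(2) S2_hmul_square[OF q0(1)])
    also have "\<dots> \<in> J" using w(1) py(2,3)[OF w(1)] CJ QCJ
      by (intro subspace_add[OF sJ] subspace_diff[OF sJ] subspace_neg[OF sJ] subspace_scale[OF sJ]) auto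
    finally show "hmul (\<tau> q) x \<in> J" unfolding q yz(1) hmul_simps(2) using pJ[OF yz(2)] by (intro subspace_add[OF sJ])
  qed
  have sum0: "a = 0 \<and> b = 0" if "a \<in> U" "b \<in> U" "a + hmul q0 b = 0" for a b by (rule uniq[OF that])
  have IJ: "I \<inter> J = {0}"
  proof -
    have "x = 0" if x: "x \<in> I" "x \<in> J" for x
    proof -
      have "x \<in> B \<oplus>\<^sub>s ?QB" using x(1) Ieq by simp
      then obtain b z where bz: "x = b + z" "b \<in> B" "z \<in> ?QB" by (rule ssumE)
      obtain b' where b': "b' \<in> B" "z = hmul q0 b'" using bz(3) by blast
      obtain d y where dy: "x = d + y" "d \<in> C" "y \<in> ?QC" using x(2) unfolding J_def by (rule ssumE)
      obtain d' where d': "d' \<in> C" "y = hmul q0 d'" using dy(3) by blast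
      have "(b - d) + hmul q0 (b' - d') = 0" using bz(1) dy(1) b'(2) d'(2) by (simp add: hmul_simps(7) algebra_simps)
      moreover have "b - d \<in> U" "b' - d' \<in> U" using bz(2) b'(1) dy(2) d'(1) BU C(2) by (auto intro: subspace_diff[OF U(1)])
      ultimately have "b - d = 0 \<and> b' - d' = 0" by (intro uniq)
      then have "b = d" "b' = d'" by auto
      then have "b \<in> B \<inter> C" "b' \<in> B \<inter> C" using bz(2) dy(2) b'(1) d'(1) by auto
      then have "b = 0" "b' = 0" using BC unfolding B_def[symmetric] by auto
      then show ?thesis using bz(1) b'(2) by simp
    qed
    then show ?thesis using subspace_0[OF sI] subspace_0[OF sJ] by blast
  qed
  have IE: "I \<subseteq> E" unfolding Ieq using BU U(2) hsub_hmul[OF E(1)] by (intro ssum_least[OF sE]) blast+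
  have JE: "J \<subseteq> E" unfolding J_def using C(2) U(2) hsub_hmul[OF E(1)] by (intro ssum_least[OF sE]) blast+
  have UIJ: "U = (U \<inter> I) \<oplus>\<^sub>s (U \<inter> J)"
  proof
    show "U \<subseteq> (U \<inter> I) \<oplus>\<^sub>s (U \<inter> J)"
    proof
      fix x assume "x \<in> U"
      then have "x \<in> B \<oplus>\<^sub>s C" using UBC B_def by simp
      then obtain b d where bd: "x = b + d" "b \<in> B" "d \<in> C" by (rule ssumE)
      show "x \<in> (U \<inter> I) \<oplus>\<^sub>s (U \<inter> J)" unfolding bd(1) using bd(2,3) UI CJ C(2) by (intro ssumI) auto
    qed
    show "(U \<inter> I) \<oplus>\<^sub>s (U \<inter> J) \<subseteq> U" by (intro ssum_least[OF U(1)]) auto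
  qed
  have EIJ: "E = I \<oplus>\<^sub>s J"
  proof
    show "I \<oplus>\<^sub>s J \<subseteq> E" by (rule ssum_least[OF sE IE JE])
    have sIJ: "subspace (I \<oplus>\<^sub>s J)" by (rule subspace_ssum[OF sI sJ])
    have hIJ: "hsub (I \<oplus>\<^sub>s J)" by (rule hsub_ssum[OF hI hJ])
    have "U \<subseteq> I \<oplus>\<^sub>s J" by (subst UIJ) (auto elim!: ssumE intro!: ssumI)
    then have "U \<subseteq> I \<oplus>\<^sub>s J" "?Q \<subseteq> I \<oplus>\<^sub>s J" using hsub_hmul[OF hIJ] by blast+
    then show "E \<subseteq> I \<oplus>\<^sub>s J" unfolding dec by (intro ssum_least[OF sIJ])
  qed
  have sp: "splits U E I J" unfolding splits_def using hI hJ IJ EIJ UIJ by blast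
  show ?thesis
    by (intro exI[of _ m] exI[of _ q] exI[of _ \<tau>] exI[of _ f] exI[of _ I] exI[of _ J] conjI)
      (use m qS sp tau(1) lf finj I_def fW UI ftw in auto)
qed

section \<open>The theorem of Krull and Schmidt\<close>

text \<open>A triple \<open>(\<rho>, U, E)\<close> of operators, subspace and space. A pair with a chosen representative \<open>\<rho>\<close> of
  its structure is such an object, and so is a quaternionic subspace of tuples with \<open>hmul\<close>; morphisms commute with the
  chosen operators.\<close>

type_synonym 'b obj = "(quat \<Rightarrow> 'b \<Rightarrow> 'b) \<times> 'b set \<times> 'b set"

definition carr :: "'b obj \<Rightarrow> 'b set" where "carr X = snd (snd X)"

definition obj :: "'b::real_vector obj \<Rightarrow> bool" where
  "obj = (\<lambda>(\<rho>, U, E). subspace E \<and> subspace U \<and> U \<subseteq> E \<and>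
     (\<forall>q. \<rho> q ` E \<subseteq> E \<and> linear_from E (\<rho> q)))"

definition mor :: "'b::real_vector obj \<Rightarrow> 'c::real_vector obj \<Rightarrow> ('b \<Rightarrow> 'c) \<Rightarrow> bool" where
  "mor = (\<lambda>(\<rho>, U, E) (\<rho>', U', E') f. linear_from E f \<and> f ` E \<subseteq> E' \<and> f ` U \<subseteq> U' \<and>
     (\<forall>q. \<forall>x\<in>E. f (\<rho> q x) = \<rho>' q (f x)))"

definition inverses :: "'b::real_vector obj \<Rightarrow> 'c::real_vector obj \<Rightarrow> ('b \<Rightarrow> 'c) \<Rightarrow> ('c \<Rightarrow> 'b) \<Rightarrow> bool" where
  "inverses X Y f g \<longleftrightarrow> mor X Y f \<and> mor Y X g \<and> (\<forall>x\<in>carr X. g (f x) = x) \<and> (\<forall>y\<in>carr Y. f (g y) = y)"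

definition objiso :: "'b::real_vector obj \<Rightarrow> 'c::real_vector obj \<Rightarrow> bool" where
  "objiso X Y \<longleftrightarrow> (\<exists>f g. inverses X Y f g)"

text \<open>The endomorphism ring is local.\<close>

definition local_obj :: "'b::real_vector obj \<Rightarrow> bool" where
  "local_obj X \<longleftrightarrow> carr X \<noteq> {0} \<and> (\<forall>f g. mor X X f \<longrightarrow> mor X X g \<longrightarrow> (\<forall>x\<in>carr X. f x + g x = x) \<longrightarrow>
     (\<exists>h. inverses X X f h) \<or> (\<exists>h. inverses X X g h))"

lemma obj_zero: "obj X \<Longrightarrow> 0 \<in> carr X"
  by (auto simp: obj_def carr_def subspace_0)

lemma mor_in: "mor X Y f \<Longrightarrow> x \<in> carr X \<Longrightarrow> f x \<in> carr Y"
  by (auto simp: mor_def carr_def split: prod.splits)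

lemma mor_add: "mor X Y f \<Longrightarrow> x \<in> carr X \<Longrightarrow> y \<in> carr X \<Longrightarrow> f (x + y) = f x + f y"
  by (auto simp: mor_def carr_def linear_from_def split: prod.splits)

lemma mor_zero: assumes "mor X Y f" "obj X" shows "f 0 = 0"
  using mor_add[OF assms(1) obj_zero[OF assms(2)] obj_zero[OF assms(2)]] by simp

lemma obj_diff: "obj X \<Longrightarrow> x \<in> carr X \<Longrightarrow> y \<in> carr X \<Longrightarrow> x - y \<in> carr X"
  by (auto simp: obj_def carr_def subspace_diff)
lemma obj_sum: "obj X \<Longrightarrow> (\<And>i. i \<in> I \<Longrightarrow> f i \<in> carr X) \<Longrightarrow> sum f I \<in> carr X"
  by (auto simp: obj_def carr_def subspace_sum)

lemma mor_diff: assumes "mor X Y f" "obj X" "x \<in> carr X" "y \<in> carr X" shows "f (x - y) = f x - f y"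
  using mor_add[OF assms(1) obj_diff[OF assms(2-4)] assms(4)] by (simp add: algebra_simps)

lemma mor_sum: assumes "mor X Y f" "obj X" "finite I" "\<And>i. i \<in> I \<Longrightarrow> g i \<in> carr X"
  shows "f (\<Sum>i\<in>I. g i) = (\<Sum>i\<in>I. f (g i))"
  using assms(3,4)
proof (induction I)
  case empty show ?case using mor_zero[OF assms(1,2)] by simp
next
  case (insert i I)
  then show ?case using mor_add[OF assms(1), of "g i" "sum g I"] obj_sum[OF assms(2), of I g] by simp
qed

lemma mor_comp: assumes "mor X Y f" "mor Y Z g" shows "mor X Z (\<lambda>x. g (f x))"
proof -
  obtain \<rho> U E \<rho>' U' E' \<rho>'' U'' E'' where XY: "X = (\<rho>, U, E)" "Y = (\<rho>', U', E')" "Z = (\<rho>'', U'', E'')"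
    by (metis prod.exhaust)
  have f: "linear_from E f" "\<And>x. x \<in> E \<Longrightarrow> f x \<in> E'" "f ` U \<subseteq> U'" "\<And>q x. x \<in> E \<Longrightarrow> f (\<rho> q x) = \<rho>' q (f x)"
    and g: "linear_from E' g" "\<And>x. x \<in> E' \<Longrightarrow> g x \<in> E''" "g ` U' \<subseteq> U''" "\<And>q x. x \<in> E' \<Longrightarrow> g (\<rho>' q x) = \<rho>'' q (g x)"
    using assms by (auto simp: mor_def XY)
  show ?thesis unfolding mor_def XY prod.case
  proof (intro conjI allI ballI)
    show "linear_from E (\<lambda>x. g (f x))" using f(1,2) g(1) by (simp add: linear_from_def)
    show "(\<lambda>x. g (f x)) ` E \<subseteq> E''" using f(2) g(2) by blast
    show "(\<lambda>x. g (f x)) ` U \<subseteq> U''" using f(3) g(3) by blast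
    show "g (f (\<rho> q x)) = \<rho>'' q (g (f x))" if "x \<in> E" for q x using f(2,4)[OF that] g(4) by simp
  qed
qed

lemma mor_id: "mor X X (\<lambda>x. x)"
  by (auto simp: mor_def linear_from_def split: prod.splits)

lemma mor_diff_fun: assumes "mor X Y f" "mor X Y g" "obj Y" shows "mor X Y (\<lambda>x. f x - g x)"
proof -
  obtain \<rho> U E \<rho>' U' E' where XY: "X = (\<rho>, U, E)" "Y = (\<rho>', U', E')" by (metis prod.exhaust)
  have f: "linear_from E f" "f ` E \<subseteq> E'" "f ` U \<subseteq> U'" "\<And>q x. x \<in> E \<Longrightarrow> f (\<rho> q x) = \<rho>' q (f x)"
    and g: "linear_from E g" "g ` E \<subseteq> E'" "g ` U \<subseteq> U'" "\<And>q x. x \<in> E \<Longrightarrow> g (\<rho> q x) = \<rho>' q (g x)"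
    using assms(1,2) by (auto simp: mor_def XY)
  have Y: "subspace E'" "subspace U'" "\<And>q. linear_from E' (\<rho>' q)" using assms(3) by (auto simp: obj_def XY)
  have d: "\<rho>' q (x - y) = \<rho>' q x - \<rho>' q y" if "x \<in> E'" "y \<in> E'" for q x y
  proof -
    have "\<rho>' q ((x - y) + y) = \<rho>' q (x - y) + \<rho>' q y"
      using Y(3)[of q] subspace_diff[OF Y(1) that] that(2) unfolding linear_from_def by blast
    then show ?thesis by (simp add: algebra_simps)
  qed
  show ?thesis unfolding mor_def XY prod.case
  proof (intro conjI allI ballI)
    show "linear_from E (\<lambda>x. f x - g x)" using f(1) g(1) by (auto simp: linear_from_def algebra_simps)
    show "(\<lambda>x. f x - g x) ` E \<subseteq> E'" using f(2) g(2) by (auto intro!: subspace_diff[OF Y(1)])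
    show "(\<lambda>x. f x - g x) ` U \<subseteq> U'" using f(3) g(3) by (auto intro!: subspace_diff[OF Y(2)])
    show "f (\<rho> q x) - g (\<rho> q x) = \<rho>' q (f x - g x)" if "x \<in> E" for q x
    proof -
      have "f x \<in> E'" "g x \<in> E'" using that f(2) g(2) by auto
      then show ?thesis using f(4)[OF that] g(4)[OF that] d by simp
    qed
  qed
qed

lemma mor_zero_fun: assumes "obj Y" shows "mor X Y (\<lambda>x. 0)"
proof -
  obtain \<rho> U E \<rho>' U' E' where XY: "X = (\<rho>, U, E)" "Y = (\<rho>', U', E')" by (metis prod.exhaust)
  have Y: "subspace E'" "subspace U'" "\<And>q. linear_from E' (\<rho>' q)" using assms by (auto simp: obj_def XY)
  have "\<rho>' q 0 = 0" for q
  proof -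
    have "\<rho>' q (0 *\<^sub>R 0) = 0 *\<^sub>R \<rho>' q 0" using Y(3)[of q] subspace_0[OF Y(1)] unfolding linear_from_def by blast
    then show ?thesis by simp
  qed
  then show ?thesis using subspace_0[OF Y(1)] subspace_0[OF Y(2)] by (auto simp: mor_def XY linear_from_def)
qed

lemma mor_sum_fun: assumes "obj Y" "finite I" "\<And>i. i \<in> I \<Longrightarrow> mor X Y (f i)"
  shows "mor X Y (\<lambda>x. \<Sum>i\<in>I. f i x)"
  using assms(2,3)
proof (induction I)
  case empty show ?case using mor_zero_fun[OF assms(1)] by simp
next
  case (insert i I)
  have m: "mor X Y (\<lambda>x. \<Sum>i\<in>I. f i x)" "mor X Y (f i)" using insert by auto
  have "mor X Y (\<lambda>x. f i x - (0 - (\<Sum>i\<in>I. f i x)))"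
    by (rule mor_diff_fun[OF m(2) mor_diff_fun[OF mor_zero_fun[OF assms(1)] m(1) assms(1)] assms(1)])
  then show ?case using insert(1,2) by simp
qed

text \<open>The defining property of a local ring for two summands, iterated.\<close>

lemma local_sum:
  assumes X: "obj X" "local_obj X" and "finite J" "\<And>j. j \<in> J \<Longrightarrow> mor X X (f j)"
    and "\<And>x. x \<in> carr X \<Longrightarrow> (\<Sum>j\<in>J. f j x) = x"
  shows "\<exists>j\<in>J. \<exists>h. inverses X X (f j) h"
  using assms(3-5)
proof (induction J arbitrary: f)
  case empty
  then have "carr X \<subseteq> {0}" by auto
  then show ?case using X obj_zero[OF X(1)] by (auto simp: local_obj_def)
next
  case (insert j0 J)
  let ?r = "\<lambda>x. \<Sum>j\<in>J. f j x"
  have mr: "mor X X ?r" using insert by (intro mor_sum_fun[OF X(1)]) auto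
  have "\<forall>x\<in>carr X. f j0 x + ?r x = x" using insert by simp
  then consider "\<exists>h. inverses X X (f j0) h" | "\<exists>h. inverses X X ?r h"
    using X(2) mr insert.prems(1)[of j0] unfolding local_obj_def by blast
  then show ?case
  proof cases
    case 1 then show ?thesis by blast
  next
    case 2
    then obtain r' where r': "mor X X r'" "\<And>x. x \<in> carr X \<Longrightarrow> r' (?r x) = x" "\<And>x. x \<in> carr X \<Longrightarrow> ?r (r' x) = x"
      unfolding inverses_def by blast
    have mf: "mor X X (f j)" if "j \<in> J" for j using insert.prems(1) that by blast
    have "\<exists>j\<in>J. \<exists>h. inverses X X (\<lambda>x. r' (f j x)) h"
    proof (rule insert.IH)
      show "mor X X (\<lambda>x. r' (f j x))" if "j \<in> J" for j by (rule mor_comp[OF mf[OF that] r'(1)])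
      show "(\<Sum>j\<in>J. r' (f j x)) = x" if x: "x \<in> carr X" for x
        using mor_sum[OF r'(1) X(1) insert.hyps(1), of "\<lambda>j. f j x"] mor_in[OF mf x] r'(2)[OF x] by simp
    qed
    then obtain j h where j: "j \<in> J" and h: "mor X X h" "\<And>x. x \<in> carr X \<Longrightarrow> h (r' (f j x)) = x"
      "\<And>x. x \<in> carr X \<Longrightarrow> r' (f j (h x)) = x"
      unfolding inverses_def by blast
    have "inverses X X (f j) (\<lambda>x. h (r' x))"
      unfolding inverses_def
    proof (intro conjI ballI)
      show "mor X X (f j)" by (rule mf[OF j])
      show "mor X X (\<lambda>x. h (r' x))" by (rule mor_comp[OF r'(1) h(1)])
      fix x assume x: "x \<in> carr X"
      show "h (r' (f j x)) = x" by (rule h(2)[OF x])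
      have r'x: "r' x \<in> carr X" by (rule mor_in[OF r'(1) x])
      have "f j (h (r' x)) \<in> carr X" by (intro mor_in[OF mf[OF j]] mor_in[OF h(1)] r'x)
      then have "f j (h (r' x)) = ?r (r' (f j (h (r' x))))" using r'(3) by simp
      also have "\<dots> = x" using h(3)[OF r'x] r'(3)[OF x] by simp
      finally show "f j (h (r' x)) = x" .
    qed
    then show ?thesis using j by blast
  qed
qed

text \<open>The composition \<open>e = \<alpha> \<circ> g \<circ> \<beta>\<close> is an idempotent of the local endomorphism ring of \<open>Y\<close>, hence 1 or 0;
  it is not 0, because \<open>e \<circ> \<alpha> = \<alpha>\<close> is injective on a nonzero space.\<close>

lemma local_factor:
  assumes X: "obj X" "local_obj X" and Y: "obj Y" "local_obj Y"
    and \<alpha>: "mor X Y \<alpha>" and \<beta>: "mor Y X \<beta>" and inv: "inverses X X (\<lambda>x. \<beta> (\<alpha> x)) g"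
  shows "inverses X Y \<alpha> (\<lambda>y. g (\<beta> y))"
proof -
  have g: "mor X X g" "\<And>x. x \<in> carr X \<Longrightarrow> g (\<beta> (\<alpha> x)) = x" using inv unfolding inverses_def by auto
  have mgb: "mor Y X (\<lambda>y. g (\<beta> y))" by (rule mor_comp[OF \<beta> g(1)])
  let ?e = "\<lambda>y. \<alpha> (g (\<beta> y))"
  have me: "mor Y Y ?e" by (rule mor_comp[OF mgb \<alpha>])
  have me': "mor Y Y (\<lambda>y. y - ?e y)" by (rule mor_diff_fun[OF mor_id me Y(1)])
  have "\<forall>y\<in>carr Y. ?e y + (y - ?e y) = y" by simp
  then consider "\<exists>h. inverses Y Y ?e h" | "\<exists>h. inverses Y Y (\<lambda>y. y - ?e y) h"
    using Y(2) me me' unfolding local_obj_def by blast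
  then have "?e y = y" if y: "y \<in> carr Y" for y
  proof cases
    case 1
    then obtain h where h: "\<And>y. y \<in> carr Y \<Longrightarrow> h (?e y) = y" unfolding inverses_def by blast
    have ey: "?e y \<in> carr Y" by (rule mor_in[OF me y])
    have "?e (?e y) = ?e y" using g(2)[OF mor_in[OF mgb y]] by simp
    then show ?thesis using h[OF ey] h[OF y] by simp
  next
    case 2
    then obtain h where h: "mor Y Y h" "\<And>y. y \<in> carr Y \<Longrightarrow> h (y - ?e y) = y" unfolding inverses_def by blast
    have "x = 0" if x: "x \<in> carr X" for x
    proof -
      have "\<alpha> x - ?e (\<alpha> x) = 0" using g(2)[OF x] by simp
      then have "\<alpha> x = 0" using h(2)[OF mor_in[OF \<alpha> x]] mor_zero[OF h(1) Y(1)] by simp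
      then show "x = 0" using g(2)[OF x] mor_zero[OF \<beta> Y(1)] mor_zero[OF g(1) X(1)] by simp
    qed
    then have "carr X = {0}" using obj_zero[OF X(1)] by auto
    then show ?thesis using X(2) by (simp add: local_obj_def)
  qed
  then show ?thesis unfolding inverses_def using \<alpha> mgb g(2) by blast
qed

text \<open>The matrices \<open>a\<close> and \<open>b\<close> are mutually inverse isomorphisms between the direct sums of the \<open>X i\<close> and
  of the \<open>Y j\<close>. By \<open>local_sum\<close> and \<open>local_factor\<close> some entry \<open>a j0 i0\<close> of the column of \<open>i0\<close> is invertible. Gaussian
  elimination with this pivot leaves the Schur complement \<open>a'\<close>, whose inverse is \<open>b\<close> without the row \<open>i0\<close> and the
  column \<open>j0\<close>, and the induction hypothesis applies.\<close>

theorem krull_schmidt: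
  fixes X :: "nat \<Rightarrow> 'b::real_vector obj" and Y :: "nat \<Rightarrow> 'c::real_vector obj"
  assumes "finite I" "finite J"
    and "\<And>i. i \<in> I \<Longrightarrow> obj (X i) \<and> local_obj (X i)" and "\<And>j. j \<in> J \<Longrightarrow> obj (Y j) \<and> local_obj (Y j)"
    and "\<And>i j. i \<in> I \<Longrightarrow> j \<in> J \<Longrightarrow> mor (X i) (Y j) (a j i)"
    and "\<And>i j. i \<in> I \<Longrightarrow> j \<in> J \<Longrightarrow> mor (Y j) (X i) (b i j)"
    and "\<And>i i' x. i \<in> I \<Longrightarrow> i' \<in> I \<Longrightarrow> x \<in> carr (X i') \<Longrightarrow> (\<Sum>j\<in>J. b i j (a j i' x)) = (if i = i' then x else 0)"
    and "\<And>j j' y. j \<in> J \<Longrightarrow> j' \<in> J \<Longrightarrow> y \<in> carr (Y j') \<Longrightarrow> (\<Sum>i\<in>I. a j i (b i j' y)) = (if j = j' then y else 0)"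
  shows "\<exists>\<pi>. bij_betw \<pi> I J \<and> (\<forall>i\<in>I. objiso (X i) (Y (\<pi> i)))"
  using assms
proof (induction I arbitrary: J a rule: finite_induct)
  case empty
  have "J = {}"
  proof (rule ccontr)
    assume "J \<noteq> {}"
    then obtain j where j: "j \<in> J" by blast
    have "y = 0" if "y \<in> carr (Y j)" for y using empty.prems(7)[OF j j that] by simp
    then have "carr (Y j) = {0}" using obj_zero empty.prems(3)[OF j] by blast
    then show False using empty.prems(3)[OF j] by (simp add: local_obj_def)
  qed
  then show ?case by (simp add: bij_betw_def)
next
  case (insert i0 I)
  note fJ = insert.prems(1) and oX = insert.prems(2) and oY = insert.prems(3) and ma = insert.prems(4) and mb = insert.prems(5)
    and ba = insert.prems(6) and ab = insert.prems(7)
  have X0: "obj (X i0)" "local_obj (X i0)" using oX by auto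
  have "\<exists>j\<in>J. \<exists>h. inverses (X i0) (X i0) (\<lambda>x. b i0 j (a j i0 x)) h"
  proof (rule local_sum[OF X0 fJ])
    show "mor (X i0) (X i0) (\<lambda>x. b i0 j (a j i0 x))" if "j \<in> J" for j
      using mor_comp[OF ma mb] that by blast
    show "(\<Sum>j\<in>J. b i0 j (a j i0 x)) = x" if "x \<in> carr (X i0)" for x using ba[of i0 i0 x] that by simp
  qed
  then obtain j0 g where j0: "j0 \<in> J" and g: "inverses (X i0) (X i0) (\<lambda>x. b i0 j0 (a j0 i0 x)) g" by blast
  have Y0: "obj (Y j0)" "local_obj (Y j0)" using oY j0 by auto
  define ai where "ai y = g (b i0 j0 y)" for y
  have inv: "inverses (X i0) (Y j0) (a j0 i0) ai"
    unfolding ai_def by (rule local_factor[OF X0 Y0 ma[OF _ j0] mb[OF _ j0] g]) auto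
  then have mai: "mor (Y j0) (X i0) ai" and ai1: "\<And>x. x \<in> carr (X i0) \<Longrightarrow> ai (a j0 i0 x) = x"
    and ai2: "\<And>y. y \<in> carr (Y j0) \<Longrightarrow> a j0 i0 (ai y) = y" unfolding inverses_def by auto
  let ?J = "J - {j0}"
  define a' where "a' j i x = a j i x - a j i0 (ai (a j0 i x))" for j i x
  have mz: "mor (X i) (X i0) (\<lambda>x. ai (a j0 i x))" if "i \<in> I" for i
    using mor_comp[OF ma[OF _ j0] mai] that by blast
  have "\<exists>\<pi>. bij_betw \<pi> I ?J \<and> (\<forall>i\<in>I. objiso (X i) (Y (\<pi> i)))"
  proof (rule insert.IH[of ?J a'])
    show "finite ?J" using fJ by simp
    show "obj (X i) \<and> local_obj (X i)" if "i \<in> I" for i using oX that by blast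
    show "obj (Y j) \<and> local_obj (Y j)" if "j \<in> ?J" for j using oY that by blast
    show "mor (X i) (Y j) (a' j i)" if i: "i \<in> I" and j: "j \<in> ?J" for i j
    proof -
      have "mor (X i) (Y j) (\<lambda>x. a j i0 (ai (a j0 i x)))" using mor_comp[OF mz[OF i] ma[of i0 j]] j by blast
      then show ?thesis unfolding a'_def using ma[of i j] i j oY[of j] by (intro mor_diff_fun) auto
    qed
    show "mor (Y j) (X i) (b i j)" if "i \<in> I" "j \<in> ?J" for i j using mb that by blast
    show "(\<Sum>j\<in>?J. b i j (a' j i' x)) = (if i = i' then x else 0)" if i: "i \<in> I" "i' \<in> I" and x: "x \<in> carr (X i')" for i i' x
    proof -
      define z where "z = ai (a j0 i' x)"
      have z: "z \<in> carr (X i0)" unfolding z_def by (rule mor_in[OF mz[OF i(2)] x])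
      have y: "a j0 i' x \<in> carr (Y j0)" using mor_in[OF ma[OF _ j0] x] i by blast
      have "b i j (a' j i' x) = b i j (a j i' x) - b i j (a j i0 z)" if j: "j \<in> ?J" for j
        unfolding a'_def z_def[symmetric]
      proof (rule mor_diff)
        show "mor (Y j) (X i) (b i j)" "obj (Y j)" using mb oY i j by auto
        show "a j i' x \<in> carr (Y j)" using mor_in[OF ma x, of j] i j by auto
        show "a j i0 z \<in> carr (Y j)" using mor_in[OF ma z, of j] j by auto
      qed
      then have "(\<Sum>j\<in>?J. b i j (a' j i' x)) = (\<Sum>j\<in>?J. b i j (a j i' x)) - (\<Sum>j\<in>?J. b i j (a j i0 z))"
        by (simp add: sum_subtractf)
      also have "(\<Sum>j\<in>?J. b i j (a j i' x)) = (if i = i' then x else 0) - b i j0 (a j0 i' x)"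
        using ba[of i i' x] i x fJ j0 by (simp add: sum_diff1)
      also have "(\<Sum>j\<in>?J. b i j (a j i0 z)) = - b i j0 (a j0 i0 z)"
        using ba[of i i0 z] i z fJ j0 insert.hyps(2) by (auto simp: sum_diff1)
      also have "a j0 i0 z = a j0 i' x" unfolding z_def by (rule ai2[OF y])
      finally show ?thesis by simp
    qed
    show "(\<Sum>i\<in>I. a' j i (b i j' y)) = (if j = j' then y else 0)" if j: "j \<in> ?J" "j' \<in> ?J" and y: "y \<in> carr (Y j')" for j j' y
    proof -
      define w where "w = b i0 j' y"
      have w: "w \<in> carr (X i0)" unfolding w_def using mor_in[OF mb y] j by blast
      have by': "b i j' y \<in> carr (X i)" if "i \<in> I" for i using mor_in[OF mb y] that j by blast
      have ay: "a j0 i (b i j' y) \<in> carr (Y j0)" if "i \<in> I" for i using mor_in[OF ma[OF _ j0] by'[OF that]] that by blast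
      have mc: "mor (Y j0) (Y j) (\<lambda>t. a j i0 (ai t))" using mor_comp[OF mai ma[of i0 j]] j by blast
      have s: "(\<Sum>i\<in>I. a j0 i (b i j' y)) = - a j0 i0 w"
        using ab[of j0 j' y] j j0 y insert.hyps by (simp add: w_def add_eq_0_iff2)
      have "(\<Sum>i\<in>I. a' j i (b i j' y)) = (\<Sum>i\<in>I. a j i (b i j' y)) - (\<Sum>i\<in>I. a j i0 (ai (a j0 i (b i j' y))))"
        unfolding a'_def by (simp add: sum_subtractf)
      also have "(\<Sum>i\<in>I. a j i0 (ai (a j0 i (b i j' y)))) = a j i0 (ai (\<Sum>i\<in>I. a j0 i (b i j' y)))"
        using mor_sum[OF mc Y0(1) insert.hyps(1) ay] by simp
      also have "\<dots> = - a j i0 w"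
      proof -
        have aw: "a j0 i0 w \<in> carr (Y j0)" using mor_in[OF ma[OF _ j0] w] by blast
        have "a j i0 (ai (0 - a j0 i0 w)) = a j i0 (ai 0) - a j i0 (ai (a j0 i0 w))"
          by (rule mor_diff[OF mc Y0(1) obj_zero[OF Y0(1)] aw])
        then show ?thesis unfolding s using mor_zero[OF mc Y0(1)] ai1[OF w] by simp
      qed
      also have "(\<Sum>i\<in>I. a j i (b i j' y)) = (if j = j' then y else 0) - a j i0 w"
        using ab[of j j' y] j y insert.hyps by (simp add: w_def algebra_simps)
      finally show ?thesis by simp
    qed
  qed
  then obtain \<pi> where \<pi>: "bij_betw \<pi> I ?J" "\<forall>i\<in>I. objiso (X i) (Y (\<pi> i))" by blast
  let ?\<pi> = "\<pi>(i0 := j0)"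
  have "bij_betw ?\<pi> I ?J" using \<pi>(1) insert.hyps(2) by (subst bij_betw_cong[of _ _ \<pi>]) auto
  then have "bij_betw ?\<pi> (insert i0 I) (insert j0 ?J)"
    using notIn_Un_bij_betw[of i0 I ?\<pi> ?J] insert.hyps(2) by simp
  moreover have "insert j0 ?J = J" using j0 by blast
  moreover have "\<forall>i\<in>insert i0 I. objiso (X i) (Y (?\<pi> i))" using \<pi>(2) inv insert.hyps(2) by (auto simp: objiso_def)
  ultimately show ?case by metis
qed

lemma inverses_trans: assumes "inverses X Y f g" "inverses Y Z h k" shows "inverses X Z (\<lambda>x. h (f x)) (\<lambda>z. g (k z))"
  using assms mor_comp[of X Y f Z h] mor_comp[of Z Y k X g] mor_in[of X Y f] mor_in[of Z Y k] unfolding inverses_def by auto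

lemma local_objiso:
  assumes iso: "objiso X Y" and X: "obj X" "local_obj X" and Y: "obj Y"
  shows "local_obj Y"
proof -
  obtain s t where st: "inverses X Y s t" using iso unfolding objiso_def by blast
  have s: "mor X Y s" "mor Y X t" and ts: "\<And>x. x \<in> carr X \<Longrightarrow> t (s x) = x" "\<And>y. y \<in> carr Y \<Longrightarrow> s (t y) = y"
    using st unfolding inverses_def by auto
  have pull: "\<exists>h. inverses Y Y f h" if f: "mor Y Y f" and h: "inverses X X (\<lambda>x. t (f (s x))) h" for f h
  proof -
    have hi: "mor X X h" "\<And>x. x \<in> carr X \<Longrightarrow> h (t (f (s x))) = x" "\<And>x. x \<in> carr X \<Longrightarrow> t (f (s (h x))) = x"
      using h unfolding inverses_def by auto
    have "inverses Y Y f (\<lambda>y. s (h (t y)))"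
      unfolding inverses_def
    proof (intro conjI ballI f)
      show "mor Y Y (\<lambda>y. s (h (t y)))" by (rule mor_comp[OF mor_comp[OF s(2) hi(1)] s(1)])
      fix y assume y: "y \<in> carr Y"
      have ty: "t y \<in> carr X" by (rule mor_in[OF s(2) y])
      show "s (h (t (f y))) = y" using hi(2)[OF ty] ts(2)[OF y] by simp
      have "f (s (h (t y))) \<in> carr Y" by (intro mor_in[OF f] mor_in[OF s(1)] mor_in[OF hi(1)] ty)
      then have "f (s (h (t y))) = s (t (f (s (h (t y)))))" using ts(2) by simp
      also have "\<dots> = y" using hi(3)[OF ty] ts(2)[OF y] by simp
      finally show "f (s (h (t y))) = y" .
    qed
    then show ?thesis by blast
  qed
  show ?thesis unfolding local_obj_def
  proof (intro conjI allI impI)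
    show "carr Y \<noteq> {0}"
    proof
      assume "carr Y = {0}"
      then have "x = 0" if "x \<in> carr X" for x using ts(1)[OF that] mor_in[OF s(1) that] mor_zero[OF s(2) Y] by simp
      then have "carr X = {0}" using obj_zero[OF X(1)] by blast
      then show False using X(2) by (simp add: local_obj_def)
    qed
    fix f g assume fg: "mor Y Y f" "mor Y Y g" "\<forall>y\<in>carr Y. f y + g y = y"
    have m: "mor X X (\<lambda>x. t (f (s x)))" "mor X X (\<lambda>x. t (g (s x)))"
      using mor_comp[OF mor_comp[OF s(1) fg(1)] s(2)] mor_comp[OF mor_comp[OF s(1) fg(2)] s(2)] by auto
    have "t (f (s x)) + t (g (s x)) = x" if x: "x \<in> carr X" for x
    proof -
      have sx: "s x \<in> carr Y" by (rule mor_in[OF s(1) x])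
      have "t (f (s x)) + t (g (s x)) = t (f (s x) + g (s x))"
        by (rule mor_add[OF s(2) mor_in[OF fg(1) sx] mor_in[OF fg(2) sx], symmetric])
      then show ?thesis using fg(3) sx ts(1)[OF x] by simp
    qed
    then have "(\<exists>h. inverses X X (\<lambda>x. t (f (s x))) h) \<or> (\<exists>h. inverses X X (\<lambda>x. t (g (s x))) h)"
      using X(2) m unfolding local_obj_def by blast
    then show "(\<exists>h. inverses Y Y f h) \<or> (\<exists>h. inverses Y Y g h)" using pull fg(1,2) by blast
  qed
qed

section \<open>Local endomorphism rings of the listed pairs\<close>

lemma linear_from_extend:
  fixes f :: "'a::real_vector \<Rightarrow> 'b::real_vector"
  assumes "subspace E" "linear_from E f"
  shows "\<exists>F. linear F \<and> (\<forall>x\<in>E. F x = f x)"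
proof -
  obtain B where B: "B \<subseteq> E" "independent B" "E \<subseteq> span B" using maximal_independent_subset by blast
  have sB: "span B = E" using B assms(1) by (simp add: span_minimal subset_antisym)
  obtain F :: "'a \<Rightarrow> 'b" where F: "linear F" "\<forall>x\<in>B. F x = f x" using linear_independent_extend[OF B(2), of f] by blast
  have f0: "f 0 = 0"
  proof -
    have "f (0 *\<^sub>R 0) = 0 *\<^sub>R f 0" using assms subspace_0[OF assms(1)] unfolding linear_from_def by blast
    then show ?thesis by simp
  qed
  have "F x = f x \<and> x \<in> E" if "x \<in> span B" for x
    using that
  proof (induction rule: span_induct_alt)
    case base show ?case using f0 linear_0[OF F(1)] subspace_0[OF assms(1)] by simp
  next
    case (step c x y)
    have xE: "x \<in> E" "c *\<^sub>R x \<in> E" using step(1) B(1) subspace_scale[OF assms(1)] by auto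
    have "f (c *\<^sub>R x + y) = c *\<^sub>R f x + f y" using assms(2) xE step(2) unfolding linear_from_def by auto
    then show ?case using step F xE subspace_add[OF assms(1)] by (simp add: linear_add[OF F(1)] linear_scale[OF F(1)])
  qed
  then show ?thesis using F(1) sB by blast
qed

lemma bijective_mor_invertible:
  assumes X: "obj X" and X_eq: "X = (\<rho>, U, E)" and Y_eq: "Y = (\<rho>', U', E')" and f: "mor X Y f"
    and inj: "\<And>x. x \<in> E \<Longrightarrow> f x = 0 \<Longrightarrow> x = 0" and onE: "f ` E = E'" and onU: "f ` U = U'"
  shows "\<exists>h. inverses X Y f h"
proof -
  have cE: "carr X = E" "carr Y = E'" by (simp_all add: carr_def X_eq Y_eq)
  have sE: "subspace E" "U \<subseteq> E" and \<rho>E: "\<And>q x. x \<in> E \<Longrightarrow> \<rho> q x \<in> E" using X by (auto simp: obj_def X_eq)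
  have m: "linear_from E f" "\<And>q x. x \<in> E \<Longrightarrow> f (\<rho> q x) = \<rho>' q (f x)" using f by (auto simp: mor_def X_eq Y_eq)
  have injE: "inj_on f E"
  proof (rule inj_onI)
    fix x y assume xy: "x \<in> E" "y \<in> E" "f x = f y"
    then have "f (x - y) = 0" using mor_diff[OF f X, of x y] by (simp add: cE)
    then show "x = y" using inj[of "x - y"] subspace_diff[OF sE(1) xy(1,2)] by simp
  qed
  define h where "h = inv_into E f"
  have h: "h y \<in> E" "f (h y) = y" if "y \<in> E'" for y
    using that onE inv_into_into[of y f E] f_inv_into_f[of y f E] by (simp_all add: h_def)
  have hf: "h (f x) = x" if "x \<in> E" for x unfolding h_def by (rule inv_into_f_f[OF injE that])
  have fin: "y = h z" if "y \<in> E" "f y = z" for y z using hf[OF that(1)] that(2) by simp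
  have "mor Y X h" unfolding mor_def X_eq Y_eq prod.case
  proof (intro conjI allI ballI)
    show "linear_from E' h" unfolding linear_from_def
    proof (intro conjI allI ballI)
      fix x y assume xy: "x \<in> E'" "y \<in> E'"
      show "h (x + y) = h x + h y"
        using mor_add[OF f, of "h x" "h y"] h xy subspace_add[OF sE(1)] by (intro fin[symmetric]) (auto simp: cE)
    next
      fix c x assume x: "x \<in> E'"
      have "f (c *\<^sub>R h x) = c *\<^sub>R x" using m(1) h[OF x] unfolding linear_from_def by auto
      then show "h (c *\<^sub>R x) = c *\<^sub>R h x" using h[OF x] subspace_scale[OF sE(1)] by (intro fin[symmetric]) auto
    qed
    show "h ` E' \<subseteq> E" using h by blast
    show "h ` U' \<subseteq> U"
    proof (rule image_subsetI)
      fix y assume "y \<in> U'"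
      then have "y \<in> f ` U" using onU by simp
      then obtain u where "y = f u" "u \<in> U" by (rule imageE)
      then show "h y \<in> U" using hf[of u] sE(2) by auto
    qed
    show "h (\<rho>' q x) = \<rho> q (h x)" if x: "x \<in> E'" for q x
      using m(2)[of "h x" q] h[OF x] \<rho>E by (intro fin[symmetric]) auto
  qed
  then show ?thesis unfolding inverses_def using f hf h(2) by (auto simp: cE)
qed

lemma injective_endo_invertible:
  assumes X: "obj X" and X_eq: "X = (\<rho>, U, E)" and fE: "fin_dim E" and f: "mor X X f" and inj: "\<And>x. x \<in> E \<Longrightarrow> f x = 0 \<Longrightarrow> x = 0"
  shows "\<exists>h. inverses X X f h"
proof (rule bijective_mor_invertible[OF X X_eq X_eq f inj])
  have sE: "subspace E" "subspace U" "U \<subseteq> E" using X by (auto simp: obj_def X_eq)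
  have m: "linear_from E f" "f ` E \<subseteq> E" "f ` U \<subseteq> U" using f by (auto simp: mor_def X_eq)
  obtain F where F: "linear F" "\<forall>x\<in>E. F x = f x" using linear_from_extend[OF sE(1) m(1)] by blast
  have FE: "F ` E = f ` E" and FU: "F ` U = f ` U" using F(2) sE(3) by (auto intro!: image_cong)
  have Finj: "x = 0" if "x \<in> E" "F x = 0" for x using inj that F(2) by simp
  have fU: "fin_dim U" by (rule fin_dim_mono[OF fE sE(3)])
  show "f ` E = E"
    using subspace_eq_of_dim_le[OF fE linear_subspace_image[OF F(1) sE(1)] sE(1)] dim_image_inj[OF F(1) sE(1) fE Finj] m(2) FE by simp
  have "dim (F ` U) = dim U" using Finj sE(3) by (intro dim_image_inj[OF F(1) sE(2) fU]) auto
  then show "f ` U = U" using subspace_eq_of_dim_le[OF fU linear_subspace_image[OF F(1) sE(2)] sE(2)] m(3) FU by simp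
qed

lemma obj_hmul: "hsub E \<Longrightarrow> subspace U \<Longrightarrow> U \<subseteq> E \<Longrightarrow> obj (hmul, U, E)"
  by (auto simp: obj_def hsub_def linear_from_def hmul_simps)

text \<open>By \<open>slope_stable_injective\<close> nonzero endomorphisms of a stable pair are injective, hence invertible.\<close>

lemma local_stable:
  assumes st: "slope_stable U E" and E: "E \<subseteq> quat_tuples n"
  shows "local_obj (hmul, U, E)"
proof -
  have h: "hsub E" "E \<noteq> {0}" "subspace U" "U \<subseteq> E" using st unfolding slope_stable_def by auto
  let ?X = "(hmul, U, E)"
  have X: "obj ?X" using obj_hmul h by blast
  have cE: "carr ?X = E" by (simp add: carr_def)
  have sE: "subspace E" using h(1) hsub_subspace by blast
  have fE: "fin_dim E" by (rule fin_dim_sub_tuples[OF E])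
  have fU: "fin_dim U" by (rule fin_dim_mono[OF fE h(4)])
  have key: "\<exists>h. inverses ?X ?X f h" if f: "mor ?X ?X f" and nz: "\<exists>x\<in>E. f x \<noteq> 0" for f
  proof (rule injective_endo_invertible[OF X refl fE f])
    have m: "linear_from E f" "f ` E \<subseteq> E" "f ` U \<subseteq> U" "\<And>q x. x \<in> E \<Longrightarrow> f (hmul q x) = hmul q (f x)" using f by (auto simp: mor_def)
    obtain F where F: "linear F" "\<forall>x\<in>E. F x = f x" using linear_from_extend[OF sE m(1)] by blast
    have FE: "F ` E = f ` E" and FU: "F ` U = f ` U" using F(2) h(4) by (auto intro!: image_cong)
    have Fq: "F (hmul q x) = hmul q (F x)" if "x \<in> E" for q x using m(4)[OF that] F(2) hsub_hmul[OF h(1) that] that by simp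
    have hI: "hsub (F ` E)" unfolding hsub_def
    proof (intro conjI allI ballI)
      show "subspace (F ` E)" by (rule linear_subspace_image[OF F(1) sE])
      fix q y assume "y \<in> F ` E"
      then obtain x where x: "x \<in> E" "y = F x" by blast
      have "hmul q y = F (hmul q x)" using Fq[OF x(1)] x(2) by simp
      then show "hmul q y \<in> F ` E" using hsub_hmul[OF h(1) x(1)] by blast
    qed
    have hK: "hsub {x \<in> E. F x = 0}"
      using sE by (intro hsubI) (auto simp: subspace_0 subspace_add linear_0[OF F(1)] linear_add[OF F(1)] hsub_hmul[OF h(1)] Fq)
    fix x assume x: "x \<in> E" "f x = 0"
    show "x = 0"
    proof (rule slope_stable_injective[OF st E F(1) hK _ _ x(1)])
      show "F x = 0" using x F(2) by simp
      show "\<exists>x\<in>E. F x \<noteq> 0" using nz F(2) by auto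
      have IE: "F ` E \<subseteq> E" using m(2) FE by simp
      show "dim (F ` U) * dim E \<le> dim U * dim (F ` E)"
      proof (cases "F ` E = E")
        case True
        have "dim (F ` U) \<le> dim U" using FU m(3) by (intro dim_mono_fin[OF fU]) auto
        then show ?thesis using True by simp
      next
        case False
        have ne: "F ` E \<noteq> {0}" using nz F(2) by force
        have "F ` U \<subseteq> U \<inter> F ` E" using FU m(3) image_mono[OF h(4), of F] by blast
        then have "dim (F ` U) \<le> dim (U \<inter> F ` E)" by (rule dim_mono_fin[OF fin_dim_mono[OF fU], rotated]) auto
        then have "dim (F ` U) * dim E \<le> dim (U \<inter> F ` E) * dim E" by (rule mult_le_mono1)
        also have "\<dots> < dim U * dim (F ` E)" using st hI IE ne False unfolding slope_stable_def by blast
        finally show ?thesis by simp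
      qed
    qed
  qed
  show ?thesis unfolding local_obj_def cE
  proof (intro conjI allI impI)
    show "E \<noteq> {0}" by (rule h(2))
    fix f g assume fg: "mor ?X ?X f" "mor ?X ?X g" "\<forall>x\<in>E. f x + g x = x"
    obtain x where "x \<in> E" "x \<noteq> 0" using h(2) subspace_0[OF sE] by blast
    then have "f x \<noteq> 0 \<or> g x \<noteq> 0" using fg(3) by fastforce
    then show "(\<exists>h. inverses ?X ?X f h) \<or> (\<exists>h. inverses ?X ?X g h)" using key fg(1,2) \<open>x \<in> E\<close> by blast
  qed
qed

lemma cline_independent:
  assumes q: "q \<in> S2" and t: "t \<in> S2" "t \<noteq> q" "t \<noteq> - q"
    and z: "of_real c0 + c1 *\<^sub>R q + c2 *\<^sub>R t + c3 *\<^sub>R (q * t) = 0"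
  shows "c0 = 0 \<and> c1 = 0 \<and> c2 = 0 \<and> c3 = 0"
proof -
  have cq: "qcnj p = - p" if "p \<in> S2" for p using that by (simp add: S2_iff quat_simps)
  have nr: "a = 0 \<and> b = 0" if "of_real a + b *\<^sub>R q = 0" for a b
  proof -
    have "a = 0" using that q by (auto simp: quat_simps S2_iff)
    then have "b *\<^sub>R q = 0" using that by simp
    then show ?thesis using S2_nonzero[OF q] \<open>a = 0\<close> by simp
  qed
  have "qcnj (of_real c0 + c1 *\<^sub>R q + c2 *\<^sub>R t + c3 *\<^sub>R (q * t)) = 0" unfolding z by simp
  then have "of_real c0 - c1 *\<^sub>R q - c2 *\<^sub>R t + c3 *\<^sub>R (t * q) = 0"
    by (simp add: qcnj_add qcnj_scaleR qcnj_mult cq[OF q] cq[OF t(1)]) (simp add: quat_simps)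
  then have "t * (of_real c2 + (- c3) *\<^sub>R q) = of_real c0 + (- c1) *\<^sub>R q"
    by (simp add: algebra_simps of_real_def)
  then have "t * (of_real c2 + (- c3) *\<^sub>R q) \<in> cline q" by (simp only: clineI)
  then have "of_real c2 + (- c3) *\<^sub>R q = 0" using cline_mult_imp_zero[OF q t clineI] by blast
  then have "c2 = 0 \<and> - c3 = 0" by (rule nr)
  then have c: "c2 = 0" "c3 = 0" by auto
  then show ?thesis using z nr[of c0 c1] by simp
qed

lemma tuples_expand: assumes "x \<in> quat_tuples k" shows "x = (\<Sum>i<k. hmul (x i) (single i 1))"
proof
  fix j
  have "(\<Sum>i<k. hmul (x i) (single i 1)) j = (\<Sum>i<k. if i = j then x j else 0)"
    unfolding fun_sum by (intro sum.cong) (auto simp: single_def)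
  also have "\<dots> = x j" using assms by (auto simp: quat_tuples_def)
  finally show "x j = (\<Sum>i<k. hmul (x i) (single i 1)) j" by simp
qed

lemma W_sub_direction:
  assumes "q \<in> S2"
  obtains t where "t \<in> S2" "t \<noteq> q" "t \<noteq> - q" and "\<And>k. W_sub k q = {x \<in> quat_tuples k. \<exists>a b :: nat \<Rightarrow> real. b k = 0 \<and>
        (\<forall>i<k. x i = of_real (a i) + b i *\<^sub>R q + b (i + 1) *\<^sub>R t)}"
proof (rule that[of "if q = quat_i \<or> q = - quat_i then quat_j else quat_i"])
  have ij: "quat_j \<noteq> quat_i" "quat_j \<noteq> - quat_i" by (simp_all add: quat_simps)
  show "(if q = quat_i \<or> q = - quat_i then quat_j else quat_i) \<in> S2" by simp
  show "(if q = quat_i \<or> q = - quat_i then quat_j else quat_i) \<noteq> q" using ij by auto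
  show "(if q = quat_i \<or> q = - quat_i then quat_j else quat_i) \<noteq> - q" using ij by (metis minus_minus)
qed (simp add: W_sub_def Let_def)

lemma subspace_W_sub: "subspace (W_sub k q)"
proof -
  define t where "t = (if q = quat_i \<or> q = - quat_i then quat_j else quat_i)"
  have W: "W_sub k q = {x \<in> quat_tuples k. \<exists>a b :: nat \<Rightarrow> real. b k = 0 \<and>
        (\<forall>i<k. x i = of_real (a i) + b i *\<^sub>R q + b (i + 1) *\<^sub>R t)}" by (simp add: W_sub_def Let_def t_def)
  show ?thesis
  proof (rule subspaceI)
    show "0 \<in> W_sub k q" unfolding W by (auto simp: quat_tuples_def intro!: exI[of _ "\<lambda>_. 0"])
    fix x y assume "x \<in> W_sub k q" "y \<in> W_sub k q"
    then obtain a b a' b' :: "nat \<Rightarrow> real" where ab: "b k = 0" "\<forall>i<k. x i = of_real (a i) + b i *\<^sub>R q + b (i + 1) *\<^sub>R t"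
      "b' k = 0" "\<forall>i<k. y i = of_real (a' i) + b' i *\<^sub>R q + b' (i + 1) *\<^sub>R t" "x \<in> quat_tuples k" "y \<in> quat_tuples k" unfolding W by blast
    have "\<exists>a b :: nat \<Rightarrow> real. b k = 0 \<and> (\<forall>i<k. (x + y) i = of_real (a i) + b i *\<^sub>R q + b (i + 1) *\<^sub>R t)"
      by (rule exI[where x = "\<lambda>i. a i + a' i"], rule exI[where x = "\<lambda>i. b i + b' i"]) (use ab in \<open>auto simp: algebra_simps\<close>)
    then show "x + y \<in> W_sub k q" unfolding W using subspace_add[OF subspace_tuples, of x k y] ab by blast
  next
    fix r x assume "x \<in> W_sub k q"
    then obtain a b :: "nat \<Rightarrow> real" where ab: "b k = 0" "\<forall>i<k. x i = of_real (a i) + b i *\<^sub>R q + b (i + 1) *\<^sub>R t" "x \<in> quat_tuples k" unfolding W by blast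
    have "\<exists>a b :: nat \<Rightarrow> real. b k = 0 \<and> (\<forall>i<k. (r *\<^sub>R x) i = of_real (a i) + b i *\<^sub>R q + b (i + 1) *\<^sub>R t)"
      by (rule exI[where x = "\<lambda>i. r * a i"], rule exI[where x = "\<lambda>i. r * b i"]) (use ab in \<open>auto simp: algebra_simps of_real_def\<close>)
    then show "r *\<^sub>R x \<in> W_sub k q" unfolding W using subspace_scale[OF subspace_tuples, of x k r] ab by blast
  qed
qed

lemma W_sub_tuples: "W_sub k q \<subseteq> quat_tuples k" by (auto simp: W_sub_def Let_def)

text \<open>The vectors \<open>e i = single i 1\<close> and \<open>q (e i) + t (e (i - 1))\<close> form a basis of \<open>W_sub k q\<close>. Compare the
  coordinates of their images, upwards in \<open>i\<close>, with the definition of \<open>W_sub\<close>; as \<open>1, q, t, q t\<close> are independent, the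
  coordinates above \<open>i\<close> vanish and the diagonal entry is inherited from \<open>i - 1\<close>.\<close>

lemma W_sub_endo_triangular:
  assumes q: "q \<in> S2" and k: "k \<ge> 1" and f: "mor (hmul, W_sub k q, quat_tuples k) (hmul, W_sub k q, quat_tuples k) f"
  shows "\<exists>z\<in>cline q. \<forall>i<k. f (single i 1) i = z \<and> (\<forall>j>i. f (single i 1) j = 0)"
proof -
  obtain t where t: "t \<in> S2" "t \<noteq> q" "t \<noteq> - q" and Wk: "\<And>k. W_sub k q = {x \<in> quat_tuples k. \<exists>a b :: nat \<Rightarrow> real. b k = 0 \<and>
        (\<forall>i<k. x i = of_real (a i) + b i *\<^sub>R q + b (i + 1) *\<^sub>R t)}" by (rule W_sub_direction[OF q]) blast
  note W = Wk[of k]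
  have m: "linear_from (quat_tuples k) f" "f ` quat_tuples k \<subseteq> quat_tuples k" "f ` W_sub k q \<subseteq> W_sub k q"
    "\<And>p x. x \<in> quat_tuples k \<Longrightarrow> f (hmul p x) = hmul p (f x)" using f by (auto simp: mor_def)
  have fadd: "f (x + y) = f x + f y" if "x \<in> quat_tuples k" "y \<in> quat_tuples k" for x y using m(1) that by (auto simp: linear_from_def)
  define e :: "nat \<Rightarrow> nat \<Rightarrow> quat" where "e i = single i 1" for i
  have eT: "e i \<in> quat_tuples k" if "i < k" for i unfolding e_def by (rule single_in_tuples[OF that])
  have eW: "e i \<in> W_sub k q" if "i < k" for i
  proof -
    have "\<exists>a b :: nat \<Rightarrow> real. b k = 0 \<and> (\<forall>j<k. e i j = of_real (a j) + b j *\<^sub>R q + b (j + 1) *\<^sub>R t)"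
      by (rule exI[where x = "\<lambda>j. if j = i then 1 else 0"], rule exI[where x = "\<lambda>_. 0"]) (auto simp: e_def single_def)
    then show ?thesis unfolding W using eT[OF that] by blast
  qed
  define e' where "e' i = (if i = 0 then 0 else e (i - 1))" for i
  have e'T: "e' i \<in> quat_tuples k" if "i < k" for i unfolding e'_def using that eT[of "i - 1"] subspace_0[OF subspace_tuples] by auto
  have gW: "hmul q (e i) + hmul t (e' i) \<in> W_sub k q" if i: "i < k" for i
  proof -
    have 1: "hmul q (e i) + hmul t (e' i) \<in> quat_tuples k"
      by (intro subspace_add[OF subspace_tuples] hsub_hmul[OF hsub_tuples] eT e'T i)
    have 2: "(hmul q (e i) + hmul t (e' i)) j = of_real 0 + (if j = i then 1 else 0) *\<^sub>R q + (if j + 1 = i then 1 else 0) *\<^sub>R t" for j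
      by (auto simp: e'_def e_def single_def)
    have "\<exists>a b :: nat \<Rightarrow> real. b k = 0 \<and> (\<forall>j<k. (hmul q (e i) + hmul t (e' i)) j = of_real (a j) + b j *\<^sub>R q + b (j + 1) *\<^sub>R t)"
      by (rule exI[where x = "\<lambda>_. 0"], rule exI[where x = "\<lambda>j. if j = i then 1 else 0"]) (use 2 i in auto)
    then show ?thesis unfolding W using 1 by blast
  qed
  have tq: "t * q = - (q * t) - (2 * (t \<bullet> q)) *\<^sub>R 1"
    using q t(1) by (simp add: quat_simps S2_iff)
  have qq: "q * q = -1" by (rule S2_square[OF q])
  have step: "(\<forall>j>i. f (e i) j = 0) \<and> f (e i) i \<in> cline q \<and> (i > 0 \<longrightarrow> f (e i) i = f (e (i - 1)) (i - 1))"
    if i: "i < k" and prev: "i > 0 \<Longrightarrow> (\<forall>j>i - 1. f (e (i - 1)) j = 0) \<and> f (e (i - 1)) (i - 1) \<in> cline q" for i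
  proof -
    have "f (e i) \<in> W_sub k q" using m(3) eW[OF i] by blast
    then obtain a b where ab: "b k = 0" "\<And>j. j < k \<Longrightarrow> f (e i) j = of_real (a j) + b j *\<^sub>R q + b (j + 1) *\<^sub>R t" and fT: "f (e i) \<in> quat_tuples k"
      unfolding W by blast
    have "f (hmul q (e i) + hmul t (e' i)) \<in> W_sub k q" using m(3) gW[OF i] by blast
    also have "f (hmul q (e i) + hmul t (e' i)) = hmul q (f (e i)) + hmul t (f (e' i))"
      using fadd[of "hmul q (e i)" "hmul t (e' i)"] hsub_hmul[OF hsub_tuples] eT[OF i] e'T[OF i] m(4) by simp
    finally obtain a' b' where ab': "b' k = 0" "\<And>j. j < k \<Longrightarrow> (hmul q (f (e i)) + hmul t (f (e' i))) j = of_real (a' j) + b' j *\<^sub>R q + b' (j + 1) *\<^sub>R t"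
      unfolding W by blast
    have f0: "f 0 = 0" using m(4)[of 0 0] subspace_0[OF subspace_tuples, of k] by simp
    have e'hi: "f (e' i) j = 0" if "j \<ge> i" for j
      using prev f0 that unfolding e'_def by auto
    have hi: "b (j + 1) = 0 \<and> b' (j + 1) = 0 \<and> b' j = a j" if j: "i \<le> j" "j < k" for j
    proof -
      have "q * (of_real (a j) + b j *\<^sub>R q + b (j + 1) *\<^sub>R t) = of_real (a' j) + b' j *\<^sub>R q + b' (j + 1) *\<^sub>R t"
        using ab'(2)[OF j(2)] ab(2)[OF j(2)] e'hi[OF j(1)] by simp
      then have "of_real (- b j - a' j) + (a j - b' j) *\<^sub>R q + (- b' (j + 1)) *\<^sub>R t + b (j + 1) *\<^sub>R (q * t) = 0"
        by (simp add: algebra_simps qq of_real_def)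
      then show ?thesis using cline_independent[OF q t] by fastforce
    qed
    have zero: "f (e i) j = 0" if j: "j > i" for j
    proof (cases "j < k")
      case True
      have "b j = 0 \<and> b' j = 0" using hi[of "j - 1"] j True by simp
      then show ?thesis using hi[of j] j True ab(2)[OF True] by simp
    next
      case False then show ?thesis using fT by (simp add: quat_tuples_def)
    qed
    have fi: "f (e i) i = of_real (a i) + b i *\<^sub>R q" using ab(2)[OF i] hi[of i] i by simp
    have "f (e i) i = f (e (i - 1)) (i - 1)" if i0: "i > 0"
    proof -
      obtain \<alpha> \<beta> where z: "f (e (i - 1)) (i - 1) = of_real \<alpha> + \<beta> *\<^sub>R q" using prev[OF i0] by (auto elim: clineE)
      have i1: "i - 1 < k" "i - 1 + 1 = i" using i i0 by auto
      have "q * (of_real (a (i - 1)) + b (i - 1) *\<^sub>R q + b i *\<^sub>R t) + t * (of_real \<alpha> + \<beta> *\<^sub>R q)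
          = of_real (a' (i - 1)) + b' (i - 1) *\<^sub>R q + b' i *\<^sub>R t"
        using ab'(2)[OF i1(1)] ab(2)[OF i1(1)] z i0 i1(2) by (simp add: e'_def)
      then have "of_real (- b (i - 1) - a' (i - 1) - \<beta> * (2 * (t \<bullet> q))) + (a (i - 1) - b' (i - 1)) *\<^sub>R q + (\<alpha> - b' i) *\<^sub>R t + (b i - \<beta>) *\<^sub>R (q * t) = 0"
        by (simp add: algebra_simps qq tq of_real_def)
      then have "\<alpha> = b' i" "b i = \<beta>" using cline_independent[OF q t] by fastforce+
      then show ?thesis using fi z hi[of i] i by simp
    qed
    then show ?thesis using zero fi clineI[of "a i" "b i" q] by simp
  qed
  have all: "i < k \<Longrightarrow> (\<forall>j>i. f (e i) j = 0) \<and> f (e i) i \<in> cline q \<and> f (e i) i = f (e 0) 0" for i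
  proof (induction i)
    case 0 then show ?case using step[of 0] by simp
  next
    case (Suc i)
    have P: "(\<forall>j>i. f (e i) j = 0) \<and> f (e i) i \<in> cline q \<and> f (e i) i = f (e 0) 0"
      by (rule Suc.IH[OF Suc_lessD[OF Suc.prems]])
    have "(\<forall>j>Suc i. f (e (Suc i)) j = 0) \<and> f (e (Suc i)) (Suc i) \<in> cline q \<and>
        (Suc i > 0 \<longrightarrow> f (e (Suc i)) (Suc i) = f (e (Suc i - 1)) (Suc i - 1))"
    proof (rule step[OF Suc.prems])
      show "(\<forall>j>Suc i - 1. f (e (Suc i - 1)) j = 0) \<and> f (e (Suc i - 1)) (Suc i - 1) \<in> cline q"
        unfolding diff_Suc_1 using P by blast
    qed
    then show ?case unfolding diff_Suc_1 using P by auto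
  qed
  show ?thesis
  proof (rule bexI[of _ "f (e 0) 0"])
    show "f (e 0) 0 \<in> cline q" using all[of 0] k by simp
    show "\<forall>i<k. f (single i 1) i = f (e 0) 0 \<and> (\<forall>j>i. f (single i 1) j = 0)" using all unfolding e_def by blast
  qed
qed

text \<open>An endomorphism with nonzero diagonal entry is injective, and the diagonal entries of two
  endomorphisms with sum 1 are not both zero.\<close>

lemma local_W_sub:
  assumes q: "q \<in> S2" and k: "k \<ge> 1"
  shows "local_obj (hmul, W_sub k q, quat_tuples k)"
proof -
  let ?X = "(hmul, W_sub k q, quat_tuples k)"
  have X: "obj ?X" by (rule obj_hmul[OF hsub_tuples subspace_W_sub W_sub_tuples])
  have cE: "carr ?X = quat_tuples k" by (simp add: carr_def)
  have key: "\<exists>h. inverses ?X ?X f h" if f: "mor ?X ?X f" and z: "z \<noteq> 0" "\<forall>i<k. f (single i 1) i = z \<and> (\<forall>j>i. f (single i 1) j = 0)" for f z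
  proof (rule injective_endo_invertible[OF X refl fin_dim_tuples f])
    fix x assume x: "x \<in> quat_tuples k" "f x = 0"
    have m: "\<And>p x. x \<in> quat_tuples k \<Longrightarrow> f (hmul p x) = hmul p (f x)" using f by (auto simp: mor_def)
    have "f x = (\<Sum>i<k. hmul (x i) (f (single i 1)))"
    proof -
      have "f (\<Sum>i<k. hmul (x i) (single i 1)) = (\<Sum>i<k. f (hmul (x i) (single i 1)))"
        by (rule mor_sum[OF f X]) (auto simp: cE intro!: hsub_hmul[OF hsub_tuples] single_in_tuples)
      also have "\<dots> = (\<Sum>i<k. hmul (x i) (f (single i 1)))" using m single_in_tuples by (intro sum.cong) auto
      finally show ?thesis using tuples_expand[OF x(1)] by simp
    qed
    then have fx: "f x j = (\<Sum>i<k. x i * f (single i 1) j)" for j by simp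
    show "x = 0"
    proof (rule ccontr)
      assume "x \<noteq> 0"
      then obtain i where i: "x i \<noteq> 0" by (auto simp: fun_eq_iff)
      define S where "S = {i. i < k \<and> x i \<noteq> 0}"
      have fS: "finite S" unfolding S_def by simp
      have "i \<in> S" using i x(1) unfolding S_def quat_tuples_def by (auto simp: not_less[symmetric])
      then have neS: "S \<noteq> {}" by blast
      define j where "j = Max S"
      have j: "j < k" "x j \<noteq> 0" using Max_in[OF fS neS] by (auto simp: S_def j_def)
      have hi: "x i = 0" if "i > j" "i < k" for i
      proof (rule ccontr)
        assume "x i \<noteq> 0"
        then have "i \<in> S" using that by (simp add: S_def)
        then have "i \<le> j" unfolding j_def by (rule Max_ge[OF fS])
        then show False using that by simp
      qed
      have "f x j = (\<Sum>i<k. if i = j then x j * z else 0)" unfolding fx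
      proof (rule sum.cong[OF refl])
        fix i assume i: "i \<in> {..<k}"
        consider "i < j" | "i = j" | "i > j" by linarith
        then show "x i * f (single i 1) j = (if i = j then x j * z else 0)"
          using z(2) i hi by cases auto
      qed
      then have "f x j = x j * z" using j by simp
      then show False using x(2) j z(1) by simp
    qed
  qed
  show ?thesis unfolding local_obj_def cE
  proof (intro conjI allI impI)
    have "dim (quat_tuples k) > 0" using k by (simp add: dim_tuples)
    then show "quat_tuples k \<noteq> {0}" by (metis dim_zero_space less_irrefl)
    fix f g assume fg: "mor ?X ?X f" "mor ?X ?X g" "\<forall>x\<in>quat_tuples k. f x + g x = x"
    obtain z where z: "\<forall>i<k. f (single i 1) i = z \<and> (\<forall>j>i. f (single i 1) j = 0)" using W_sub_endo_triangular[OF q k fg(1)] by blast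
    obtain w where w: "\<forall>i<k. g (single i 1) i = w \<and> (\<forall>j>i. g (single i 1) j = 0)" using W_sub_endo_triangular[OF q k fg(2)] by blast
    have "f (single 0 1) + g (single 0 1) = single 0 1" using fg(3) single_in_tuples[of 0 k 1] k by simp
    then have "(f (single 0 1) + g (single 0 1)) 0 = 1" by (simp add: single_def)
    then have "z + w = 1" using z w k by simp
    then have "z \<noteq> 0 \<or> w \<noteq> 0" by auto
    then show "(\<exists>h. inverses ?X ?X f h) \<or> (\<exists>h. inverses ?X ?X g h)" using key[OF fg(1) _ z] key[OF fg(2) _ w] by blast
  qed
qed

section \<open>Quaternionic structures and their representatives\<close>

lemma Aut_facts: "\<sigma> \<in> Aut_quat \<Longrightarrow> linear \<sigma>" "\<sigma> \<in> Aut_quat \<Longrightarrow> \<sigma> 1 = 1" "\<sigma> \<in> Aut_quat \<Longrightarrow> \<sigma> (p * q) = \<sigma> p * \<sigma> q"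
  "\<sigma> \<in> Aut_quat \<Longrightarrow> bij \<sigma>"
  by (auto simp: Aut_quat_def)

lemma Aut_id: "id \<in> Aut_quat" by (simp add: Aut_quat_def linear_id)

lemma Aut_comp: assumes "\<sigma> \<in> Aut_quat" "\<tau> \<in> Aut_quat" shows "\<sigma> \<circ> \<tau> \<in> Aut_quat"
  using assms linear_compose[of \<tau> \<sigma>] by (auto simp: Aut_quat_def bij_comp)

lemma Aut_inv: assumes "\<sigma> \<in> Aut_quat" shows "inv \<sigma> \<in> Aut_quat" "\<sigma> (inv \<sigma> q) = q" "inv \<sigma> (\<sigma> q) = q"
proof -
  note A = Aut_facts[OF assms]
  show 1: "\<sigma> (inv \<sigma> q) = q" for q using A(4) by (simp add: bij_is_surj surj_f_inv_f)
  show 2: "inv \<sigma> (\<sigma> q) = q" for q using A(4) by (simp add: bij_is_inj)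
  have eq: "inv \<sigma> x = y" if "x = \<sigma> y" for x y using 2 that by simp
  have "linear (inv \<sigma>)"
    by (rule linearI) (rule eq, simp add: linear_add[OF A(1)] linear_scale[OF A(1)] 1)+
  moreover have "inv \<sigma> 1 = 1" by (rule eq) (simp add: A(2))
  moreover have "inv \<sigma> (p * q) = inv \<sigma> p * inv \<sigma> q" for p q by (rule eq) (simp add: A(3) 1)
  ultimately show "inv \<sigma> \<in> Aut_quat" using bij_imp_bij_inv[OF A(4)] by (simp add: Aut_quat_def)
qed

lemma Aut_qcnj: assumes "\<sigma> \<in> Aut_quat" shows "\<sigma> (qcnj q) = qcnj (\<sigma> q)"
proof -
  note A = Aut_facts[OF assms]
  obtain a b p where q: "q = of_real a + b *\<^sub>R p" "p \<in> S2" by (rule quat_polar)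
  have c: "qcnj p = - p" if "p \<in> S2" for p using that by (simp add: S2_iff quat_simps)
  have r: "qcnj (of_real a) = of_real a" "\<sigma> (of_real a) = of_real a" for a
    using linear_scale[OF A(1), of a 1] by (simp_all add: quat_simps of_real_def A(2))
  show ?thesis unfolding q(1) using c[OF q(2)] c[OF Aut_S2[OF assms q(2)]]
    by (simp add: qcnj_add qcnj_scaleR linear_add[OF A(1)] linear_scale[OF A(1)] linear_diff[OF A(1)] linear_neg[OF A(1)] r)
qed

lemma orbit_self: "\<rho> \<in> orbit \<rho>" unfolding orbit_def using Aut_id by (metis (mono_tags, lifting) comp_id mem_Collect_eq)

lemma orbit_comp: "\<rho>' \<in> orbit \<rho> \<Longrightarrow> \<sigma> \<in> Aut_quat \<Longrightarrow> \<rho>' \<circ> \<sigma> \<in> orbit \<rho>"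
  unfolding orbit_def using Aut_comp by (auto simp: comp_assoc)

lemma orbit_eq: assumes "\<rho>' \<in> orbit \<rho>" shows "orbit \<rho>' = orbit \<rho>"
proof -
  obtain \<sigma> where s: "\<sigma> \<in> Aut_quat" "\<rho>' = \<rho> \<circ> \<sigma>" using assms unfolding orbit_def by blast
  have "\<rho> = \<rho>' \<circ> inv \<sigma>" unfolding s(2) using Aut_inv(2)[OF s(1)] by (auto simp: fun_eq_iff)
  then have "\<rho> \<in> orbit \<rho>'" unfolding orbit_def using Aut_inv(1)[OF s(1)] by blast
  then show ?thesis using assms orbit_comp unfolding orbit_def by blast
qed

lemma hypercomplex_facts:
  assumes "hypercomplex E \<rho>"
  shows "x \<in> E \<Longrightarrow> \<rho> q x \<in> E" "linear_from E (\<rho> q)" "\<rho> (p + q) x = \<rho> p x + \<rho> q x" "\<rho> (c *\<^sub>R q) x = c *\<^sub>R \<rho> q x"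
    "x \<in> E \<Longrightarrow> \<rho> 1 x = x" "\<rho> (p * q) x = \<rho> p (\<rho> q x)"
  using assms by (auto simp: hypercomplex_def Hom_def zero_ext_def linear_add linear_scale)

lemma hypercomplex_orbit: assumes "hypercomplex E \<rho>" "\<rho>' \<in> orbit \<rho>" shows "hypercomplex E \<rho>'"
proof -
  obtain \<sigma> where s: "\<sigma> \<in> Aut_quat" "\<rho>' = \<rho> \<circ> \<sigma>" using assms(2) unfolding orbit_def by blast
  then show ?thesis using assms(1) linear_compose[OF Aut_facts(1)[OF s(1)], of \<rho>] Aut_facts[OF s(1)]
    by (auto simp: hypercomplex_def)
qed

lemma rep_facts:
  assumes "is_pair P" "\<rho> \<in> qstruct (snd P)"
  shows "hypercomplex (vspace (snd P)) \<rho>" "qstruct (snd P) = orbit \<rho>" "subspace (vspace (snd P))" "fin_dim (vspace (snd P))"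
    "subspace (fst P)" "fst P \<subseteq> vspace (snd P)"
proof -
  obtain U E where P: "P = (U, E)" by (cases P)
  obtain B \<rho>0 where B: "finite B" "vspace E = span B" and r: "hypercomplex (vspace E) \<rho>0" "qstruct E = orbit \<rho>0"
    using assms(1) unfolding is_pair_def quaternionic_space_def P by auto
  have m: "\<rho> \<in> orbit \<rho>0" using assms(2) r(2) by (simp add: P)
  show "hypercomplex (vspace (snd P)) \<rho>" using hypercomplex_orbit[OF r(1) m] by (simp add: P)
  show "qstruct (snd P) = orbit \<rho>" using orbit_eq[OF m] r(2) by (simp add: P)
  show "subspace (vspace (snd P))" by (simp add: P B(2))
  show "fin_dim (vspace (snd P))" unfolding fin_dim_def using B by (auto simp: P)
  show "subspace (fst P)" "fst P \<subseteq> vspace (snd P)" using assms(1) by (auto simp: is_pair_def P)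
qed

lemma rep_exists: "is_pair P \<Longrightarrow> \<exists>\<rho>. \<rho> \<in> qstruct (snd P)"
proof -
  assume "is_pair P"
  then obtain \<rho> where "qstruct (snd P) = orbit \<rho>" unfolding is_pair_def quaternionic_space_def by (auto split: prod.splits)
  then show "\<exists>\<rho>. \<rho> \<in> qstruct (snd P)" using orbit_self[of \<rho>] by auto
qed

lemma admissible_eq:
  assumes "qstruct E = orbit \<rho>" shows "admissible_structures E = \<rho> ` S2"
proof
  show "admissible_structures E \<subseteq> \<rho> ` S2"
    unfolding admissible_structures_def assms orbit_def using Aut_S2 by auto
  show "\<rho> ` S2 \<subseteq> admissible_structures E"
    unfolding admissible_structures_def assms using orbit_self by blast
qed

section \<open>Isomorphisms of pairs\<close>

definition pobj :: "(quat \<Rightarrow> 'a \<Rightarrow> 'a) \<Rightarrow> 'a qpair \<Rightarrow> 'a obj" where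
  "pobj \<rho> P = (\<rho>, fst P, vspace (snd P))"

lemma carr_pobj: "carr (pobj \<rho> P) = vspace (snd P)" by (simp add: carr_def pobj_def)

lemma obj_pobj: assumes "is_pair P" "\<rho> \<in> qstruct (snd P)" shows "obj (pobj \<rho> P)"
  using rep_facts[OF assms] hypercomplex_facts[OF rep_facts(1)[OF assms]] by (auto simp: obj_def pobj_def)

lemma pair_morphism_of_mor:
  assumes P: "is_pair P" "\<rho> \<in> qstruct (snd P)" and P': "is_pair P'" "\<rho>' \<in> qstruct (snd P')"
    and f: "mor (pobj \<rho> P) (pobj \<rho>' P') f"
  shows "pair_morphism P P' f"
proof -
  let ?E = "snd P" and ?E' = "snd P'"
  have f': "linear_from (vspace ?E) f" "f ` vspace ?E \<subseteq> vspace ?E'" "f ` fst P \<subseteq> fst P'"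
    "\<And>q x. x \<in> vspace ?E \<Longrightarrow> f (\<rho> q x) = \<rho>' q (f x)" using f by (auto simp: mor_def pobj_def)
  have a: "admissible_structures ?E = \<rho> ` S2" "admissible_structures ?E' = \<rho>' ` S2"
    using admissible_eq rep_facts(2)[OF P] rep_facts(2)[OF P'] by auto
  define T where "T J = \<rho>' (SOME q. q \<in> S2 \<and> J = \<rho> q)" for J
  have T: "\<exists>q\<in>S2. J = \<rho> q \<and> T J = \<rho>' q" if "J \<in> \<rho> ` S2" for J
  proof -
    have "\<exists>q. q \<in> S2 \<and> J = \<rho> q" using that by blast
    then have "(SOME q. q \<in> S2 \<and> J = \<rho> q) \<in> S2 \<and> J = \<rho> (SOME q. q \<in> S2 \<and> J = \<rho> q)" by (rule someI_ex)
    then show ?thesis unfolding T_def by blast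
  qed
  have "T ` admissible_structures ?E \<subseteq> admissible_structures ?E'" using T unfolding a by blast
  moreover have "f (J x) = T J (f x)" if "J \<in> admissible_structures ?E" "x \<in> vspace ?E" for J x
    using T[of J] that f'(4) unfolding a by auto
  ultimately have "quaternionic_map ?E ?E' f" unfolding quaternionic_map_def using f'(1,2) by blast
  then show ?thesis using f'(3) by (simp add: pair_morphism_def split_beta)
qed

lemma isomorphic_of_objiso:
  assumes P: "is_pair P" "\<rho> \<in> qstruct (snd P)" and P': "is_pair P'" "\<rho>' \<in> qstruct (snd P')"
    and iso: "objiso (pobj \<rho> P) (pobj \<rho>' P')"
  shows "isomorphic P P'"
proof -
  obtain f g where "inverses (pobj \<rho> P) (pobj \<rho>' P') f g" using iso unfolding objiso_def by blast
  then have fg: "mor (pobj \<rho> P) (pobj \<rho>' P') f" "mor (pobj \<rho>' P') (pobj \<rho> P) g"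
    "\<forall>x\<in>vspace (snd P). g (f x) = x" "\<forall>y\<in>vspace (snd P'). f (g y) = y" unfolding inverses_def carr_pobj by auto
  show ?thesis unfolding isomorphic_def
    using P(1) P'(1) pair_morphism_of_mor[OF P P' fg(1)] pair_morphism_of_mor[OF P' P fg(2)] fg(3,4) by blast
qed

text \<open>An isomorphism \<open>t\<close> satisfies \<open>t (\<rho> q x) = \<rho>1 (\<sigma> q) (t x)\<close> for some map \<open>\<sigma>\<close> of the quaternions. As \<open>\<rho>1\<close> acts
  faithfully on a nonzero vector, \<open>\<sigma>\<close> is an algebra automorphism, and \<open>t\<close> commutes with the actions \<open>\<rho>\<close> and \<open>\<rho>1 \<circ> \<sigma>\<close>. On the zero
  space take \<open>\<sigma> = id\<close>.\<close>

lemma objiso_of_isomorphic: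
  assumes iso: "isomorphic P P'" and \<rho>: "\<rho> \<in> qstruct (snd P)"
  shows "\<exists>\<rho>'\<in>qstruct (snd P'). objiso (pobj \<rho> P) (pobj \<rho>' P')"
proof -
  have P: "is_pair P" and P': "is_pair P'" using iso by (auto simp: isomorphic_def)
  obtain t s where ts: "pair_morphism P P' t" "pair_morphism P' P s"
    and st: "\<And>x. x \<in> vspace (snd P) \<Longrightarrow> s (t x) = x" "\<And>y. y \<in> vspace (snd P') \<Longrightarrow> t (s y) = y"
    using iso unfolding isomorphic_def by blast
  let ?E = "vspace (snd P)" and ?E' = "vspace (snd P')"
  obtain T where t: "linear_from ?E t" "t ` ?E \<subseteq> ?E'" "t ` fst P \<subseteq> fst P'"
    and T: "T ` admissible_structures (snd P) \<subseteq> admissible_structures (snd P')"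
      "\<And>J x. J \<in> admissible_structures (snd P) \<Longrightarrow> x \<in> ?E \<Longrightarrow> t (J x) = T J (t x)"
    using ts(1) unfolding pair_morphism_def quaternionic_map_def by (auto split: prod.splits)
  have s: "linear_from ?E' s" "s ` ?E' \<subseteq> ?E" "s ` fst P' \<subseteq> fst P"
    using ts(2) unfolding pair_morphism_def quaternionic_map_def by (auto split: prod.splits)
  obtain \<rho>1 where r1: "\<rho>1 \<in> qstruct (snd P')" using rep_exists[OF P'] by blast
  note H = hypercomplex_facts[OF rep_facts(1)[OF P \<rho>]]
  note H1 = hypercomplex_facts[OF rep_facts(1)[OF P' r1]]
  have a: "admissible_structures (snd P) = \<rho> ` S2" "admissible_structures (snd P') = \<rho>1 ` S2"
    using admissible_eq rep_facts(2)[OF P \<rho>] rep_facts(2)[OF P' r1] by auto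
  have tE: "t x \<in> ?E'" if "x \<in> ?E" for x using t(2) that by blast
  have sE: "s y \<in> ?E" if "y \<in> ?E'" for y using s(2) that by blast
  have tadd: "t (x + y) = t x + t y" if "x \<in> ?E" "y \<in> ?E" for x y using t(1) that by (simp add: linear_from_def)
  have tsc: "t (c *\<^sub>R x) = c *\<^sub>R t x" if "x \<in> ?E" for c x using t(1) that by (simp add: linear_from_def)
  have E0: "0 \<in> ?E" "0 \<in> ?E'" using rep_facts(3)[OF P \<rho>] rep_facts(3)[OF P' r1] by (auto simp: subspace_0)
  have \<rho>sc: "\<rho> q (c *\<^sub>R x) = c *\<^sub>R \<rho> q x" if "x \<in> ?E" for q c x using H(2)[of q] that by (simp add: linear_from_def)
  have exq: "\<exists>q'. \<forall>x\<in>?E. t (\<rho> q x) = \<rho>1 q' (t x)" for q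
  proof -
    obtain a' b p where q: "q = of_real a' + b *\<^sub>R p" "p \<in> S2" by (rule quat_polar)
    obtain p' where p': "T (\<rho> p) = \<rho>1 p'" using T(1) q(2) unfolding a by blast
    have "t (\<rho> q x) = \<rho>1 (of_real a' + b *\<^sub>R p') (t x)" if x: "x \<in> ?E" for x
    proof -
      have e: "\<rho> q x = a' *\<^sub>R x + b *\<^sub>R \<rho> p x" unfolding q(1) of_real_def H(3,4) H(5)[OF x] ..
      have pE: "\<rho> p x \<in> ?E" by (rule H(1)[OF x])
      have sc: "c *\<^sub>R y \<in> ?E" if "y \<in> ?E" for c y using that rep_facts(3)[OF P \<rho>] by (simp add: subspace_scale)
      have "t (\<rho> q x) = a' *\<^sub>R t x + b *\<^sub>R t (\<rho> p x)" unfolding e using tadd[OF sc[OF x] sc[OF pE]] tsc x pE by simp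
      also have "t (\<rho> p x) = \<rho>1 p' (t x)" using T(2)[of "\<rho> p" x] x q(2) p' unfolding a by simp
      finally show ?thesis unfolding of_real_def H1(3,4) H1(5)[OF tE[OF x]] .
    qed
    then show ?thesis by blast
  qed
  then obtain \<sigma> where \<sigma>: "\<And>q x. x \<in> ?E \<Longrightarrow> t (\<rho> q x) = \<rho>1 (\<sigma> q) (t x)" by metis
  have "\<exists>\<tau>\<in>Aut_quat. \<forall>q. \<forall>x\<in>?E. t (\<rho> q x) = \<rho>1 (\<tau> q) (t x)"
  proof (cases "?E = {0}")
    case True
    have "t 0 = 0" using tsc[of 0 0] E0 by simp
    moreover have "\<rho> q 0 = 0" "\<rho>1 q 0 = 0" for q
      using \<rho>sc[OF E0(1), of q 0] H1(2)[of q] E0(2) by (simp_all add: linear_from_def) (metis scaleR_zero_left)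
    ultimately show ?thesis using True Aut_id by auto
  next
    case False
    then obtain x0 where x0: "x0 \<in> ?E" "x0 \<noteq> 0" using E0 by blast
    define y0 where "y0 = t x0"
    have y0: "y0 \<in> ?E'" "y0 \<noteq> 0"
    proof -
      show "y0 \<in> ?E'" unfolding y0_def by (rule tE[OF x0(1)])
      have "s 0 = 0" using s(1) E0(2) unfolding linear_from_def by (metis scaleR_zero_left)
      then show "y0 \<noteq> 0" using st(1)[OF x0(1)] x0(2) unfolding y0_def by auto
    qed
    have \<rho>10: "\<rho>1 p 0 = 0" for p using H1(2)[of p] E0(2) unfolding linear_from_def by (metis scaleR_zero_left)
    have uniq: "p = p'" if "\<rho>1 p y0 = \<rho>1 p' y0" for p p'
    proof (rule ccontr)
      assume "p \<noteq> p'"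
      have "\<rho>1 ((p - p') + p') y0 = \<rho>1 (p - p') y0 + \<rho>1 p' y0" by (rule H1(3))
      then have "\<rho>1 (p - p') y0 = 0" using that by simp
      then have "\<rho>1 (inverse (p - p') * (p - p')) y0 = 0" unfolding H1(6) using \<rho>10 by simp
      then show False using \<open>p \<noteq> p'\<close> H1(5)[OF y0(1)] y0(2) by simp
    qed
    have \<sigma>0: "\<rho>1 (\<sigma> q) y0 = t (\<rho> q x0)" for q unfolding y0_def using \<sigma>[OF x0(1)] by simp
    have l: "linear \<sigma>"
    proof (rule linearI)
      fix p q c
      show "\<sigma> (p + q) = \<sigma> p + \<sigma> q"
        by (rule uniq) (simp add: \<sigma>0 H(3) H1(3) tadd[OF H(1)[OF x0(1)] H(1)[OF x0(1)]])
      show "\<sigma> (c *\<^sub>R p) = c *\<^sub>R \<sigma> p" by (rule uniq) (simp add: \<sigma>0 H(4) H1(4) tsc[OF H(1)[OF x0(1)]])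
    qed
    have one: "\<sigma> 1 = 1" by (rule uniq) (simp add: \<sigma>0 H(5)[OF x0(1)] H1(5)[OF y0(1)], simp add: y0_def)
    have mult: "\<sigma> (p * q) = \<sigma> p * \<sigma> q" for p q
      by (rule uniq) (simp add: \<sigma>0 H(6) H1(6) \<sigma>[OF H(1)[OF x0(1)]])
    have inj0: "q = 0" if "\<sigma> q = 0" for q
    proof (rule ccontr)
      assume "q \<noteq> 0"
      then have "\<sigma> (q * inverse q) = 1" using one by simp
      then show False using that by (simp add: mult)
    qed
    have inj: "inj \<sigma>" unfolding linear_injective_0[OF l] using inj0 by blast
    have "range \<sigma> = UNIV"
      using subspace_eq_of_dim_le[OF fin_dim_quat linear_subspace_image[OF l subspace_UNIV] subspace_UNIV subset_UNIV]
        dim_image_inj[OF l subspace_UNIV fin_dim_quat inj0] by simp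
    then have "\<sigma> \<in> Aut_quat" using l one mult inj by (simp add: Aut_quat_def bij_def)
    then show ?thesis using \<sigma> by blast
  qed
  then obtain \<tau> where \<tau>: "\<tau> \<in> Aut_quat" "\<And>q x. x \<in> ?E \<Longrightarrow> t (\<rho> q x) = \<rho>1 (\<tau> q) (t x)" by blast
  let ?\<rho>' = "\<rho>1 \<circ> \<tau>"
  have r': "?\<rho>' \<in> qstruct (snd P')" unfolding rep_facts(2)[OF P' r1] by (rule orbit_comp[OF orbit_self \<tau>(1)])
  have "inverses (pobj \<rho> P) (pobj ?\<rho>' P') t s"
    unfolding inverses_def carr_pobj
  proof (intro conjI ballI st)
    show "mor (pobj \<rho> P) (pobj ?\<rho>' P') t" using t \<tau>(2) by (simp add: mor_def pobj_def)
    have "s (?\<rho>' q y) = \<rho> q (s y)" if y: "y \<in> ?E'" for q y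
    proof -
      have "s (?\<rho>' q y) = s (t (\<rho> q (s y)))" using \<tau>(2)[OF sE[OF y]] st(2)[OF y] by simp
      also have "\<dots> = \<rho> q (s y)" by (rule st(1)[OF H(1)[OF sE[OF y]]])
      finally show ?thesis .
    qed
    then show "mor (pobj ?\<rho>' P') (pobj \<rho> P) s" using s by (simp add: mor_def pobj_def)
  qed
  then show ?thesis using r' unfolding objiso_def by blast
qed

lemma isomorphic_sym: "isomorphic P P' \<Longrightarrow> isomorphic P' P" by (auto simp: isomorphic_def)

lemma objiso_trans: "objiso X Y \<Longrightarrow> objiso Y Z \<Longrightarrow> objiso X Z"
  unfolding objiso_def using inverses_trans by blast

lemma isomorphic_trans: assumes "isomorphic P Q" "isomorphic Q R" shows "isomorphic P R"
proof -
  have p: "is_pair P" "is_pair R" using assms by (auto simp: isomorphic_def)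
  obtain \<rho> where r: "\<rho> \<in> qstruct (snd P)" using rep_exists[OF p(1)] by blast
  obtain \<rho>' where r': "\<rho>' \<in> qstruct (snd Q)" "objiso (pobj \<rho> P) (pobj \<rho>' Q)" using objiso_of_isomorphic[OF assms(1) r] by blast
  obtain \<rho>'' where r'': "\<rho>'' \<in> qstruct (snd R)" "objiso (pobj \<rho>' Q) (pobj \<rho>'' R)" using objiso_of_isomorphic[OF assms(2) r'(1)] by blast
  show ?thesis by (rule isomorphic_of_objiso[OF p(1) r p(2) r''(1) objiso_trans[OF r'(2) r''(2)]])
qed

lemma objiso_cong: assumes "\<And>q x. x \<in> E \<Longrightarrow> \<rho> q x = \<rho>' q x" shows "objiso (\<rho>, U, E) (\<rho>', U, E)"
  unfolding objiso_def inverses_def by (rule exI[of _ "\<lambda>x. x"], rule exI[of _ "\<lambda>x. x"]) (simp add: mor_def linear_from_def assms)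

section \<open>Quaternionic subspaces as pairs\<close>

text \<open>\<open>hmul\<close> extended by 0 outside \<open>F\<close>, the form of operators that \<open>hypercomplex\<close> asks for.\<close>

definition hrep :: "(nat \<Rightarrow> quat) set \<Rightarrow> quat \<Rightarrow> (nat \<Rightarrow> quat) \<Rightarrow> nat \<Rightarrow> quat" where
  "hrep F q = zero_ext F (hmul q)"

definition hspace :: "(nat \<Rightarrow> quat) set \<Rightarrow> (nat \<Rightarrow> quat) qspace" where
  "hspace F = \<lparr>vspace = F, qstruct = orbit (hrep F)\<rparr>"

lemma hspace_sel [simp]: "vspace (hspace F) = F" "qstruct (hspace F) = orbit (hrep F)" by (simp_all add: hspace_def)

lemma quat_space_hspace: "quat_space n = hspace (quat_tuples n)"
  unfolding quat_space_def hspace_def hrep_def hmul_def ..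

lemma hrep_in: "x \<in> F \<Longrightarrow> hrep F q x = hmul q x" and hrep_out: "x \<notin> F \<Longrightarrow> hrep F q x = 0"
  by (simp_all add: hrep_def zero_ext_def)

lemma hypercomplex_hrep: assumes "hsub F" shows "hypercomplex F (hrep F)"
  unfolding hypercomplex_def
proof (intro conjI allI)
  have s: "subspace F" using assms hsub_subspace by blast
  show "hrep F q \<in> Hom F F" for q
    using s hsub_hmul[OF assms] by (auto simp: Hom_def linear_from_def hrep_in hrep_out hmul_simps subspace_add subspace_scale)
  show "linear (hrep F)" by (rule linearI) (auto simp: fun_eq_iff hrep_def zero_ext_def algebra_simps)
  show "hrep F 1 = zero_ext F id" by (auto simp: hrep_def zero_ext_def)
  show "hrep F (p * q) = hrep F p \<circ> hrep F q" for p q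
  proof
    fix x show "hrep F (p * q) x = (hrep F p \<circ> hrep F q) x"
      using hsub_hmul[OF assms, of x q] subspace_0[OF s] by (cases "x \<in> F") (simp_all add: hrep_in hrep_out hmul_simps)
  qed
qed

lemma fin_dim_span_eq: "fin_dim S \<Longrightarrow> subspace S \<Longrightarrow> \<exists>B. finite B \<and> S = span B"
proof -
  assume f: "fin_dim S" and s: "subspace S"
  obtain B where "B \<subseteq> S" "independent B" "S \<subseteq> span B" "finite B" "card B = dim S" by (rule fin_dim_basis[OF f])
  then show ?thesis using s by (intro exI[of _ B]) (simp add: span_minimal subset_antisym)
qed

lemma is_pair_hspace: assumes "hsub F" "F \<subseteq> quat_tuples n" "subspace U" "U \<subseteq> F" shows "is_pair (U, hspace F)"
  using hypercomplex_hrep[OF assms(1)] fin_dim_span_eq[OF fin_dim_sub_tuples[OF assms(2)] hsub_subspace[OF assms(1)]] assms(3,4)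
  by (auto simp: is_pair_def quaternionic_space_def)

lemma isomorphic_hspace:
  assumes "hsub E" "E \<subseteq> quat_tuples n" "subspace U" "U \<subseteq> E" and "hsub E'" "E' \<subseteq> quat_tuples n'" "subspace U'" "U' \<subseteq> E'"
    and \<tau>: "\<tau> \<in> Aut_quat" and f: "linear f" "\<And>p x. f (hmul p x) = hmul (\<tau> p) (f x)"
    and inj: "\<And>x. x \<in> E \<Longrightarrow> f x = 0 \<Longrightarrow> x = 0" and on: "f ` E = E'" "f ` U = U'"
  shows "isomorphic (U, hspace E) (U', hspace E')"
proof (rule isomorphic_of_objiso)
  show "is_pair (U, hspace E)" "is_pair (U', hspace E')" using assms is_pair_hspace by auto
  show "hrep E \<in> qstruct (snd (U, hspace E))" using orbit_self by simp
  show r': "hrep E' \<circ> \<tau> \<in> qstruct (snd (U', hspace E'))" using orbit_comp[OF orbit_self \<tau>] by simp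
  have o: "obj (pobj (hrep E) (U, hspace E))" by (rule obj_pobj) fact+
  have "mor (pobj (hrep E) (U, hspace E)) (pobj (hrep E' \<circ> \<tau>) (U', hspace E')) f"
    using f on by (auto simp: mor_def pobj_def linear_from_def linear_add linear_scale hrep_in)
  then have "\<exists>h. inverses (pobj (hrep E) (U, hspace E)) (pobj (hrep E' \<circ> \<tau>) (U', hspace E')) f h"
    by (rule bijective_mor_invertible[OF o pobj_def pobj_def]) (use inj on in auto)
  then show "objiso (pobj (hrep E) (U, hspace E)) (pobj (hrep E' \<circ> \<tau>) (U', hspace E'))"
    unfolding objiso_def by blast
qed

lemma isomorphic_hiso:
  assumes "hsub E" "E \<subseteq> quat_tuples n" "subspace U" "U \<subseteq> E" and "hsub E'" "E' \<subseteq> quat_tuples n'" "subspace U'" "U' \<subseteq> E'"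
    and "hiso U E U' E'"
  shows "isomorphic (U, hspace E) (U', hspace E')"
proof -
  obtain f where f: "hlin f" "\<forall>x\<in>E. f x = 0 \<longrightarrow> x = 0" "f ` E = E'" "f ` U = U'" using assms(9) unfolding hiso_def by blast
  show ?thesis
    by (rule isomorphic_hspace[OF assms(1-8) Aut_id hlin_linear[OF f(1)]]) (use f hlin_hmul[OF f(1)] in auto)
qed

section \<open>Dual pairs\<close>

text \<open>The inner product identifies \<open>H\<^sup>N\<close> with its dual. It takes orthogonal complements to annihilators, and the
  adjoint of the multiplication by \<open>q\<close> is the multiplication by \<open>qcnj q\<close>, which is how the dual structure is twisted.\<close>

lemma dual_pair_isomorphic:
  assumes UM: "subspace UM" "UM \<subseteq> quat_tuples N"
  shows "isomorphic (perp N (quat_tuples N) UM, quat_space N) (dual_pair (UM, quat_space N))"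
proof -
  let ?V = "quat_tuples N"
  define d where "d y = zero_ext ?V (\<lambda>x. ip N y x)" for y
  define E' :: "((nat \<Rightarrow> quat) \<Rightarrow> real) set" where "E' = Hom ?V UNIV"
  have ld: "linear d" unfolding d_def by (rule linearI) (auto simp: fun_eq_iff zero_ext_def ip_simps)
  have d_in: "d y x = ip N y x" if "x \<in> ?V" for x y using that by (simp add: d_def zero_ext_def)
  have d_out: "d y x = 0" if "x \<notin> ?V" for x y using that by (simp add: d_def zero_ext_def)
  have dinj: "y = 0" if "y \<in> ?V" "d y = 0" for y
    using ip_pos[OF that(1)] d_in[OF that(1), of y] that(2) by simp
  have dE: "d y \<in> E'" for y
    using subspace_add[OF subspace_tuples, of _ N] subspace_scale[OF subspace_tuples, of _ N]
    by (auto simp: E'_def Hom_def linear_from_def d_in d_out ip_simps)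
  have dV: "d ` ?V = E'"
  proof
    show "d ` ?V \<subseteq> E'" using dE by blast
    show "E' \<subseteq> d ` ?V"
    proof
      fix \<alpha> assume \<alpha>: "\<alpha> \<in> E'"
      obtain F where F: "linear F" "\<forall>x\<in>?V. F x = \<alpha> x"
        using linear_from_extend[of ?V \<alpha>] \<alpha> by (auto simp: E'_def Hom_def)
      define y where "y r = (if r < N then \<Sum>\<epsilon>\<in>units. F (single r \<epsilon>) *\<^sub>R \<epsilon> else 0)" for r
      have y: "y \<in> ?V" by (simp add: y_def quat_tuples_def)
      have ls: "linear (\<lambda>q. F (single r q))" for r using linear_compose[OF linear_single F(1), of r] by (simp add: o_def)
      have "ip N y x = F x" if x: "x \<in> ?V" for x
      proof -
        have "y r \<bullet> q = F (single r q)" if "r < N" for r q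
        proof -
          have "F (single r q) = qRe q * F (single r 1) + qI q * F (single r quat_i) + qJ q * F (single r quat_j) + qK q * F (single r quat_k)"
            by (subst quat_span[of q]) (simp add: linear_add[OF ls] linear_scale[OF ls])
          then show ?thesis using that by (simp add: y_def sum_units inner_quat_def algebra_simps)
        qed
        then have "ip N y x = (\<Sum>r<N. F (single r (x r)))" by (simp add: ip_def)
        also have "\<dots> = F (\<Sum>r<N. single r (x r))" by (rule linear_sum[OF F(1), symmetric])
        also have "(\<Sum>r<N. single r (x r)) = x"
        proof
          fix j
          have "(\<Sum>r<N. single r (x r)) j = (\<Sum>r<N. if r = j then x j else 0)"
            unfolding fun_sum by (intro sum.cong) (auto simp: single_def)
          also have "\<dots> = x j" using x by (auto simp: quat_tuples_def)
          finally show "(\<Sum>r<N. single r (x r)) j = x j" .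
        qed
        finally show ?thesis .
      qed
      then have "d y = \<alpha>" using F(2) \<alpha> d_in d_out by (auto simp: fun_eq_iff E'_def Hom_def) (metis)
      then show "\<alpha> \<in> d ` ?V" using y by blast
    qed
  qed
  define \<rho>s where "\<rho>s q = zero_ext E' (\<lambda>\<alpha>. \<alpha> \<circ> hrep ?V (qcnj q))" for q
  have key: "\<rho>s q (d y) = d (hmul q y)" for q y
  proof
    fix x
    have "\<rho>s q (d y) x = d y (hrep ?V (qcnj q) x)" using dE[of y] by (simp add: \<rho>s_def zero_ext_def)
    also have "\<dots> = d (hmul q y) x"
    proof (cases "x \<in> ?V")
      case True
      then show ?thesis using hsub_hmul[OF hsub_tuples True, of "qcnj q"] by (simp add: hrep_in d_in ip_hmul)
    next
      case False
      then show ?thesis using subspace_0[OF subspace_tuples, of N] by (simp add: hrep_out d_out d_in ip_simps)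
    qed
    finally show "\<rho>s q (d y) x = d (hmul q y) x" .
  qed
  have out: "\<rho>s q \<alpha> = 0" if "\<alpha> \<notin> E'" for q \<alpha> using that by (simp add: \<rho>s_def zero_ext_def)
  have sE': "subspace E'" unfolding dV[symmetric] by (rule linear_subspace_image[OF ld subspace_tuples])
  have fE': "fin_dim E'" unfolding dV[symmetric] by (rule fin_dim_image[OF fin_dim_tuples ld])
  have rep: "\<exists>y\<in>?V. \<alpha> = d y" if "\<alpha> \<in> E'" for \<alpha> using that dV by blast
  have hyp: "hypercomplex E' \<rho>s"
    unfolding hypercomplex_def
  proof (intro conjI allI)
    show "\<rho>s q \<in> Hom E' E'" for q unfolding Hom_def
    proof (intro CollectI conjI allI impI)
      show "linear_from E' (\<rho>s q)" unfolding linear_from_def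
      proof (intro conjI ballI allI)
        fix \<alpha> \<beta> assume "\<alpha> \<in> E'" "\<beta> \<in> E'"
        then obtain y z where "\<alpha> = d y" "\<beta> = d z" using rep by blast
        then show "\<rho>s q (\<alpha> + \<beta>) = \<rho>s q \<alpha> + \<rho>s q \<beta>" by (simp only: key linear_add[OF ld, symmetric] hmul_simps(2))
      next
        fix c \<alpha> assume "\<alpha> \<in> E'"
        then obtain y where "\<alpha> = d y" using rep by blast
        then show "\<rho>s q (c *\<^sub>R \<alpha>) = c *\<^sub>R \<rho>s q \<alpha>" by (simp only: key linear_scale[OF ld, symmetric] hmul_simps(5))
      qed
      show "\<rho>s q ` E' \<subseteq> E'"
      proof (rule image_subsetI)
        fix \<alpha> assume "\<alpha> \<in> E'"
        then obtain y where "\<alpha> = d y" using rep by blast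
        then show "\<rho>s q \<alpha> \<in> E'" using key dE by simp
      qed
    qed (rule out)
    show "linear \<rho>s"
    proof (rule linearI; rule ext)
      fix p q c \<alpha>
      show "\<rho>s (p + q) \<alpha> = (\<rho>s p + \<rho>s q) \<alpha>"
      proof (cases "\<alpha> \<in> E'")
        case True
        then obtain y where "\<alpha> = d y" using rep by blast
        then show ?thesis by (simp add: key hmul_simps(1) linear_add[OF ld])
      qed (simp add: out)
      show "\<rho>s (c *\<^sub>R p) \<alpha> = (c *\<^sub>R \<rho>s p) \<alpha>"
      proof (cases "\<alpha> \<in> E'")
        case True
        then obtain y where "\<alpha> = d y" using rep by blast
        then show ?thesis by (simp add: key hmul_simps(4) linear_scale[OF ld])
      qed (simp add: out)
    qed
    show "\<rho>s 1 = zero_ext E' id"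
    proof
      fix \<alpha> show "\<rho>s 1 \<alpha> = zero_ext E' id \<alpha>"
        using rep[of \<alpha>] key[of 1] out[of \<alpha> 1] by (auto simp: zero_ext_def)
    qed
    show "\<rho>s (p * q) = \<rho>s p \<circ> \<rho>s q" for p q
    proof
      fix \<alpha> show "\<rho>s (p * q) \<alpha> = (\<rho>s p \<circ> \<rho>s q) \<alpha>"
      proof (cases "\<alpha> \<in> E'")
        case True
        then obtain y where "\<alpha> = d y" using rep by blast
        then show ?thesis by (simp add: key hmul_simps(3))
      next
        case False
        have "\<rho>s p 0 = 0" using key[of p 0] linear_0[OF ld] by simp
        then show ?thesis using False by (simp add: out)
      qed
    qed
  qed
  have dual: "dual_pair (UM, quat_space N) = ({\<alpha> \<in> E'. \<forall>x\<in>UM. \<alpha> x = 0}, \<lparr>vspace = E', qstruct = orbit \<rho>s\<rparr>)"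
  proof -
    have "{\<lambda>q. zero_ext E' (\<lambda>\<alpha>. \<alpha> \<circ> \<rho> (qcnj q)) |\<rho>. \<rho> \<in> orbit (hrep ?V)} = orbit \<rho>s"
    proof -
      have e: "(\<lambda>q. zero_ext E' (\<lambda>\<alpha>. \<alpha> \<circ> (hrep ?V \<circ> \<sigma>) (qcnj q))) = \<rho>s \<circ> \<sigma>" if "\<sigma> \<in> Aut_quat" for \<sigma>
        unfolding \<rho>s_def comp_def Aut_qcnj[OF that] ..
      show ?thesis
      proof (intro set_eqI iffI)
        fix \<rho>' assume "\<rho>' \<in> {\<lambda>q. zero_ext E' (\<lambda>\<alpha>. \<alpha> \<circ> \<rho> (qcnj q)) |\<rho>. \<rho> \<in> orbit (hrep ?V)}"
        then obtain \<sigma> where "\<sigma> \<in> Aut_quat" "\<rho>' = (\<lambda>q. zero_ext E' (\<lambda>\<alpha>. \<alpha> \<circ> (hrep ?V \<circ> \<sigma>) (qcnj q)))"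
          unfolding orbit_def by blast
        then show "\<rho>' \<in> orbit \<rho>s" unfolding orbit_def using e by blast
      next
        fix \<rho>' assume "\<rho>' \<in> orbit \<rho>s"
        then obtain \<sigma> where s: "\<sigma> \<in> Aut_quat" "\<rho>' = \<rho>s \<circ> \<sigma>" unfolding orbit_def by blast
        have "hrep ?V \<circ> \<sigma> \<in> orbit (hrep ?V)" unfolding orbit_def using s(1) by blast
        then show "\<rho>' \<in> {\<lambda>q. zero_ext E' (\<lambda>\<alpha>. \<alpha> \<circ> \<rho> (qcnj q)) |\<rho>. \<rho> \<in> orbit (hrep ?V)}"
          using e[OF s(1)] s(2) by (intro CollectI exI[of _ "hrep ?V \<circ> \<sigma>"]) simp
      qed
    qed
    then show ?thesis by (simp add: dual_pair_def dual_space_def Let_def quat_space_hspace E'_def)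
  qed
  have dperp: "d ` perp N ?V UM = {\<alpha> \<in> E'. \<forall>x\<in>UM. \<alpha> x = 0}"
  proof (intro set_eqI iffI)
    fix \<alpha> assume "\<alpha> \<in> d ` perp N ?V UM"
    then obtain y where y: "\<alpha> = d y" "y \<in> perp N ?V UM" by (rule imageE)
    then show "\<alpha> \<in> {\<alpha> \<in> E'. \<forall>x\<in>UM. \<alpha> x = 0}" using dE UM(2) by (auto simp: perp_def d_in subset_iff)
  next
    fix \<alpha> assume a: "\<alpha> \<in> {\<alpha> \<in> E'. \<forall>x\<in>UM. \<alpha> x = 0}"
    then obtain y where y: "y \<in> ?V" "\<alpha> = d y" using rep by blast
    have "ip N y x = 0" if "x \<in> UM" for x using a that d_in[of x y] UM(2) y(2) by auto
    then show "\<alpha> \<in> d ` perp N ?V UM" using y by (auto simp: perp_def)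
  qed
  have dsel: "vspace (snd (dual_pair (UM, quat_space N))) = E'" "fst (dual_pair (UM, quat_space N)) = {\<alpha> \<in> E'. \<forall>x\<in>UM. \<alpha> x = 0}"
    unfolding dual by simp_all
  have vsel: "vspace (quat_space N) = ?V" by (simp add: quat_space_hspace)
  have sP: "subspace (perp N ?V UM)" "perp N ?V UM \<subseteq> ?V" using subspace_perp[OF subspace_tuples] perp_subset by auto
  have pd: "is_pair (dual_pair (UM, quat_space N))"
    unfolding dual is_pair_def quaternionic_space_def prod.case
  proof (intro conjI)
    show "\<exists>B. finite B \<and> vspace \<lparr>vspace = E', qstruct = orbit \<rho>s\<rparr> = span B" using fin_dim_span_eq[OF fE' sE'] by simp
    show "\<exists>\<rho>. hypercomplex (vspace \<lparr>vspace = E', qstruct = orbit \<rho>s\<rparr>) \<rho> \<and> qstruct \<lparr>vspace = E', qstruct = orbit \<rho>s\<rparr> = orbit \<rho>"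
      using hyp by auto
    show "subspace {\<alpha> \<in> E'. \<forall>x\<in>UM. \<alpha> x = 0}" unfolding dperp[symmetric] by (rule linear_subspace_image[OF ld sP(1)])
  qed auto
  have pp: "is_pair (perp N ?V UM, quat_space N)" unfolding quat_space_hspace by (rule is_pair_hspace[OF hsub_tuples subset_refl sP])
  have r: "hrep ?V \<in> qstruct (snd (perp N ?V UM, quat_space N))" using orbit_self by (simp add: quat_space_hspace)
  show ?thesis
  proof (rule isomorphic_of_objiso[OF pp r pd])
    show "\<rho>s \<in> qstruct (snd (dual_pair (UM, quat_space N)))" unfolding dual using orbit_self by simp
    have m: "mor (pobj (hrep ?V) (perp N ?V UM, quat_space N)) (pobj \<rho>s (dual_pair (UM, quat_space N))) d"
      unfolding mor_def pobj_def prod.case dsel fst_conv snd_conv vsel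
    proof (intro conjI allI ballI)
      show "linear_from ?V d" unfolding linear_from_def by (simp add: linear_add[OF ld] linear_scale[OF ld])
      show "d ` ?V \<subseteq> E'" "d ` perp N ?V UM \<subseteq> {\<alpha> \<in> E'. \<forall>x\<in>UM. \<alpha> x = 0}" unfolding dV dperp by simp_all
      show "d (hrep ?V q x) = \<rho>s q (d x)" if "x \<in> ?V" for q x unfolding key hrep_in[OF that] ..
    qed
    have "\<exists>h. inverses (pobj (hrep ?V) (perp N ?V UM, quat_space N)) (pobj \<rho>s (dual_pair (UM, quat_space N))) d h"
      by (rule bijective_mor_invertible[OF obj_pobj[OF pp r] pobj_def pobj_def m])
        (simp_all only: dsel fst_conv snd_conv vsel dV dperp dinj)
    then show "objiso (pobj (hrep ?V) (perp N ?V UM, quat_space N)) (pobj \<rho>s (dual_pair (UM, quat_space N)))"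
      unfolding objiso_def by blast
  qed
qed

section \<open>Normal forms of the listed pairs\<close>

text \<open>Representatives of the listed pairs inside \<open>quat_tuples N\<close>, with orthogonal complements in place of the duals.\<close>

definition normal_form :: "(nat \<Rightarrow> nat \<Rightarrow> quat) \<Rightarrow> nat \<Rightarrow> (nat \<Rightarrow> quat) set \<Rightarrow> bool" where
  "normal_form c N UM \<longleftrightarrow> model c N UM \<or> (\<exists>UN'. model c N UN' \<and> UM = perp N (quat_tuples N) UN') \<or>
     (N \<ge> 1 \<and> (\<exists>q\<in>S2. UM = W_sub N q))"

lemma normal_form_subspace:
  assumes "admissible_choice c" "normal_form c N UM" shows "subspace UM" "UM \<subseteq> quat_tuples N"
proof -
  consider "model c N UM" | UN' where "UM = perp N (quat_tuples N) UN'" | q where "UM = W_sub N q"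
    using assms(2) unfolding normal_form_def by blast
  then have "subspace UM \<and> UM \<subseteq> quat_tuples N"
  proof cases
    case 1 show ?thesis using model_stable[OF assms(1) 1] by (simp add: slope_stable_def)
  next
    case 2 show ?thesis unfolding 2 using subspace_perp[OF subspace_tuples] perp_subset by simp
  next
    case 3 show ?thesis unfolding 3 using subspace_W_sub W_sub_tuples by simp
  qed
  then show "subspace UM" "UM \<subseteq> quat_tuples N" by auto
qed

lemma normal_form_local:
  assumes "admissible_choice c" "normal_form c N UM" shows "local_obj (hmul, UM, quat_tuples N)"
proof -
  consider "model c N UM" | UN' where "model c N UN'" "UM = perp N (quat_tuples N) UN'" | q where "N \<ge> 1" "q \<in> S2" "UM = W_sub N q"
    using assms(2) unfolding normal_form_def by blast
  then show ?thesis
  proof cases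
    case 1 show ?thesis by (rule local_stable[OF model_stable[OF assms(1) 1] subset_refl])
  next
    case 2 show ?thesis unfolding 2(2) by (rule local_stable[OF slope_stable_perp[OF model_stable[OF assms(1) 2(1)] subset_refl] subset_refl])
  next
    case 3 then show ?thesis by (simp add: local_W_sub)
  qed
qed

lemma listed_iff_normal_form:
  assumes c: "admissible_choice c"
  shows "listed c P \<longleftrightarrow> (\<exists>N UM. normal_form c N UM \<and> isomorphic P (UM, quat_space N))"
proof
  have dual: "isomorphic (perp N (quat_tuples N) UM, quat_space N) (dual_pair (UM, quat_space N))" if "model c N UM" for N UM
    using dual_pair_isomorphic model_stable[OF c that] unfolding slope_stable_def by blast
  have mU: "model c (k + 1) (U_sub k (c k))" and mV: "model c (2 * k + 1) (V_sub k)" for k unfolding model_def by blast+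
  {
    assume "listed c P"
    then consider k where "isomorphic P (U_sub k (c k), quat_space (k + 1))" | k where "isomorphic P (V_sub k, quat_space (2 * k + 1))"
      | k q where "k \<ge> 1" "q \<in> S2" "isomorphic P (W_sub k q, quat_space k)"
      | k where "isomorphic P (dual_pair (U_sub k (c k), quat_space (k + 1)))"
      | k where "isomorphic P (dual_pair (V_sub k, quat_space (2 * k + 1)))" unfolding listed_def by blast
    then show "\<exists>N UM. normal_form c N UM \<and> isomorphic P (UM, quat_space N)"
    proof cases
      case 1 then show ?thesis using mU unfolding normal_form_def by blast
    next
      case 2 then show ?thesis using mV unfolding normal_form_def by blast
    next
      case 3 then show ?thesis unfolding normal_form_def by blast
    next
      case (4 k)
      then show ?thesis using isomorphic_trans[OF 4 isomorphic_sym[OF dual[OF mU]]] mU unfolding normal_form_def by blast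
    next
      case (5 k)
      then show ?thesis using isomorphic_trans[OF 5 isomorphic_sym[OF dual[OF mV]]] mV unfolding normal_form_def by blast
    qed
  }
  assume "\<exists>N UM. normal_form c N UM \<and> isomorphic P (UM, quat_space N)"
  then obtain N UM where n: "normal_form c N UM" and iso: "isomorphic P (UM, quat_space N)" by blast
  consider "model c N UM" | UN' where "model c N UN'" "UM = perp N (quat_tuples N) UN'" | q where "N \<ge> 1" "q \<in> S2" "UM = W_sub N q"
    using n unfolding normal_form_def by blast
  then show "listed c P"
  proof cases
    case 1 then show ?thesis using iso unfolding listed_def model_def by blast
  next
    case 2
    have "isomorphic P (dual_pair (UN', quat_space N))" using isomorphic_trans[OF iso] dual[OF 2(1)] 2(2) by simp
    then show ?thesis using 2(1) unfolding listed_def model_def by blast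
  next
    case 3 then show ?thesis using iso unfolding listed_def by blast
  qed
qed

lemma listed_local:
  assumes c: "admissible_choice c" and P: "listed c P" "\<rho> \<in> qstruct (snd P)"
  shows "is_pair P" "obj (pobj \<rho> P)" "local_obj (pobj \<rho> P)"
proof -
  obtain N UM where n: "normal_form c N UM" and iso: "isomorphic P (UM, quat_space N)"
    using P(1) listed_iff_normal_form[OF c] by blast
  show pP: "is_pair P" using iso by (simp add: isomorphic_def)
  show o: "obj (pobj \<rho> P)" by (rule obj_pobj[OF pP P(2)])
  note s = normal_form_subspace[OF c n]
  let ?V = "quat_tuples N"
  have X: "obj (hmul, UM, ?V)" "local_obj (hmul, UM, ?V)" using obj_hmul[OF hsub_tuples s] normal_form_local[OF c n] by auto
  have pM: "is_pair (UM, quat_space N)" using iso by (simp add: isomorphic_def)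
  have rM: "hrep ?V \<in> qstruct (snd (UM, quat_space N))" using orbit_self by (simp add: quat_space_hspace)
  have "objiso (hmul, UM, ?V) (hrep ?V, UM, ?V)" by (rule objiso_cong) (simp add: hrep_in)
  then have LM: "local_obj (pobj (hrep ?V) (UM, quat_space N))"
    using local_objiso[OF _ X] obj_pobj[OF pM rM] by (simp add: pobj_def quat_space_hspace)
  obtain \<rho>' where r': "\<rho>' \<in> qstruct (snd P)" "objiso (pobj (hrep ?V) (UM, quat_space N)) (pobj \<rho>' P)"
    using objiso_of_isomorphic[OF isomorphic_sym[OF iso] rM] by blast
  have L': "local_obj (pobj \<rho>' P)" by (rule local_objiso[OF r'(2) obj_pobj[OF pM rM] LM obj_pobj[OF pP r'(1)]])
  have "\<rho> \<in> orbit \<rho>'" using rep_facts(2)[OF pP r'(1)] P(2) by simp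
  then obtain \<sigma> where \<sigma>: "\<sigma> \<in> Aut_quat" "\<rho> = \<rho>' \<circ> \<sigma>" unfolding orbit_def by blast
  \<comment> \<open>Precomposition with an automorphism does not change the set of operators, nor the endomorphisms.\<close>
  have mm: "mor (pobj \<rho> P) (pobj \<rho> P) f \<longleftrightarrow> mor (pobj \<rho>' P) (pobj \<rho>' P) f" for f
  proof -
    have "(\<forall>q. \<forall>x\<in>vspace (snd P). f (\<rho> q x) = \<rho> q (f x)) \<longleftrightarrow> (\<forall>q. \<forall>x\<in>vspace (snd P). f (\<rho>' q x) = \<rho>' q (f x))"
      unfolding \<sigma>(2) comp_def using Aut_inv(2)[OF \<sigma>(1)] by metis
    then show ?thesis by (simp add: mor_def pobj_def)
  qed
  show "local_obj (pobj \<rho> P)" using L' unfolding local_obj_def inverses_def carr_pobj mm .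
qed

section \<open>Internal decompositions\<close>

text \<open>If neither \<open>U\<close> nor its orthogonal complement has slope greater than \<open>1/2\<close> anywhere, then both have dimension
  exactly \<open>dim E / 2\<close>.\<close>

lemma listed_summand:
  assumes c: "admissible_choice c" and E: "hsub E" "E \<subseteq> quat_tuples n" "E \<noteq> {0}" and U: "subspace U" "U \<subseteq> E"
  shows "\<exists>I J. splits U E I J \<and> I \<noteq> {0} \<and> listed c (U \<inter> I, hspace I)"
proof -
  have sE: "subspace E" using E hsub_subspace by blast
  have fin: ?thesis if sp: "splits U E I J" and n: "normal_form c N UM" and
    iso: "I \<subseteq> quat_tuples n \<Longrightarrow> isomorphic (U \<inter> I, hspace I) (UM, quat_space N)" for I J N UM
  proof -
    have h: "hsub I" "hsub J" "E = I \<oplus>\<^sub>s J" using sp unfolding splits_def by auto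
    have "I \<subseteq> E" using ssum_sup1[OF hsub_subspace[OF h(2)], of I] h(3) by simp
    then have It: "I \<subseteq> quat_tuples n" using E(2) by blast
    have L: "listed c (U \<inter> I, hspace I)" using iso[OF It] n listed_iff_normal_form[OF c] by blast
    have r: "hrep I \<in> qstruct (snd (U \<inter> I, hspace I))" using orbit_self by simp
    have "I \<noteq> {0}" using listed_local(3)[OF c L r] unfolding local_obj_def carr_pobj by simp
    then show ?thesis using sp L by blast
  qed
  have sub: "hsub I" "subspace (U \<inter> I)" if "splits U E I J" for I J
    using that U(1) hsub_subspace unfolding splits_def by (auto intro: subspace_inter)
  show ?thesis
  proof (cases "\<exists>K0. hsub K0 \<and> K0 \<subseteq> E \<and> (dim K0 < 2 * dim (U \<inter> K0) \<or> dim K0 < 2 * dim (perp n E U \<inter> K0))")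
    case True
    then obtain K0 where "hsub K0" "K0 \<subseteq> E" "dim K0 < 2 * dim (U \<inter> K0) \<or> dim K0 < 2 * dim (perp n E U \<inter> K0)" by blast
    then obtain N UM A B where m: "model c N UM" and sp: "splits U E A B"
      and iso: "hiso (U \<inter> A) A UM (quat_tuples N) \<or> hiso (perp N (quat_tuples N) UM) (quat_tuples N) (U \<inter> A) A"
      using indefinite_summand[OF c E(1,2) U] by blast
    note sA = sub[OF sp]
    have UM: "subspace UM" "UM \<subseteq> quat_tuples N" using model_stable[OF c m] unfolding slope_stable_def by auto
    from iso show ?thesis
    proof
      assume h: "hiso (U \<inter> A) A UM (quat_tuples N)"
      show ?thesis
      proof (rule fin[OF sp])
        show "normal_form c N UM" using m unfolding normal_form_def by blast
        show "isomorphic (U \<inter> A, hspace A) (UM, quat_space N)" if "A \<subseteq> quat_tuples n"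
          unfolding quat_space_hspace by (rule isomorphic_hiso[OF sA(1) that sA(2) _ hsub_tuples subset_refl UM h]) auto
      qed
    next
      assume h: "hiso (perp N (quat_tuples N) UM) (quat_tuples N) (U \<inter> A) A"
      let ?UP = "perp N (quat_tuples N) UM"
      have UP: "subspace ?UP" "?UP \<subseteq> quat_tuples N" using subspace_perp[OF subspace_tuples] perp_subset by auto
      show ?thesis
      proof (rule fin[OF sp])
        show "normal_form c N ?UP" using m unfolding normal_form_def by blast
        show "isomorphic (U \<inter> A, hspace A) (?UP, quat_space N)" if "A \<subseteq> quat_tuples n"
          unfolding quat_space_hspace
          by (rule isomorphic_sym, rule isomorphic_hiso[OF hsub_tuples subset_refl UP sA(1) that sA(2) _ h]) auto
      qed
    qed
  next
    case False
    then have semi: "2 * dim (U \<inter> K) \<le> dim K" and semi': "2 * dim (perp n E U \<inter> K) \<le> dim K" if "hsub K" "K \<subseteq> E" for K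
      using that by (meson not_less)+
    have "U \<inter> E = U" "perp n E U \<inter> E = perp n E U" using U(2) perp_subset by blast+
    then have "2 * dim U \<le> dim E" "2 * dim (perp n E U) \<le> dim E" using semi[OF E(1) subset_refl] semi'[OF E(1) subset_refl] by auto
    then have half: "2 * dim U = dim E" using perp_decomp(3)[OF E(2) sE U] by linarith
    obtain k q \<tau> f I J where k: "k \<ge> 1" and q: "q \<in> S2" and sp: "splits U E I J" and tau: "\<tau> \<in> Aut_quat" and lf: "linear f"
      and inj: "\<forall>x\<in>quat_tuples k. f x = 0 \<longrightarrow> x = 0" and on: "f ` quat_tuples k = I" "f ` W_sub k q = U \<inter> I"
      and tw: "\<forall>p x. f (hmul p x) = hmul (\<tau> p) (f x)"
    proof -
      have "\<exists>k q \<tau> f I J. k \<ge> 1 \<and> q \<in> S2 \<and> splits U E I J \<and> \<tau> \<in> Aut_quat \<and> linear f \<and>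
        (\<forall>x\<in>quat_tuples k. f x = 0 \<longrightarrow> x = 0) \<and> f ` quat_tuples k = I \<and> f ` W_sub k q = U \<inter> I \<and>
        (\<forall>p x. f (hmul p x) = hmul (\<tau> p) (f x))"
        by (rule regular_summand[OF E U half]) (rule semi)
      then show ?thesis by (elim exE conjE) (rule that; assumption)
    qed
    note sA = sub[OF sp]
    show ?thesis
    proof (rule fin[OF sp])
      show "normal_form c k (W_sub k q)" using k q unfolding normal_form_def by blast
      show "isomorphic (U \<inter> I, hspace I) (W_sub k q, quat_space k)" if It: "I \<subseteq> quat_tuples n"
        unfolding quat_space_hspace
      proof (rule isomorphic_sym, rule isomorphic_hspace[OF hsub_tuples subset_refl subspace_W_sub W_sub_tuples sA(1) It sA(2) _ tau lf _ _ on])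
        show "x = 0" if "x \<in> quat_tuples k" "f x = 0" for x using inj that by blast
      qed (use tw in auto)
    qed
  qed
qed

lemma internal_decomposition:
  assumes c: "admissible_choice c" and "hsub E" "E \<subseteq> quat_tuples n" "subspace U" "U \<subseteq> E"
  shows "\<exists>Es. (\<forall>F\<in>set Es. hsub F \<and> F \<subseteq> E \<and> F \<noteq> {0} \<and> listed c (U \<inter> F, hspace F)) \<and>
    (\<lambda>y. \<Sum>i<length Es. y i) ` seq_product Es = E \<and>
    (\<forall>y\<in>seq_product Es. (\<Sum>i<length Es. y i) = 0 \<longrightarrow> y = 0) \<and>
    (\<lambda>y. \<Sum>i<length Es. y i) ` seq_product (map (\<lambda>F. U \<inter> F) Es) = U"
  using assms(2-5)
proof (induction "dim E" arbitrary: E U rule: less_induct)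
  case less
  show ?case
  proof (cases "E = {0}")
    case True
    have s: "seq_product [] = {0 :: nat \<Rightarrow> nat \<Rightarrow> quat}" by (auto simp: seq_product_def fun_eq_iff)
    have "U = {0}" using True less.prems subspace_0 by blast
    then show ?thesis using True s by (intro exI[of _ "[]"]) auto
  next
    case False
    obtain I J where sp: "splits U E I J" and I0: "I \<noteq> {0}" and L: "listed c (U \<inter> I, hspace I)"
      using listed_summand[OF c less.prems(1,2) False less.prems(3,4)] by blast
    have h: "hsub I" "hsub J" "I \<inter> J = {0}" "E = I \<oplus>\<^sub>s J" "U = (U \<inter> I) \<oplus>\<^sub>s (U \<inter> J)" using sp unfolding splits_def by auto
    have s: "subspace I" "subspace J" using h hsub_subspace by auto
    have IE: "I \<subseteq> E" "J \<subseteq> E" using h(4) ssum_sup1[OF s(2), of I] ssum_sup2[OF s(1), of J] by auto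
    have fE: "fin_dim E" by (rule fin_dim_sub_tuples[OF less.prems(2)])
    have fI: "fin_dim I" "fin_dim J" using fin_dim_mono[OF fE] IE by auto
    have "dim E = dim I + dim J" using dim_direct_sum[OF s fI h(3)] h(4) by simp
    moreover have "dim I > 0" using dim_eq_0_fin[OF fI(1) s(1)] I0 by blast
    ultimately have lt: "dim J < dim E" by simp
    have "\<exists>Es. (\<forall>F\<in>set Es. hsub F \<and> F \<subseteq> J \<and> F \<noteq> {0} \<and> listed c (U \<inter> J \<inter> F, hspace F)) \<and>
      (\<lambda>y. \<Sum>i<length Es. y i) ` seq_product Es = J \<and>
      (\<forall>y\<in>seq_product Es. (\<Sum>i<length Es. y i) = 0 \<longrightarrow> y = 0) \<and>
      (\<lambda>y. \<Sum>i<length Es. y i) ` seq_product (map (\<lambda>F. U \<inter> J \<inter> F) Es) = U \<inter> J"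
      by (rule less.hyps[OF lt h(2)]) (use IE less.prems s in \<open>auto intro: subspace_inter\<close>)
    then obtain Es where Es: "\<forall>F\<in>set Es. hsub F \<and> F \<subseteq> J \<and> F \<noteq> {0} \<and> listed c (U \<inter> J \<inter> F, hspace F)"
      and on: "(\<lambda>y. \<Sum>i<length Es. y i) ` seq_product Es = J"
      and inj: "\<forall>y\<in>seq_product Es. (\<Sum>i<length Es. y i) = 0 \<longrightarrow> y = 0"
      and onU: "(\<lambda>y. \<Sum>i<length Es. y i) ` seq_product (map (\<lambda>F. U \<inter> J \<inter> F) Es) = U \<inter> J" by (elim exE conjE) (rule that; assumption)
    have UF: "U \<inter> J \<inter> F = U \<inter> F" if "F \<in> set Es" for F using Es that by blast
    have mapU: "map (\<lambda>F. U \<inter> J \<inter> F) Es = map (\<lambda>F. U \<inter> F) Es" using UF by simp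
    have shift_in: "(\<lambda>i. y (Suc i)) \<in> seq_product Fs" "y 0 \<in> F" if "y \<in> seq_product (F # Fs)"
      for y :: "nat \<Rightarrow> nat \<Rightarrow> quat" and F Fs
      using that by (force simp: seq_product_def)+
    have cons_in: "(\<lambda>i. case i of 0 \<Rightarrow> x | Suc i \<Rightarrow> y i) \<in> seq_product (F # Fs)" if "x \<in> F" "y \<in> seq_product Fs"
      for x :: "nat \<Rightarrow> quat" and y F Fs
      using that by (auto simp: seq_product_def nth_Cons split: nat.splits)
    have image: "(\<lambda>y. \<Sum>i<Suc m. y i) ` seq_product (F # Fs) = F \<oplus>\<^sub>s (\<lambda>y. \<Sum>i<m. y i) ` seq_product Fs"
      for m and F :: "(nat \<Rightarrow> quat) set" and Fs
    proof (intro set_eqI iffI)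
      fix z assume "z \<in> (\<lambda>y. \<Sum>i<Suc m. y i) ` seq_product (F # Fs)"
      then obtain y where y: "z = (\<Sum>i<Suc m. y i)" "y \<in> seq_product (F # Fs)" by (rule imageE)
      have "y 0 + (\<Sum>i<m. y (Suc i)) \<in> F \<oplus>\<^sub>s (\<lambda>y. \<Sum>i<m. y i) ` seq_product Fs"
        by (rule ssumI[OF shift_in(2)[OF y(2)] image_eqI[OF refl shift_in(1)[OF y(2)]]])
      then show "z \<in> F \<oplus>\<^sub>s (\<lambda>y. \<Sum>i<m. y i) ` seq_product Fs" unfolding y(1) sum.lessThan_Suc_shift .
    next
      fix z assume "z \<in> F \<oplus>\<^sub>s (\<lambda>y. \<Sum>i<m. y i) ` seq_product Fs"
      then obtain x w where "z = x + w" "x \<in> F" "w \<in> (\<lambda>y. \<Sum>i<m. y i) ` seq_product Fs" by (rule ssumE)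
      then obtain y where y: "z = x + (\<Sum>i<m. y i)" "x \<in> F" "y \<in> seq_product Fs" by blast
      have "z = (\<Sum>i<Suc m. (case i of 0 \<Rightarrow> x | Suc i \<Rightarrow> y i))" unfolding y(1) sum.lessThan_Suc_shift by simp
      then show "z \<in> (\<lambda>y. \<Sum>i<Suc m. y i) ` seq_product (F # Fs)" using cons_in[OF y(2,3)] by (rule image_eqI)
    qed
    show ?thesis
    proof (intro exI[of _ "I # Es"] conjI)
      show "\<forall>F\<in>set (I # Es). hsub F \<and> F \<subseteq> E \<and> F \<noteq> {0} \<and> listed c (U \<inter> F, hspace F)"
      proof
        fix F assume F: "F \<in> set (I # Es)"
        show "hsub F \<and> F \<subseteq> E \<and> F \<noteq> {0} \<and> listed c (U \<inter> F, hspace F)"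
        proof (cases "F = I")
          case True
          then show ?thesis using IE(1) h(1) I0 L by simp
        next
          case False
          then have m: "F \<in> set Es" using F by simp
          then have a: "hsub F" "F \<subseteq> J" "F \<noteq> {0}" "listed c (U \<inter> J \<inter> F, hspace F)" using Es by blast+
          show ?thesis using a(1,3) a(4)[unfolded UF[OF m]] subset_trans[OF a(2) IE(2)] by simp
        qed
      qed
      show "(\<lambda>y. \<Sum>i<length (I # Es). y i) ` seq_product (I # Es) = E"
        using image[of "length Es" I Es] on h(4) by simp
      show "(\<lambda>y. \<Sum>i<length (I # Es). y i) ` seq_product (map (\<lambda>F. U \<inter> F) (I # Es)) = U"
        using image[of "length Es" "U \<inter> I" "map (\<lambda>F. U \<inter> F) Es"] onU[unfolded mapU] h(5) by simp
      show "\<forall>y\<in>seq_product (I # Es). (\<Sum>i<length (I # Es). y i) = 0 \<longrightarrow> y = 0"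
      proof (intro ballI impI)
        fix y assume y: "y \<in> seq_product (I # Es)" and z: "(\<Sum>i<length (I # Es). y i) = 0"
        let ?y = "\<lambda>i. y (Suc i)"
        have e: "y 0 + (\<Sum>i<length Es. ?y i) = 0" using z by (simp add: sum.lessThan_Suc_shift del: sum.lessThan_Suc)
        have J': "(\<Sum>i<length Es. ?y i) \<in> J" using shift_in(1)[OF y] on by blast
        have "y 0 = - (\<Sum>i<length Es. ?y i)" using e by (simp add: eq_neg_iff_add_eq_0)
        then have "y 0 \<in> J" using subspace_neg[OF s(2) J'] by simp
        then have y0: "y 0 = 0" using shift_in(2)[OF y] h(3) by blast
        then have "?y = 0" using inj shift_in(1)[OF y] e by simp
        then have "y (Suc i) = 0" for i by (simp add: fun_eq_iff)
        then show "y = 0" using y0 by (auto simp: fun_eq_iff) (metis not0_implies_Suc)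
      qed
    qed
  qed
qed

section \<open>Coordinates\<close>

text \<open>Take a maximal number of vectors of \<open>E\<close> that are independent over the quaternions; their span is \<open>E\<close>, as a vector
  outside could be added.\<close>

lemma coordinates:
  assumes P: "is_pair P" and r: "\<rho> \<in> qstruct (snd P)"
  shows "\<exists>n U0. subspace U0 \<and> U0 \<subseteq> quat_tuples n \<and> objiso (hmul, U0, quat_tuples n) (pobj \<rho> P)"
proof -
  let ?E = "vspace (snd P)"
  note R = rep_facts[OF P r]
  note H = hypercomplex_facts[OF R(1)]
  define \<Phi> where "\<Phi> n v x = (\<Sum>r<n. \<rho> (x r) (v r))" for n :: nat and v :: "nat \<Rightarrow> 'a" and x :: "nat \<Rightarrow> quat"
  define free where "free n v \<longleftrightarrow> (\<forall>r<n. v r \<in> ?E) \<and> (\<forall>x\<in>quat_tuples n. \<Phi> n v x = 0 \<longrightarrow> x = 0)" for n v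
  have lin: "linear (\<Phi> n v)" for n v
    by (rule linearI) (simp_all add: \<Phi>_def H(3,4) sum.distrib scaleR_sum_right)
  have \<Phi>E: "\<Phi> n v x \<in> ?E" if "\<forall>r<n. v r \<in> ?E" for n v x
    unfolding \<Phi>_def using that by (intro subspace_sum[OF R(3)] H(1)) auto
  have zero: "\<rho> q 0 = 0" for q
    using H(2)[of q] subspace_0[OF R(3)] unfolding linear_from_def by (metis scaleR_zero_left)
  have madd: "\<rho> q (x + y) = \<rho> q x + \<rho> q y" if "x \<in> ?E" "y \<in> ?E" for q x y using H(2)[of q] that by (simp add: linear_from_def)
  have equi: "\<Phi> n v (hmul q x) = \<rho> q (\<Phi> n v x)" if v: "\<forall>r<n. v r \<in> ?E" for n v q x
  proof -
    have "\<rho> q (\<Sum>r\<in>A. \<rho> (x r) (v r)) = (\<Sum>r\<in>A. \<rho> q (\<rho> (x r) (v r)))" if "finite A" "A \<subseteq> {..<n}" for A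
      using that
    proof (induction A)
      case empty then show ?case by (simp add: zero)
    next
      case (insert a A)
      then show ?case using v H(1) by (subst sum.insert) (auto simp: madd subspace_sum[OF R(3)] subset_iff)
    qed
    then show ?thesis by (simp add: \<Phi>_def H(6) hmul_def)
  qed
  have bound: "n \<le> dim ?E" if "free n v" for n v
  proof -
    have v: "\<forall>r<n. v r \<in> ?E" and inj: "\<And>x. x \<in> quat_tuples n \<Longrightarrow> \<Phi> n v x = 0 \<Longrightarrow> x = 0" using that by (auto simp: free_def)
    have "4 * n = dim (\<Phi> n v ` quat_tuples n)"
      using dim_image_inj[OF lin subspace_tuples fin_dim_tuples inj] dim_tuples[of n] by simp
    also have "\<dots> \<le> dim ?E" by (rule dim_mono_fin[OF R(4)]) (use \<Phi>E[OF v] in auto)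
    finally show ?thesis by simp
  qed
  have fin: "finite {n. \<exists>v. free n v}"
  proof (rule finite_subset)
    show "{n. \<exists>v. free n v} \<subseteq> {..dim ?E}"
    proof
      fix n assume "n \<in> {n. \<exists>v. free n v}"
      then obtain v where "free n v" by (elim CollectE exE)
      then show "n \<in> {..dim ?E}" using bound by simp
    qed
  qed simp
  have "x = 0" if "x \<in> quat_tuples 0" for x using that by (simp add: quat_tuples_def fun_eq_iff)
  then have "free 0 v" for v by (simp add: free_def)
  then have "0 \<in> {n. \<exists>v. free n v}" by blast
  then have ne: "{n. \<exists>v. free n v} \<noteq> {}" by (rule ex_in_conv[THEN iffD1, OF exI])
  define n where "n = Max {n. \<exists>v. free n v}"
  have "n \<in> {n. \<exists>v. free n v}" unfolding n_def by (rule Max_in[OF fin ne])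
  then obtain v where fr: "free n v" by (elim CollectE exE)
  have max: "m \<le> n" if "free m w" for m w unfolding n_def by (rule Max_ge[OF fin]) (rule CollectI, rule exI, rule that)
  have v: "\<forall>r<n. v r \<in> ?E" and inj: "\<And>x. x \<in> quat_tuples n \<Longrightarrow> \<Phi> n v x = 0 \<Longrightarrow> x = 0" using fr by (auto simp: free_def)
  have on: "\<Phi> n v ` quat_tuples n = ?E"
  proof (rule ccontr)
    assume "\<Phi> n v ` quat_tuples n \<noteq> ?E"
    then obtain w where w: "w \<in> ?E" "w \<notin> \<Phi> n v ` quat_tuples n" using \<Phi>E[OF v] by blast
    have "free (Suc n) (v(n := w))" unfolding free_def
    proof (intro conjI ballI impI allI)
      show "(v(n := w)) r \<in> ?E" if "r < Suc n" for r using that v w(1) by (cases "r = n") auto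
      fix x assume x: "x \<in> quat_tuples (Suc n)" and z: "\<Phi> (Suc n) (v(n := w)) x = 0"
      define x' where "x' r = (if r < n then x r else 0)" for r
      have x': "x' \<in> quat_tuples n" by (simp add: x'_def quat_tuples_def)
      have s: "\<Phi> n v x' + \<rho> (x n) w = 0" using z by (simp add: \<Phi>_def x'_def)
      have n0: "x n = 0"
      proof (rule ccontr)
        assume "x n \<noteq> 0"
        then have "w = \<rho> (inverse (x n)) (\<rho> (x n) w)" using H(6)[of "inverse (x n)" "x n" w] H(5)[OF w(1)] by simp
        also have "\<rho> (x n) w = \<Phi> n v (- x')" using s by (simp add: linear_neg[OF lin] eq_neg_iff_add_eq_0 add.commute)
        also have "\<rho> (inverse (x n)) (\<Phi> n v (- x')) = \<Phi> n v (hmul (inverse (x n)) (- x'))" by (rule equi[OF v, symmetric])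
        finally have e: "w = \<Phi> n v (hmul (inverse (x n)) (- x'))" .
        have "hmul (inverse (x n)) (- x') \<in> quat_tuples n" by (rule hsub_hmul[OF hsub_tuples subspace_neg[OF subspace_tuples x']])
        then show False using w(2) e by blast
      qed
      have "\<rho> 0 w = 0" using H(4)[of 0 0 w] by simp
      then have "x' = 0" using inj[OF x'] s n0 by simp
      then have "x r = 0" if "r < n" for r using that by (simp add: x'_def fun_eq_iff) metis
      then show "x = 0" using x n0 by (auto simp: quat_tuples_def fun_eq_iff) (metis less_antisym not_le not_less_eq_eq)
    qed
    then show False using max by fastforce
  qed
  define U0 where "U0 = {x \<in> quat_tuples n. \<Phi> n v x \<in> fst P}"
  have U0: "subspace U0" "U0 \<subseteq> quat_tuples n"
    using R(5) subspace_tuples[of n] unfolding subspace_def U0_def by (auto simp: linear_0[OF lin] linear_add[OF lin] linear_scale[OF lin])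
  have onU: "\<Phi> n v ` U0 = fst P"
  proof
    show "fst P \<subseteq> \<Phi> n v ` U0"
    proof
      fix u assume u: "u \<in> fst P"
      then have "u \<in> \<Phi> n v ` quat_tuples n" using R(6) on by blast
      then show "u \<in> \<Phi> n v ` U0" using u by (auto simp: U0_def)
    qed
  qed (auto simp: U0_def)
  have m: "mor (hmul, U0, quat_tuples n) (\<rho>, fst P, ?E) (\<Phi> n v)"
    unfolding mor_def prod.case
    by (intro conjI allI ballI) (simp_all add: on onU equi[OF v] linear_from_def linear_add[OF lin] linear_scale[OF lin])
  have "\<exists>h. inverses (hmul, U0, quat_tuples n) (\<rho>, fst P, ?E) (\<Phi> n v) h"
    by (rule bijective_mor_invertible[OF obj_hmul[OF hsub_tuples U0] refl refl m inj on onU])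
  then have "objiso (hmul, U0, quat_tuples n) (pobj \<rho> P)" unfolding objiso_def pobj_def by blast
  then show ?thesis using U0 by blast
qed

section \<open>Products\<close>

lemma subspace_seq_product:
  fixes Es :: "'a::real_vector set list"
  assumes "\<And>i. i < length Es \<Longrightarrow> subspace (Es ! i)" shows "subspace (seq_product Es)"
  using assms unfolding subspace_def seq_product_def by auto

lemma product_rep_in: "x \<in> seq_product Es \<Longrightarrow> i < length Es \<Longrightarrow> product_rep Es r q x i = r i q (x i)"
  by (simp add: product_rep_def zero_ext_def)

lemma hypercomplex_product:
  fixes Es :: "'a::real_vector set list"
  assumes s: "\<And>i. i < length Es \<Longrightarrow> subspace (Es ! i)" and h: "\<And>i. i < length Es \<Longrightarrow> hypercomplex (Es ! i) (r i)"
  shows "hypercomplex (seq_product Es) (product_rep Es r)"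
proof -
  let ?S = "seq_product Es" and ?\<rho> = "product_rep Es r"
  have xE: "x i \<in> Es ! i" if "x \<in> ?S" "i < length Es" for x i using that by (auto simp: seq_product_def)
  have \<rho>: "?\<rho> q x = (\<lambda>i. if i < length Es then r i q (x i) else 0)" if "x \<in> ?S" for q x
    using that by (simp add: product_rep_def zero_ext_def)
  have out: "?\<rho> q x = 0" if "x \<notin> ?S" for q x using that by (simp add: product_rep_def zero_ext_def)
  note H = hypercomplex_facts[OF h]
  have \<rho>S: "?\<rho> q x \<in> ?S" if "x \<in> ?S" for q x
    unfolding \<rho>[OF that] using H(1) xE[OF that] by (simp add: seq_product_def)
  have lf: "r i q (x + y) = r i q x + r i q y" "r i q (c *\<^sub>R x) = c *\<^sub>R r i q x"
    if "i < length Es" "x \<in> Es ! i" "y \<in> Es ! i" for i q x y c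
    using H(2)[OF that(1), of q] that(2,3) unfolding linear_from_def by blast+
  have S: "subspace ?S" by (rule subspace_seq_product) (rule s)
  show ?thesis unfolding hypercomplex_def
  proof (intro conjI allI)
    show "?\<rho> q \<in> Hom ?S ?S" for q unfolding Hom_def
    proof (intro CollectI conjI allI impI)
      show "linear_from ?S (?\<rho> q)" unfolding linear_from_def
      proof (intro conjI ballI allI)
        fix x y assume xy: "x \<in> ?S" "y \<in> ?S"
        show "?\<rho> q (x + y) = ?\<rho> q x + ?\<rho> q y"
          unfolding \<rho>[OF xy(1)] \<rho>[OF xy(2)] \<rho>[OF subspace_add[OF S xy]]
          by (rule ext) (simp add: lf(1) xE xy)
      next
        fix c x assume x: "x \<in> ?S"
        show "?\<rho> q (c *\<^sub>R x) = c *\<^sub>R ?\<rho> q x"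
          unfolding \<rho>[OF x] \<rho>[OF subspace_scale[OF S x]]
          by (rule ext) (simp add: scaleR_fun_def lf(2)[OF _ xE[OF x] xE[OF x]])
      qed
      show "?\<rho> q ` ?S \<subseteq> ?S" using \<rho>S by blast
    qed (rule out)
    show "linear ?\<rho>"
    proof (rule linearI; rule ext)
      fix p q c x
      show "?\<rho> (p + q) x = (?\<rho> p + ?\<rho> q) x"
        by (cases "x \<in> ?S") (simp_all add: \<rho> out H(3) fun_eq_iff)
      show "?\<rho> (c *\<^sub>R p) x = (c *\<^sub>R ?\<rho> p) x"
        by (cases "x \<in> ?S") (simp_all add: scaleR_fun_def \<rho> out H(4) fun_eq_iff)
    qed
    show "?\<rho> 1 = zero_ext ?S id"
    proof
      fix x show "?\<rho> 1 x = zero_ext ?S id x"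
      proof (cases "x \<in> ?S")
        case True
        then have "x i = 0" if "\<not> i < length Es" for i using that by (simp add: seq_product_def)
        then show ?thesis using True by (simp add: \<rho> zero_ext_def fun_eq_iff H(5) xE)
      qed (simp add: out zero_ext_def)
    qed
    show "?\<rho> (p * q) = ?\<rho> p \<circ> ?\<rho> q" for p q
    proof
      fix x show "?\<rho> (p * q) x = (?\<rho> p \<circ> ?\<rho> q) x"
      proof (cases "x \<in> ?S")
        case True
        show ?thesis unfolding comp_def \<rho>[OF \<rho>S[OF True]] unfolding \<rho>[OF True] by (simp add: H(6) fun_eq_iff)
      next
        case False
        have "?\<rho> p 0 = 0"
        proof
          fix i
          have "r i p (0 *\<^sub>R 0) = 0 *\<^sub>R r i p 0" if "i < length Es"
            by (rule lf(2)[OF that subspace_0[OF s[OF that]] subspace_0[OF s[OF that]]])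
          then show "?\<rho> p 0 i = 0 i" unfolding \<rho>[OF subspace_0[OF S]] by simp
        qed
        then show ?thesis using False by (simp add: out)
      qed
    qed
  qed
qed

text \<open>The isometries \<open>T i\<close> send \<open>hrep (Es ! 0) q\<close> to \<open>hrep (Es ! i) q\<close>. This is well defined because
  the quaternions act faithfully on the nonzero space \<open>Es ! 0\<close>.\<close>

lemma product_structure_hspace:
  assumes "\<And>F. F \<in> set Es \<Longrightarrow> hsub F \<and> F \<noteq> {0}"
  shows "product_structure (map hspace Es) (orbit (product_rep Es (\<lambda>i. hrep (Es ! i))))"
proof (cases "Es = []")
  case True
  have "product_rep ([] :: (nat \<Rightarrow> quat) set list) (\<lambda>i. hrep (Es ! i)) = (\<lambda>q x. 0)"
    by (auto simp: product_rep_def zero_ext_def fun_eq_iff)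
  then show ?thesis using True by (simp add: product_structure_def)
next
  case False
  define h where "h = hrep (Es ! 0)"
  have F0: "hsub (Es ! 0)" "Es ! 0 \<noteq> {0}" using assms[of "Es ! 0"] False by auto
  have lh: "linear h" using hypercomplex_hrep[OF F0(1)] unfolding h_def hypercomplex_def by blast
  obtain x where x: "x \<in> Es ! 0" "x \<noteq> 0" using F0 subspace_0[OF hsub_subspace[OF F0(1)]] by blast
  have "q = 0" if "h q = 0" for q
  proof -
    obtain i where "x i \<noteq> 0" using x(2) by (auto simp: fun_eq_iff)
    moreover have "hmul q x = 0" using that hrep_in[OF x(1), of q] unfolding h_def by (simp add: fun_eq_iff)
    ultimately show ?thesis by (simp add: hmul_def fun_eq_iff) metis
  qed
  then have inj: "inj h" unfolding linear_injective_0[OF lh] by blast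
  define T where "T i J = (if i = 0 then J else hrep (Es ! i) (inv h J))" for i J
  have Th: "T i (h q) = hrep (Es ! i) q" for i q using inj by (simp add: T_def h_def)
  then have Tc: "T i \<circ> h = hrep (Es ! i)" for i by (simp add: fun_eq_iff)
  have len: "0 < length Es" using False by simp
  have nth: "map hspace Es ! i = hspace (Es ! i)" if "i < length Es" for i using that by simp
  have "\<exists>T Tt. \<exists>\<rho>\<in>qstruct (map hspace Es ! 0). T 0 = id \<and>
      (\<forall>i<length (map hspace Es). oriented_isometry (map hspace Es ! 0) (map hspace Es ! i) (T i) \<and>
         linear_from (range \<rho>) (Tt i) \<and>
         (\<forall>J\<in>admissible_structures (map hspace Es ! 0). Tt i J = T i J) \<and>
         Tt i \<circ> \<rho> \<in> qstruct (map hspace Es ! i)) \<and>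
      orbit (product_rep Es (\<lambda>i. hrep (Es ! i))) = orbit (product_rep (map vspace (map hspace Es)) (\<lambda>i. Tt i \<circ> \<rho>))"
  proof (rule exI[where x = T], rule exI[where x = T], rule bexI[where x = h], intro conjI allI impI)
    show "T 0 = id" by (simp add: T_def fun_eq_iff)
    show m0: "h \<in> qstruct (map hspace Es ! 0)" unfolding nth[OF len] using orbit_self by (simp add: h_def)
    have "map vspace (map hspace Es) = Es" by (simp add: o_def)
    then show "orbit (product_rep Es (\<lambda>i. hrep (Es ! i))) = orbit (product_rep (map vspace (map hspace Es)) (\<lambda>i. T i \<circ> h))"
      by (simp add: Tc)
    fix i assume "i < length (map hspace Es)"
    then have i: "i < length Es" by simp
    have mi: "hrep (Es ! i) \<in> qstruct (map hspace Es ! i)" unfolding nth[OF i] using orbit_self by simp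
    then show "T i \<circ> h \<in> qstruct (map hspace Es ! i)" unfolding Tc .
    have "S2_oriented_isometry id" by (simp add: S2_oriented_isometry_def)
    then show "oriented_isometry (map hspace Es ! 0) (map hspace Es ! i) (T i)"
      unfolding oriented_isometry_def using m0 mi Th by (intro bexI[where x = h] bexI[where x = "hrep (Es ! i)"] exI[where x = id]) simp_all
    have li: "linear (hrep (Es ! i))" using hypercomplex_hrep assms[of "Es ! i"] i unfolding hypercomplex_def by auto
    show "linear_from (range h) (T i)" unfolding linear_from_def
    proof (intro conjI ballI allI)
      fix f g assume "f \<in> range h" "g \<in> range h"
      then obtain p q where "f = h p" "g = h q" by blast
      then show "T i (f + g) = T i f + T i g" by (simp only: linear_add[OF lh, symmetric] Th linear_add[OF li])
    next
      fix c f assume "f \<in> range h"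
      then obtain p where "f = h p" by blast
      then show "T i (c *\<^sub>R f) = c *\<^sub>R T i f" by (simp only: linear_scale[OF lh, symmetric] Th linear_scale[OF li])
    qed
  qed simp
  then show ?thesis unfolding product_structure_def using False by simp
qed

section \<open>Existence\<close>

lemma decomposition_exists:
  assumes c: "admissible_choice c" and P: "is_pair P"
  shows "\<exists>Ps :: (nat \<Rightarrow> quat) qpair list. decomposition c P Ps"
proof -
  obtain \<rho> where r: "\<rho> \<in> qstruct (snd P)" using rep_exists[OF P] by blast
  obtain n U0 where U0: "subspace U0" "U0 \<subseteq> quat_tuples n" and co: "objiso (hmul, U0, quat_tuples n) (pobj \<rho> P)"
    using coordinates[OF P r] by blast
  obtain Es where Es: "\<forall>F\<in>set Es. hsub F \<and> F \<subseteq> quat_tuples n \<and> F \<noteq> {0} \<and> listed c (U0 \<inter> F, hspace F)"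
    and on: "(\<lambda>y. \<Sum>i<length Es. y i) ` seq_product Es = quat_tuples n"
    and inj: "\<forall>y\<in>seq_product Es. (\<Sum>i<length Es. y i) = 0 \<longrightarrow> y = 0"
    and onU: "(\<lambda>y. \<Sum>i<length Es. y i) ` seq_product (map (\<lambda>F. U0 \<inter> F) Es) = U0"
    using internal_decomposition[OF c hsub_tuples subset_refl U0] by (elim exE conjE) (rule that; assumption)
  define Ps where "Ps = map (\<lambda>F. (U0 \<inter> F, hspace F)) Es"
  define \<rho>P where "\<rho>P = product_rep Es (\<lambda>i. hrep (Es ! i))"
  define R where "R = (seq_product (map (\<lambda>F. U0 \<inter> F) Es), \<lparr>vspace = seq_product Es, qstruct = orbit \<rho>P\<rparr>)"
  let ?UP = "seq_product (map (\<lambda>F. U0 \<inter> F) Es)" and ?S = "seq_product Es"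
  have Ei: "hsub (Es ! i)" "Es ! i \<subseteq> quat_tuples n" "subspace (Es ! i)" if "i < length Es" for i
    using bspec[OF Es nth_mem[OF that]] hsub_subspace by simp_all
  have maps: "map snd Ps = map hspace Es" "map fst Ps = map (\<lambda>F. U0 \<inter> F) Es" "map (vspace \<circ> snd) Ps = Es"
    by (simp_all add: Ps_def o_def)
  have hF: "hsub F \<and> F \<noteq> {0}" if "F \<in> set Es" for F using bspec[OF Es that] by simp
  have prodR: "is_product Ps R" unfolding is_product_def maps R_def \<rho>P_def
  proof (intro exI conjI)
    show "product_structure (map hspace Es) (orbit (product_rep Es (\<lambda>i. hrep (Es ! i))))"
      by (rule product_structure_hspace) (rule hF)
  qed (rule refl)
  have sS: "subspace ?S" by (rule subspace_seq_product) (rule Ei(3))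
  have "fin_dim (fun_space {..<length Es} (quat_tuples n))" using dim_fun_space[of "{..<length Es}" "quat_tuples n"] by simp
  moreover have "?S \<subseteq> fun_space {..<length Es} (quat_tuples n)"
  proof
    fix y assume y: "y \<in> ?S"
    have "y i \<in> quat_tuples n" if "i < length Es" for i using subsetD[OF Ei(2)[OF that]] y that by (simp add: seq_product_def)
    then show "y \<in> fun_space {..<length Es} (quat_tuples n)" using y by (simp add: seq_product_def fun_space_def)
  qed
  ultimately have fS: "fin_dim ?S" by (rule fin_dim_mono)
  have hyp: "hypercomplex ?S \<rho>P" unfolding \<rho>P_def by (rule hypercomplex_product) (simp_all add: Ei hypercomplex_hrep)
  have sUP: "subspace ?UP"
    by (rule subspace_seq_product) (simp add: subspace_inter[OF U0(1)] Ei(3))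
  have UPS: "?UP \<subseteq> ?S" by (auto simp: seq_product_def)
  have pR: "is_pair R" unfolding is_pair_def R_def quaternionic_space_def prod.case
  proof (intro conjI sUP)
    show "\<exists>B. finite B \<and> vspace \<lparr>vspace = ?S, qstruct = orbit \<rho>P\<rparr> = span B" using fin_dim_span_eq[OF fS sS] by simp
    show "\<exists>\<rho>. hypercomplex (vspace \<lparr>vspace = ?S, qstruct = orbit \<rho>P\<rparr>) \<rho> \<and> qstruct \<lparr>vspace = ?S, qstruct = orbit \<rho>P\<rparr> = orbit \<rho>"
      using hyp by auto
    show "?UP \<subseteq> vspace \<lparr>vspace = ?S, qstruct = orbit \<rho>P\<rparr>" using UPS by simp
  qed
  have rR: "\<rho>P \<in> qstruct (snd R)" unfolding R_def using orbit_self by simp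
  have pR_eq: "pobj \<rho>P R = (\<rho>P, ?UP, ?S)" by (simp add: pobj_def R_def)
  let ?f = "\<lambda>y :: nat \<Rightarrow> nat \<Rightarrow> quat. \<Sum>i<length Es. y i"
  have lh: "linear (hmul q)" for q by (rule linearI) (simp_all add: hmul_simps)
  have m: "mor (pobj \<rho>P R) (hmul, U0, quat_tuples n) ?f"
    unfolding pR_eq mor_def prod.case on onU
  proof (intro conjI allI ballI subset_refl)
    show "linear_from ?S ?f" unfolding linear_from_def
    proof (intro conjI ballI allI)
      show "?f (x + y) = ?f x + ?f y" for x y by (simp add: sum.distrib)
      have sc: "(c *\<^sub>R y) i = c *\<^sub>R y i" for c i and y :: "nat \<Rightarrow> nat \<Rightarrow> quat" by (simp only: scaleR_fun_def)
      show "?f (c *\<^sub>R y) = c *\<^sub>R ?f y" for c y unfolding sc by (rule scaleR_sum_right[symmetric])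
    qed
    fix q y assume y: "y \<in> ?S"
    have "?f (\<rho>P q y) = (\<Sum>i<length Es. hmul q (y i))" unfolding \<rho>P_def
      by (rule sum.cong) (use y in \<open>auto simp: product_rep_in seq_product_def hrep_in\<close>)
    also have "\<dots> = hmul q (?f y)" by (rule linear_sum[OF lh, symmetric])
    finally show "?f (\<rho>P q y) = hmul q (?f y)" .
  qed
  have "\<exists>h. inverses (pobj \<rho>P R) (hmul, U0, quat_tuples n) ?f h"
    by (rule bijective_mor_invertible[OF obj_pobj[OF pR rR] pR_eq refl m _ on onU]) (use inj in blast)
  then have "objiso (pobj \<rho>P R) (pobj \<rho> P)" using objiso_trans[OF _ co] unfolding objiso_def by blast
  then have "isomorphic P R" by (intro isomorphic_sym[OF isomorphic_of_objiso[OF pR rR P r]])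
  moreover have "\<forall>F\<in>set Ps. listed c F" unfolding Ps_def using Es by simp
  ultimately show ?thesis unfolding decomposition_def using prodR by blast
qed

section \<open>Uniqueness\<close>

text \<open>A decomposition makes \<open>P\<close> the biproduct of its factors, in the sense of maps that commute with the action. By
  definition of the product structure, the representative on the product that matches \<open>\<rho>\<close> is \<open>product_rep\<close> of representatives
  of the factors, all of them composed with the same automorphism.\<close>

lemma decomposition_biproduct:
  fixes P :: "'a::real_vector qpair" and Ps :: "'b::real_vector qpair list"
  assumes c: "admissible_choice c" and dec: "decomposition c P Ps" and \<rho>: "\<rho> \<in> qstruct (snd P)"
  shows "\<exists>r \<iota> \<pi>. (\<forall>i<length Ps. r i \<in> qstruct (snd (Ps ! i)) \<and> mor (pobj (r i) (Ps ! i)) (pobj \<rho> P) (\<iota> i) \<and>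
       mor (pobj \<rho> P) (pobj (r i) (Ps ! i)) (\<pi> i) \<and>
       (\<forall>j<length Ps. \<forall>x\<in>vspace (snd (Ps ! i)). \<pi> j (\<iota> i x) = (if i = j then x else 0))) \<and>
     (\<forall>x\<in>vspace (snd P). (\<Sum>i<length Ps. \<iota> i (\<pi> i x)) = x)"
proof -
  obtain R where L: "\<forall>F\<in>set Ps. listed c F" and prod: "is_product Ps R" and iso: "isomorphic P R"
    using dec unfolding decomposition_def by blast
  obtain \<rho>R where rR: "\<rho>R \<in> qstruct (snd R)" and oi: "objiso (pobj \<rho> P) (pobj \<rho>R R)"
    using objiso_of_isomorphic[OF iso \<rho>] by blast
  have P: "is_pair P" and pR: "is_pair R" using iso by (auto simp: isomorphic_def)
  obtain f g where "inverses (pobj \<rho> P) (pobj \<rho>R R) f g" using oi unfolding objiso_def by blast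
  then have f: "mor (pobj \<rho> P) (pobj \<rho>R R) f" and g: "mor (pobj \<rho>R R) (pobj \<rho> P) g"
    and gf: "\<And>x. x \<in> vspace (snd P) \<Longrightarrow> g (f x) = x" and fg: "\<And>y. y \<in> vspace (snd R) \<Longrightarrow> f (g y) = y"
    unfolding inverses_def carr_pobj by auto
  have oR: "obj (pobj \<rho>R R)" by (rule obj_pobj[OF pR rR])
  define Es where "Es = map (vspace \<circ> snd) Ps"
  let ?S = "seq_product Es" and ?SU = "seq_product (map fst Ps)"
  obtain R' where st: "product_structure (map snd Ps) R'" and R: "R = (?SU, \<lparr>vspace = ?S, qstruct = R'\<rparr>)"
    using prod unfolding is_product_def Es_def by blast
  have vR: "vspace (snd R) = ?S" "fst R = ?SU" by (simp_all add: R)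
  have len: "length Es = length Ps" by (simp add: Es_def)
  have Esi: "Es ! i = vspace (snd (Ps ! i))" if "i < length Ps" for i using that by (simp add: Es_def)
  have fS: "f x \<in> ?S" if "x \<in> vspace (snd P)" for x using mor_in[OF f] that unfolding carr_pobj vR by blast
  show ?thesis
  proof (cases "Ps = []")
    case True
    have "x = 0" if "x \<in> vspace (snd P)" for x
    proof -
      have "f x = 0" using fS[OF that] True by (simp add: seq_product_def Es_def fun_eq_iff)
      then show ?thesis using gf[OF that] mor_zero[OF g oR] by simp
    qed
    then show ?thesis using True by simp
  next
    case False
    have "\<exists>T Tt. \<exists>\<rho>\<in>qstruct (map snd Ps ! 0). T 0 = id \<and>
        (\<forall>i<length (map snd Ps). oriented_isometry (map snd Ps ! 0) (map snd Ps ! i) (T i) \<and>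
           linear_from (range \<rho>) (Tt i) \<and>
           (\<forall>J\<in>admissible_structures (map snd Ps ! 0). Tt i J = T i J) \<and>
           Tt i \<circ> \<rho> \<in> qstruct (map snd Ps ! i)) \<and>
        R' = orbit (product_rep (map vspace (map snd Ps)) (\<lambda>i. Tt i \<circ> \<rho>))"
      using st False unfolding product_structure_def by (simp only: map_is_Nil_conv if_False)
    then obtain T Tt \<rho>0 where T: "\<forall>i<length (map snd Ps). oriented_isometry (map snd Ps ! 0) (map snd Ps ! i) (T i) \<and>
        linear_from (range \<rho>0) (Tt i) \<and> (\<forall>J\<in>admissible_structures (map snd Ps ! 0). Tt i J = T i J) \<and>
        Tt i \<circ> \<rho>0 \<in> qstruct (map snd Ps ! i)"
      and R': "R' = orbit (product_rep (map vspace (map snd Ps)) (\<lambda>i. Tt i \<circ> \<rho>0))"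
      by (elim exE bexE conjE) (rule that; assumption)
    have R'': "R' = orbit (product_rep Es (\<lambda>i. Tt i \<circ> \<rho>0))" unfolding R' by (simp add: Es_def)
    obtain \<sigma> where \<sigma>: "\<sigma> \<in> Aut_quat" and \<rho>R: "\<rho>R = product_rep Es (\<lambda>i. Tt i \<circ> \<rho>0) \<circ> \<sigma>"
      using rR unfolding R orbit_def R'' by auto
    define r where "r i = Tt i \<circ> \<rho>0 \<circ> \<sigma>" for i
    have r0: "Tt i \<circ> \<rho>0 \<in> qstruct (snd (Ps ! i))" if "i < length Ps" for i using T that by simp
    have pi: "is_pair (Ps ! i)" if "i < length Ps" for i
      by (rule listed_local(1)[OF c _ r0[OF that]]) (use L that in auto)
    have r: "r i \<in> qstruct (snd (Ps ! i))" if "i < length Ps" for i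
      unfolding r_def rep_facts(2)[OF pi[OF that] r0[OF that]] by (rule orbit_comp[OF orbit_self \<sigma>])
    note F = rep_facts[OF pi r]
    have \<rho>R_in: "\<rho>R q y i = r i q (y i)" if "y \<in> ?S" "i < length Ps" for q y i
      using product_rep_in[OF that(1)] that(2) by (simp add: \<rho>R r_def len)
    have \<rho>R_out: "\<rho>R q y i = 0" if "y \<in> ?S" "\<not> i < length Ps" for q y i
      using that by (simp add: \<rho>R product_rep_def zero_ext_def len)
    have r_zero: "r i q 0 = 0" if "i < length Ps" for i q
    proof -
      have "r i q (0 *\<^sub>R 0) = 0 *\<^sub>R r i q 0"
        using hypercomplex_facts(2)[OF F(1)[OF that that], of q] subspace_0[OF F(3)[OF that that]] unfolding linear_from_def by blast
      then show ?thesis by simp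
    qed
    have sS: "single i x \<in> ?S" if "i < length Ps" "x \<in> vspace (snd (Ps ! i))" for i x
      using that subspace_0[OF F(3)] by (auto simp: seq_product_def single_def len Esi)
    have sSU: "single i x \<in> ?SU" if "i < length Ps" "x \<in> fst (Ps ! i)" for i x
      using that subspace_0[OF F(5)] by (auto simp: seq_product_def single_def)
    have mi: "mor (pobj (r i) (Ps ! i)) (pobj \<rho>R R) (single i)" if i: "i < length Ps" for i
      unfolding mor_def pobj_def prod.case vR
    proof (intro conjI allI ballI)
      show "linear_from (vspace (snd (Ps ! i))) (single i)"
        unfolding linear_from_def by (simp add: linear_add[OF linear_single] linear_scale[OF linear_single])
      show "single i ` vspace (snd (Ps ! i)) \<subseteq> ?S" "single i ` fst (Ps ! i) \<subseteq> ?SU" using sS[OF i] sSU[OF i] by auto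
      fix q x assume x: "x \<in> vspace (snd (Ps ! i))"
      show "single i (r i q x) = \<rho>R q (single i x)"
      proof
        fix j show "single i (r i q x) j = \<rho>R q (single i x) j"
          using \<rho>R_in[OF sS[OF i x], of j q] \<rho>R_out[OF sS[OF i x], of j q] r_zero[of j q] i
          by (cases "j < length Ps") (auto simp: single_def)
      qed
    qed
    have mp: "mor (pobj \<rho>R R) (pobj (r i) (Ps ! i)) (\<lambda>y. y i)" if i: "i < length Ps" for i
      unfolding mor_def pobj_def prod.case vR
    proof (intro conjI allI ballI)
      show "linear_from ?S (\<lambda>y. y i)" by (simp add: linear_from_def scaleR_fun_def)
      show "(\<lambda>y. y i) ` ?S \<subseteq> vspace (snd (Ps ! i))" "(\<lambda>y. y i) ` ?SU \<subseteq> fst (Ps ! i)"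
        using i by (auto simp: seq_product_def len Esi)
    qed (rule \<rho>R_in[OF _ i])
    show ?thesis
    proof (rule exI[where x = r], rule exI[where x = "\<lambda>i x. g (single i x)"], rule exI[where x = "\<lambda>i x. f x i"], intro conjI allI impI ballI)
      fix i assume i: "i < length Ps"
      show "r i \<in> qstruct (snd (Ps ! i))" by (rule r[OF i])
      show "mor (pobj (r i) (Ps ! i)) (pobj \<rho> P) (\<lambda>x. g (single i x))" by (rule mor_comp[OF mi[OF i] g])
      show "mor (pobj \<rho> P) (pobj (r i) (Ps ! i)) (\<lambda>x. f x i)" by (rule mor_comp[OF f mp[OF i]])
      fix j x assume "j < length Ps" "x \<in> vspace (snd (Ps ! i))"
      then show "f (g (single i x)) j = (if i = j then x else 0)" using fg[of "single i x"] sS[OF i] by (simp add: vR single_def)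
    next
      fix x assume x: "x \<in> vspace (snd P)"
      have y: "f x \<in> ?S" by (rule fS[OF x])
      have "(\<Sum>i<length Ps. g (single i (f x i))) = g (\<Sum>i<length Ps. single i (f x i))"
      proof (rule mor_sum[OF g oR finite_lessThan, symmetric])
          fix i assume "i \<in> {..<length Ps}"
          then have i: "i < length Ps" by simp
          then have "f x i \<in> vspace (snd (Ps ! i))" using y by (simp add: seq_product_def len Esi)
          then show "single i (f x i) \<in> carr (pobj \<rho>R R)" unfolding carr_pobj vR by (rule sS[OF i])
        qed
        also have "(\<Sum>i<length Ps. single i (f x i)) = f x"
      proof
        fix j
        have "(\<Sum>i<length Ps. single i (f x i)) j = (\<Sum>i<length Ps. if i = j then f x j else 0)"
          unfolding fun_sum by (intro sum.cong) (auto simp: single_def)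
        also have "\<dots> = f x j" using y by (auto simp: seq_product_def len)
        finally show "(\<Sum>i<length Ps. single i (f x i)) j = f x j" .
      qed
      finally show "(\<Sum>i<length Ps. g (single i (f x i))) = x" using gf[OF x] by simp
    qed
  qed
qed

text \<open>Both decompositions are taken with respect to the same representative \<open>\<rho>\<close>. The injections of one followed by
  the projections of the other form the mutually inverse matrices of \<open>krull_schmidt\<close>.\<close>

lemma decomposition_unique:
  fixes P :: "'a::real_vector qpair" and Ps :: "'b::real_vector qpair list" and Ps' :: "'c::real_vector qpair list"
  assumes c: "admissible_choice c" "admissible_choice c'" and dec: "decomposition c P Ps" "decomposition c' P Ps'"
  shows "same_factors Ps Ps'"
proof -
  have P: "is_pair P" using dec(1) unfolding decomposition_def isomorphic_def by blast
  obtain \<rho> where \<rho>: "\<rho> \<in> qstruct (snd P)" using rep_exists[OF P] by blast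
  have L: "\<forall>F\<in>set Ps. listed c F" "\<forall>F\<in>set Ps'. listed c' F" using dec unfolding decomposition_def by auto
  obtain r \<iota> p where A: "\<forall>i<length Ps. r i \<in> qstruct (snd (Ps ! i)) \<and> mor (pobj (r i) (Ps ! i)) (pobj \<rho> P) (\<iota> i) \<and>
       mor (pobj \<rho> P) (pobj (r i) (Ps ! i)) (p i) \<and>
       (\<forall>j<length Ps. \<forall>x\<in>vspace (snd (Ps ! i)). p j (\<iota> i x) = (if i = j then x else 0))"
     and sumA: "\<forall>x\<in>vspace (snd P). (\<Sum>i<length Ps. \<iota> i (p i x)) = x"
    using decomposition_biproduct[OF c(1) dec(1) \<rho>] by (elim exE conjE) (rule that; assumption)
  obtain r' \<iota>' p' where B: "\<forall>i<length Ps'. r' i \<in> qstruct (snd (Ps' ! i)) \<and> mor (pobj (r' i) (Ps' ! i)) (pobj \<rho> P) (\<iota>' i) \<and>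
       mor (pobj \<rho> P) (pobj (r' i) (Ps' ! i)) (p' i) \<and>
       (\<forall>j<length Ps'. \<forall>x\<in>vspace (snd (Ps' ! i)). p' j (\<iota>' i x) = (if i = j then x else 0))"
     and sumB: "\<forall>x\<in>vspace (snd P). (\<Sum>i<length Ps'. \<iota>' i (p' i x)) = x"
    using decomposition_biproduct[OF c(2) dec(2) \<rho>] by (elim exE conjE) (rule that; assumption)
  let ?X = "\<lambda>i. pobj (r i) (Ps ! i)" and ?Y = "\<lambda>j. pobj (r' j) (Ps' ! j)"
  have rA: "r i \<in> qstruct (snd (Ps ! i))" and LA: "listed c (Ps ! i)" if "i < length Ps" for i using A L that by auto
  have rB: "r' i \<in> qstruct (snd (Ps' ! i))" and LB: "listed c' (Ps' ! i)" if "i < length Ps'" for i using B L that by auto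
  have mA: "mor (?X i) (pobj \<rho> P) (\<iota> i)" "mor (pobj \<rho> P) (?X i) (p i)" if "i < length Ps" for i using A that by blast+
  have mB: "mor (?Y j) (pobj \<rho> P) (\<iota>' j)" "mor (pobj \<rho> P) (?Y j) (p' j)" if "j < length Ps'" for j using B that by blast+
  note lA = listed_local[OF c(1) LA rA] and lB = listed_local[OF c(2) LB rB]
  have oP: "obj (pobj \<rho> P)" by (rule obj_pobj[OF P \<rho>])
  have "\<exists>\<pi>. bij_betw \<pi> {..<length Ps} {..<length Ps'} \<and> (\<forall>i\<in>{..<length Ps}. objiso (?X i) (?Y (\<pi> i)))"
  proof (rule krull_schmidt[where a = "\<lambda>j i x. p' j (\<iota> i x)" and b = "\<lambda>i j y. p i (\<iota>' j y)"])
    show "obj (?X i) \<and> local_obj (?X i)" if "i \<in> {..<length Ps}" for i using lA(2,3) that by simp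
    show "obj (?Y j) \<and> local_obj (?Y j)" if "j \<in> {..<length Ps'}" for j using lB(2,3) that by simp
    show "mor (?X i) (?Y j) (\<lambda>x. p' j (\<iota> i x))" if "i \<in> {..<length Ps}" "j \<in> {..<length Ps'}" for i j
      by (rule mor_comp[OF mA(1) mB(2)]) (use that in auto)
    show "mor (?Y j) (?X i) (\<lambda>y. p i (\<iota>' j y))" if "i \<in> {..<length Ps}" "j \<in> {..<length Ps'}" for i j
      by (rule mor_comp[OF mB(1) mA(2)]) (use that in auto)
    show "(\<Sum>j\<in>{..<length Ps'}. p i (\<iota>' j (p' j (\<iota> i' x)))) = (if i = i' then x else 0)"
      if i: "i \<in> {..<length Ps}" and i': "i' \<in> {..<length Ps}" and x: "x \<in> carr (?X i')" for i i' x
    proof -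
      have z: "\<iota> i' x \<in> carr (pobj \<rho> P)" using mor_in[OF mA(1) x] i' by simp
      have "(\<Sum>j\<in>{..<length Ps'}. p i (\<iota>' j (p' j (\<iota> i' x)))) = p i (\<Sum>j\<in>{..<length Ps'}. \<iota>' j (p' j (\<iota> i' x)))"
        by (rule mor_sum[OF mA(2) oP, symmetric]) (use i in \<open>simp_all add: mor_in[OF mB(1) mor_in[OF mB(2) z]]\<close>)
      also have "\<dots> = p i (\<iota> i' x)" using sumB z by (simp add: carr_pobj)
      also have "\<dots> = (if i = i' then x else 0)" using A i i' x by (auto simp: carr_pobj)
      finally show ?thesis .
    qed
    show "(\<Sum>i\<in>{..<length Ps}. p' j (\<iota> i (p i (\<iota>' j' y)))) = (if j = j' then y else 0)"
      if j: "j \<in> {..<length Ps'}" and j': "j' \<in> {..<length Ps'}" and y: "y \<in> carr (?Y j')" for j j' y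
    proof -
      have z: "\<iota>' j' y \<in> carr (pobj \<rho> P)" using mor_in[OF mB(1) y] j' by simp
      have "(\<Sum>i\<in>{..<length Ps}. p' j (\<iota> i (p i (\<iota>' j' y)))) = p' j (\<Sum>i\<in>{..<length Ps}. \<iota> i (p i (\<iota>' j' y)))"
        by (rule mor_sum[OF mB(2) oP, symmetric]) (use j in \<open>simp_all add: mor_in[OF mA(1) mor_in[OF mA(2) z]]\<close>)
      also have "\<dots> = p' j (\<iota>' j' y)" using sumA z by (simp add: carr_pobj)
      also have "\<dots> = (if j = j' then y else 0)" using B j j' y by (auto simp: carr_pobj)
      finally show ?thesis .
    qed
  qed auto
  then obtain \<pi> where \<pi>: "bij_betw \<pi> {..<length Ps} {..<length Ps'}" "\<forall>i\<in>{..<length Ps}. objiso (?X i) (?Y (\<pi> i))" by blast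
  have "isomorphic (Ps ! i) (Ps' ! \<pi> i)" if i: "i < length Ps" for i
  proof -
    have j: "\<pi> i < length Ps'" using bij_betwE[OF \<pi>(1)] i by blast
    show ?thesis by (rule isomorphic_of_objiso[OF lA(1) rA lB(1) rB]) (use i j \<pi>(2) in auto)
  qed
  then show ?thesis unfolding same_factors_def using \<pi>(1) by blast
qed

theorem theorem4p1:
  fixes E :: "'a::real_vector qspace" and U :: "'a set"
    and c c' :: "nat \<Rightarrow> nat \<Rightarrow> quat"
  assumes "quaternionic_space E"
    and "subspace U" and "U \<subseteq> vspace E"
    and "admissible_choice c" and "admissible_choice c'"
  shows "(\<exists>Ps :: (nat \<Rightarrow> quat) qpair list. decomposition c (U, E) Ps) \<and>
    (\<forall>(Ps :: 'b::real_vector qpair list) (Ps' :: 'c::real_vector qpair list).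
       decomposition c (U, E) Ps \<longrightarrow> decomposition c' (U, E) Ps' \<longrightarrow> same_factors Ps Ps')"
proof -
  have "is_pair (U, E)" using assms(1-3) by (simp add: is_pair_def)
  then show ?thesis using decomposition_exists[OF assms(4)] decomposition_unique[OF assms(4,5)] by blast
qed

end
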